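(* Let $(X,J)$ be a spectrally negative MAP with matrix exponent $F$, scale matrix $W$, and $Z(\alpha,x)=e^{\alpha x}\big(I-\int_0^x e^{-\alpha y}W(y)\,\mathrm dy\,F(\alpha)\big)$. Fix $a>0$ and consider the two-sided reflection $H(t)=X(t)+R_l(t)-R_u(t)\in[-a,0]$ with $\rho_r=\inf\{t\ge0:R_u(t)>r\}$, and let $F^*(\alpha)$ be the matrix exponent with $\mathbb E_0[e^{-\alpha R_l(\rho_r)};J(\rho_r)]=e^{F^*(\alpha)r}$, $r\ge0$. Then for all $\alpha\ge0$ and $x\in[-a,0]$, $Z(\alpha,a)$ is invertible and \[F^*(\alpha)=W(a)F(\alpha)Z(\alpha,a)^{-1}-\alpha I,\qquad \mathbb E_x[e^{-\alpha R_l(\rho_0)};J(\rho_0)]=Z(\alpha,a+x)Z(\alpha,a)^{-1}.\]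
   Context: Setting: $(X,J)$ is a Markov additive process (MAP): $X$ real-valued càdlàg, $J$ right-continuous with finite state space $E=\{1,\dots,N\}$, such that given $J(t)=i$, $(X(t+s)-X(t),J(t+s))_{s\ge0}$ is independent of $\mathcal F_t$ and distributed as $(X(s)-X(0),J(s))_{s\ge0}$ given $J(0)=i$. Killing allowed (absorbing state $\partial$, $X=\infty$ when $J=\partial$). $J$ is an irreducible Markov chain with transition rate matrix $Q$ (row sums $\le0$); while $J=i$, $X$ evolves as a Lévy process $X_i$; a transition $i\to j\ne i$ causes an independent jump $U_{ij}\le0$. Each $X_i$ is spectrally negative and not with non-increasing paths; paths of $X$ not a.s. monotone. Matrix exponent $F(\alpha)=\mathrm{diag}(\psi_i(\alpha))+Q\circ G(\alpha)$ with $\mathbb Ee^{\alpha X_i(t)}=e^{\psi_i(\alpha)t}$, $G(\alpha)_{ij}=\mathbb Ee^{\alpha U_{ij}}$ ($G_{ii}=1$). The scale matrix $W$ is the unique continuous $W:[0,\infty)\to\mathbb R^{N\times N}$ with $\int_0^\infty e^{-\alpha x}W(x)\,\mathrm dx=F(\alpha)^{-1}$ for $\alpha>\eta=\max\{\Re z:\det F(z)=0\}$. Two-sided reflection: for $X(0)=x\in[-a,0]$, $(H,R_l,R_u)$ is the unique triple with $H(t)=X(t)+R_l(t)-R_u(t)\in[-a,0]$, where $R_l,R_u$ are non-decreasing with $R_l(0)=R_u(0)=0$, $R_l$ increasing only on $\{t:H(t)=-a\}$ and $R_u$ only on $\{t:H(t)=0\}$. When $X(0)=0$, $(R_l(\rho_r),J(\rho_r))_{r\ge0}$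 is a Markov-modulated compound Poisson process, whose matrix exponent is $F^*$. $\mathbb E_x[V;J(\tau)]$ is the matrix with $(i,j)$ entry $\mathbb E_{x,i}[V\mathbf 1\{J(\tau)=j\}]$, $\mathbb P_{x,i}$ being the law given $X(0)=x$, $J(0)=i$. *)

theory Defs
  imports "HOL-Probability.Probability"
begin

primrec mpow :: "real^'n::finite^'n \<Rightarrow> nat \<Rightarrow> real^'n^'n" where
  "mpow A 0 = mat 1"
| "mpow A (Suc k) = A ** mpow A k"

definition mexp :: "real^'n::finite^'n \<Rightarrow> real^'n^'n" where
  "mexp A = (\<Sum>k. scaleR (1 / fact k) (mpow A k))"

text \<open>Entry (i,j) is the integral of V times the indicator of {S = Some j} under the law P i
  (law given J(0) = i); None is the cemetery state.\<close>
definition E_mat :: "('n::finite \<Rightarrow> 'w measure) \<Rightarrow> ('w \<Rightarrow> real) \<Rightarrow> ('w \<Rightarrow> 'n option) \<Rightarrow> real^'n^'n" where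
  "E_mat P V S = (\<chi> i j. \<integral>\<omega>. V \<omega> * indicator {\<omega>. S \<omega> = Some j} \<omega> \<partial>(P i))"

definition natural_events :: "'w measure \<Rightarrow> (real \<Rightarrow> 'w \<Rightarrow> real) \<Rightarrow> (real \<Rightarrow> 'w \<Rightarrow> 'n option) \<Rightarrow> real \<Rightarrow> 'w set set" where
  "natural_events M X J t = sigma_sets (space M)
     {{\<omega>\<in>space M. X s \<omega> \<in> B \<and> J s \<omega> = Some k} | s B k. 0 \<le> s \<and> s \<le> t \<and> B \<in> sets borel}"

definition markov_additive ::
  "'w measure \<Rightarrow> (real \<Rightarrow> 'n::finite \<Rightarrow> 'w measure) \<Rightarrow> (real \<Rightarrow> 'w \<Rightarrow> real) \<Rightarrow> (real \<Rightarrow> 'w \<Rightarrow> 'n option) \<Rightarrow> bool" where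
  "markov_additive M P X J \<longleftrightarrow>
     (\<forall>x i. prob_space (P x i) \<and> sets (P x i) = sets M \<and> space (P x i) = space M) \<and>
     (\<forall>t. X t \<in> borel_measurable M \<and> J t \<in> measurable M (count_space UNIV)) \<and>
     (\<forall>x i. AE \<omega> in P x i. X 0 \<omega> = x \<and> J 0 \<omega> = Some i) \<and>
     \<comment> \<open>cadlag paths of X, right-continuous J, absorbing cemetery state None\<close>
     (\<forall>\<omega>\<in>space M.
        (\<forall>t\<ge>0. continuous (at_right t) (\<lambda>s. X s \<omega>)) \<and>
        (\<forall>t>0. \<exists>l. ((\<lambda>s. X s \<omega>) \<longlongrightarrow> l) (at_left t)) \<and>
        (\<forall>t\<ge>0. \<exists>e>0. \<forall>s\<in>{t..t+e}. J s \<omega> = J t \<omega>) \<and>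
        (\<forall>s t. 0 \<le> s \<longrightarrow> s \<le> t \<longrightarrow> J s \<omega> = None \<longrightarrow> J t \<omega> = None)) \<and>
     \<comment> \<open>Markov additive property (finite-dimensional form)\<close>
     (\<forall>x i t j A (n::nat) (s::nat \<Rightarrow> real) (B::nat \<Rightarrow> real set) (k::nat \<Rightarrow> 'n).
        0 \<le> t \<longrightarrow> A \<in> natural_events M X J t \<longrightarrow> (\<forall>m<n. 0 \<le> s m \<and> B m \<in> sets borel) \<longrightarrow>
        measure (P x i) (A \<inter> {\<omega>\<in>space M. J t \<omega> = Some j \<and>
            (\<forall>m<n. X (t + s m) \<omega> - X t \<omega> \<in> B m \<and> J (t + s m) \<omega> = Some (k m))})
        = measure (P x i) (A \<inter> {\<omega>\<in>space M. J t \<omega> = Some j}) *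
          measure (P 0 j) {\<omega>\<in>space M. \<forall>m<n. X (s m) \<omega> - X 0 \<omega> \<in> B m \<and> J (s m) \<omega> = Some (k m)})"

definition spectrally_negative_MAP ::
  "'w measure \<Rightarrow> (real \<Rightarrow> 'n::finite \<Rightarrow> 'w measure) \<Rightarrow> (real \<Rightarrow> 'w \<Rightarrow> real) \<Rightarrow> (real \<Rightarrow> 'w \<Rightarrow> 'n option) \<Rightarrow> bool" where
  "spectrally_negative_MAP M P X J \<longleftrightarrow>
     markov_additive M P X J \<and>
     (\<forall>\<omega>\<in>space M. \<forall>t>0. J t \<omega> \<noteq> None \<longrightarrow>
        (\<forall>l. ((\<lambda>s. X s \<omega>) \<longlongrightarrow> l) (at_left t) \<longrightarrow> X t \<omega> \<le> l)) \<and>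
     (\<forall>i j. \<exists>t>0. measure (P 0 i) {\<omega>\<in>space M. J t \<omega> = Some j} > 0) \<and>
     (\<forall>i. \<not> (AE \<omega> in P 0 i. \<forall>s t. 0 \<le> s \<longrightarrow> s \<le> t \<longrightarrow> (\<forall>u\<in>{0..t}. J u \<omega> = Some i) \<longrightarrow> X t \<omega> \<le> X s \<omega>)) \<and>
     \<not> (\<forall>i. AE \<omega> in P 0 i. \<forall>s t. 0 \<le> s \<longrightarrow> s \<le> t \<longrightarrow> J t \<omega> \<noteq> None \<longrightarrow> X s \<omega> \<le> X t \<omega>) \<and>
     \<not> (\<forall>i. AE \<omega> in P 0 i. \<forall>s t. 0 \<le> s \<longrightarrow> s \<le> t \<longrightarrow> J t \<omega> \<noteq> None \<longrightarrow> X t \<omega> \<le> X s \<omega>)"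

definition is_matrix_exponent ::
  "(real \<Rightarrow> 'n::finite \<Rightarrow> 'w measure) \<Rightarrow> (real \<Rightarrow> 'w \<Rightarrow> real) \<Rightarrow> (real \<Rightarrow> 'w \<Rightarrow> 'n option) \<Rightarrow> (real \<Rightarrow> real^'n^'n) \<Rightarrow> bool" where
  "is_matrix_exponent P X J F \<longleftrightarrow>
     (\<forall>\<alpha>\<ge>0. \<forall>t\<ge>0.
        (\<forall>i j. integrable (P 0 i) (\<lambda>\<omega>. exp (\<alpha> * X t \<omega>) * indicator {\<omega>. J t \<omega> = Some j} \<omega>)) \<and>
        E_mat (P 0) (\<lambda>\<omega>. exp (\<alpha> * X t \<omega>)) (J t) = mexp (scaleR t (F \<alpha>)))"

definition is_scale_matrix :: "(real \<Rightarrow> real^'n::finite^'n) \<Rightarrow> (real \<Rightarrow> real^'n^'n) \<Rightarrow> bool" where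
  "is_scale_matrix F W \<longleftrightarrow>
     continuous_on {0..} W \<and>
     (\<exists>\<alpha>0\<ge>0. \<forall>\<alpha>>\<alpha>0. invertible (F \<alpha>) \<and>
        ((\<lambda>y. scaleR (exp (- \<alpha> * y)) (W y)) has_integral matrix_inv (F \<alpha>)) {0..})"

definition Zmat :: "(real \<Rightarrow> real^'n::finite^'n) \<Rightarrow> (real \<Rightarrow> real^'n^'n) \<Rightarrow> real \<Rightarrow> real \<Rightarrow> real^'n^'n" where
  "Zmat F W \<alpha> x = scaleR (exp (\<alpha> * x)) (mat 1 - integral {0..x} (\<lambda>y. scaleR (exp (- \<alpha> * y)) (W y)) ** F \<alpha>)"

definition two_sided_reflection :: "real \<Rightarrow> (real \<Rightarrow> real) \<Rightarrow> (real \<Rightarrow> real) \<Rightarrow> (real \<Rightarrow> real) \<Rightarrow> bool" where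
  "two_sided_reflection a x Rl Ru \<longleftrightarrow>
     (let H = (\<lambda>t. x t + Rl t - Ru t) in
       (\<forall>t\<ge>0. - a \<le> H t \<and> H t \<le> 0) \<and>
       Rl 0 = 0 \<and> Ru 0 = 0 \<and> mono_on {0..} Rl \<and> mono_on {0..} Ru \<and>
       (\<forall>t\<ge>0. continuous (at_right t) Rl \<and> continuous (at_right t) Ru) \<and>
       {t. 0 \<le> t \<and> H t \<noteq> - a} \<in> sets borel \<and>
       {t. 0 \<le> t \<and> H t \<noteq> 0} \<in> sets borel \<and>
       emeasure (interval_measure (\<lambda>t. Rl (max 0 t))) {t. 0 \<le> t \<and> H t \<noteq> - a} = 0 \<and>
       emeasure (interval_measure (\<lambda>t. Ru (max 0 t))) {t. 0 \<le> t \<and> H t \<noteq> 0} = 0)"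

definition passage :: "(real \<Rightarrow> real) \<Rightarrow> real \<Rightarrow> real" where
  "passage Ru r = Inf {t. 0 \<le> t \<and> r < Ru t}"

definition phase_at_passage :: "(real \<Rightarrow> 'n option) \<Rightarrow> (real \<Rightarrow> real) \<Rightarrow> real \<Rightarrow> 'n option" where
  "phase_at_passage J Ru r = (if \<exists>t\<ge>0. r < Ru t then J (passage Ru r) else None)"

end

(* The functions f_c(k, y) = Z(alpha, y)_{kc} turn exp(-alpha R_l(t)) f_c(J(t), a + H(t)) into a
   martingale up to pushes at the upper barrier: inside (-a, 0) they are harmonic for the MAP, and the
   slope alpha Z at 0 cancels the factor exp(-alpha R_l) at the lower barrier. Stopping at rho_r gives
     Z(alpha, a + x) = E_x[exp(-alpha R_l(rho_r)); J(rho_r)] Z(alpha, a)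
                       + E_x[int_0^r exp(-alpha R_l(rho_c)) 1{J(rho_c)} dc] Z'(alpha, a).
   With r = 0 this is the exit identity (and x = -a makes Z(alpha, a) invertible); with x = 0, dividing
   by r and letting r tend to 0 gives Fstar Z + Z' = 0, where Z' = alpha Z - W F at a.

   No generator or stochastic calculus is used. Harmonicity comes from Laplace inversion: the twice
   integrated scale matrix satisfies a renewal equation along t -> X(t), because both sides have the
   transform exp(t F) F^{-1}. Difference quotients of width eta of the twice integrated matrix
   approximate Z, with a drift error supported on {a + H < eta}. Dynkin's formula is obtained by
   telescoping over dyadic grids, and the error vanishes because H(s) = -a has probability 0 for s > 0,
   which follows by reversing the increments of X over a short interval of constant phase. *)

theory Submission
  imports Defs "HOL-Complex_Analysis.Complex_Analysis" "HOL-Real_Asymp.Real_Asymp"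
begin

text \<open>Two obstacles shape the proof. First, Z is not C^1 at 0 when W(0) F is not zero, so it
  cannot be inserted into a change of variables at the lower barrier. The backward difference
  quotient of the twice integrated matrix is C^1 and still satisfies f' = alpha f on the negative
  half-line, so the lower pushes drop out as the grid is refined; the price is the drift error near
  -a. Second, the regulators are given path by path and are only measurable, whereas the Markov
  property speaks of events of (X, J) before killing. They are rebuilt from the observable path by
  alternating one-sided Skorokhod maps. The regularity behind the null event H(s) = -a comes from
  the exponent at r = 0: E_0[exp(-R_l(rho_0)); J(rho_0) = i] = 1 forces rho_0 to be reached in phase
  i, so X exceeds X(rho_0) at times arbitrarily soon afterwards. Since Dynkin's formula needs
  bounded quantities, paths are also stopped when time or R_l exceeds an integer m; this cap is
  removed because almost surely rho_r or killing has occurred by some finite time.\<close>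

notation LIMSEQ (infix "\<leadsto>" 60)

abbreviation (input) Bor :: "'a measure => ('a => 'b::topological_space) set" where "Bor \<equiv> borel_measurable"

subsection \<open>Paths of the two-sided reflection\<close>

lemma continuous_at_right_seq:
	fixes f :: "real => 'b::topological_space"
	assumes "continuous (at_right t) f" "\<And>n. t <= s n" "s \<leadsto> t"
	shows "(%n. f (s n)) \<leadsto> f t"
proof -
	have "continuous (at t within {t..}) f"
	proof -
		have "(f \<longlongrightarrow> f t) (at t within {t<..})"
			using assms(1) by (simp add: continuous_within)
		moreover have "at t within {t..} = at t within {t<..}"
			by (rule at_within_Ici_at_right)
		ultimately show ?thesis by (simp add: continuous_within)
	qed
	thus ?thesis
		using assms(2,3) unfolding continuous_within_sequentially by (auto simp: o_def)
qed

lemma left_approx: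
	fixes t :: real
	assumes "0 < t"
	obtains s :: "nat => real" where "\<And>n. 0 <= s n" "\<And>n. s n < t" "incseq s" "s \<leadsto> t"
proof (rule that[of "%n. t-t*inverse (real (Suc n))"])
	show "0 <= t-t*inverse (real (Suc n))" for n
		using assms mult_left_mono[of "inverse (real (Suc n))" 1 t] by (simp add: inverse_le_1_iff del: of_nat_Suc)
	show "t-t*inverse (real (Suc n)) < t" for n
		using assms by simp
	show "incseq (%n. t-t*inverse (real (Suc n)))"
		using assms by (auto simp: incseq_def intro!: mult_left_mono le_imp_inverse_le)
	have "(%n. t-t*inverse (real (Suc n))) \<leadsto> t-t*0"
		by (intro tendsto_diff tendsto_mult tendsto_const LIMSEQ_inverse_real_of_nat)
	thus "(%n. t-t*inverse (real (Suc n))) \<leadsto> t" by simp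
qed

locale reflected =
	fixes a :: real and x l u :: "real => real"
	assumes a_pos: "a > 0"
		and refl: "two_sided_reflection a x l u"
		and x_rc: "\<And>t. 0 <= t ==> continuous (at_right t) x"
begin

definition h :: "real => real" where "h t = x t+l t-u t"

lemma
	shows h_ge: "0 <= t ==> - a <= h t" and h_le: "0 <= t ==> h t <= 0"
		and l0: "l 0 = 0" and u0: "u 0 = 0"
		and l_mono: "0 <= s ==> s <= t ==> l s <= l t"
		and u_mono: "0 <= s ==> s <= t ==> u s <= u t"
		and l_rc: "0 <= t ==> continuous (at_right t) l"
		and u_rc: "0 <= t ==> continuous (at_right t) u"
		and meas_l: "{t. 0 <= t & h t ~= - a} \<in> sets borel"
		and meas_u: "{t. 0 <= t & h t ~= 0} \<in> sets borel"
		and null_l: "emeasure (interval_measure (%t. l (max 0 t))) {t. 0 <= t & h t ~= - a} = 0"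
		and null_u: "emeasure (interval_measure (%t. u (max 0 t))) {t. 0 <= t & h t ~= 0} = 0"
	using refl unfolding two_sided_reflection_def h_def Let_def mono_on_def
	by auto

text \<open>Turning the strip upside down exchanges the barriers and the regulators. Facts about
  \<open>l\<close> at the lower barrier are proved once and transferred to \<open>u\<close> through
  this mirror image.\<close>

lemma dual: "reflected a (%t. - a-x t) u l"
proof
	show "a > 0" by (rule a_pos)
	have e: "- a-x t+u t-l t = - a-h t" for t by (simp add: h_def)
	have "{t. 0 <= t & - a-h t ~= - a} = {t. 0 <= t & h t ~= 0}"
		"{t. 0 <= t & - a-h t ~= 0} = {t. 0 <= t & h t ~= - a}" by auto
	thus "two_sided_reflection a (%t. - a-x t) u l"
		unfolding two_sided_reflection_def Let_def e mono_on_def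
		using h_ge h_le l0 u0 l_mono u_mono l_rc u_rc meas_l meas_u null_l null_u by auto
	show "continuous (at_right t) (%t. - a-x t)" if "0 <= t" for t
		using x_rc[OF that] by (intro continuous_intros)
qed

lemma dual_h: "reflected.h (%t. - a-x t) u l t = - a-h t"
	using reflected.h_def[OF dual] by (simp add: h_def)

lemma h_rc: "0 <= t ==> continuous (at_right t) h"
	unfolding h_def[abs_def] using x_rc l_rc u_rc by (intro continuous_intros) auto

lemma l_nonneg: "0 <= t ==> 0 <= l t" and u_nonneg: "0 <= t ==> 0 <= u t"
	using l_mono[of 0 t] u_mono[of 0 t] l0 u0 by auto

lemma emeasure_l_Ioc:
	assumes "0 <= s" "s <= t"
	shows "emeasure (interval_measure (%t. l (max 0 t))) {s<..t} = ennreal (l t-l s)"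
proof -
	have rc: "continuous (at_right c) (%t. l (max 0 t))" for c
	proof (cases "0 <= c")
		case True
		have "\<forall>\<^sub>F t in at_right c. l t = l (max 0 t)"
			using True by (auto simp: eventually_at_filter max_def)
		hence "((%t. l (max 0 t)) \<longlongrightarrow> l c) (at_right c)"
			using l_rc[OF True] unfolding continuous_within by (rule Lim_transform_eventually[rotated])
		thus ?thesis using True by (simp add: continuous_within)
	next
		case False
		have "\<forall>\<^sub>F t in at_right c. t < 0" using False
			unfolding eventually_at_right_field by (intro exI[of _ 0]) auto
		hence "\<forall>\<^sub>F t in at_right c. l 0 = l (max 0 t)" by eventually_elim auto
		hence "((%t. l (max 0 t)) \<longlongrightarrow> l 0) (at_right c)"
			by (rule Lim_transform_eventually[rotated]) simp
		thus ?thesis using False by (simp add: continuous_within)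
	qed
	have "emeasure (interval_measure (%t. l (max 0 t))) {s<..t} = ennreal (l (max 0 t)-l (max 0 s))"
		using assms(2) by (rule emeasure_interval_measure_Ioc) (auto intro: l_mono rc)
	thus ?thesis using assms by auto
qed

lemma l_increase:
	assumes "0 <= s" "s <= t" "l s < l t"
	shows "\<exists>v\<in>{s<..t}. h v = - a"
proof (rule ccontr)
	assume "\<not> ?thesis"
	hence "{s<..t} \<subseteq> {t. 0 <= t & h t ~= - a}" using assms(1) by auto
	hence "emeasure (interval_measure (%t. l (max 0 t))) {s<..t}
		\<le> emeasure (interval_measure (%t. l (max 0 t))) {t. 0 <= t & h t ~= - a}"
		by (rule emeasure_mono) (simp add: meas_l)
	hence "ennreal (l t-l s) <= 0"
		unfolding emeasure_l_Ioc[OF assms(1,2)] null_l .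
	thus False using assms(3) by (simp add: ennreal_eq_0_iff)
qed

text \<open>A jump of \<open>l\<close> at t would be an atom of its Stieltjes measure, and that
  measure does not charge times with h different from -a. The conclusion is left continuity in
  epsilon form.\<close>

lemma l_left_cont:
	assumes "0 < t" "h t ~= - a" "0 < e"
	shows "\<exists>s. 0 <= s & s < t & l t-l s < e"
proof (rule ccontr)
	assume "\<not> ?thesis"
	hence big: "e <= l t-l s" if "0 <= s" "s < t" for s using that by force
	let ?M = "interval_measure (%t. l (max 0 t))"
	obtain s where s: "\<And>n. 0 <= s n" "\<And>n. s n < t" "incseq s" "s \<leadsto> t"
		by (rule left_approx[OF assms(1)]) (rule that)
	note s0 = s(1) and st = s(2) and slim = s(4)
	have "decseq (%n. {s n<..t})"
		using s(3) by (auto simp: decseq_def incseq_def) (meson order.strict_trans1)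
	moreover have "range (%n. {s n<..t}) \<subseteq> sets ?M" by auto
	moreover have "emeasure ?M {s n<..t} ~= \<infinity>" for n
		using emeasure_l_Ioc[OF s0 less_imp_le[OF st]] by simp
	ultimately have "(%n. emeasure ?M {s n<..t}) \<leadsto> emeasure ?M (\<Inter>n. {s n<..t})"
		by (intro Lim_emeasure_decseq) auto
	moreover have "(\<Inter>n. {s n<..t}) = {t}"
	proof -
		have "v = t" if "\<And>n. s n < v" "v <= t" for v
			using LIMSEQ_le_const2[OF slim, of v] that by (force intro: less_imp_le)
		thus ?thesis using st by auto
	qed
	ultimately have lim: "(%n. emeasure ?M {s n<..t}) \<leadsto> emeasure ?M {t}" by simp
	have "ennreal e <= emeasure ?M {s n<..t}" for n
		using emeasure_l_Ioc[OF s0 less_imp_le[OF st]] big[OF s0 st] by (simp add: ennreal_leI)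
	hence "ennreal e <= emeasure ?M {t}"
		by (intro LIMSEQ_le_const[OF lim]) auto
	moreover have "emeasure ?M {t} <= emeasure ?M {t. 0 <= t & h t ~= - a}"
		using assms by (intro emeasure_mono) (auto simp: meas_l)
	ultimately show False using null_l assms(3) by simp
qed

text \<open>By right continuity h stays above -a for a while after t, and \<open>l\<close> cannot
  increase there.\<close>

lemma l_const_right:
	assumes "0 <= t" "h t ~= - a"
	obtains e where "0 < e" "\<And>s. t <= s ==> s <= t+e ==> l s = l t"
proof -
	have "- a < h t" using assms h_ge[of t] by simp
	hence "\<forall>\<^sub>F s in at_right t. - a < h s"
		using h_rc[OF assms(1)] by (auto simp: continuous_within intro: order_tendstoD)
	then obtain b where b: "b > t" "\<And>s. t < s ==> s < b ==> - a < h s"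
		unfolding eventually_at_right_field by blast
	show ?thesis
	proof (rule that[of "(b-t)/2"])
		fix s assume s: "t <= s" "s <= t+(b-t)/2"
		show "l s = l t"
		proof (rule ccontr)
			assume "l s ~= l t"
			hence "l t < l s" using l_mono[OF assms(1) s(1)] by simp
			then obtain v where "v \<in> {t<..s}" "h v = - a" using l_increase[OF assms(1) s(1)] by auto
			moreover from this have "v < b" using s b(1) by (auto simp: field_simps)
			ultimately show False using b(2)[of v] by auto
		qed
	qed (use b in simp)
qed

text \<open>At the passage of a level, h sits at the barrier: otherwise \<open>l\<close> would be
  constant just after the passage (if it equals c there) or left continuous at it (if it exceeds c),
  and either contradicts the infimum.\<close>

lemma passage_l:
	assumes "0 <= c" "0 <= t1" "c < l t1"
	shows passage_l_ge: "0 <= passage l c"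
		and passage_l_less: "0 <= s ==> s < passage l c ==> l s <= c"
		and passage_l_gr: "passage l c < s ==> c < l s"
		and l_passage: "c <= l (passage l c)"
		and h_passage_l: "h (passage l c) = - a"
proof -
	let ?S = "{t. 0 <= t & c < l t}"
	let ?s = "passage l c"
	have ne: "t1 \<in> ?S" and bb: "bdd_below ?S" using assms by (auto intro: bdd_belowI[of _ 0])
	show ge: "0 <= ?s" unfolding passage_def using ne by (intro cInf_greatest) auto
	show less: "l s <= c" if "0 <= s" "s < ?s" for s
		using that cInf_lower[OF _ bb, of s] unfolding passage_def by force
	show gr: "c < l s" if "?s < s" for s
	proof -
		have "Inf ?S < s" using that by (simp add: passage_def)
		moreover have "?S ~= {}" using ne by (rule ex_in_conv[THEN iffD1, OF exI])
		ultimately have "\<exists>v\<in>?S. v < s" by (intro cInf_lessD)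
		then obtain v where "v \<in> ?S" "v < s" ..
		thus ?thesis using l_mono[of v s] by auto
	qed
	show ge_c: "c <= l ?s"
	proof -
		have "(%n. l (?s+inverse (real (Suc n)))) \<leadsto> l ?s"
			using LIMSEQ_inverse_real_of_nat_add[of ?s]
			by (intro continuous_at_right_seq[OF l_rc[OF ge]]) auto
		thus ?thesis by (rule LIMSEQ_le_const) (auto intro!: less_imp_le gr)
	qed
	show "h ?s = - a"
	proof (rule ccontr)
		assume n: "h ?s ~= - a"
		show False
		proof (cases "l ?s = c")
			case True
			obtain e where e: "0 < e" "\<And>s. ?s <= s ==> s <= ?s+e ==> l s = l ?s"
				by (rule l_const_right[OF ge n]) (rule that)
			have "l (?s+e) = l ?s" by (rule e(2)) (use e(1) in auto)
			thus False using gr[of "?s+e"] e(1) True by simp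
		next
			case False
			hence c: "c < l ?s" using ge_c by simp
			hence "?s ~= 0" using l0 assms(1) by auto
			hence p: "0 < ?s" using ge by simp
			obtain s where "0 <= s" "s < ?s" "l ?s-l s < l ?s-c"
				using l_left_cont[OF p n, of "l ?s-c"] c by auto
			thus False using less[of s] by simp
		qed
	qed
qed

lemmas u_increase = reflected.l_increase[OF dual, unfolded dual_h, simplified]
	and u_left_cont = reflected.l_left_cont[OF dual, unfolded dual_h, simplified]
	and u_const_right = reflected.l_const_right[OF dual, unfolded dual_h, simplified]
	and passage_u_ge = reflected.passage_l_ge[OF dual, unfolded dual_h, simplified]
	and passage_u_less = reflected.passage_l_less[OF dual, unfolded dual_h, simplified]
	and passage_u_gr = reflected.passage_l_gr[OF dual, unfolded dual_h, simplified]
	and u_passage = reflected.l_passage[OF dual, unfolded dual_h, simplified]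
	and h_passage_u = reflected.h_passage_l[OF dual, unfolded dual_h, simplified]

lemma l_tendsto_left:
	assumes "0 < t" "h t ~= - a" "\<And>n. 0 <= s n" "\<And>n. s n <= t" "s \<leadsto> t"
	shows "(%n. l (s n)) \<leadsto> l t"
proof (rule LIMSEQ_I)
	fix e :: real assume "0 < e"
	obtain v where v: "0 <= v" "v < t" "l t-l v < e" using l_left_cont[OF assms(1,2) \<open>0 < e\<close>] by auto
	have "\<forall>\<^sub>F n in sequentially. v < s n" using assms(5) v(2) by (rule order_tendstoD)
	then obtain N where N: "\<And>n. n \<ge> N ==> v < s n" by (auto simp: eventually_sequentially)
	have "norm (l (s n)-l t) < e" if "n \<ge> N" for n
		using l_mono[OF v(1) less_imp_le[OF N[OF that]]] l_mono[OF assms(3) assms(4), of n] v(3) by auto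
	thus "\<exists>no. \<forall>n\<ge>no. norm (l (s n)-l t) < e" by blast
qed

text \<open>The regulator \<open>u\<close> can jump only together with an upward jump of x. Just
  before the passage u <= c and h <= 0, so x <= c - l there; \<open>l\<close> is left continuous
  because h = 0 is away from -a. If x does not jump up and \<open>u\<close> exceeded c, then h would
  be negative at the passage.\<close>

lemma u_passage_eq:
	assumes "0 <= c" "0 <= t1" "c < u t1"
		and nojump: "0 < passage u c ==> \<exists>y. (x \<longlongrightarrow> y) (at_left (passage u c)) & x (passage u c) <= y"
	shows "u (passage u c) = c"
proof (rule ccontr)
	let ?s = "passage u c"
	assume "u ?s ~= c"
	hence c: "c < u ?s" using u_passage[OF assms(1-3)] by simp
	have ge: "0 <= ?s" by (rule passage_u_ge[OF assms(1-3)])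
	have h0: "h ?s = 0" by (rule h_passage_u[OF assms(1-3)])
	have "?s ~= 0" using c u0 assms(1) by auto
	hence p: "0 < ?s" using ge by simp
	obtain y where y: "(x \<longlongrightarrow> y) (at_left ?s)" "x ?s <= y" using nojump[OF p] by auto
	obtain s where s: "\<And>n. 0 <= s n" "\<And>n. s n < ?s" "incseq s" "s \<leadsto> ?s"
		by (rule left_approx[OF p]) (rule that)
	note s0 = s(1,2) and slim = s(4)
	have fs: "filterlim s (at_left ?s) sequentially"
		by (rule tendsto_imp_filterlim_at_left[OF slim]) (simp add: s0(2))
	have xl: "(%n. x (s n)) \<leadsto> y" by (rule filterlim_compose[OF y(1) fs])
	have ll: "(%n. l (s n)) \<leadsto> l ?s"
		using h0 a_pos by (intro l_tendsto_left p s0 slim less_imp_le[OF s0(2)]) auto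
	have "x (s n) <= - l (s n)+c" for n
		using h_le[OF s0(1)[of n]] passage_u_less[OF assms(1-3) s0(1) s0(2), of n] by (simp add: h_def)
	hence "y <= - l ?s+c" by (intro LIMSEQ_le[OF xl tendsto_add[OF tendsto_minus[OF ll] tendsto_const]]) auto
	thus False using y(2) c h0 by (simp add: h_def)
qed

end

section \<open>The regulators as limits of alternating one-sided Skorokhod maps\<close>

lemma right_rat:
	fixes g :: "real => real"
	assumes "continuous (at_right s) g" "y < g s" "s < t"
	obtains q where "q \<in> \<rat>" "s < q" "q < t" "y < g q"
proof -
	have "\<forall>\<^sub>F r in at_right s. y < g r"
		using assms(1,2) by (auto simp: continuous_within intro: order_tendstoD)
	then obtain b where b: "b > s" "\<And>r. s < r ==> r < b ==> y < g r"
		unfolding eventually_at_right_field by blast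
	obtain q where "q \<in> \<rat>" "s < q" "q < min b t" using Rats_dense_in_real[of s "min b t"] b assms(3) by auto
	thus ?thesis using that[of q] b(2)[of q] by auto
qed

text \<open>The one-sided Skorokhod regulator that keeps x + f below 0. The supremum runs over
  rational times, hence is countable and measurable, and it takes values in \<open>ereal\<close> so
  that limits of iterates require no bound in advance.\<close>

definition runsup :: "(real => real) => (real => ereal) => real => ereal" where
	"runsup x f t = (SUP q\<in>\<rat> \<inter> {0..t}. max 0 (ereal (x q)+f q))"

lemma runsup_mono: "(\<And>q. q \<in> \<rat> ==> 0 <= q ==> q <= t ==> f q <= g q) ==> runsup x f t <= runsup x g t"
	unfolding runsup_def by (intro SUP_subset_mono order_refl max.mono add_left_mono) auto

lemma runsup_mono_time: "s <= t ==> runsup x f s <= runsup x f t"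
	unfolding runsup_def by (intro SUP_subset_mono) auto

lemma runsup_cong:
	"(\<And>q. q \<in> \<rat> ==> 0 <= q ==> q <= t ==> x q = y q) ==> (\<And>q. q \<in> \<rat> ==> 0 <= q ==> q <= t ==> f q = g q) ==>
		runsup x f t = runsup y g t"
	unfolding runsup_def by (intro SUP_cong) auto

lemma runsup_nonneg: "0 <= t ==> 0 <= runsup x f t"
	unfolding runsup_def by (intro SUP_upper2[of 0]) auto

text \<open>Suprema commute, so \<open>runsup\<close> passes to the limit of the iterates; this
  direction yields both half-steps for the limit in \<open>iter_limit\<close>.\<close>

lemma runsup_SUP:
	fixes f :: "nat => real => ereal"
	shows "runsup x (%q. SUP n. f n q) t <= (SUP n. runsup x (f n) t)"
	unfolding runsup_def
proof (rule SUP_least)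
	fix q assume q: "q \<in> \<rat> \<inter> {0..t}"
	have "ereal (x q)+(SUP n. f n q) = (SUP n. ereal (x q)+f n q)"
		by (rule SUP_ereal_add_right[symmetric]) auto
	also have "\<dots> <= (SUP n. SUP q\<in>\<rat> \<inter> {0..t}. max 0 (ereal (x q)+f n q))"
		by (intro SUP_subset_mono order_refl SUP_upper2[OF q] max.cobounded2)
	finally have "ereal (x q)+(SUP n. f n q) <= (SUP n. SUP q\<in>\<rat> \<inter> {0..t}. max 0 (ereal (x q)+f n q))" .
	moreover have "0 <= (SUP n. SUP q\<in>\<rat> \<inter> {0..t}. max 0 (ereal (x q)+f n q))"
		by (intro SUP_upper2[of 0] SUP_upper2[OF q]) auto
	ultimately show "max 0 (ereal (x q)+(SUP n. f n q)) <= (SUP n. SUP q\<in>\<rat> \<inter> {0..t}. max 0 (ereal (x q)+f n q))"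
		by simp
qed

text \<open>Regulation alternates between top and bottom, starting from no lower push. Each iterate
  depends only on the path up to t, which makes the limit adapted.\<close>

primrec lower_iter :: "real => (real => real) => nat => real => ereal" where
	"lower_iter a x 0 = (%t. 0)"
| "lower_iter a x (Suc n) = runsup (%t. - a-x t) (runsup x (lower_iter a x n))"

lemma lower_iter_cong:
	assumes "\<And>q. 0 <= q ==> q <= t ==> x q = y q"
	shows "lower_iter a x n t = lower_iter a y n t"
	using assms
proof (induction n arbitrary: t)
	case (Suc n)
	show ?case unfolding lower_iter.simps
		by (intro runsup_cong) (auto simp: Suc.prems intro!: Suc.IH Suc.prems)
qed simp

context reflected
begin

text \<open>Skorokhod's formula for the lower regulator with the upper one given. One bound is h >=
  -a. For the other, the path lies at -a when \<open>l\<close> passes a level c, so -a - x + u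
  equals l >= c there, and right continuity carries this to a rational time; t is rational because
  the passage may be t itself.\<close>

lemma runsup_u:
	assumes "t \<in> \<rat>" "0 <= t"
	shows "runsup (%t. - a-x t) (%q. ereal (u q)) t = ereal (l t)"
proof (rule antisym)
	show "runsup (%t. - a-x t) (%q. ereal (u q)) t <= ereal (l t)"
		unfolding runsup_def
	proof (rule SUP_least)
		fix q assume q: "q \<in> \<rat> \<inter> {0..t}"
		hence "- a-x q+u q <= l q" using h_ge[of q] by (simp add: h_def)
		also have "l q <= l t" using q by (intro l_mono) auto
		finally show "max 0 (ereal (- a-x q)+ereal (u q)) <= ereal (l t)"
			using l_nonneg[OF assms(2)] by simp
	qed
	show "ereal (l t) <= runsup (%t. - a-x t) (%q. ereal (u q)) t"
	proof (rule dense_le)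
		fix z assume z: "z < ereal (l t)"
		show "z <= runsup (%t. - a-x t) (%q. ereal (u q)) t"
		proof (cases "0 <= z")
			case False
			thus ?thesis using runsup_nonneg[OF assms(2)] by (meson linear order_trans)
		next
			case True
			then obtain y where y: "z = ereal y" using z by (cases z) auto
			define c where "c = (y+l t)/2"
			have c: "0 <= c" "y < c" "c < l t" using True z y by (auto simp: c_def)
			note pas = passage_l[OF c(1) assms(2) c(3)]
			let ?s = "passage l c"
			let ?g = "%q. - a-x q+u q"
			have st: "?s <= t" using pas(2)[OF assms(2)] c(3) by (meson not_le)
			have gs: "y < ?g ?s" using pas(4,5) c(2) by (simp add: h_def)
			have "\<exists>q\<in>\<rat> \<inter> {0..t}. y < ?g q"
			proof (cases "?s = t")
				case True thus ?thesis using gs assms by auto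
			next
				case False
				hence lt: "?s < t" using st by simp
				have rc: "continuous (at_right ?s) ?g"
					using x_rc[OF pas(1)] u_rc[OF pas(1)] by (intro continuous_intros)
				obtain q where "q \<in> \<rat>" "?s < q" "q < t" "y < ?g q"
					by (rule right_rat[OF rc gs lt]) (rule that)
				thus ?thesis using pas(1) by (intro bexI[of _ q]) auto
			qed
			then obtain q where "q \<in> \<rat> \<inter> {0..t}" "y < ?g q" by blast
			thus ?thesis unfolding runsup_def y by (intro SUP_upper2[of q]) (auto simp: le_max_iff_disj)
		qed
	qed
qed

text \<open>Agreement before th extends past th when h th is off the lower barrier: there
  \<open>l\<close> is left continuous and then constant for a while, so the increasing minorant
  \<open>li\<close> catches up with it; \<open>u\<close> follows because it is the one-sided
  regulator generated by \<open>l\<close>.\<close>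

lemma iter_step:
	fixes li ui :: "real => ereal"
	assumes mono: "\<And>p q. 0 <= p ==> p <= q ==> li p <= li q" "\<And>q. 0 <= q ==> 0 <= li q"
		and le: "\<And>q. q \<in> \<rat> ==> 0 <= q ==> li q <= ereal (l q)" "\<And>q. q \<in> \<rat> ==> 0 <= q ==> ui q <= ereal (u q)"
		and A: "\<And>q. q \<in> \<rat> ==> 0 <= q ==> ereal (u q) <= runsup x li q ==> ereal (u q) <= ui q"
		and th: "0 <= th" "h th ~= - a" and eq: "\<And>q. q \<in> \<rat> ==> 0 <= q ==> q < th ==> li q = ereal (l q)"
	shows "\<exists>e>0. \<forall>q\<in>\<rat>. th <= q --> q <= th+e --> li q = ereal (l q) & ui q = ereal (u q)"
proof -
	obtain e where e: "0 < e" "\<And>s. th <= s ==> s <= th+e ==> l s = l th"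
		by (rule l_const_right[OF th]) (rule that)
	have L: "li q = ereal (l q)" if q: "q \<in> \<rat>" "th <= q" "q <= th+e" for q
	proof (rule antisym)
		have q0: "0 <= q" using q th(1) by simp
		show "li q <= ereal (l q)" by (rule le(1)[OF q(1) q0])
		have lq: "l q = l th" by (rule e(2)[OF q(2,3)])
		show "ereal (l q) <= li q"
		proof (cases "th = 0")
			case True thus ?thesis using mono(2)[OF q0] lq l0 by (simp flip: zero_ereal_def)
		next
			case False
			hence thp: "0 < th" using th(1) by simp
			show ?thesis
			proof (rule ereal_le_epsilon2)
				fix d :: real assume d: "0 < d"
				obtain s where s: "0 <= s" "s < th" "l th-l s < d" using l_left_cont[OF thp th(2) d] by auto
				obtain p where p: "p \<in> \<rat>" "s < p" "p < th" using Rats_dense_in_real[OF s(2)] by auto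
				have "l th <= l p+d" using s l_mono[of s p] p by simp
				hence "ereal (l q) <= ereal (l p)+ereal d" using lq by simp
				also have "ereal (l p) = li p" using eq[of p] p s by simp
				also have "li p <= li q" using p s q by (intro mono) auto
				finally show "ereal (l q) <= li q+ereal d" by (simp add: add_right_mono)
			qed
		qed
	qed
	have all: "li q = ereal (l q)" if "q \<in> \<rat>" "0 <= q" "q <= th+e" for q
		using L[of q] eq[of q] that by (cases "q < th") auto
	have "ui q = ereal (u q)" if q: "q \<in> \<rat>" "th <= q" "q <= th+e" for q
	proof (rule antisym)
		have q0: "0 <= q" using q th(1) by simp
		show "ui q <= ereal (u q)" by (rule le(2)[OF q(1) q0])
		have "ereal (u q) = runsup x (%q. ereal (l q)) q"
			using reflected.runsup_u[OF dual q(1) q0] by simp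
		also have "\<dots> = runsup x li q" using q by (intro runsup_cong) (auto simp: all)
		finally show "ereal (u q) <= ui q" using A[OF q(1) q0] by simp
	qed
	thus ?thesis using L e(1) by blast
qed

text \<open>The iterates stay below l and u by monotonicity of \<open>runsup\<close>. If the limits
  fell short somewhere, agreement would still hold before the infimum of the bad rational times, and
  it would extend past it.\<close>

lemma iter_limit:
	assumes t: "t \<in> \<rat>" "0 <= t"
	shows "(SUP n. lower_iter a x n t) = ereal (l t)"
		and "(SUP n. runsup x (lower_iter a x n) t) = ereal (u t)"
proof -
	define li where "li t = (SUP n. lower_iter a x n t)" for t
	define ui where "ui t = (SUP n. runsup x (lower_iter a x n) t)" for t
	have le1: "lower_iter a x n q <= ereal (l q)" if "q \<in> \<rat>" "0 <= q" for q n
		using that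
	proof (induction n arbitrary: q)
		case 0 thus ?case using l_nonneg by simp
	next
		case (Suc n)
		have "lower_iter a x (Suc n) q <= runsup (%t. - a-x t) (runsup x (%q. ereal (l q))) q"
			unfolding lower_iter.simps by (intro runsup_mono Suc.IH)
		also have "\<dots> = runsup (%t. - a-x t) (%q. ereal (u q)) q"
			using reflected.runsup_u[OF dual] by (intro runsup_cong) auto
		also have "\<dots> = ereal (l q)" by (rule runsup_u[OF Suc.prems])
		finally show ?case .
	qed
	have le2: "runsup x (lower_iter a x n) q <= ereal (u q)" if "q \<in> \<rat>" "0 <= q" for q n
	proof -
		have "runsup x (lower_iter a x n) q <= runsup x (%q. ereal (l q)) q" by (intro runsup_mono le1)
		also have "\<dots> = ereal (u q)" using reflected.runsup_u[OF dual that] by simp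
		finally show ?thesis .
	qed
	have le: "li q <= ereal (l q)" "ui q <= ereal (u q)" if "q \<in> \<rat>" "0 <= q" for q
		unfolding li_def ui_def using le1[OF that] le2[OF that] by (auto intro: SUP_least)
	have mono1: "lower_iter a x n p <= lower_iter a x n q" if "p <= q" for n p q
		using that by (cases n) (auto intro: runsup_mono_time)
	have mono: "li p <= li q" "ui p <= ui q" if "p <= q" for p q
		unfolding li_def ui_def using mono1[OF that] runsup_mono_time[OF that] by (auto intro!: SUP_mono)
	have pos: "0 <= li q" "0 <= ui q" if "0 <= q" for q
		unfolding li_def ui_def by (auto intro!: SUP_upper2[of 0] runsup_nonneg that)
	have A: "runsup x li q <= ui q" for q unfolding li_def ui_def by (rule runsup_SUP)
	have B: "runsup (%t. - a-x t) ui q <= li q" for q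
	proof -
		have "runsup (%t. - a-x t) ui q <= (SUP n. runsup (%t. - a-x t) (runsup x (lower_iter a x n)) q)"
			unfolding ui_def by (rule runsup_SUP)
		also have "\<dots> <= li q" unfolding li_def
			by (intro SUP_least, rule SUP_upper2[where i="Suc n" for n]) auto
		finally show ?thesis .
	qed
	define E where "E q \<longleftrightarrow> li q = ereal (l q) & ui q = ereal (u q)" for q
	have "E t"
	proof (rule ccontr)
		assume nE: "\<not> E t"
		define Bad where "Bad = {q. q \<in> \<rat> & 0 <= q & \<not> E q}"
		define th where "th = Inf Bad"
		have ne: "Bad ~= {}" using nE t by (auto simp: Bad_def)
		have bb: "bdd_below Bad" by (rule bdd_belowI[of _ 0]) (simp add: Bad_def)
		have th0: "0 <= th" unfolding th_def using ne by (intro cInf_greatest) (auto simp: Bad_def)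
		have below: "E q" if "q \<in> \<rat>" "0 <= q" "q < th" for q
		proof (rule ccontr)
			assume "\<not> E q"
			hence "q \<in> Bad" using that by (simp add: Bad_def)
			hence "th <= q" unfolding th_def using bb by (intro cInf_lower)
			thus False using that by simp
		qed
		\<comment> \<open>As a > 0, h th differs from at least one barrier; \<open>iter_step\<close>
		  applies to the path or to its mirror image, with the roles of l and u exchanged.\<close>
		have "\<exists>e>0. \<forall>q\<in>\<rat>. th <= q --> q <= th+e --> E q"
		proof (cases "h th = - a")
			case False
			show ?thesis unfolding E_def
			proof (rule iter_step)
				show "h th ~= - a" "0 <= th" by fact+
				show "li q = ereal (l q)" if "q \<in> \<rat>" "0 <= q" "q < th" for q
					using below[OF that] by (simp add: E_def)
				show "ereal (u q) <= ui q" if "ereal (u q) <= runsup x li q" for q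
					using that A[of q] by (rule order_trans)
			qed (use mono pos le in auto)
		next
			case True
			have "\<exists>e>0. \<forall>q\<in>\<rat>. th <= q --> q <= th+e --> ui q = ereal (u q) & li q = ereal (l q)"
			proof (rule reflected.iter_step[OF dual])
				show "reflected.h (%t. - a-x t) u l th ~= - a" unfolding dual_h using True a_pos by simp
				show "0 <= th" by fact
				show "ui q = ereal (u q)" if "q \<in> \<rat>" "0 <= q" "q < th" for q
					using below[OF that] by (simp add: E_def)
				show "ereal (l q) <= li q" if "ereal (l q) <= runsup (%t. - a-x t) ui q" for q
					using that B[of q] by (rule order_trans)
			qed (use mono pos le in auto)
			thus ?thesis unfolding E_def by blast
		qed
		then obtain e where e: "0 < e" "\<And>q. q \<in> \<rat> ==> th <= q ==> q <= th+e ==> E q" by blast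
		have "th+e <= th" unfolding th_def
		proof (rule cInf_greatest[OF ne])
			fix q assume q: "q \<in> Bad"
			show "Inf Bad+e <= q"
			proof (rule ccontr)
				assume "\<not> Inf Bad+e <= q"
				moreover have "th <= q" unfolding th_def by (rule cInf_lower[OF q bb])
				ultimately have "E q" using q by (intro e(2)) (auto simp: Bad_def th_def)
				thus False using q by (simp add: Bad_def)
			qed
		qed
		thus False using e(1) by simp
	qed
	thus "(SUP n. lower_iter a x n t) = ereal (l t)" "(SUP n. runsup x (lower_iter a x n) t) = ereal (u t)"
		by (simp_all add: E_def li_def ui_def)
qed

end

subsection \<open>Matrix exponentials\<close>

lemma mpow_bound:
	fixes A :: "real^'n::finite^'n"
	assumes B: "\<And>i j. \<bar>A$i$j\<bar> <= B"
	shows "\<bar>mpow A k $ i $ j\<bar> <= (real CARD('n)*B) ^ k"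
proof (induction k arbitrary: i)
	case 0 show ?case by (simp add: mat_def)
next
	case (Suc k)
	have B0: "0 <= B" using B[of i j] by linarith
	have "\<bar>mpow A (Suc k) $ i $ j\<bar> <= (\<Sum>p\<in>UNIV. \<bar>A $ i $ p\<bar>*\<bar>mpow A k $ p $ j\<bar>)"
		by (simp add: matrix_matrix_mult_def) (intro order_trans[OF sum_abs], simp add: abs_mult)
	also have "\<dots> <= (\<Sum>p\<in>(UNIV::'n set). B*(real CARD('n)*B) ^ k)"
		by (intro sum_mono mult_mono B Suc.IH) (auto simp: B0)
	also have "\<dots> = (real CARD('n)*B) ^ Suc k" by simp
	finally show ?case .
qed

lemma mpow_commute: "mpow A (Suc k) = mpow A k ** A"
	by (induction k) (simp_all add: matrix_mul_assoc)

lemma mpow_scaleR: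
	fixes A :: "real^'n::finite^'n"
	shows "mpow (scaleR t A) k $ i $ j = t ^ k*mpow A k $ i $ j"
proof (induction k arbitrary: i)
	case (Suc k)
	have "mpow (scaleR t A) (Suc k) $ i $ j = (\<Sum>p\<in>UNIV. (t*A $ i $ p)*mpow (scaleR t A) k $ p $ j)"
		by (simp add: matrix_matrix_mult_def)
	also have "\<dots> = (\<Sum>p\<in>UNIV. t ^ Suc k*(A $ i $ p*mpow A k $ p $ j))"
		by (simp add: Suc.IH mult_ac)
	also have "\<dots> = t ^ Suc k*mpow A (Suc k) $ i $ j"
		by (simp add: matrix_matrix_mult_def sum_distrib_left)
	finally show ?case .
qed simp

lemma mexp_summable:
	fixes A :: "real^'n::finite^'n"
	shows "summable (%k. (mpow A k $ i $ j/fact k)*t ^ k)"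
proof -
	define B where "B = (\<Sum>i\<in>UNIV. \<Sum>j\<in>UNIV. \<bar>A$i$j\<bar>)"
	have B: "\<bar>A$i$j\<bar> <= B" for i j
	proof -
		have "\<bar>A$i$j\<bar> <= (\<Sum>j\<in>UNIV. \<bar>A$i$j\<bar>)" by (rule member_le_sum) auto
		also have "\<dots> <= B" unfolding B_def by (rule member_le_sum) (auto intro: sum_nonneg)
		finally show ?thesis .
	qed
	let ?c = "real CARD('n)*B"
	have "summable (%k. (?c*\<bar>t\<bar>) ^ k /\<^sub>R fact k)" by (rule summable_exp_generic)
	moreover have "norm ((mpow A k $ i $ j/fact k)*t ^ k) <= (?c*\<bar>t\<bar>) ^ k /\<^sub>R fact k" for k
	proof -
		have "norm ((mpow A k $ i $ j/fact k)*t ^ k) = \<bar>mpow A k $ i $ j\<bar>*\<bar>t\<bar> ^ k/fact k"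
			by (simp add: abs_mult power_abs)
		also have "\<dots> <= ?c ^ k*\<bar>t\<bar> ^ k/fact k"
			by (intro divide_right_mono mult_right_mono mpow_bound B) auto
		finally show ?thesis by (simp add: power_mult_distrib divide_inverse mult_ac)
	qed
	ultimately show ?thesis by (rule summable_comparison_test'[where N=0])
qed

lemma mexp_entry:
	fixes A :: "real^'n::finite^'n"
	shows "mexp (scaleR t A) $ i $ j = (\<Sum>k. (mpow A k $ i $ j/fact k)*t ^ k)"
proof -
	define L :: "real^'n^'n" where "L = (\<chi> i j. \<Sum>k. (mpow A k $ i $ j/fact k)*t ^ k)"
	have "(%n. \<Sum>k<n. scaleR (1/fact k) (mpow (scaleR t A) k)) \<leadsto> L"
	proof (intro vec_tendstoI)
		fix i j
		have "(%k. (mpow A k $ i $ j/fact k)*t ^ k) sums (L $ i $ j)"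
			unfolding L_def using summable_sums[OF mexp_summable] by simp
		thus "(%n. (\<Sum>k<n. scaleR (1/fact k) (mpow (scaleR t A) k)) $ i $ j) \<leadsto> L $ i $ j"
			by (simp add: sums_def mpow_scaleR mult_ac)
	qed
	hence "mexp (scaleR t A) = L" unfolding mexp_def by (intro sums_unique[symmetric]) (simp add: sums_def)
	thus ?thesis by (simp add: L_def)
qed

lemma mexp_0: "mexp 0 = (mat 1 :: real^'n::finite^'n)"
proof -
	have "mexp (scaleR 0 (0::real^'n^'n)) $ i $ j = mat 1 $ i $ j" for i j
		unfolding mexp_entry using powser_zero[of "%k. mpow 0 k $ i $ j/fact k"] by simp
	thus ?thesis by (simp add: vec_eq_iff)
qed

lemma mexp_deriv:
	fixes A :: "real^'n::finite^'n"
	shows "((%t. mexp (scaleR t A) $ i $ j) has_real_derivative (mexp (scaleR t A) ** A) $ i $ j) (at t)"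
proof -
	let ?c = "%i j k. mpow A k $ i $ j/fact k"
	have "((%t. \<Sum>k. ?c i j k*t ^ k) has_real_derivative (\<Sum>k. diffs (?c i j) k*t ^ k)) (at t)"
		by (rule termdiffs_strong_converges_everywhere) (rule mexp_summable)
	moreover have "(\<Sum>k. diffs (?c i j) k*t ^ k) = (mexp (scaleR t A) ** A) $ i $ j"
	proof -
		have "diffs (?c i j) k*t ^ k = (\<Sum>p\<in>UNIV. (?c i p k*t ^ k)*A $ p $ j)" for k
		proof -
			have "diffs (?c i j) k = mpow A (Suc k) $ i $ j/fact k"
				by (simp add: diffs_def divide_simps del: mpow.simps)
			also have "\<dots> = (\<Sum>p\<in>UNIV. ?c i p k*A $ p $ j)"
				unfolding mpow_commute by (simp add: matrix_matrix_mult_def sum_divide_distrib)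
			finally show ?thesis by (simp add: sum_distrib_left sum_distrib_right mult_ac)
		qed
		hence "(\<Sum>k. diffs (?c i j) k*t ^ k) = (\<Sum>k. \<Sum>p\<in>UNIV. (?c i p k*t ^ k)*A $ p $ j)" by simp
		also have "\<dots> = (\<Sum>p\<in>UNIV. \<Sum>k. (?c i p k*t ^ k)*A $ p $ j)"
			by (rule suminf_sum) (intro summable_mult2 mexp_summable)
		also have "\<dots> = (\<Sum>p\<in>UNIV. (\<Sum>k. ?c i p k*t ^ k)*A $ p $ j)"
			by (intro sum.cong refl suminf_mult2[symmetric] mexp_summable)
		also have "\<dots> = (mexp (scaleR t A) ** A) $ i $ j"
			by (simp add: matrix_matrix_mult_def mexp_entry)
		finally show ?thesis .
	qed
	ultimately show ?thesis by (simp add: mexp_entry)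
qed

lemma mexp_cont: "continuous_on S (%t. mexp (scaleR t (A :: real^'n::finite^'n)) $ i $ j)"
	by (intro continuous_at_imp_continuous_on ballI DERIV_isCont[OF mexp_deriv])

text \<open>Multiplied by the inverse of A = F(c), this integrated form is the transform of the
  renewal equation \<open>scale_renewal\<close>. It avoids differentiating expectations in
  t.\<close>

lemma mexp_integral:
	fixes A :: "real^'n::finite^'n"
	assumes "0 <= t"
	shows "mexp (scaleR t A) = mat 1+(\<chi> i j. integral {0..t} (%s. mexp (scaleR s A) $ i $ j)) ** A"
proof -
	have "mexp (scaleR t A) $ i $ j-mat 1 $ i $ j =
		(\<Sum>p\<in>UNIV. integral {0..t} (%s. mexp (scaleR s A) $ i $ p)*A $ p $ j)" for i j
	proof -
		have "((%s. (mexp (scaleR s A) ** A) $ i $ j) has_integral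
			(mexp (scaleR t A) $ i $ j-mexp (scaleR 0 A) $ i $ j)) {0..t}"
			using assms by (intro fundamental_theorem_of_calculus)
				(auto intro!: has_field_derivative_at_within mexp_deriv simp flip: has_real_derivative_iff_has_vector_derivative)
		hence "((%s. \<Sum>p\<in>UNIV. mexp (scaleR s A) $ i $ p*A $ p $ j) has_integral
			(mexp (scaleR t A) $ i $ j-mat 1 $ i $ j)) {0..t}"
			by (simp add: matrix_matrix_mult_def mexp_0)
		moreover have "((%s. \<Sum>p\<in>UNIV. mexp (scaleR s A) $ i $ p*A $ p $ j) has_integral
			(\<Sum>p\<in>UNIV. integral {0..t} (%s. mexp (scaleR s A) $ i $ p)*A $ p $ j)) {0..t}"
			by (intro has_integral_sum has_integral_mult_left integrable_integral integrable_continuous_real mexp_cont) auto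
		ultimately show ?thesis by (rule has_integral_unique)
	qed
	thus ?thesis by (simp add: vec_eq_iff matrix_matrix_mult_def algebra_simps)
qed

subsection \<open>Uniqueness of the bilateral Laplace transform\<close>

lemma norm_exp_minus_1_le:
	fixes z :: complex
	shows "norm (exp z-1) <= norm z*exp (norm z)"
proof -
	have "norm (exp z-exp 0) <= exp (norm z)*norm (z-0)"
	proof (rule field_differentiable_bound[where S="cball 0 (norm z)" and f'=exp])
		show "(exp has_field_derivative exp w) (at w within cball 0 (norm z))" for w :: complex
			by (rule has_field_derivative_at_within) (rule DERIV_exp)
		show "norm (exp w) <= exp (norm z)" if "w \<in> cball 0 (norm z)" for w :: complex
			using that norm_exp[of w] by (auto intro: order_trans)
	qed auto
	thus ?thesis by (simp add: mult.commute)
qed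

lemma abs_le_exp_div: "0 < (e::real) ==> \<bar>x\<bar> <= exp (e*\<bar>x\<bar>)/e"
proof -
	assume "0 < e"
	moreover have "e*\<bar>x\<bar> <= exp (e*\<bar>x\<bar>)" using exp_ge_add_one_self[of "e*\<bar>x\<bar>"] by linarith
	ultimately show ?thesis by (simp add: field_simps)
qed

lemma laplace_bilateral_holomorphic:
	fixes g :: "real => real"
	assumes int: "\<And>t. c < t ==> integrable lborel (%x. exp (- t*x)*g x)"
	shows "(%z. \<integral>x. exp (- z*complex_of_real x)*complex_of_real (g x) \<partial>lborel) holomorphic_on {z. c < Re z}"
		and "\<And>z. c < Re z ==> integrable lborel (%x. exp (- z*complex_of_real x)*complex_of_real (g x))"
proof -
	have meas: "g \<in> Bor borel"
	proof -
		obtain s where s: "c < s" using gt_ex by blast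
		have m: "(%x. exp (- s*x)*g x) \<in> Bor borel"
			using borel_measurable_integrable[OF int[OF s]] by simp
		have "(%x. exp (s*x)*(exp (- s*x)*g x)) \<in> Bor borel"
			by (rule borel_measurable_times[OF _ m]) simp
		moreover have "(%x. exp (s*x)*(exp (- s*x)*g x)) = g" by (simp add: fun_eq_iff exp_minus)
		ultimately show ?thesis by (simp only:)
	qed
	have nrm: "norm (exp (- z*complex_of_real x)*complex_of_real (g x)) = \<bar>exp (- Re z*x)*g x\<bar>" for z x
		by (simp add: norm_mult abs_mult)
	show integ: "integrable lborel (%x. exp (- z*complex_of_real x)*complex_of_real (g x))" if "c < Re z" for z
		by (rule Bochner_Integration.integrable_bound[OF int[OF that]]) (use meas nrm in \<open>auto\<close>)
	let ?\<Phi> = "%z. \<integral>x. exp (- z*complex_of_real x)*complex_of_real (g x) \<partial>lborel"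
	show "?\<Phi> holomorphic_on {z. c < Re z}"
	proof (rule holomorphic_onI)
		fix z assume "z \<in> {z. c < Re z}"
		hence z: "c < Re z" by simp
		\<comment> \<open>Two of the three parts are spent: one factor exp(e |x|) comes from an increment
		  of size at most e, another one bounds |x|. Hence the domination at Re z - 2e and Re z + 2e, both
		  to the right of c.\<close>
		define e where "e = (Re z-c)/3"
		have e: "0 < e" "c < Re z-2*e" using z by (auto simp: e_def field_simps)
		let ?D = "\<integral>x. - complex_of_real x*(exp (- z*complex_of_real x)*complex_of_real (g x)) \<partial>lborel"
		have "((%y. (?\<Phi> y-?\<Phi> z)/(y-z)) \<longlongrightarrow> ?D) (at z)"
			unfolding tendsto_at_iff_sequentially
		proof (intro allI impI)
			fix y :: "nat => complex" assume y: "\<forall>i. y i \<in> UNIV - {z}" "y \<leadsto> z"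
			obtain N where N: "\<And>n. n \<ge> N ==> norm (y n-z) < e"
				using y(2) e(1) by (auto simp: lim_sequentially dist_norm)
			define w where "w n = y (n+N)-z" for n
			have w0: "w n ~= 0" "norm (w n) < e" for n using y(1) N[of "n+N"] by (auto simp: w_def)
			have wlim: "w \<leadsto> 0"
				unfolding w_def using LIMSEQ_ignore_initial_segment[OF y(2), of N] by (simp add: LIM_zero_iff)
			let ?E = "%x. exp (- z*complex_of_real x)*complex_of_real (g x)"
			let ?q = "%n x. (exp (- w n*complex_of_real x)-1)/w n*?E x"
			let ?b = "%x. 1/e*(\<bar>exp (- (Re z-2*e)*x)*g x\<bar>+\<bar>exp (- (Re z+2*e)*x)*g x\<bar>)"
			have "(%n. \<integral>x. ?q n x \<partial>lborel) \<leadsto> ?D"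
			proof (rule integral_dominated_convergence[where w="?b"])
				show "(%x. - complex_of_real x*?E x) \<in> Bor lborel" using meas by simp
				show "?q n \<in> Bor lborel" for n using meas by simp
				show "integrable lborel ?b"
					using e z by (intro integrable_mult_right Bochner_Integration.integrable_add integrable_abs int) auto
				show "AE x in lborel. (%n. ?q n x) \<leadsto> - complex_of_real x*?E x"
				proof (rule AE_I2)
					fix x
					have "((%h. exp (- h*complex_of_real x)) has_field_derivative (- complex_of_real x)) (at 0)"
						by (auto intro!: derivative_eq_intros)
					hence "((%h. (exp (- h*complex_of_real x)-1)/h) \<longlongrightarrow> - complex_of_real x) (at 0)"
						by (simp add: has_field_derivative_iff)
					moreover have "filterlim w (at 0) sequentially"
						by (rule filterlim_atI[OF wlim]) (simp add: w0(1))
					ultimately have "(%n. (exp (- w n*complex_of_real x)-1)/w n) \<leadsto> - complex_of_real x"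
						by (rule filterlim_compose)
					thus "(%n. ?q n x) \<leadsto> - complex_of_real x*?E x" by (intro tendsto_mult tendsto_const)
				qed
				show "AE x in lborel. norm (?q n x) <= ?b x" for n
				proof (rule AE_I2)
					fix x
					have "norm (exp (- w n*complex_of_real x)-1) <= norm (w n)*\<bar>x\<bar>*exp (norm (w n)*\<bar>x\<bar>)"
						using norm_exp_minus_1_le[of "- w n*complex_of_real x"] by (simp add: norm_mult)
					hence "norm ((exp (- w n*complex_of_real x)-1)/w n) <= \<bar>x\<bar>*exp (norm (w n)*\<bar>x\<bar>)"
						using w0(1)[of n] by (simp add: norm_divide field_simps)
					also have "\<dots> <= (exp (e*\<bar>x\<bar>)/e)*exp (e*\<bar>x\<bar>)"
						using w0(2)[of n] e(1) by (intro mult_mono abs_le_exp_div) (auto intro!: mult_right_mono)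
					also have "\<dots> = 1/e*exp (2*e*\<bar>x\<bar>)" by (simp flip: exp_add)
					also have "\<dots> <= 1/e*(exp (2*e*x)+exp (- 2*e*x))"
						using e(1) by (intro mult_left_mono) (auto simp: abs_if)
					finally have "norm (?q n x) <= 1/e*(exp (2*e*x)+exp (- 2*e*x))*norm (?E x)"
						unfolding norm_mult[of "(exp (- w n*complex_of_real x)-1)/w n"] by (rule mult_right_mono) simp
					also have "\<dots> = ?b x"
						unfolding nrm by (simp add: abs_mult algebra_simps flip: exp_add)
					finally show "norm (?q n x) <= ?b x" .
				qed
			qed
			also have "(%n. \<integral>x. ?q n x \<partial>lborel) = (%n. (?\<Phi> (y (n+N))-?\<Phi> z)/(y (n+N)-z))"
			proof
				fix n
				have yn: "c < Re (y (n+N))"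
					using abs_Re_le_cmod[of "w n"] w0(2)[of n] e by (simp add: w_def)
				have "?q n x = (exp (- y (n+N)*complex_of_real x)*complex_of_real (g x)-?E x)/(y (n+N)-z)" for x
					using w0(1)[of n] by (simp add: w_def field_simps flip: exp_add)
				thus "(\<integral>x. ?q n x \<partial>lborel) = (?\<Phi> (y (n+N))-?\<Phi> z)/(y (n+N)-z)"
					using integ[OF yn] integ[OF z] by simp
			qed
			finally show "((%y. (?\<Phi> y-?\<Phi> z)/(y-z)) \<circ> y) \<leadsto> ?D"
				unfolding o_def by (rule LIMSEQ_offset)
		qed
		hence "(?\<Phi> has_field_derivative ?D) (at z)" by (simp add: has_field_derivative_iff)
		thus "?\<Phi> field_differentiable (at z within {z. c < Re z})"
			by (meson field_differentiable_at_within field_differentiable_def)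
	qed
qed

text \<open>The positive and negative parts of v have equal mass (take t = 0). If the mass is
  positive they normalise to probability densities with the same characteristic function, and Levy's
  uniqueness theorem applies.\<close>

lemma integrable_fourier_zero:
	fixes v :: "real => real"
	assumes int: "integrable lborel v"
		and zero: "\<And>t. (\<integral>x. iexp (t*x)*complex_of_real (v x) \<partial>lborel) = 0"
	shows "AE x in lborel. v x = 0"
proof -
	let ?p = "%x. max 0 (v x)" and ?n = "%x. max 0 (- v x)"
	have [measurable]: "v \<in> Bor borel" using int by auto
	have ip: "integrable lborel ?p" and "in": "integrable lborel ?n" using int by auto
	have v: "v x = ?p x-?n x" for x by auto
	have ic: "integrable lborel (%x. iexp (t*x)*complex_of_real (f x))" if "integrable lborel f" for t and f :: "real => real"
	proof (rule Bochner_Integration.integrable_bound[OF that])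
		have "f \<in> Bor borel" using borel_measurable_integrable[OF that] by simp
		thus "(%x. iexp (t*x)*complex_of_real (f x)) \<in> Bor lborel" by simp
	qed (auto simp: norm_mult)
	have eqc: "(\<integral>x. iexp (t*x)*complex_of_real (?p x) \<partial>lborel) = (\<integral>x. iexp (t*x)*complex_of_real (?n x) \<partial>lborel)" for t
	proof -
		have "0 = (\<integral>x. iexp (t*x)*complex_of_real (?p x)-iexp (t*x)*complex_of_real (?n x) \<partial>lborel)"
			unfolding zero[of t, symmetric]
			by (rule Bochner_Integration.integral_cong) (auto simp: max_def algebra_simps)
		also have "\<dots> = (\<integral>x. iexp (t*x)*complex_of_real (?p x) \<partial>lborel)-(\<integral>x. iexp (t*x)*complex_of_real (?n x) \<partial>lborel)"
			by (rule Bochner_Integration.integral_diff[OF ic[OF ip] ic[OF "in"]])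
		finally show ?thesis by simp
	qed
	define m where "m = (\<integral>x. ?p x \<partial>lborel)"
	have "complex_of_real (\<integral>x. ?p x \<partial>lborel) = complex_of_real (\<integral>x. ?n x \<partial>lborel)"
		using eqc[of 0] by (simp only: mult_zero_left of_real_0 mult_zero_right exp_zero mult_1 integral_complex_of_real)
	hence m': "m = (\<integral>x. ?n x \<partial>lborel)" by (simp add: m_def)
	have m0: "0 <= m" unfolding m_def by (rule integral_nonneg_AE) auto
	show ?thesis
	proof (cases "m = 0")
		case True
		have "AE x in lborel. ?p x = 0" "AE x in lborel. ?n x = 0"
			using integral_nonneg_eq_0_iff_AE[OF ip] integral_nonneg_eq_0_iff_AE[OF "in"] True m' m_def by auto
		thus ?thesis by eventually_elim (auto simp: max_def split: if_splits)
	next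
		case False
		hence m: "0 < m" using m0 by simp
		define D where "D f = density lborel (%x. ennreal (f x/m))" for f :: "real => real"
		have rd: "real_distribution (D f)" and ch: "char (D f) = (%t. (\<integral>x. iexp (t*x)*complex_of_real (f x) \<partial>lborel)/m)"
			if f: "integrable lborel f" "\<And>x. 0 <= f x" "(\<integral>x. f x \<partial>lborel) = m" for f
		proof -
			have [measurable]: "f \<in> Bor borel" using borel_measurable_integrable[OF f(1)] by simp
			have "prob_space (D f)"
			proof
				have "emeasure (D f) (space (D f)) = (\<integral>\<^sup>+x. ennreal (f x/m) \<partial>lborel)"
					unfolding D_def by (subst emeasure_density) auto
				also have "\<dots> = ennreal (\<integral>x. f x/m \<partial>lborel)"
					using f m by (intro nn_integral_eq_integral) (auto intro!: AE_I2)
				also have "\<dots> = 1" using f(3) m by simp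
				finally show "emeasure (D f) (space (D f)) = 1" .
			qed
			thus "real_distribution (D f)"
				by (simp add: real_distribution_def real_distribution_axioms_def D_def)
			show "char (D f) = (%t. (\<integral>x. iexp (t*x)*complex_of_real (f x) \<partial>lborel)/m)"
			proof
				fix t
				have "char (D f) t = (\<integral>x. (f x/m) *\<^sub>R iexp (t*x) \<partial>lborel)"
					unfolding char_def D_def using f(2) m by (subst integral_density) auto
				also have "\<dots> = (\<integral>x. (iexp (t*x)*complex_of_real (f x))/complex_of_real m \<partial>lborel)"
					by (rule Bochner_Integration.integral_cong) (auto simp: scaleR_conv_of_real)
				also have "\<dots> = (\<integral>x. iexp (t*x)*complex_of_real (f x) \<partial>lborel)/m"
					by (rule Bochner_Integration.integral_divide_zero)
				finally show "char (D f) t = (\<integral>x. iexp (t*x)*complex_of_real (f x) \<partial>lborel)/m" .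
			qed
		qed
		have "D ?p = D ?n"
		proof (rule Levy_uniqueness)
			show "real_distribution (D ?p)" using ip m_def by (intro rd) auto
			show "real_distribution (D ?n)" using "in" m' by (intro rd) auto
			show "char (D ?p) = char (D ?n)"
				using ch[OF ip] ch[OF "in"] m_def m' eqc by simp
		qed
		hence "AE x in lborel. ennreal (?p x/m) = ennreal (?n x/m)"
			unfolding D_def by (subst (asm) sigma_finite_measure.density_unique_iff[OF lborel.sigma_finite_measure_axioms]) auto
		thus ?thesis
		proof eventually_elim
			case (elim x)
			hence "?p x/m = ?n x/m" using m by (subst (asm) ennreal_inj) auto
			thus ?case using m by (auto simp: max_def split: if_splits)
		qed
	qed
qed

text \<open>Vanishing on a real half-line extends to the half-plane by analytic continuation; on the
  line Re z = c + 1 the transform is the Fourier transform of an integrable function. Continuity of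
  g turns almost everywhere into everywhere.\<close>

lemma laplace_bilateral_zero:
	fixes g :: "real => real"
	assumes cont: "continuous_on UNIV g"
		and int: "\<And>t. c < t ==> integrable lborel (%x. exp (- t*x)*g x)"
		and zero: "\<And>t. c < t ==> (\<integral>x. exp (- t*x)*g x \<partial>lborel) = 0"
	shows "g x = 0"
proof -
	let ?\<Phi> = "%z. \<integral>x. exp (- z*complex_of_real x)*complex_of_real (g x) \<partial>lborel"
	have real0: "?\<Phi> (complex_of_real t) = 0" if "c < t" for t
	proof -
		have "?\<Phi> (complex_of_real t) = (\<integral>x. complex_of_real (exp (- t*x)*g x) \<partial>lborel)"
			by (rule Bochner_Integration.integral_cong) (auto simp: exp_of_real simp flip: of_real_minus of_real_mult)
		thus ?thesis using zero[OF that] by (simp only: integral_complex_of_real of_real_0)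
	qed
	have S: "open {z. c < Re z}" "connected {z. c < Re z}"
		using open_halfspace_Re_gt[of c] convex_halfspace_Re_gt[of c] by (auto intro: convex_connected)
	have lim: "complex_of_real (c+1) islimpt complex_of_real ` {c<..}"
		unfolding islimpt_approachable
	proof (intro allI impI)
		fix e :: real assume "0 < e"
		thus "\<exists>x'\<in>complex_of_real ` {c<..}. x' ~= complex_of_real (c+1) & dist x' (complex_of_real (c+1)) < e"
			by (intro bexI[of _ "complex_of_real (c+1+e/2)"])
				(auto simp: dist_norm simp flip: of_real_diff of_real_add simp del: of_real_add)
	qed
	have all0: "?\<Phi> z = 0" if "c < Re z" for z
		by (rule analytic_continuation[OF laplace_bilateral_holomorphic(1) S _ _ lim, of g])
			(use int real0 that in auto)
	let ?v = "%x. exp (- (c+1)*x)*g x"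
	have "AE x in lborel. ?v x = 0"
	proof (rule integrable_fourier_zero)
		show "integrable lborel ?v" by (rule int) simp
		fix t
		have "(\<integral>x. iexp (t*x)*complex_of_real (?v x) \<partial>lborel) = ?\<Phi> (Complex (c+1) (- t))"
		proof (rule Bochner_Integration.integral_cong[OF refl])
			fix x
			have "- Complex (c+1) (- t)*complex_of_real x = \<i>*complex_of_real (t*x)+complex_of_real (- (c+1)*x)"
				by (simp add: complex_eq_iff algebra_simps)
			thus "iexp (t*x)*complex_of_real (?v x) = exp (- Complex (c+1) (- t)*complex_of_real x)*complex_of_real (g x)"
				by (simp only: exp_add of_real_mult[of "exp (- (c+1)*x)" "g x"] exp_of_real[symmetric] mult.assoc)
		qed
		thus "(\<integral>x. iexp (t*x)*complex_of_real (?v x) \<partial>lborel) = 0" using all0[of "Complex (c+1) (- t)"] by simp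
	qed
	hence "AE x in lebesgue. x \<in> {x. g x = 0}"
		by (intro AE_completion) auto
	moreover have "closed {x. g x = 0}" using cont by (intro closed_Collect_eq) auto
	ultimately have "x \<in> {x. g x = 0}" by (intro mem_closed_if_AE_lebesgue)
	thus ?thesis by simp
qed

subsection \<open>Pushes at the barriers along dyadic grids\<close>

text \<open>With the value 0 at the cemetery, killed paths drop out of expectations of test
  functions.\<close>

definition phase_eval :: "('n => real => real) => 'n option => real => real" where
	"phase_eval f p y = (case p of None => 0 | Some i => f i y)"

lemma phase_eval_simps [simp]: "phase_eval f None y = 0" "phase_eval f (Some i) y = f i y"
	by (simp_all add: phase_eval_def)

text \<open>Exactly one half-open step from z k to z (k + 1) contains c. Summing over steps under
  the integral therefore selects, for each level c of a regulator, the grid step during which it is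
  passed.\<close>

lemma incseq_locate:
	fixes z F :: "nat => real"
	assumes "incseq z" "z 0 <= c" "c < z N"
	obtains K where "K < N" "z K <= c" "c < z (Suc K)"
		"(\<Sum>k<N. (if z k <= c & c < z (Suc k) then F k else 0)) = F K"
proof -
	define L where "L = (LEAST k. c < z k)"
	have L: "c < z L" unfolding L_def using assms(3) by (rule LeastI)
	have Ll: "z k <= c" if "k < L" for k using not_less_Least[of k "%k. c < z k"] that by (simp add: L_def)
	have "L <= N" unfolding L_def using assms(3) by (rule Least_le)
	moreover have "L ~= 0" using L assms(2) by (auto intro: ccontr)
	ultimately obtain K where K: "L = Suc K" "K < N" by (cases L) auto
	have iff: "z k <= c & c < z (Suc k) \<longleftrightarrow> k = K" for k
	proof
		assume k: "z k <= c & c < z (Suc k)"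
		have "\<not> k < K" using Ll[of "Suc k"] K k by auto
		moreover have "\<not> Suc K <= k" using incseqD[OF assms(1), of "Suc K" k] L K k by auto
		ultimately show "k = K" by simp
	qed (use L Ll[of K] K in auto)
	show ?thesis
	proof (rule that[of K])
		show "(\<Sum>k<N. (if z k <= c & c < z (Suc k) then F k else 0)) = F K"
			unfolding iff using K(2) by (simp add: sum.delta)
	qed (use K L Ll[of K] in auto)
qed

lemma incseq_locate_none:
	fixes z :: "nat => real"
	assumes "incseq z" "c < z 0 | z N <= c"
	shows "(\<Sum>k<N. (if z k <= c & c < z (Suc k) then F k else 0 :: real)) = 0"
proof (intro sum.neutral ballI)
	fix k assume "k \<in> {..<N}"
	thus "(if z k <= c & c < z (Suc k) then F k else 0 :: real) = 0"
		using assms(2) incseqD[OF assms(1), of 0 k] incseqD[OF assms(1), of "Suc k" N] by auto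
qed

locale reflected_phase = reflected a x l u for a x l u +
	fixes j :: "real => 'n::finite option"
	assumes j_rc: "0 <= t ==> \<exists>e>0. \<forall>s\<in>{t..t+e}. j s = j t"
		and j_absorb: "0 <= s ==> s <= t ==> j s = None ==> j t = None"
		and x_left: "0 < t ==> \<exists>y. (x \<longlongrightarrow> y) (at_left t)"
		and no_up_jump: "0 < t ==> j t ~= None ==> (x \<longlongrightarrow> y) (at_left t) ==> x t <= y"
begin

lemma u_passage_alive:
	assumes "0 <= c" "0 <= t1" "c < u t1" "j (passage u c) ~= None"
	shows "u (passage u c) = c"
	using u_passage_eq[OF assms(1-3)] x_left no_up_jump assms(4) by blast

lemma j_eventually:
	assumes "0 <= t" "\<And>n. t <= s n" "s \<leadsto> t"
	shows "\<forall>\<^sub>F n in sequentially. j (s n) = j t"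
proof -
	obtain e where e: "e > 0" "\<And>s. s \<in> {t..t+e} ==> j s = j t" using j_rc[OF assms(1)] by blast
	have "\<forall>\<^sub>F n in sequentially. s n < t+e" using assms(3) e(1) by (intro order_tendstoD) auto
	thus ?thesis by eventually_elim (use assms(2) in \<open>auto intro: e(2)\<close>)
qed

text \<open>Besides the level r of \<open>u\<close>, the integer m caps both time and
  \<open>l\<close>, so that the stopped sums are bounded. Strict inequality for the regulators
  matches \<open>passage\<close>.\<close>

definition stop :: "real => nat => real => bool" where
	"stop r m t \<longleftrightarrow> r < u t | real m < l t | real m <= t"

lemma stop_mono: "0 <= s ==> s <= t ==> stop r m s ==> stop r m t"
	unfolding stop_def using l_mono[of s t] u_mono[of s t] by auto

definition tau :: "real => nat => real" where "tau r m = Inf {t. 0 <= t & stop r m t}"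

lemma tau:
	shows tau_nonneg: "0 <= tau r m" and tau_le: "tau r m <= real m"
		and stop_gr_tau: "tau r m < t ==> stop r m t"
		and stop_tau_le: "0 <= t ==> stop r m t ==> tau r m <= t"
proof -
	have m: "real m \<in> {t. 0 <= t & stop r m t}" by (simp add: stop_def)
	have bb: "bdd_below {t. 0 <= t & stop r m t}" by (rule bdd_belowI[of _ 0]) simp
	show "0 <= tau r m" unfolding tau_def using m by (intro cInf_greatest) blast+
	show "tau r m <= real m" unfolding tau_def by (rule cInf_lower[OF m bb])
	show "tau r m <= t" if "0 <= t" "stop r m t" unfolding tau_def by (rule cInf_lower[OF _ bb]) (use that in simp)
	show "stop r m t" if t: "tau r m < t"
	proof -
		have "\<exists>s\<in>{t. 0 <= t & stop r m t}. s < t"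
		proof (rule cInf_lessD)
			show "{t. 0 <= t & stop r m t} ~= {}" using m by blast
		qed (use t in \<open>simp add: tau_def\<close>)
		thus ?thesis using stop_mono[of _ t] by fastforce
	qed
qed

definition grid :: "nat => nat => real" where "grid n k = real k/2 ^ n"

lemma grid_nonneg [simp]: "0 <= grid n k" by (simp add: grid_def)
lemma grid_0 [simp]: "grid n 0 = 0" by (simp add: grid_def)
lemma grid_Suc: "grid n (Suc k) = grid n k+1/2 ^ n" by (simp add: grid_def field_simps)
lemma grid_mono: "k <= k' ==> grid n k <= grid n k'" by (simp add: grid_def divide_right_mono)

definition stop_index :: "real => nat => nat => nat" where
	"stop_index r m n = (LEAST k. stop r m (grid n k))"

lemma stop_index:
	shows stop_index_le: "stop_index r m n <= m*2 ^ n"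
		and stop_stop_index: "stop r m (grid n (stop_index r m n))"
		and stop_iff: "stop r m (grid n k) \<longleftrightarrow> stop_index r m n <= k"
proof -
	have m: "stop r m (grid n (m*2 ^ n))" by (simp add: stop_def grid_def)
	show "stop_index r m n <= m*2 ^ n" unfolding stop_index_def using m by (rule Least_le)
	show s: "stop r m (grid n (stop_index r m n))" unfolding stop_index_def using m by (rule LeastI)
	show "stop r m (grid n k) \<longleftrightarrow> stop_index r m n <= k"
	proof
		show "stop_index r m n <= k" if "stop r m (grid n k)" unfolding stop_index_def using that by (rule Least_le)
		show "stop r m (grid n k)" if "stop_index r m n <= k"
			by (rule stop_mono[OF _ _ s]) (auto simp: grid_mono that)
	qed
qed

lemma grid_stop_index_ge: "tau r m <= grid n (stop_index r m n)"
	by (rule stop_tau_le[OF _ stop_stop_index]) simp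

lemma grid_stop_index_le: "grid n (stop_index r m n) <= tau r m+1/2 ^ n"
proof -
	define k where "k = nat \<lfloor>2 ^ n*tau r m\<rfloor>+1"
	have fl: "0 <= \<lfloor>2 ^ n*tau r m\<rfloor>" using tau_nonneg[of r m] by simp
	have "real k = of_int \<lfloor>2 ^ n*tau r m\<rfloor>+1" using fl by (simp add: k_def)
	hence k: "2 ^ n*tau r m < real k" "real k <= 2 ^ n*tau r m+1" by linarith+
	have "tau r m < grid n k" using k(1) by (simp add: grid_def field_simps)
	hence "stop_index r m n <= k" using stop_gr_tau stop_iff by blast
	hence "grid n (stop_index r m n) <= grid n k" by (rule grid_mono)
	also have "\<dots> <= tau r m+1/2 ^ n" using k(2) by (simp add: grid_def field_simps)
	finally show ?thesis .
qed

lemma inv_pow2_tendsto: "(%n. 1/2 ^ n :: real) \<leadsto> 0"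
	using LIMSEQ_inverse_realpow_zero[of 2] by (simp add: inverse_eq_divide)

lemma grid_stop_index_tendsto: "(%n. grid n (stop_index r m n)) \<leadsto> tau r m"
proof (rule tendsto_sandwich[OF _ _ tendsto_const])
	show "(%n. tau r m+1/2 ^ n) \<leadsto> tau r m" using tendsto_add[OF tendsto_const inv_pow2_tendsto] by simp
qed (auto simp: grid_stop_index_ge grid_stop_index_le)

lemma passage_grid:
	assumes "0 <= c" "l (grid n k) <= c" "c < l (grid n (Suc k))"
	shows "grid n k <= passage l c" "passage l c <= grid n (Suc k)"
proof -
	note p = passage_l[OF assms(1) grid_nonneg assms(3)]
	show "grid n k <= passage l c" using p(3)[of "grid n k"] assms(2) by force
	show "passage l c <= grid n (Suc k)" using p(2)[of "grid n (Suc k)"] assms(3) by force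
qed

lemma passage_grid_u:
	assumes "0 <= c" "u (grid n k) <= c" "c < u (grid n (Suc k))"
	shows "grid n k <= passage u c" "passage u c <= grid n (Suc k)"
proof -
	show "grid n k <= passage u c" using passage_u_gr[OF assms(1) grid_nonneg assms(3), of "grid n k"] assms(2) by force
	show "passage u c <= grid n (Suc k)" using passage_u_less[OF assms(1) grid_nonneg assms(3), of "grid n (Suc k)"] assms(3) by force
qed

lemma grid_squeeze:
	assumes "\<And>n. grid n (K n) <= s" "\<And>n. s <= grid n (Suc (K n))"
	shows "(%n. grid n (K n)) \<leadsto> s" "(%n. grid n (Suc (K n))) \<leadsto> s"
proof -
	have 1: "(%n. s-1/2 ^ n) \<leadsto> s" "(%n. s+1/2 ^ n) \<leadsto> s"
		using tendsto_diff[OF tendsto_const inv_pow2_tendsto] tendsto_add[OF tendsto_const inv_pow2_tendsto] by simp_all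
	show "(%n. grid n (K n)) \<leadsto> s"
	proof (rule tendsto_sandwich[OF _ _ 1(1) tendsto_const])
		have "s-1/2 ^ n <= grid n (K n)" for n using assms(2)[of n] by (simp add: grid_Suc)
		thus "\<forall>\<^sub>F n in sequentially. s-1/2 ^ n <= grid n (K n)" by simp
	qed (simp add: assms(1))
	show "(%n. grid n (Suc (K n))) \<leadsto> s"
	proof (rule tendsto_sandwich[OF _ _ tendsto_const 1(2)])
		have "grid n (Suc (K n)) <= s+1/2 ^ n" for n using assms(1)[of n] by (simp add: grid_Suc)
		thus "\<forall>\<^sub>F n in sequentially. grid n (Suc (K n)) <= s+1/2 ^ n" by simp
	qed (simp add: assms(2))
qed

lemma x_bound:
	assumes "0 <= t" "t <= T"
	shows "\<bar>x t\<bar> <= a+l T+u T"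
	using h_ge[of t] h_le[of t] l_mono[of t T] u_mono[of t T] l_nonneg[of t] u_nonneg[of t] assms
	by (auto simp: h_def)

end

text \<open>That \<open>b\<close> vanishes on the negative half-line says f' = al f there: this is
  the boundary condition under which exp(-al l) f(a + h) does not change while \<open>l\<close>
  alone grows at the lower barrier.\<close>

locale reflected_functional = reflected_phase a x l u j
	for a x l u and j :: "real => 'n::finite option" +
	fixes al :: real and f b :: "'n => real => real"
	assumes al: "0 <= al"
		and f_deriv: "(f i has_real_derivative al*f i y-b i y) (at y)"
		and b_cont: "continuous_on UNIV (b i)"
		and b_neg: "y <= 0 ==> b i y = 0"
begin

abbreviation f' :: "'n => real => real" where "f' i y \<equiv> al*f i y-b i y"

lemma f_cont: "continuous_on S (f i)"
	by (intro continuous_at_imp_continuous_on ballI DERIV_isCont[OF f_deriv])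

lemma b_cont': "continuous_on S (b i)"
	by (rule continuous_on_subset[OF b_cont]) simp

lemma f'_cont: "continuous_on S (f' i)"
	by (intro continuous_intros f_cont b_cont')

definition Phi :: "real => real" where
	"Phi t = phase_eval f (j t) (a+h t)*exp (- al*l t)"

lemma Phi_tendsto:
	assumes "0 <= t" "\<And>n. t <= s n" "s \<leadsto> t"
	shows "(%n. Phi (s n)) \<leadsto> Phi t"
proof -
	have h: "(%n. h (s n)) \<leadsto> h t" by (rule continuous_at_right_seq[OF h_rc[OF assms(1)] assms(2,3)])
	have l: "(%n. l (s n)) \<leadsto> l t" by (rule continuous_at_right_seq[OF l_rc[OF assms(1)] assms(2,3)])
	have "(%n. phase_eval f (j t) (a+h (s n))*exp (- al*l (s n))) \<leadsto> Phi t"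
	proof (cases "j t")
		case (Some i)
		have "(%n. f i (a+h (s n))) \<leadsto> f i (a+h t)"
			by (rule continuous_on_tendsto_compose[OF f_cont[of UNIV]]) (auto intro!: tendsto_intros h)
		thus ?thesis unfolding Phi_def Some by (auto intro!: tendsto_intros l)
	qed (simp add: Phi_def)
	moreover have "\<forall>\<^sub>F n in sequentially. phase_eval f (j t) (a+h (s n))*exp (- al*l (s n)) = Phi (s n)"
		using j_eventually[OF assms] by eventually_elim (simp add: Phi_def)
	ultimately show ?thesis by (rule Lim_transform_eventually)
qed

text \<open>The part of the increment of \<^term>\<open>Phi\<close> over the k-th grid step that is due to the two
	regulators moving at the new value of the free process.\<close>
definition push :: "nat => nat => real" where
	"push n k = Phi (grid n (Suc k)) -
		 exp (- al*l (grid n k))*phase_eval f (j (grid n (Suc k))) (a+x (grid n (Suc k))+l (grid n k)-u (grid n k))"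

text \<open>From the old to the new pair of regulator values, \<open>u\<close> moves first with
  \<open>l\<close> at its old value, then \<open>l\<close> moves with \<open>u\<close> at its new
  value. In the second move the al terms cancel: the derivative of exp(-al c) f(y + c) in c is
  -exp(-al c) b(y + c).\<close>

lemma push_eq:
	"push n k =
		 - (\<integral>c. indicator {l (grid n k)..<l (grid n (Suc k))} c *
					(exp (- al*c)*phase_eval b (j (grid n (Suc k))) (a+x (grid n (Suc k))+c-u (grid n (Suc k)))) \<partial>lborel)
		 - (\<integral>c. indicator {u (grid n k)..<u (grid n (Suc k))} c *
					(exp (- al*l (grid n k))*phase_eval f' (j (grid n (Suc k))) (a+x (grid n (Suc k))+l (grid n k)-c)) \<partial>lborel)"
proof (cases "j (grid n (Suc k))")
	case None thus ?thesis by (simp add: push_def Phi_def)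
next
	case (Some i)
	define s t where "s = grid n k" and "t = grid n (Suc k)"
	have st: "0 <= s" "s <= t" by (auto simp: s_def t_def grid_mono)
	let ?y = "a+x t"
	have ll: "l s <= l t" and uu: "u s <= u t" using l_mono[OF st] u_mono[OF st] .
	have FTC: "(\<integral>c. indicator {A..<B} c*g c \<partial>lborel) = G B-G A"
		if AB: "A <= B" and G: "\<And>c. (G has_real_derivative g c) (at c)" and g: "continuous_on UNIV g" for A B and G g :: "real => real"
	proof -
		have "(\<integral>c. indicator {A..B} c *\<^sub>R g c \<partial>lborel) = G B-G A"
			by (rule integral_FTC_Icc[OF AB])
				(use G g in \<open>auto intro: has_field_derivative_at_within continuous_on_subset simp flip: has_real_derivative_iff_has_vector_derivative\<close>)
		moreover have "(\<integral>c. indicator {A..B} c *\<^sub>R g c \<partial>lborel) = (\<integral>c. indicator {A..<B} c*g c \<partial>lborel)"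
		proof (rule integral_cong_AE)
			have [measurable]: "g \<in> Bor borel" using g by (rule borel_measurable_continuous_onI)
			show "(%c. indicator {A..B} c *\<^sub>R g c) \<in> Bor lborel"
				"(%c. indicator {A..<B} c*g c) \<in> Bor lborel" by measurable
			show "AE c in lborel. indicator {A..B} c *\<^sub>R g c = indicator {A..<B} c*g c"
				using AE_lborel_singleton[of B] by eventually_elim (auto simp: indicator_def)
		qed
		ultimately show ?thesis by simp
	qed
	have L: "(\<integral>c. indicator {l s..<l t} c*(exp (- al*c)*b i (?y+c-u t)) \<partial>lborel)
		= - (exp (- al*l t)*f i (?y+l t-u t)) - - (exp (- al*l s)*f i (?y+l s-u t))"
	proof (rule FTC[OF ll])
		show "((%c. - (exp (- al*c)*f i (?y+c-u t))) has_real_derivative exp (- al*c)*b i (?y+c-u t)) (at c)" for c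
			by (auto intro!: derivative_eq_intros DERIV_chain2[OF f_deriv] simp: algebra_simps)
		show "continuous_on UNIV (%c. exp (- al*c)*b i (?y+c-u t))"
			by (intro continuous_intros continuous_on_compose2[OF b_cont]) auto
	qed
	have U: "(\<integral>c. indicator {u s..<u t} c*(exp (- al*l s)*f' i (?y+l s-c)) \<partial>lborel)
		= - (exp (- al*l s)*f i (?y+l s-u t)) - - (exp (- al*l s)*f i (?y+l s-u s))"
	proof (rule FTC[OF uu])
		show "((%c. - (exp (- al*l s)*f i (?y+l s-c))) has_real_derivative exp (- al*l s)*f' i (?y+l s-c)) (at c)" for c
			by (auto intro!: derivative_eq_intros DERIV_chain2[OF f_deriv] simp: algebra_simps)
		show "continuous_on UNIV (%c. exp (- al*l s)*f' i (?y+l s-c))"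
			by (intro continuous_intros continuous_on_compose2[OF b_cont] continuous_on_compose2[OF f_cont[of UNIV]]) auto
	qed
	have "push n k = exp (- al*l t)*f i (?y+l t-u t)-exp (- al*l s)*f i (?y+l s-u s)"
		using Some unfolding push_def Phi_def s_def[symmetric] t_def[symmetric] by (simp add: h_def algebra_simps)
	thus ?thesis
		using Some L U unfolding s_def[symmetric] t_def[symmetric] by simp
qed

lemma ico_integral_bound:
	fixes g :: "real => real"
	assumes "A <= B" "\<And>c. A <= c ==> c < B ==> \<bar>g c\<bar> <= C" and [measurable]: "g \<in> Bor borel"
	shows "\<bar>\<integral>c. indicator {A..<B} c*g c \<partial>lborel\<bar> <= C*(B-A)"
proof (cases "A = B")
	case False
	hence C: "0 <= C" using assms(1) abs_ge_zero[of "g A"] assms(2)[of A] by linarith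
	have int: "integrable lborel (%c. indicator {A..<B} c*C)" by (intro integrable_mult_left integrable_real_indicator) (auto simp: emeasure_lborel_Ico[OF assms(1)])
	have "norm (\<integral>c. indicator {A..<B} c*g c \<partial>lborel) <= (\<integral>c. indicator {A..<B} c*C \<partial>lborel)"
	proof (rule Bochner_Integration.integral_norm_bound_integral)
		show le: "norm (indicator {A..<B} c*g c) <= indicator {A..<B} c*C" for c
			using assms(2)[of c] by (auto simp: indicator_def)
		show "integrable lborel (%c. indicator {A..<B} c*g c)"
			by (rule Bochner_Integration.integrable_bound[OF int]) (use le C in \<open>auto simp: indicator_def abs_mult\<close>)
	qed (rule int)
	also have "\<dots> = C*(B-A)" using assms(1) by simp
	finally show ?thesis by simp
qed simp

lemma phase_eval_cont:
	"(\<And>i. continuous_on UNIV (g i)) ==> continuous_on UNIV (phase_eval g p)"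
	by (cases p) (simp_all add: phase_eval_def)

lemma phase_eval_meas [measurable]:
	"phase_eval b p \<in> Bor borel" "phase_eval f' p \<in> Bor borel" "phase_eval f p \<in> Bor borel"
	by (intro borel_measurable_continuous_onI phase_eval_cont b_cont f'_cont f_cont)+

text \<open>Before the stopping index the integrals in \<open>push_eq\<close> are bounded by
  increments of \<open>l\<close> and \<open>u\<close>, which telescope to at most m and r. The aim
  is uniformity in n: only the last step escapes, and it is paid for by an exponential of x at the
  stopped grid point.\<close>

lemma pushes_bound:
	assumes r: "0 <= r" and m: "0 < m" and th: "0 <= th"
		and Cb: "\<And>i y. y <= a ==> \<bar>b i y\<bar> <= Cb"
		and Cf: "\<And>i y. y <= a+r ==> \<bar>f' i y\<bar> <= Cf"
		and C0: "\<And>i y. y <= a ==> \<bar>f i y\<bar> <= C0"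
		and C: "\<And>i y. \<bar>f i y\<bar> <= C*(1+exp (th*y))"
	shows "\<bar>\<Sum>k<stop_index r m n. push n k\<bar> <= Cb*real m+Cf*r+C0+C+C*exp (th*(a+real m)) *
		(if j (grid n (stop_index r m n)) = None then 0 else exp (th*x (grid n (stop_index r m n))))"
proof -
	have "\<not> stop r m 0" using r m by (simp add: stop_def l0 u0)
	hence "\<not> stop_index r m n <= 0" using stop_iff[of r m n 0] by simp
	\<comment> \<open>The last step is split off because u <= r and l <= m are known at grid points up
	  to N only.\<close>
	then obtain N where N: "stop_index r m n = Suc N" by (cases "stop_index r m n") auto
	have ns: "u (grid n k) <= r" "l (grid n k) <= real m" if "k <= N" for k
		using stop_iff[of r m n k] that N by (auto simp: stop_def not_le)
	have pos: "0 <= Cb" "0 <= Cf" "0 <= C0" "0 <= C"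
		using Cb[of a undefined] Cf[of a undefined] C0[of a undefined] C[of undefined 0] r abs_ge_zero[of "f undefined 0"] by (auto intro: order_trans[OF abs_ge_zero])
	have step: "\<bar>push n k\<bar> <= Cb*(l (grid n (Suc k))-l (grid n k))+Cf*(u (grid n (Suc k))-u (grid n k))"
		if k: "k < N" for k
	proof -
		let ?s = "grid n k" and ?t = "grid n (Suc k)"
		have st: "0 <= ?s" "?s <= ?t" by (auto simp: grid_mono)
		have ll: "l ?s <= l ?t" and uu: "u ?s <= u ?t" using l_mono[OF st] u_mono[OF st] .
		have 1: "\<bar>\<integral>c. indicator {l ?s..<l ?t} c*(exp (- al*c)*phase_eval b (j ?t) (a+x ?t+c-u ?t)) \<partial>lborel\<bar>
			\<le> Cb*(l ?t-l ?s)"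
		proof (rule ico_integral_bound[OF ll])
			fix c assume c: "l ?s <= c" "c < l ?t"
			have "0 <= c" using l_nonneg[OF st(1)] c by simp
			hence e: "exp (- al*c) <= 1" using al by simp
			have "a+x ?t+c-u ?t <= a" using h_le[of ?t] c by (simp add: h_def)
			hence "\<bar>phase_eval b (j ?t) (a+x ?t+c-u ?t)\<bar> <= Cb"
				using Cb pos by (cases "j ?t") auto
			thus "\<bar>exp (- al*c)*phase_eval b (j ?t) (a+x ?t+c-u ?t)\<bar> <= Cb"
				using mult_mono[OF e, of "\<bar>phase_eval b (j ?t) (a+x ?t+c-u ?t)\<bar>" Cb] by (simp add: abs_mult)
		qed measurable
		have 2: "\<bar>\<integral>c. indicator {u ?s..<u ?t} c*(exp (- al*l ?s)*phase_eval f' (j ?t) (a+x ?t+l ?s-c)) \<partial>lborel\<bar>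
			\<le> Cf*(u ?t-u ?s)"
		proof (rule ico_integral_bound[OF uu])
			fix c assume c: "u ?s <= c" "c < u ?t"
			have e: "exp (- al*l ?s) <= 1" using al l_nonneg[OF st(1)] by simp
			have "a+x ?t+l ?s-c <= a+h ?t+u ?t-c" using ll by (simp add: h_def)
			also have "\<dots> <= a+r" using h_le[of ?t] ns(1)[of "Suc k"] k c u_nonneg[OF st(1)] by simp
			finally have "\<bar>phase_eval f' (j ?t) (a+x ?t+l ?s-c)\<bar> <= Cf"
				using Cf pos by (cases "j ?t") auto
			thus "\<bar>exp (- al*l ?s)*phase_eval f' (j ?t) (a+x ?t+l ?s-c)\<bar> <= Cf"
				using mult_mono[OF e, of "\<bar>phase_eval f' (j ?t) (a+x ?t+l ?s-c)\<bar>" Cf] by (simp add: abs_mult)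
		qed measurable
		show ?thesis unfolding push_eq using 1 2 by linarith
	qed
	have "\<bar>\<Sum>k<N. push n k\<bar> <= (\<Sum>k<N. Cb*(l (grid n (Suc k))-l (grid n k))+Cf*(u (grid n (Suc k))-u (grid n k)))"
		by (intro order_trans[OF sum_abs] sum_mono step) simp
	also have "\<dots> = Cb*l (grid n N)+Cf*u (grid n N)"
		using sum_lessThan_telescope[of "%k. l (grid n k)" N] sum_lessThan_telescope[of "%k. u (grid n k)" N]
		by (simp add: sum.distrib l0 u0 flip: sum_distrib_left)
	also have "\<dots> <= Cb*real m+Cf*r" using ns[of N] pos by (intro add_mono mult_left_mono) auto
	finally have main: "\<bar>\<Sum>k<N. push n k\<bar> <= Cb*real m+Cf*r" .
	let ?T = "grid n (Suc N)"
	have Phi: "\<bar>Phi t\<bar> <= C0" if "0 <= t" for t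
	proof -
		have e: "exp (- al*l t) <= 1" using al l_nonneg[OF that] by simp
		have "\<bar>phase_eval f (j t) (a+h t)\<bar> <= C0" using C0 pos h_le[OF that] by (cases "j t") auto
		thus ?thesis using mult_mono[of "\<bar>phase_eval f (j t) (a+h t)\<bar>" C0 "exp (- al*l t)" 1] e pos
			by (simp add: Phi_def abs_mult)
	qed
	have "\<bar>exp (- al*l (grid n N))*phase_eval f (j ?T) (a+x ?T+l (grid n N)-u (grid n N))\<bar>
		\<le> C+C*exp (th*(a+real m))*(if j ?T = None then 0 else exp (th*x ?T))"
	proof (cases "j ?T")
		case None thus ?thesis using pos by simp
	next
		case (Some i)
		have e: "exp (- al*l (grid n N)) <= 1" using al l_nonneg[of "grid n N"] by simp
		have "\<bar>f i (a+x ?T+l (grid n N)-u (grid n N))\<bar> <= C*(1+exp (th*(a+x ?T+l (grid n N)-u (grid n N))))"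
			by (rule C)
		also have "\<dots> <= C*(1+exp (th*(a+x ?T+real m)))"
			using pos ns(2)[of N] u_nonneg[of "grid n N"] th by (intro mult_left_mono add_left_mono) (auto intro!: mult_left_mono)
		also have "\<dots> = C+C*exp (th*(a+real m))*exp (th*x ?T)" by (simp add: algebra_simps flip: exp_add)
		finally have "\<bar>f i (a+x ?T+l (grid n N)-u (grid n N))\<bar> <= C+C*exp (th*(a+real m))*exp (th*x ?T)" .
		thus ?thesis using Some mult_mono[OF e, of "\<bar>f i (a+x ?T+l (grid n N)-u (grid n N))\<bar>"]
			by (simp add: abs_mult)
	qed
	hence "\<bar>push n N\<bar> <= C0+(C+C*exp (th*(a+real m))*(if j ?T = None then 0 else exp (th*x ?T)))"
		unfolding push_def using Phi[OF grid_nonneg, of n "Suc N"] by linarith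
	thus ?thesis unfolding N using main by simp
qed

lemma compact_bound:
	fixes g :: "'n => real => real"
	assumes "\<And>i. continuous_on UNIV (g i)"
	obtains C where "0 <= C" "\<And>p y. \<bar>y\<bar> <= R ==> \<bar>phase_eval g p y\<bar> <= C"
proof -
	have "\<exists>C. \<forall>y. \<bar>y\<bar> <= R --> \<bar>g i y\<bar> <= C" for i
	proof -
		have "compact (g i ` {- R..R})"
			by (intro compact_continuous_image continuous_on_subset[OF assms]) auto
		hence "bounded (g i ` {- R..R})" by (rule compact_imp_bounded)
		then obtain C where "\<forall>z\<in>g i ` {- R..R}. norm z <= C" by (auto simp: bounded_iff)
		thus ?thesis by (intro exI[of _ C]) (auto simp: abs_le_iff)
	qed
	then obtain C where C: "\<And>i y. \<bar>y\<bar> <= R ==> \<bar>g i y\<bar> <= C i" by metis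
	show ?thesis
	proof (rule that[of "\<Sum>i\<in>UNIV. \<bar>C i\<bar>"])
		show "\<bar>phase_eval g p y\<bar> <= (\<Sum>i\<in>UNIV. \<bar>C i\<bar>)" if "\<bar>y\<bar> <= R" for p y
		proof (cases p)
			case (Some i)
			have "\<bar>g i y\<bar> <= \<bar>C i\<bar>" using C[OF that, of i] by linarith
			also have "\<dots> <= (\<Sum>i\<in>UNIV. \<bar>C i\<bar>)" by (rule member_le_sum) auto
			finally show ?thesis using Some by simp
		qed (simp add: sum_nonneg)
	qed (simp add: sum_nonneg)
qed

lemma grid_incseq: "incseq (%k. l (grid n k))" "incseq (%k. u (grid n k))"
	by (auto simp: incseq_def intro!: l_mono u_mono grid_mono)

lemma grid_stop_le: "k < stop_index r m n ==> grid n (Suc k) <= real m+1"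
proof -
	assume "k < stop_index r m n"
	hence "grid n (Suc k) <= grid n (stop_index r m n)" by (intro grid_mono) simp
	also have "\<dots> <= tau r m+1/2 ^ n" by (rule grid_stop_index_le)
	also have "1/2 ^ n <= (1::real)" by simp
	finally show ?thesis using tau_le[of r m] by simp
qed

text \<open>In the limit the level c is passed at \<open>passage l c\<close>, where h = -a and l >=
  c. So the argument a + x + c - u of \<open>b\<close> is at most a + h = 0, where \<open>b\<close>
  vanishes.\<close>

lemma lower_push_tendsto:
	"(%n. \<integral>c. (\<Sum>k<stop_index r m n. (if l (grid n k) <= c & c < l (grid n (Suc k))
		 then exp (- al*c)*phase_eval b (j (grid n (Suc k))) (a+x (grid n (Suc k))+c-u (grid n (Suc k))) else 0)) \<partial>lborel)
	 \<leadsto> 0"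
proof -
	let ?N = "%n. stop_index r m n"
	let ?F = "%n c k. exp (- al*c)*phase_eval b (j (grid n (Suc k))) (a+x (grid n (Suc k))+c-u (grid n (Suc k)))"
	let ?S = "%n c. \<Sum>k<?N n. (if l (grid n k) <= c & c < l (grid n (Suc k)) then ?F n c k else 0)"
	define T where "T = real m+1"
	have T0: "0 <= T" by (simp add: T_def)
	define R where "R = a+(a+l T+u T)+l T+u T"
	obtain C where C: "0 <= C" "\<And>p y. \<bar>y\<bar> <= R ==> \<bar>phase_eval b p y\<bar> <= C"
		by (rule compact_bound[of b R, OF b_cont]) (rule that)
	\<comment> \<open>The indicator removes the single level l(tau), for which it depends on n whether
	  the stopped grid sum has passed it; one point does not affect the integral.\<close>
	have "(%n. \<integral>c. ?S n c*indicator (- {l (tau r m)}) c \<partial>lborel) \<leadsto> (\<integral>c. 0 \<partial>(lborel::real measure))"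
	proof (rule integral_dominated_convergence[where w="%c. indicator {0..l T} c*C"])
		show "integrable lborel (%c. indicator {0..l T} c*C)" by (intro integrable_mult_left integrable_real_indicator) (auto simp: emeasure_lborel_Icc_eq)
		show "(%c. ?S n c*indicator (- {l (tau r m)}) c) \<in> Bor lborel" for n by measurable
		show "AE c in lborel. norm (?S n c*indicator (- {l (tau r m)}) c) <= indicator {0..l T} c*C" for n
		proof (rule AE_I2)
			fix c :: real
			show "norm (?S n c*indicator (- {l (tau r m)}) c) <= indicator {0..l T} c*C"
			proof (cases "0 <= c & c < l (grid n (?N n))")
				case True
				hence c: "l (grid n 0) <= c" "c < l (grid n (?N n))" by (auto simp: l0)
				obtain K where K: "K < ?N n" "l (grid n K) <= c" "c < l (grid n (Suc K))" "?S n c = ?F n c K"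
					by (rule incseq_locate[OF grid_incseq(1) c, where F="?F n c"]) (rule that)
				have t: "grid n (Suc K) <= T" unfolding T_def by (rule grid_stop_le[OF K(1)])
				have lT: "c <= l T" using K(3) l_mono[OF grid_nonneg t] by simp
				have "\<bar>a+x (grid n (Suc K))+c-u (grid n (Suc K))\<bar> <= R"
					using x_bound[OF grid_nonneg t] u_mono[OF grid_nonneg t] u_nonneg[of "grid n (Suc K)"] True lT a_pos
					unfolding R_def by auto
				hence "\<bar>phase_eval b (j (grid n (Suc K))) (a+x (grid n (Suc K))+c-u (grid n (Suc K)))\<bar> <= C" by (rule C(2))
				moreover have "exp (- al*c) <= 1" using al True by simp
				ultimately have "\<bar>?F n c K\<bar> <= 1*C" unfolding abs_mult by (intro mult_mono) auto
				thus ?thesis using K(4) True lT C(1) by (auto simp: indicator_def)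
			next
				case False
				hence "?S n c = 0" by (intro incseq_locate_none grid_incseq) (auto simp: l0)
				thus ?thesis using C(1) by simp
			qed
		qed
		show "AE c in lborel. (%n. ?S n c*indicator (- {l (tau r m)}) c) \<leadsto> 0"
		proof (rule AE_I2)
			fix c :: real
			consider "c < 0 | c = l (tau r m)" | "l (tau r m) < c" | "0 <= c" "c < l (tau r m)" by linarith
			thus "(%n. ?S n c*indicator (- {l (tau r m)}) c) \<leadsto> 0"
			proof cases
				case 1
				have "?S n c*indicator (- {l (tau r m)}) c = 0" for n
					using 1 incseq_locate_none[OF grid_incseq(1), of c n "?N n"] by (auto simp: l0)
				thus ?thesis by (simp only: tendsto_const)
			next
				case 2
				have "(%n. l (grid n (?N n))) \<leadsto> l (tau r m)"
					by (rule continuous_at_right_seq[OF l_rc[OF tau_nonneg] grid_stop_index_ge grid_stop_index_tendsto])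
				hence "\<forall>\<^sub>F n in sequentially. l (grid n (?N n)) < c" using 2 by (rule order_tendstoD)
				hence "\<forall>\<^sub>F n in sequentially. 0 = ?S n c*indicator (- {l (tau r m)}) c"
					by eventually_elim (use incseq_locate_none[OF grid_incseq(1)] in force)
				thus ?thesis by (rule Lim_transform_eventually[OF tendsto_const])
			next
				case 3
				have lt: "c < l (grid n (?N n))" for n using l_mono[OF tau_nonneg grid_stop_index_ge, of r m n] 3 by simp
				have "\<exists>K. l (grid n K) <= c & c < l (grid n (Suc K)) & ?S n c = ?F n c K" for n
				proof -
					have c: "l (grid n 0) <= c" using 3 by (simp add: l0)
					show ?thesis by (rule incseq_locate[OF grid_incseq(1) c lt, where F="?F n c"]) (intro exI conjI)
				qed
				hence "\<forall>n. \<exists>K. l (grid n K) <= c & c < l (grid n (Suc K)) & ?S n c = ?F n c K" by (rule allI)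
				from choice[OF this] obtain K where "\<forall>n. l (grid n (K n)) <= c & c < l (grid n (Suc (K n))) & ?S n c = ?F n c (K n)" ..
				hence K: "\<And>n. l (grid n (K n)) <= c" "\<And>n. c < l (grid n (Suc (K n)))" "\<And>n. ?S n c = ?F n c (K n)"
					by simp_all
				let ?s = "passage l c"
				note pas = passage_l[OF 3(1) tau_nonneg 3(2)]
				have le: "grid n (K n) <= ?s" "?s <= grid n (Suc (K n))" for n using passage_grid[OF 3(1) K(1,2)] by auto
				have lim: "(%n. grid n (Suc (K n))) \<leadsto> ?s" by (rule grid_squeeze(2)[OF le])
				have xl: "(%n. x (grid n (Suc (K n)))) \<leadsto> x ?s" "(%n. u (grid n (Suc (K n)))) \<leadsto> u ?s"
					by (rule continuous_at_right_seq[OF x_rc[OF pas(1)] le(2) lim] continuous_at_right_seq[OF u_rc[OF pas(1)] le(2) lim])+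
				have "a+x ?s+c-u ?s <= 0" using pas(4,5) by (simp add: h_def)
				hence z: "phase_eval b (j ?s) (a+x ?s+c-u ?s) = 0" using b_neg by (cases "j ?s") auto
				have "(%n. phase_eval b (j ?s) (a+x (grid n (Suc (K n)))+c-u (grid n (Suc (K n))))) \<leadsto> phase_eval b (j ?s) (a+x ?s+c-u ?s)"
					by (rule continuous_on_tendsto_compose[OF phase_eval_cont[of b, OF b_cont]]) (auto intro!: tendsto_intros xl)
				hence "(%n. exp (- al*c)*phase_eval b (j ?s) (a+x (grid n (Suc (K n)))+c-u (grid n (Suc (K n))))) \<leadsto> exp (- al*c)*0"
					unfolding z by (intro tendsto_mult tendsto_const)
				hence lim0: "(%n. exp (- al*c)*phase_eval b (j ?s) (a+x (grid n (Suc (K n)))+c-u (grid n (Suc (K n))))) \<leadsto> 0"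
					by (simp only: mult_zero_right)
				have ev: "\<forall>\<^sub>F n in sequentially. exp (- al*c)*phase_eval b (j ?s) (a+x (grid n (Suc (K n)))+c-u (grid n (Suc (K n)))) = ?S n c*indicator (- {l (tau r m)}) c"
					using j_eventually[OF pas(1) le(2) lim] by eventually_elim (use 3 K(3) in simp)
				show ?thesis by (rule Lim_transform_eventually[OF lim0 ev])
			qed
		qed
	qed simp
	moreover have "(\<integral>c. ?S n c*indicator (- {l (tau r m)}) c \<partial>lborel) = (\<integral>c. ?S n c \<partial>lborel)" for n
	proof (rule integral_cong_AE)
		show "AE c in lborel. ?S n c*indicator (- {l (tau r m)}) c = ?S n c"
			using AE_lborel_singleton[of "l (tau r m)"] by eventually_elim auto
	qed measurable
	ultimately show ?thesis by simp
qed

text \<open>When \<open>u\<close> passes the level c one has h = 0, and u = c unless the path is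
  killed there, so the argument a + x + l - c equals a. The limiting integrand is measurable as a
  pointwise limit of grid sums.\<close>

lemma upper_push_tendsto:
	"(%n. \<integral>c. (\<Sum>k<stop_index r m n. (if u (grid n k) <= c & c < u (grid n (Suc k))
		 then exp (- al*l (grid n k))*phase_eval f' (j (grid n (Suc k))) (a+x (grid n (Suc k))+l (grid n k)-c) else 0)) \<partial>lborel)
	 \<leadsto> (\<integral>c. indicator {0..<u (tau r m)} c*(exp (- al*l (passage u c))*phase_eval f' (j (passage u c)) a) \<partial>lborel)" (is "_ \<leadsto> (\<integral>c. ?G c \<partial>lborel)")
	and upper_push_meas: "(%c. indicator {0..<u (tau r m)} c*(exp (- al*l (passage u c))*phase_eval f' (j (passage u c)) a))
		\<in> borel_measurable borel"
proof -
	let ?N = "%n. stop_index r m n"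
	let ?F = "%n c k. exp (- al*l (grid n k))*phase_eval f' (j (grid n (Suc k))) (a+x (grid n (Suc k))+l (grid n k)-c)"
	let ?S = "%n c. \<Sum>k<?N n. (if u (grid n k) <= c & c < u (grid n (Suc k)) then ?F n c k else 0)"
	define T where "T = real m+1"
	have T0: "0 <= T" by (simp add: T_def)
	define R where "R = a+(a+l T+u T)+l T+u T"
	obtain C where C: "0 <= C" "\<And>p y. \<bar>y\<bar> <= R ==> \<bar>phase_eval f' p y\<bar> <= C"
		by (rule compact_bound[of f' R, OF f'_cont]) (rule that)
	have Slim: "(%n. ?S n c*indicator (- {u (tau r m)}) c) \<leadsto> ?G c" for c
	proof -
			consider "c < 0 | c = u (tau r m)" | "u (tau r m) < c" | "0 <= c" "c < u (tau r m)" by linarith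
			thus ?thesis
			proof cases
				case 1
				have "?S n c*indicator (- {u (tau r m)}) c = 0" for n
					using 1 incseq_locate_none[OF grid_incseq(2), of c n "?N n"] by (auto simp: u0)
				moreover have "?G c = 0" using 1 by (auto simp: indicator_def)
				ultimately show ?thesis by (simp only: tendsto_const)
			next
				case 2
				have "(%n. u (grid n (?N n))) \<leadsto> u (tau r m)"
					by (rule continuous_at_right_seq[OF u_rc[OF tau_nonneg] grid_stop_index_ge grid_stop_index_tendsto])
				hence "\<forall>\<^sub>F n in sequentially. u (grid n (?N n)) < c" using 2 by (rule order_tendstoD)
				hence "\<forall>\<^sub>F n in sequentially. 0 = ?S n c*indicator (- {u (tau r m)}) c"
					by eventually_elim (use incseq_locate_none[OF grid_incseq(2)] in force)
				hence "(%n. ?S n c*indicator (- {u (tau r m)}) c) \<leadsto> 0"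
					by (rule Lim_transform_eventually[OF tendsto_const])
				moreover have "?G c = 0" using 2 by (auto simp: indicator_def)
				ultimately show ?thesis by (simp only:)
			next
				case 3
				have lt: "c < u (grid n (?N n))" for n using u_mono[OF tau_nonneg grid_stop_index_ge, of r m n] 3 by simp
				have "\<exists>K. u (grid n K) <= c & c < u (grid n (Suc K)) & ?S n c = ?F n c K" for n
				proof -
					have c: "u (grid n 0) <= c" using 3 by (simp add: u0)
					show ?thesis by (rule incseq_locate[OF grid_incseq(2) c lt, where F="?F n c"]) (intro exI conjI)
				qed
				hence "\<forall>n. \<exists>K. u (grid n K) <= c & c < u (grid n (Suc K)) & ?S n c = ?F n c K" by (rule allI)
				from choice[OF this] obtain K where "\<forall>n. u (grid n (K n)) <= c & c < u (grid n (Suc (K n))) & ?S n c = ?F n c (K n)" ..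
				hence K: "\<And>n. u (grid n (K n)) <= c" "\<And>n. c < u (grid n (Suc (K n)))" "\<And>n. ?S n c = ?F n c (K n)"
					by simp_all
				let ?s = "passage u c"
				have s0: "0 <= ?s" and h0: "h ?s = 0"
					using passage_u_ge[OF 3(1) tau_nonneg 3(2)] h_passage_u[OF 3(1) tau_nonneg 3(2)] by auto
				have le: "grid n (K n) <= ?s" "?s <= grid n (Suc (K n))" for n using passage_grid_u[OF 3(1) K(1,2)] by auto
				have lim: "(%n. grid n (Suc (K n))) \<leadsto> ?s" "(%n. grid n (K n)) \<leadsto> ?s" by (rule grid_squeeze[OF le])+
				have xl: "(%n. x (grid n (Suc (K n)))) \<leadsto> x ?s"
					by (rule continuous_at_right_seq[OF x_rc[OF s0] le(2) lim(1)])
				\<comment> \<open>\<open>l\<close> is sampled at the left end of the step, so left continuity at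
				  the passage is required; it holds because h = 0 there.\<close>
				have ll: "(%n. l (grid n (K n))) \<leadsto> l ?s"
				proof (cases "?s = 0")
					case True
					hence "grid n (K n) = 0" for n using le(1)[of n] grid_nonneg[of n "K n"] by simp
					thus ?thesis using True by simp
				next
					case False
					show ?thesis
						by (rule l_tendsto_left[OF _ _ grid_nonneg le(1) lim(2)]) (use False s0 h0 a_pos in auto)
				qed
				have z: "phase_eval f' (j ?s) (a+x ?s+l ?s-c) = phase_eval f' (j ?s) a"
				proof (cases "j ?s")
					case (Some i)
					have "j ?s ~= None" using Some by simp
					hence "u ?s = c" by (rule u_passage_alive[OF 3(1) tau_nonneg 3(2)])
					moreover have "x ?s+l ?s-u ?s = 0" using h0 unfolding h_def .
					ultimately have "a+x ?s+l ?s-c = a" by linarith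
					thus ?thesis by (simp only:)
				qed simp
				have "(%n. phase_eval f' (j ?s) (a+x (grid n (Suc (K n)))+l (grid n (K n))-c)) \<leadsto> phase_eval f' (j ?s) (a+x ?s+l ?s-c)"
					by (rule continuous_on_tendsto_compose[OF phase_eval_cont[of f', OF f'_cont]]) (auto intro!: tendsto_intros xl ll)
				hence lim0: "(%n. exp (- al*l (grid n (K n)))*phase_eval f' (j ?s) (a+x (grid n (Suc (K n)))+l (grid n (K n))-c)) \<leadsto> exp (- al*l ?s)*phase_eval f' (j ?s) a"
					unfolding z by (intro tendsto_intros ll)
				have ev: "\<forall>\<^sub>F n in sequentially. exp (- al*l (grid n (K n)))*phase_eval f' (j ?s) (a+x (grid n (Suc (K n)))+l (grid n (K n))-c) = ?S n c*indicator (- {u (tau r m)}) c"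
					using j_eventually[OF s0 le(2) lim(1)] by eventually_elim (use 3 K(3) in simp)
				have "?G c = exp (- al*l ?s)*phase_eval f' (j ?s) a" using 3 by simp
				thus ?thesis using Lim_transform_eventually[OF lim0 ev] by (simp only:)
			qed
	qed
	have Smeas: "(%c. ?S n c*indicator (- {u (tau r m)}) c) \<in> Bor borel" for n by measurable
	show Gm: "?G \<in> Bor borel" by (rule borel_measurable_LIMSEQ_real[OF Slim Smeas])
	have "(%n. \<integral>c. ?S n c*indicator (- {u (tau r m)}) c \<partial>lborel) \<leadsto> (\<integral>c. ?G c \<partial>lborel)"
	proof (rule integral_dominated_convergence[where w="%c. indicator {0..u T} c*C"])
		show "integrable lborel (%c. indicator {0..u T} c*C)" by (intro integrable_mult_left integrable_real_indicator) (auto simp: emeasure_lborel_Icc_eq)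
		show "(%c. ?S n c*indicator (- {u (tau r m)}) c) \<in> Bor lborel" for n using Smeas by simp
		show "AE c in lborel. norm (?S n c*indicator (- {u (tau r m)}) c) <= indicator {0..u T} c*C" for n
		proof (rule AE_I2)
			fix c :: real
			show "norm (?S n c*indicator (- {u (tau r m)}) c) <= indicator {0..u T} c*C"
			proof (cases "0 <= c & c < u (grid n (?N n))")
				case True
				hence c: "u (grid n 0) <= c" "c < u (grid n (?N n))" by (auto simp: u0)
				obtain K where K: "K < ?N n" "u (grid n K) <= c" "c < u (grid n (Suc K))" "?S n c = ?F n c K"
					by (rule incseq_locate[OF grid_incseq(2) c, where F="?F n c"]) (rule that)
				have t: "grid n (Suc K) <= T" unfolding T_def by (rule grid_stop_le[OF K(1)])
				have t': "grid n K <= T" using t grid_mono[of K "Suc K" n] by simp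
				have uT: "c <= u T" using K(3) u_mono[OF grid_nonneg t] by simp
				have "\<bar>a+x (grid n (Suc K))+l (grid n K)-c\<bar> <= R"
					using x_bound[OF grid_nonneg t] l_mono[OF grid_nonneg t'] l_nonneg[of "grid n K"] True uT a_pos
					unfolding R_def by auto
				hence "\<bar>phase_eval f' (j (grid n (Suc K))) (a+x (grid n (Suc K))+l (grid n K)-c)\<bar> <= C" by (rule C(2))
				moreover have "exp (- al*l (grid n K)) <= 1" using al l_nonneg[of "grid n K"] by simp
				ultimately have "\<bar>?F n c K\<bar> <= 1*C" unfolding abs_mult by (intro mult_mono) auto
				thus ?thesis using K(4) True uT C(1) by (auto simp: indicator_def)
			next
				case False
				hence "?S n c = 0" by (intro incseq_locate_none grid_incseq) (auto simp: u0)
				thus ?thesis using C(1) by simp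
			qed
		qed
	qed (use Gm Slim in simp_all)
	moreover have "(\<integral>c. ?S n c*indicator (- {u (tau r m)}) c \<partial>lborel) = (\<integral>c. ?S n c \<partial>lborel)" for n
	proof (rule integral_cong_AE)
		show "AE c in lborel. ?S n c*indicator (- {u (tau r m)}) c = ?S n c"
			using AE_lborel_singleton[of "u (tau r m)"] by eventually_elim auto
	qed measurable
	ultimately show "(%n. \<integral>c. ?S n c \<partial>lborel) \<leadsto> (\<integral>c. ?G c \<partial>lborel)" by simp
qed

lemma pushes_tendsto:
	"(%n. \<Sum>k<stop_index r m n. push n k) \<longlonglongrightarrow>
		 - (\<integral>c. indicator {0..<u (tau r m)} c*(exp (- al*l (passage u c))*phase_eval f' (j (passage u c)) a) \<partial>lborel)"
proof -
	have int: "integrable lborel (%c. if A <= c & c < B then g c else 0)"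
		if "continuous_on UNIV g" for A B and g :: "real => real"
	proof -
		have "integrable lborel (%c. indicator {A..B} c *\<^sub>R g c)"
			by (rule borel_integrable_compact) (auto intro: continuous_on_subset[OF that])
		note i = this
		have [measurable]: "g \<in> Bor borel" using that by (rule borel_measurable_continuous_onI)
		show ?thesis
			by (rule Bochner_Integration.integrable_bound[OF i]) (auto simp: indicator_def)
	qed
	have c1: "continuous_on UNIV (%c. exp (- al*c)*phase_eval b p (y+c-z))" for p y z
		by (intro continuous_intros continuous_on_compose2[OF phase_eval_cont[of b, OF b_cont]]) auto
	have c2: "continuous_on UNIV (%c. e*phase_eval f' p (y+z-c))" for p e y z
		by (intro continuous_intros continuous_on_compose2[OF phase_eval_cont[of f', OF f'_cont]]) auto
	have "(\<Sum>k<stop_index r m n. push n k) =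
		 - (\<integral>c. (\<Sum>k<stop_index r m n. (if l (grid n k) <= c & c < l (grid n (Suc k))
		 then exp (- al*c)*phase_eval b (j (grid n (Suc k))) (a+x (grid n (Suc k))+c-u (grid n (Suc k))) else 0)) \<partial>lborel)
		 - (\<integral>c. (\<Sum>k<stop_index r m n. (if u (grid n k) <= c & c < u (grid n (Suc k))
		 then exp (- al*l (grid n k))*phase_eval f' (j (grid n (Suc k))) (a+x (grid n (Suc k))+l (grid n k)-c) else 0)) \<partial>lborel)" for n
	proof -
		have ind: "indicator {A..<B} c*g = (if A <= c & c < B then g else 0)" for A B c g :: real
			by (simp add: indicator_def)
		show ?thesis
			unfolding push_eq ind
			by (subst (1 2) Bochner_Integration.integral_sum) (auto simp: sum_subtractf sum_negf intro!: int c1 c2)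
	qed
	thus ?thesis using tendsto_diff[OF tendsto_minus[OF lower_push_tendsto] upper_push_tendsto, of r m] by simp
qed

end

subsection \<open>The Markov additive property\<close>

text \<open>The dyadic times \<open>T n s\<close> converge to s from the right and make the process
  piecewise constant in time. The truncation \<open>max 0\<close> extends the process to the whole
  real line, so that \<open>lborel\<close> can serve as time.\<close>

lemma measurable_right_cont_process:
	fixes Y :: "real => 'w => real"
	assumes m: "\<And>t. 0 <= t ==> Y t \<in> Bor M"
		and rc: "\<And>w t. w \<in> space M ==> 0 <= t ==> continuous (at_right t) (%s. Y s w)"
	shows "(%p. Y (max 0 (fst p)) (snd p)) \<in> Bor (borel \<Otimes>\<^sub>M M)"
proof (rule borel_measurable_LIMSEQ_real)
	define T :: "nat => real => real" where "T n s = (of_int \<lfloor>2 ^ n*max 0 s\<rfloor>+1)/2 ^ n" for n s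
	have T1: "max 0 s <= T n s" and T2: "T n s <= max 0 s+1/2 ^ n" for n s
	proof -
		have "2 ^ n*max 0 s <= of_int \<lfloor>2 ^ n*max 0 s\<rfloor>+1" by linarith
		thus "max 0 s <= T n s" unfolding T_def by (subst pos_le_divide_eq) (simp_all add: mult.commute)
		have "of_int \<lfloor>2 ^ n*max 0 s\<rfloor>+1 <= 2 ^ n*max 0 s+1" by linarith
		thus "T n s <= max 0 s+1/2 ^ n" unfolding T_def by (subst pos_divide_le_eq) (simp_all add: algebra_simps)
	qed
	have Tlim: "(%n. T n s) \<leadsto> max 0 s" for s
	proof (rule tendsto_sandwich[OF _ _ tendsto_const])
		have "(%n. max 0 s+1/2 ^ n) \<leadsto> max 0 s+0"
			by (intro tendsto_add tendsto_const) (use LIMSEQ_inverse_realpow_zero[of 2] in \<open>simp add: inverse_eq_divide\<close>)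
		thus "(%n. max 0 s+1/2 ^ n) \<leadsto> max 0 s" by simp
	qed (intro always_eventually allI T1 T2)+
	fix p :: "real \<times> 'w" assume "p \<in> space (borel \<Otimes>\<^sub>M M)"
	hence "snd p \<in> space M" by (auto simp: space_pair_measure)
	thus "(%n. Y (T n (fst p)) (snd p)) \<leadsto> Y (max 0 (fst p)) (snd p)"
		by (intro continuous_at_right_seq[where f="%s. Y s (snd p)"] rc T1 Tlim) auto
next
	fix n
	define g where "g k p = Y (max 0 ((of_int k+1)/(2::real) ^ n)) (snd p)" for k :: int and p :: "real \<times> 'w"
	have "(%p. g \<lfloor>(2::real) ^ n*max 0 (fst p :: real)\<rfloor> p) \<in> Bor (borel \<Otimes>\<^sub>M M)"
	proof (rule measurable_compose_countable)
		show "(%p. g k p) \<in> Bor (borel \<Otimes>\<^sub>M M)" for k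
			unfolding g_def by (rule measurable_compose[OF measurable_snd m]) simp
		show "(%p. \<lfloor>(2::real) ^ n*max 0 (fst p :: real)\<rfloor>) \<in> (borel \<Otimes>\<^sub>M M) \<rightarrow>\<^sub>M count_space UNIV" by measurable
	qed
	moreover have "max 0 ((of_int \<lfloor>(2::real) ^ n*max 0 s\<rfloor>+1)/(2::real) ^ n) = ((of_int \<lfloor>(2::real) ^ n*max 0 s\<rfloor>+1)/(2::real) ^ n :: real)" for s :: real
		by (intro max_absorb2 divide_nonneg_nonneg) simp_all
	ultimately show "(%p. Y ((of_int \<lfloor>(2::real) ^ n*max 0 (fst p)\<rfloor>+1)/(2::real) ^ n) (snd p)) \<in> Bor (borel \<Otimes>\<^sub>M M)"
		by (simp add: g_def)
qed

locale map_process =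
	fixes M :: "'w measure" and P :: "real => 'n::finite => 'w measure"
		and X :: "real => 'w => real" and J :: "real => 'w => 'n option"
	assumes MA: "markov_additive M P X J"
begin

lemmas law = MA[unfolded markov_additive_def, THEN conjunct1]
	and meas = MA[unfolded markov_additive_def, THEN conjunct2, THEN conjunct1]
	and init = MA[unfolded markov_additive_def, THEN conjunct2, THEN conjunct2, THEN conjunct1]
	and paths = MA[unfolded markov_additive_def, THEN conjunct2, THEN conjunct2, THEN conjunct2, THEN conjunct1]
	and increments = MA[unfolded markov_additive_def, THEN conjunct2, THEN conjunct2, THEN conjunct2, THEN conjunct2]

lemma prob [simp]: "prob_space (P x i)"
	and sets_P [simp, measurable_cong]: "sets (P x i) = sets M" and space_P [simp]: "space (P x i) = space M"
	using law by simp_all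

lemma X_meas [measurable]: "X t \<in> Bor M" and J_meas [measurable]: "J t \<in> M \<rightarrow>\<^sub>M count_space UNIV"
	using meas by simp_all

lemma start: "AE w in P x i. X 0 w = x & J 0 w = Some i"
	using init by simp

lemma X_rc: "w \<in> space M ==> 0 <= t ==> continuous (at_right t) (%s. X s w)"
	and X_left: "w \<in> space M ==> 0 < t ==> \<exists>l. ((%s. X s w) \<longlongrightarrow> l) (at_left t)"
	and J_rc: "w \<in> space M ==> 0 <= t ==> \<exists>e>0. \<forall>s\<in>{t..t+e}. J s w = J t w"
	and J_absorb: "w \<in> space M ==> 0 <= s ==> s <= t ==> J s w = None ==> J t w = None"
	by (drule bspec[OF paths], elim conjE, simp)+

lemma finite_P [simp]: "finite_measure (P x i)" and sigma_finite_P [simp]: "sigma_finite_measure (P x i)"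
	using prob by (auto intro: prob_space.finite_measure prob_space_imp_sigma_finite)

definition hist :: "real => 'w measure" where
	"hist t = sigma (space M) {{w\<in>space M. X s w \<in> B & J s w = Some k} | s B k. 0 <= s & s <= t & B \<in> sets borel}"

lemma space_hist [simp]: "space (hist t) = space M"
	unfolding hist_def by (rule space_measure_of) auto

lemma sets_hist: "sets (hist t) = natural_events M X J t"
	unfolding hist_def natural_events_def by (rule sets_measure_of) auto

lemma hist_gen: "0 <= s ==> s <= t ==> B \<in> sets borel ==> {w\<in>space M. X s w \<in> B & J s w = Some k} \<in> sets (hist t)"
	unfolding sets_hist natural_events_def by (rule sigma_sets.Basic) auto

lemma hist_subset: "sets (hist t) \<subseteq> sets M"
proof -
	have "{w\<in>space M. X s w \<in> B & J s w = Some k} \<in> sets M" if "B \<in> sets borel" for s B k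
		using that by measurable
	thus ?thesis unfolding sets_hist natural_events_def by (intro sets.sigma_sets_subset) auto
qed

lemma hist_mono:
	assumes "s <= t"
	shows "sets (hist s) \<subseteq> sets (hist t)"
	unfolding sets_hist natural_events_def
proof (rule sigma_sets_mono', rule subsetI)
	fix S assume "S \<in> {{w\<in>space M. X r w \<in> B & J r w = Some k} | r B k. 0 <= r & r <= s & B \<in> sets borel}"
	then obtain r B k where "S = {w\<in>space M. X r w \<in> B & J r w = Some k}" "0 <= r" "r <= s" "B \<in> sets borel"
		by (elim CollectE exE conjE)
	thus "S \<in> {{w\<in>space M. X r w \<in> B & J r w = Some k} | r B k. 0 <= r & r <= t & B \<in> sets borel}"
		using assms by (intro CollectI exI[of _ r] exI[of _ B] exI[of _ k]) simp
qed

lemma measurable_hist_mono: "s <= t ==> f \<in> hist s \<rightarrow>\<^sub>M N ==> f \<in> hist t \<rightarrow>\<^sub>M N"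
	unfolding measurable_def by (auto dest: subsetD[OF hist_mono])

lemma measurable_hist_M: "f \<in> hist s \<rightarrow>\<^sub>M N ==> f \<in> M \<rightarrow>\<^sub>M N"
	unfolding measurable_def by (auto dest: subsetD[OF hist_subset])

lemma hist_phase: "0 <= s ==> s <= t ==> {w\<in>space M. J s w = Some k} \<in> sets (hist t)"
	using hist_gen[of s t UNIV k] by simp

lemma J_hist [measurable]:
	assumes "0 <= s" "s <= t"
	shows "J s \<in> hist t \<rightarrow>\<^sub>M count_space UNIV"
proof (subst measurable_count_space_eq2)
	have "J s -` {None} \<inter> space M = space M-(\<Union>k. {w\<in>space M. J s w = Some k})" by (auto simp: not_None_eq[symmetric] simp del: not_None_eq)
	also have "\<dots> \<in> sets (hist t)"
		using hist_phase[OF assms] sets.top[of "hist t"] by (intro sets.Diff sets.finite_UN) auto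
	finally have "J s -` {p} \<inter> space M \<in> sets (hist t)" for p
		using hist_phase[OF assms] by (cases p) (auto simp: vimage_def Int_def conj_commute)
	thus "J s \<in> space (hist t) \<rightarrow> UNIV & (\<forall>a\<in>UNIV. J s -` {a} \<inter> space (hist t) \<in> sets (hist t))" by simp
qed simp

text \<open>The generating events of \<open>hist\<close> see X only together with a living phase.
  Replacing X by 0 after killing gives an adapted process that agrees with X before.\<close>

definition XA :: "real => 'w => real" where "XA t w = (if J t w = None then 0 else X t w)"

lemma XA_hist [measurable]:
	assumes "0 <= s" "s <= t"
	shows "XA s \<in> Bor (hist t)"
proof (rule measurableI)
	fix B :: "real set" assume B: "B \<in> sets borel"
	have "XA s -` B \<inter> space (hist t) = (\<Union>k. {w\<in>space M. X s w \<in> B & J s w = Some k}) \<union>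
		(if 0 \<in> B then J s -` {None} \<inter> space (hist t) else {})"
		by (auto simp: XA_def split: if_splits)
	also have "\<dots> \<in> sets (hist t)"
		using hist_gen[OF assms B] measurable_sets[OF J_hist[OF assms], of "{None}"]
		by (intro sets.Un sets.finite_UN) auto
	finally show "XA s -` B \<inter> space (hist t) \<in> sets (hist t)" .
qed simp

definition ph :: "'n => real => 'w => real" where "ph j t w = (if J t w = Some j then 1 else 0)"
definition alive :: "real => 'w => real" where "alive t w = (if J t w = None then 0 else 1)"

lemma ph_meas [measurable]: "ph j t \<in> Bor M" unfolding ph_def by measurable
lemma alive_meas [measurable]: "alive t \<in> Bor M" unfolding alive_def by measurable

lemma ph_bounds [simp]: "0 <= ph j t w" "ph j t w <= 1" "0 <= alive t w" "alive t w <= 1" "\<bar>ph j t w\<bar> = ph j t w"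
	by (auto simp: ph_def alive_def)

lemma sum_ph: "(\<Sum>j\<in>UNIV. ph j t w) = alive t w"
	by (cases "J t w") (auto simp: ph_def alive_def)

lemma phase_eval_ph: "phase_eval g (J t w) y = (\<Sum>j\<in>UNIV. g j y*ph j t w)"
proof (cases "J t w")
	case (Some i)
	have "g j y*ph j t w = (if j = i then g i y else 0)" for j using Some by (auto simp: ph_def)
	thus ?thesis using Some by simp
qed (simp add: ph_def)

lemma X_joint [measurable]: "(%p. X (max 0 (fst p)) (snd p)) \<in> Bor (borel \<Otimes>\<^sub>M M)"
	by (rule measurable_right_cont_process) (auto intro: X_rc)

lemma right_cont_J: "w \<in> space M ==> 0 <= t ==> continuous (at_right t) (%s. g (J s w) :: real)"
proof -
	assume *: "w \<in> space M" "0 <= t"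
	obtain e where e: "e > 0" "\<forall>s\<in>{t..t+e}. J s w = J t w" using J_rc[OF *] by blast
	have "\<forall>\<^sub>F s in at_right t. g (J t w) = g (J s w)"
		unfolding eventually_at_right_field
	proof (intro exI[of _ "t+e"] conjI allI impI)
		fix s assume "t < s" "s < t+e"
		hence "J s w = J t w" by (intro bspec[OF e(2)]) simp
		thus "g (J t w) = g (J s w)" by (simp only:)
	qed (use e(1) in simp)
	thus ?thesis unfolding continuous_within by (rule Lim_transform_eventually[OF tendsto_const])
qed

lemma ph_joint [measurable]: "(%p. ph j (max 0 (fst p)) (snd p)) \<in> Bor (borel \<Otimes>\<^sub>M M)"
proof (rule measurable_right_cont_process)
	show "continuous (at_right t) (%s. ph j s w)" if "w \<in> space M" "0 <= t" for t w
		unfolding ph_def by (rule right_cont_J[OF that])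
qed simp

lemma alive_joint [measurable]: "(%p. alive (max 0 (fst p)) (snd p)) \<in> Bor (borel \<Otimes>\<^sub>M M)"
proof (rule measurable_right_cont_process)
	show "continuous (at_right t) (%s. alive s w)" if "w \<in> space M" "0 <= t" for t w
		unfolding alive_def by (rule right_cont_J[OF that])
qed simp

text \<open>Countably many constraints at once, by continuity along decreasing events; with an
  enumeration of rational times this controls a whole path segment.\<close>

lemma markov_seq:
	fixes s :: "nat => real"
	assumes t: "0 <= t" and A: "A \<in> sets (hist t)" and s: "\<And>m. 0 <= s m" "\<And>m. B m \<in> sets borel"
	shows "measure (P x i) (A \<inter> {w\<in>space M. J t w = Some j \<and>
						(\<forall>m. X (t + s m) w-X t w \<in> B m & J (t + s m) w = Some (k m))})
				= measure (P x i) (A \<inter> {w\<in>space M. J t w = Some j}) *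
					measure (P 0 j) {w\<in>space M. \<forall>m. X (s m) w-X 0 w \<in> B m & J (s m) w = Some (k m)}"
proof -
	have AM: "A \<in> sets M" by (rule subsetD[OF hist_subset A])
	note [measurable] = s(2) AM
	let ?E = "%n. A \<inter> {w\<in>space M. J t w = Some j & (\<forall>m<n. X (t + s m) w-X t w \<in> B m & J (t + s m) w = Some (k m))}"
	let ?D = "%n. {w\<in>space M. \<forall>m<n. X (s m) w-X 0 w \<in> B m & J (s m) w = Some (k m)}"
	have "(%n. measure (P x i) (?E n)) \<leadsto> measure (P x i) (\<Inter>n. ?E n)"
	proof (rule finite_measure.finite_Lim_measure_decseq[OF finite_P])
		have "?E n \<in> sets M" for n by measurable
		thus "range ?E \<subseteq> sets (P x i)" by auto
	qed (auto simp: decseq_def)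
	moreover have "(\<Inter>n. ?E n) = A \<inter> {w\<in>space M. J t w = Some j \<and>
						(\<forall>m. X (t + s m) w-X t w \<in> B m & J (t + s m) w = Some (k m))}" by auto
	moreover have "(%n. measure (P 0 j) (?D n)) \<leadsto> measure (P 0 j) (\<Inter>n. ?D n)"
	proof (rule finite_measure.finite_Lim_measure_decseq[OF finite_P])
		have "?D n \<in> sets M" for n by measurable
		thus "range ?D \<subseteq> sets (P 0 j)" by auto
	qed (auto simp: decseq_def)
	moreover have "(\<Inter>n. ?D n) = {w\<in>space M. \<forall>m. X (s m) w-X 0 w \<in> B m & J (s m) w = Some (k m)}" by auto
	moreover have "measure (P x i) (?E n) = measure (P x i) (A \<inter> {w\<in>space M. J t w = Some j})*measure (P 0 j) (?D n)" for n
		by (rule increments[rule_format]) (use t A s in \<open>auto simp: sets_hist\<close>)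
	ultimately have 1: "(%n. measure (P x i) (A \<inter> {w\<in>space M. J t w = Some j})*measure (P 0 j) (?D n)) \<leadsto> measure (P x i) (A \<inter> {w\<in>space M. J t w = Some j \<and>
						(\<forall>m. X (t + s m) w-X t w \<in> B m & J (t + s m) w = Some (k m))})"
			and 2: "(%n. measure (P 0 j) (?D n)) \<leadsto> measure (P 0 j) {w\<in>space M. \<forall>m. X (s m) w-X 0 w \<in> B m & J (s m) w = Some (k m)}"
		by (simp_all only:)
	show ?thesis by (rule LIMSEQ_unique[OF 1 tendsto_mult[OF tendsto_const 2]])
qed

lemma markov1:
	assumes t: "0 <= t" and A: "A \<in> sets (hist t)" and s: "0 <= s" "B \<in> sets borel"
	shows "measure (P x i) (A \<inter> {w\<in>space M. J t w = Some j & X (t + s) w-X t w \<in> B & J (t + s) w = Some k})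
				= measure (P x i) (A \<inter> {w\<in>space M. J t w = Some j}) *
					measure (P 0 j) {w\<in>space M. X s w-X 0 w \<in> B & J s w = Some k}"
proof -
	have "measure (P x i) (A \<inter> {w\<in>space M. J t w = Some j \<and>
						(\<forall>m<(1::nat). X (t + s) w-X t w \<in> B & J (t + s) w = Some k)})
				= measure (P x i) (A \<inter> {w\<in>space M. J t w = Some j}) *
					measure (P 0 j) {w\<in>space M. \<forall>m<(1::nat). X s w-X 0 w \<in> B & J s w = Some k}"
		by (rule increments[rule_format]) (use t A s in \<open>auto simp: sets_hist\<close>)
	thus ?thesis by simp
qed

lemma sf_distr_density:
	assumes g [measurable]: "g \<in> Bor M" and Z: "Z \<in> M \<rightarrow>\<^sub>M N" and g1: "\<And>w. g w <= 1"
	shows "sigma_finite_measure (distr (density (P y l) (%w. ennreal (g w))) N Z)"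
proof -
	have "emeasure (density (P y l) (%w. ennreal (g w))) (space M) <= (\<integral>\<^sup>+w. 1 \<partial>P y l)"
	proof (subst emeasure_density)
		show "(\<integral>\<^sup>+w. ennreal (g w)*indicator (space M) w \<partial>P y l) <= (\<integral>\<^sup>+w. 1 \<partial>P y l)"
		proof (rule nn_integral_mono)
			fix w
			have "ennreal (g w) <= ennreal 1" by (rule ennreal_leI[OF g1])
			thus "ennreal (g w)*indicator (space M) w <= 1" by (simp add: indicator_def)
		qed
	qed simp_all
	also have "\<dots> = 1" using prob_space.emeasure_space_1[OF prob, of y l] by simp
	finally have "finite_measure (density (P y l) (%w. ennreal (g w)))"
		by (intro finite_measureI) (auto simp: top_unique)
	hence "finite_measure (distr (density (P y l) (%w. ennreal (g w))) N Z)"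
		by (rule finite_measure.finite_measure_distr) (use Z in simp)
	thus ?thesis by (rule finite_measure.axioms(1))
qed

lemma emeasure_distr_density:
	assumes [measurable]: "g \<in> Bor M" "Z \<in> M \<rightarrow>\<^sub>M N" "A \<in> sets N" "S \<in> sets M"
		and eq: "\<And>w. w \<in> space M ==> ennreal (g w)*indicator A (Z w) = indicator S w"
	shows "emeasure (distr (density (P y l) (%w. ennreal (g w))) N Z) A = emeasure (P y l) S"
proof -
	have "emeasure (distr (density (P y l) (%w. ennreal (g w))) N Z) A
		= (\<integral>\<^sup>+z. indicator A z \<partial>distr (density (P y l) (%w. ennreal (g w))) N Z)" by simp
	also have "\<dots> = (\<integral>\<^sup>+w. ennreal (g w)*indicator A (Z w) \<partial>P y l)"
		by (subst nn_integral_distr) (simp_all add: nn_integral_density)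
	also have "\<dots> = (\<integral>\<^sup>+w. indicator S w \<partial>P y l)" by (rule nn_integral_cong) (simp add: eq)
	also have "\<dots> = emeasure (P y l) S" by simp
	finally show ?thesis .
qed

text \<open>Given phase j at time t, the past Y and the increment are independent: the defining
  identity is the rectangle case, and rectangles determine the product. The densities
  \<open>ph\<close> stand in for conditioning, so phases of probability 0 cause no division.\<close>

lemma markov_pair:
	fixes N :: "'c measure"
	assumes t: "0 <= t" and Y [measurable]: "Y \<in> hist t \<rightarrow>\<^sub>M N" and s: "0 <= s"
	shows "distr (density (P x i) (%w. ennreal (ph j t w))) N Y \<Otimes>\<^sub>M
			distr (density (P 0 j) (%w. ennreal (ph k s w))) borel (%w. X s w-X 0 w)
		= distr (density (P x i) (%w. ennreal (ph j t w*ph k (t + s) w))) (N \<Otimes>\<^sub>M borel) (%w. (Y w, X (t + s) w-X t w))"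
proof (rule pair_measure_eqI)
	have YM [measurable]: "Y \<in> M \<rightarrow>\<^sub>M N" by (rule measurable_hist_M[OF Y])
	have fin: "sigma_finite_measure (distr (density (P y l) (%w. ennreal (g w))) N' Z)"
		if "g \<in> Bor M" "Z \<in> M \<rightarrow>\<^sub>M N'" "\<And>w. g w <= 1" for y l g and N' :: "'c measure" and Z
		by (rule sf_distr_density[OF that])
	have fin': "sigma_finite_measure (distr (density (P y l) (%w. ennreal (g w))) N' Z)"
		if "g \<in> Bor M" "Z \<in> M \<rightarrow>\<^sub>M N'" "\<And>w. g w <= 1" for y l g and N' :: "real measure" and Z
		by (rule sf_distr_density[OF that])
	show "sigma_finite_measure (distr (density (P x i) (%w. ennreal (ph j t w))) N Y)"
		by (rule fin) simp_all
	show "sigma_finite_measure (distr (density (P 0 j) (%w. ennreal (ph k s w))) borel (%w. X s w-X 0 w))"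
		by (rule fin') simp_all
	fix A B assume "A \<in> sets (distr (density (P x i) (%w. ennreal (ph j t w))) N Y)"
		and "B \<in> sets (distr (density (P 0 j) (%w. ennreal (ph k s w))) borel (%w. X s w-X 0 w))"
	hence A [measurable]: "A \<in> sets N" and B [measurable]: "B \<in> sets borel" by auto
	let ?A = "Y -` A \<inter> space M"
	have AH: "?A \<in> sets (hist t)" using measurable_sets[OF Y A] by simp
	have AM [measurable]: "?A \<in> sets M" by (rule subsetD[OF hist_subset AH])
	have 1: "emeasure (distr (density (P x i) (%w. ennreal (ph j t w))) N Y) A = emeasure (P x i) (?A \<inter> {w\<in>space M. J t w = Some j})"
		by (rule emeasure_distr_density) (auto simp: ph_def indicator_def)
	have 2: "emeasure (distr (density (P 0 j) (%w. ennreal (ph k s w))) borel (%w. X s w-X 0 w)) B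
		 = emeasure (P 0 j) {w\<in>space M. X s w-X 0 w \<in> B & J s w = Some k}"
		by (rule emeasure_distr_density) (auto simp: ph_def indicator_def)
	have 3: "emeasure (distr (density (P x i) (%w. ennreal (ph j t w*ph k (t + s) w))) (N \<Otimes>\<^sub>M borel) (%w. (Y w, X (t + s) w-X t w))) (A \<times> B)
		= emeasure (P x i) (?A \<inter> {w\<in>space M. J t w = Some j & X (t + s) w-X t w \<in> B & J (t + s) w = Some k})"
		by (rule emeasure_distr_density) (auto simp: ph_def indicator_def)
	show "emeasure (distr (density (P x i) (%w. ennreal (ph j t w))) N Y) A *
			emeasure (distr (density (P 0 j) (%w. ennreal (ph k s w))) borel (%w. X s w-X 0 w)) B =
			emeasure (distr (density (P x i) (%w. ennreal (ph j t w*ph k (t + s) w))) (N \<Otimes>\<^sub>M borel) (%w. (Y w, X (t + s) w-X t w))) (A \<times> B)"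
		unfolding 1 2 3 using markov1[OF t AH s B, of x i j k]
		by (simp add: finite_measure.emeasure_eq_measure ennreal_mult')
qed simp

lemma markov_nn:
	assumes t: "0 <= t" and Y: "Y \<in> hist t \<rightarrow>\<^sub>M N" and s: "0 <= s" and \<Psi>: "\<Psi> \<in> Bor (N \<Otimes>\<^sub>M borel)"
	shows "(\<integral>\<^sup>+w. ennreal (ph j t w*ph k (t + s) w)*\<Psi> (Y w, X (t + s) w-X t w) \<partial>P x i)
		= (\<integral>\<^sup>+w. ennreal (ph j t w)*(\<integral>\<^sup>+w'. ennreal (ph k s w')*\<Psi> (Y w, X s w'-X 0 w') \<partial>P 0 j) \<partial>P x i)"
proof -
	note [measurable] = \<Psi> measurable_hist_M[OF Y]
	let ?R = "distr (density (P 0 j) (%w. ennreal (ph k s w))) borel (%w. X s w-X 0 w)"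
	have sf: "sigma_finite_measure ?R"
		by (rule sf_distr_density) simp_all
	have "(\<integral>\<^sup>+w. ennreal (ph j t w*ph k (t + s) w)*\<Psi> (Y w, X (t + s) w-X t w) \<partial>P x i)
		= (\<integral>\<^sup>+z. \<Psi> z \<partial>distr (density (P x i) (%w. ennreal (ph j t w*ph k (t + s) w))) (N \<Otimes>\<^sub>M borel) (%w. (Y w, X (t + s) w-X t w)))"
		by (subst nn_integral_distr) (simp_all add: nn_integral_density)
	also have "\<dots> = (\<integral>\<^sup>+y. \<integral>\<^sup>+z. \<Psi> (y, z) \<partial>?R \<partial>distr (density (P x i) (%w. ennreal (ph j t w))) N Y)"
		unfolding markov_pair[OF t Y s, symmetric]
		by (rule sigma_finite_measure.nn_integral_fst[OF sf, symmetric]) simp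
	also have "\<dots> = (\<integral>\<^sup>+w. ennreal (ph j t w)*(\<integral>\<^sup>+z. \<Psi> (Y w, z) \<partial>?R) \<partial>P x i)"
		using sigma_finite_measure.borel_measurable_nn_integral_fst[OF sf, of \<Psi> N]
		by (subst nn_integral_distr) (simp_all add: nn_integral_density)
	also have "\<dots> = (\<integral>\<^sup>+w. ennreal (ph j t w)*(\<integral>\<^sup>+w'. ennreal (ph k s w')*\<Psi> (Y w, X s w'-X 0 w') \<partial>P 0 j) \<partial>P x i)"
	proof (rule nn_integral_cong)
		fix w assume "w \<in> space (P x i)"
		hence [measurable]: "Y w \<in> space N" using measurable_space[OF Y] by simp
		have "(\<integral>\<^sup>+z. \<Psi> (Y w, z) \<partial>?R) = (\<integral>\<^sup>+w'. ennreal (ph k s w')*\<Psi> (Y w, X s w'-X 0 w') \<partial>P 0 j)"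
			by (subst nn_integral_distr) (simp_all add: nn_integral_density)
		thus "ennreal (ph j t w)*(\<integral>\<^sup>+z. \<Psi> (Y w, z) \<partial>?R) =
			ennreal (ph j t w)*(\<integral>\<^sup>+w'. ennreal (ph k s w')*\<Psi> (Y w, X s w'-X 0 w') \<partial>P 0 j)" by simp
	qed
	finally show ?thesis .
qed

end

context map_process
begin

lemma markov_integral:
	fixes \<Psi> :: "'c \<times> real => real"
	assumes t: "0 <= t" and Y: "Y \<in> hist t \<rightarrow>\<^sub>M N" and s: "0 <= s" and \<Psi>: "\<Psi> \<in> Bor (N \<Otimes>\<^sub>M borel)"
		and int: "integrable (P x i) (%w. ph j t w*ph k (t + s) w*\<Psi> (Y w, X (t + s) w-X t w))"
	shows "(\<integral>w. ph j t w*ph k (t + s) w*\<Psi> (Y w, X (t + s) w-X t w) \<partial>P x i)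
		= (\<integral>w. ph j t w*(\<integral>w'. ph k s w'*\<Psi> (Y w, X s w'-X 0 w') \<partial>P 0 j) \<partial>P x i)"
		and "integrable (P x i) (%w. ph j t w*(\<integral>w'. ph k s w'*\<Psi> (Y w, X s w'-X 0 w') \<partial>P 0 j))"
proof -
	note [measurable] = \<Psi> measurable_hist_M[OF Y]
	let ?R = "distr (density (P 0 j) (%w. ennreal (ph k s w))) borel (%w. X s w-X 0 w)"
	let ?L = "distr (density (P x i) (%w. ennreal (ph j t w))) N Y"
	interpret pair_sigma_finite ?L ?R
		unfolding pair_sigma_finite_def by (intro conjI sf_distr_density) (use measurable_hist_M[OF Y] in simp_all)
	let ?D = "distr (density (P x i) (%w. ennreal (ph j t w*ph k (t + s) w))) (N \<Otimes>\<^sub>M borel) (%w. (Y w, X (t + s) w-X t w))"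
	have "integrable ?D \<Psi>"
		by (subst integrable_distr_eq) (use int in \<open>simp_all add: integrable_density mult.assoc\<close>)
	hence iLR: "integrable (?L \<Otimes>\<^sub>M ?R) \<Psi>" by (simp only: markov_pair[OF t Y s])
	have inner: "(\<integral>z. \<Psi> (Y w, z) \<partial>?R) = (\<integral>w'. ph k s w'*\<Psi> (Y w, X s w'-X 0 w') \<partial>P 0 j)" if "w \<in> space M" for w
	proof -
		have [measurable]: "Y w \<in> space N" using measurable_space[OF Y] that by simp
		show ?thesis by (subst integral_distr) (simp_all add: integral_density)
	qed
	have "(\<integral>w. ph j t w*ph k (t + s) w*\<Psi> (Y w, X (t + s) w-X t w) \<partial>P x i) = (\<integral>z. \<Psi> z \<partial>?D)"
		by (subst integral_distr) (simp_all add: integral_density)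
	also have "\<dots> = (\<integral>y. (\<integral>z. \<Psi> (y, z) \<partial>?R) \<partial>?L)"
		unfolding markov_pair[OF t Y s, symmetric] by (rule integral_fst'[OF iLR, symmetric])
	also have "\<dots> = (\<integral>w. ph j t w*(\<integral>z. \<Psi> (Y w, z) \<partial>?R) \<partial>P x i)"
		by (subst integral_distr) (simp_all add: integral_density)
	also have "\<dots> = (\<integral>w. ph j t w*(\<integral>w'. ph k s w'*\<Psi> (Y w, X s w'-X 0 w') \<partial>P 0 j) \<partial>P x i)"
		by (rule Bochner_Integration.integral_cong) (simp_all add: inner)
	finally show "(\<integral>w. ph j t w*ph k (t + s) w*\<Psi> (Y w, X (t + s) w-X t w) \<partial>P x i)
		= (\<integral>w. ph j t w*(\<integral>w'. ph k s w'*\<Psi> (Y w, X s w'-X 0 w') \<partial>P 0 j) \<partial>P x i)" .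
	have "integrable ?L (%y. \<integral>z. \<Psi> (y, z) \<partial>?R)" by (rule integrable_fst'[OF iLR])
	hence "integrable (density (P x i) (%w. ennreal (ph j t w))) (%w. \<integral>z. \<Psi> (Y w, z) \<partial>?R)"
		by (subst (asm) integrable_distr_eq) simp_all
	hence "integrable (P x i) (%w. ph j t w*(\<integral>z. \<Psi> (Y w, z) \<partial>?R))"
		by (subst (asm) integrable_density) simp_all
	thus "integrable (P x i) (%w. ph j t w*(\<integral>w'. ph k s w'*\<Psi> (Y w, X s w'-X 0 w') \<partial>P 0 j))"
		by (subst (asm) Bochner_Integration.integrable_cong[OF refl, of _ _ "%w. ph j t w*(\<integral>w'. ph k s w'*\<Psi> (Y w, X s w'-X 0 w') \<partial>P 0 j)"]) (simp_all add: inner)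
qed

lemma AE_X0: "AE w in P x i. X 0 w = x"
	using start[of x i] by eventually_elim simp

lemma alive_mono: "w \<in> space M ==> 0 <= s ==> s <= t ==> alive t w*alive s w = alive t w"
	using J_absorb[of w s t] by (auto simp: alive_def)

lemma sum_ph_ph:
	assumes "w \<in> space M" "0 <= t" "0 <= s"
	shows "(\<Sum>j\<in>UNIV. \<Sum>k\<in>UNIV. ph j t w*ph k (t + s) w) = alive (t + s) w"
proof -
	have "(\<Sum>j\<in>UNIV. \<Sum>k\<in>UNIV. ph j t w*ph k (t + s) w) = alive t w*alive (t + s) w"
		by (simp add: sum_ph flip: sum_distrib_left sum_distrib_right)
	thus ?thesis using alive_mono[of w t "t + s"] assms by (simp add: mult.commute)
qed

end

section \<open>Exponential moments and the drift over one time step\<close>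

locale exp_map_process = map_process M P X J for M P X and J :: "real => 'w => 'n::finite option" +
	assumes mgf: "0 <= c ==> 0 <= t ==> integrable (P 0 i) (%w. exp (c*X t w)*ph l t w)"
		and mgf_growth: "0 <= c ==> \<exists>\<kappa>\<ge>0. \<forall>t\<ge>0. \<forall>j. (\<Sum>l\<in>UNIV. \<integral>w. exp (c*X t w)*ph l t w \<partial>P 0 j) <= exp (\<kappa>*t)"
begin

lemma mgf_increment:
	assumes "0 <= c" "0 <= t" "0 <= s"
	shows "integrable (P x i) (%w. ph j t w*ph k (t + s) w*exp (c*(X (t + s) w-X t w)))"
proof (rule integrableI_bounded)
	\<comment> \<open>The constant 0 takes the place of the past variable, since only the increment
	  matters here.\<close>
	have "(\<integral>\<^sup>+w. ennreal (norm (ph j t w*ph k (t + s) w*exp (c*(X (t + s) w-X t w)))) \<partial>P x i)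
		= (\<integral>\<^sup>+w. ennreal (ph j t w*ph k (t + s) w)*ennreal (exp (c * snd (0::real, X (t + s) w-X t w))) \<partial>P x i)"
		by (intro nn_integral_cong) (simp add: abs_mult ennreal_mult'')
	also have "\<dots> = (\<integral>\<^sup>+w. ennreal (ph j t w)*(\<integral>\<^sup>+w'. ennreal (ph k s w')*ennreal (exp (c * snd (0::real, X s w'-X 0 w'))) \<partial>P 0 j) \<partial>P x i)"
		by (rule markov_nn[OF assms(2) _ assms(3), where N="borel"]) auto
	also have "\<dots> <= (\<integral>\<^sup>+w. (\<integral>\<^sup>+w'. ennreal (ph k s w')*ennreal (exp (c * snd (0::real, X s w'-X 0 w'))) \<partial>P 0 j) \<partial>P x i)"
		by (rule nn_integral_mono) (auto simp: ph_def)
	also have "\<dots> = (\<integral>\<^sup>+w'. ennreal (ph k s w')*ennreal (exp (c * snd (0::real, X s w'-X 0 w'))) \<partial>P 0 j)"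
		using prob_space.emeasure_space_1[OF prob, of x i] by simp
	also have "\<dots> = (\<integral>\<^sup>+w'. ennreal (exp (c*X s w')*ph k s w') \<partial>P 0 j)"
		by (rule nn_integral_cong_AE) (use AE_X0[of 0 j] in eventually_elim, simp add: ennreal_mult'' mult.commute)
	also have "\<dots> < \<infinity>"
		using mgf[OF assms(1,3), of j k] unfolding integrable_iff_bounded by (simp add: abs_mult)
	finally show "(\<integral>\<^sup>+w. ennreal (norm (ph j t w*ph k (t + s) w*exp (c*(X (t + s) w-X t w)))) \<partial>P x i) < \<infinity>" .
qed simp

text \<open>Where V is nonzero the position is at most hi, so the growth bound on f reduces to an
  exponential moment of the increment.\<close>

lemma step_integrable:
	fixes f :: "'n => real => real"
	assumes t: "0 <= t" and s: "0 <= s"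
		and [measurable]: "V \<in> Bor M" "H \<in> Bor M"
		and V1: "\<And>w. w \<in> space M ==> \<bar>V w\<bar> <= 1" and hi: "\<And>w. w \<in> space M ==> V w ~= 0 ==> H w <= hi"
		and f [measurable]: "\<And>l. f l \<in> Bor borel" and th: "0 <= th" and C: "\<And>l y. \<bar>f l y\<bar> <= C*(1+exp (th*y))"
	shows "integrable (P x i) (%w. ph j t w*ph k (t + s) w*(V w*f k (H w+(X (t + s) w-X t w))))"
proof -
	have "0 <= C*(1+exp (th*0))" by (rule order_trans[OF abs_ge_zero C])
	hence C0: "0 <= C" by simp
	have "integrable (P x i) (%w. C*1+C*exp (th*hi)*(ph j t w*ph k (t + s) w*exp (th*(X (t + s) w-X t w))))"
		using mgf_increment[OF th t s, of x i j k] prob_space.prob_space[OF prob]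
		by (intro Bochner_Integration.integrable_add integrable_mult_right) (auto intro: finite_measure.integrable_const)
	thus ?thesis
	proof (rule Bochner_Integration.integrable_bound)
		show "AE w in P x i. norm (ph j t w*ph k (t + s) w*(V w*f k (H w+(X (t + s) w-X t w))))
			\<le> norm (C*1+C*exp (th*hi)*(ph j t w*ph k (t + s) w*exp (th*(X (t + s) w-X t w))))"
		proof (rule AE_I2)
			fix w assume "w \<in> space (P x i)"
			hence om: "w \<in> space M" by simp
			let ?\<xi> = "X (t + s) w-X t w"
			show "norm (ph j t w*ph k (t + s) w*(V w*f k (H w+?\<xi>)))
				\<le> norm (C*1+C*exp (th*hi)*(ph j t w*ph k (t + s) w*exp (th*?\<xi>)))"
			proof (cases "V w = 0 | ph j t w*ph k (t + s) w = 0")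
				case True thus ?thesis by auto
			next
				case False
				hence p: "ph j t w*ph k (t + s) w = 1" by (auto simp: ph_def split: if_splits)
				have "\<bar>V w*f k (H w+?\<xi>)\<bar> <= 1*(C*(1+exp (th*(H w+?\<xi>))))"
					unfolding abs_mult using V1[OF om] C by (intro mult_mono) auto
				also have "\<dots> <= C*(1+exp (th*(hi+?\<xi>)))"
					using C0 hi[OF om] False th by (auto intro!: mult_left_mono)
				also have "\<dots> = C*1+C*exp (th*hi)*(1*exp (th*?\<xi>))" by (simp add: distrib_left exp_add)
				finally show ?thesis unfolding p using C0 by simp
			qed
		qed
	qed simp
qed

text \<open>The drift estimate, assumed for a start at time 0 and a deterministic y, is carried to
  time t with an adapted random position H and weight V: by the Markov property the step from t acts
  on (V, H) through the kernel \<open>\<phi>\<close>.\<close>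

lemma step_bound:
	fixes f :: "'n => real => real" and \<rho> :: "real => ennreal"
	assumes t: "0 <= t" and s: "0 <= s"
		and Vh: "V \<in> Bor (hist t)" and Hh: "H \<in> Bor (hist t)"
		and V1: "\<And>w. w \<in> space M ==> \<bar>V w\<bar> <= 1" and hi: "\<And>w. w \<in> space M ==> V w ~= 0 ==> H w <= hi"
		and f [measurable]: "\<And>l. f l \<in> Bor borel" and th: "0 <= th" and C: "\<And>l y. \<bar>f l y\<bar> <= C*(1+exp (th*y))"
		and \<rho> [measurable]: "\<rho> \<in> Bor borel"
		and drift: "\<And>j y. ennreal \<bar>(\<integral>w. phase_eval f (J s w) (y+X s w) \<partial>P 0 j)-f j y\<bar>
			\<le> (\<integral>\<^sup>+v. indicator {0..s} v * (\<integral>\<^sup>+w. \<rho> (y+X v w)*ennreal (alive v w) \<partial>P 0 j) \<partial>lborel)"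
	shows "ennreal \<bar>(\<integral>w. V w*phase_eval f (J (t + s) w) (H w+(X (t + s) w-X t w))*alive t w \<partial>P x i)
				- (\<integral>w. V w*phase_eval f (J t w) (H w) \<partial>P x i)\<bar>
		\<le> (\<integral>\<^sup>+v. indicator {0..s} v * (\<integral>\<^sup>+w. indicator {w. V w ~= 0} w*\<rho> (H w+(X (t + v) w-X t w))*ennreal (alive (t + v) w) \<partial>P x i) \<partial>lborel)"
proof -
	note [measurable] = measurable_hist_M[OF Vh] measurable_hist_M[OF Hh]
	have Y: "(%w. (V w, H w)) \<in> hist t \<rightarrow>\<^sub>M borel \<Otimes>\<^sub>M borel" using Vh Hh by (intro measurable_Pair)
	let ?xi = "%w. X (t + s) w-X t w"
	define \<phi> where "\<phi> j y = (\<integral>w. phase_eval f (J s w) (y+X s w) \<partial>P 0 j)" for j y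
	define \<psi> where "\<psi> j y = (\<integral>\<^sup>+v. indicator {0..s} v * (\<integral>\<^sup>+w. \<rho> (y+X v w)*ennreal (alive v w) \<partial>P 0 j) \<partial>lborel)" for j y
	have \<phi>_sum: "\<phi> j y = (\<Sum>k\<in>UNIV. \<integral>w. ph k s w*f k (y+(X s w-X 0 w)) \<partial>P 0 j)" for j y
	proof -
		have i: "integrable (P 0 j) (%w. ph k s w*f k (y+(X s w-X 0 w)))" for k
		proof -
			have "integrable (P 0 j) (%w. ph j 0 w*ph k (0 + s) w*(1*f k (y+(X (0 + s) w-X 0 w))))"
				by (rule step_integrable[OF order_refl s, where hi=y]) (use th C in auto)
			thus ?thesis
			proof (rule Bochner_Integration.integrable_cong_AE_imp)
				show "AE w in P 0 j. ph j 0 w*ph k (0 + s) w*(1*f k (y+(X (0 + s) w-X 0 w))) = ph k s w*f k (y+(X s w-X 0 w))"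
					using start[of 0 j] by eventually_elim (simp add: ph_def)
			qed simp
		qed
		have "\<phi> j y = (\<integral>w. (\<Sum>k\<in>UNIV. ph k s w*f k (y+(X s w-X 0 w))) \<partial>P 0 j)"
			unfolding \<phi>_def
		proof (rule integral_cong_AE)
			show "AE w in P 0 j. phase_eval f (J s w) (y+X s w) = (\<Sum>k\<in>UNIV. ph k s w*f k (y+(X s w-X 0 w)))"
				using AE_X0[of 0 j] by eventually_elim (simp add: phase_eval_ph mult.commute)
			show "(%w. phase_eval f (J s w) (y+X s w)) \<in> Bor (P 0 j)"
				unfolding phase_eval_ph by measurable
		qed measurable
		thus ?thesis using i by (simp add: Bochner_Integration.integral_sum)
	qed
	have \<phi>_meas [measurable]: "\<phi> j \<in> Bor borel" for j
	proof -
		interpret S: sigma_finite_measure "P 0 j" by simp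
		show ?thesis unfolding \<phi>_sum[abs_def] by measurable
	qed
	have int1: "integrable (P x i) (%w. ph j t w*ph k (t + s) w*(V w*f k (H w+?xi w)))" for j k
		by (rule step_integrable[OF t s _ _ V1 hi f th C]) simp_all
	let ?\<Psi> = "%k z. fst (fst z)*f k (snd (fst z) + snd z)"
	have mi: "(\<integral>w. ph j t w*ph k (t + s) w*(V w*f k (H w+?xi w)) \<partial>P x i)
			= (\<integral>w. ph j t w*(\<integral>w'. ph k s w'*(V w*f k (H w+(X s w'-X 0 w'))) \<partial>P 0 j) \<partial>P x i)"
		"integrable (P x i) (%w. ph j t w*(\<integral>w'. ph k s w'*(V w*f k (H w+(X s w'-X 0 w'))) \<partial>P 0 j))" for j k
		using markov_integral[OF t Y s, of "?\<Psi> k" x i j k] int1[of j k] by auto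
	have pull: "(\<integral>w'. ph k s w'*(V w*f k (H w+(X s w'-X 0 w'))) \<partial>P 0 j)
		= V w*(\<integral>w'. ph k s w'*f k (H w+(X s w'-X 0 w')) \<partial>P 0 j)" for w j k
		by (subst integral_mult_right_zero[symmetric]) (simp only: mult.left_commute)
	have int2: "integrable (P x i) (%w. ph j t w*(V w*\<phi> j (H w)))" for j
	proof -
		have "integrable (P x i) (%w. \<Sum>k\<in>UNIV. ph j t w*(\<integral>w'. ph k s w'*(V w*f k (H w+(X s w'-X 0 w'))) \<partial>P 0 j))"
			by (intro Bochner_Integration.integrable_sum mi)
		thus ?thesis by (simp add: pull \<phi>_sum sum_distrib_left)
	qed
	have int3: "integrable (P x i) (%w. ph j t w*(V w*f j (H w)))" for j
	proof -
		have "integrable (P x i) (%w. ph j t w*ph j (t+0) w*(V w*f j (H w+(X (t+0) w-X t w))))"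
			by (rule step_integrable[OF t order_refl _ _ V1 hi f th C]) simp_all
		moreover have "ph j t w*ph j t w = ph j t w" for w by (simp add: ph_def)
		ultimately show ?thesis by simp
	qed
	have L: "(\<integral>w. V w*phase_eval f (J (t + s) w) (H w+?xi w)*alive t w \<partial>P x i)
		= (\<Sum>j\<in>UNIV. \<integral>w. ph j t w*(V w*\<phi> j (H w)) \<partial>P x i)"
	proof -
		have "V w*phase_eval f (J (t + s) w) (H w+?xi w)*alive t w
			= (\<Sum>j\<in>UNIV. \<Sum>k\<in>UNIV. ph j t w*ph k (t + s) w*(V w*f k (H w+?xi w)))" for w
			unfolding phase_eval_ph sum_ph[symmetric] sum_distrib_left sum_distrib_right
			by (intro sum.cong refl) (simp add: mult_ac)
		hence "(\<integral>w. V w*phase_eval f (J (t + s) w) (H w+?xi w)*alive t w \<partial>P x i)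
			= (\<Sum>j\<in>UNIV. \<Sum>k\<in>UNIV. \<integral>w. ph j t w*ph k (t + s) w*(V w*f k (H w+?xi w)) \<partial>P x i)"
			by (simp add: Bochner_Integration.integral_sum int1 Bochner_Integration.integrable_sum)
		also have "\<dots> = (\<Sum>j\<in>UNIV. \<integral>w. (\<Sum>k\<in>UNIV. ph j t w*(\<integral>w'. ph k s w'*(V w*f k (H w+(X s w'-X 0 w'))) \<partial>P 0 j)) \<partial>P x i)"
			by (simp add: mi Bochner_Integration.integral_sum)
		finally show ?thesis by (simp add: pull \<phi>_sum sum_distrib_left)
	qed
	have R: "(\<integral>w. V w*phase_eval f (J t w) (H w) \<partial>P x i) = (\<Sum>j\<in>UNIV. \<integral>w. ph j t w*(V w*f j (H w)) \<partial>P x i)"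
	proof -
		have "V w*phase_eval f (J t w) (H w) = (\<Sum>j\<in>UNIV. ph j t w*(V w*f j (H w)))" for w
			unfolding phase_eval_ph sum_distrib_left by (simp add: mult_ac)
		thus ?thesis by (simp add: Bochner_Integration.integral_sum int3)
	qed
	have "ennreal \<bar>(\<integral>w. V w*phase_eval f (J (t + s) w) (H w+?xi w)*alive t w \<partial>P x i)
				- (\<integral>w. V w*phase_eval f (J t w) (H w) \<partial>P x i)\<bar>
		= ennreal \<bar>\<Sum>j\<in>UNIV. \<integral>w. ph j t w*(V w*(\<phi> j (H w)-f j (H w))) \<partial>P x i\<bar>"
		unfolding L R using int2 int3 by (simp add: algebra_simps flip: sum_subtractf)
	also have "\<dots> <= (\<Sum>j\<in>UNIV. ennreal \<bar>\<integral>w. ph j t w*(V w*(\<phi> j (H w)-f j (H w))) \<partial>P x i\<bar>)"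
		by (subst sum_ennreal) (auto intro!: ennreal_leI sum_abs)
	also have "\<dots> <= (\<Sum>j\<in>UNIV. \<integral>\<^sup>+w. ennreal (ph j t w)*(indicator {w. V w ~= 0} w*\<psi> j (H w)) \<partial>P x i)"
	proof (rule sum_mono)
		fix j
		have int: "integrable (P x i) (%w. ph j t w*(V w*(\<phi> j (H w)-f j (H w))))"
			using Bochner_Integration.integrable_diff[OF int2[of j] int3[of j]] by (simp add: algebra_simps)
		have "ennreal \<bar>\<integral>w. ph j t w*(V w*(\<phi> j (H w)-f j (H w))) \<partial>P x i\<bar>
			\<le> (\<integral>\<^sup>+w. ennreal (norm (ph j t w*(V w*(\<phi> j (H w)-f j (H w))))) \<partial>P x i)"
			using integral_norm_bound_ennreal[OF int] by simp
		also have "\<dots> <= (\<integral>\<^sup>+w. ennreal (ph j t w)*(indicator {w. V w ~= 0} w*\<psi> j (H w)) \<partial>P x i)"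
		proof (rule nn_integral_mono)
			fix w assume "w \<in> space (P x i)"
			hence om: "w \<in> space M" by simp
			show "ennreal (norm (ph j t w*(V w*(\<phi> j (H w)-f j (H w))))) <= ennreal (ph j t w)*(indicator {w. V w ~= 0} w*\<psi> j (H w))"
			proof (cases "V w = 0")
				case False
				have "norm (ph j t w*(V w*(\<phi> j (H w)-f j (H w)))) <= ph j t w*(1*\<bar>\<phi> j (H w)-f j (H w)\<bar>)"
					using V1[OF om] by (simp add: abs_mult) (intro mult_left_mono mult_left_le_one_le, auto)
				hence "ennreal (norm (ph j t w*(V w*(\<phi> j (H w)-f j (H w))))) <= ennreal (ph j t w)*ennreal \<bar>\<phi> j (H w)-f j (H w)\<bar>"
					by (subst ennreal_mult''[symmetric]) (auto intro!: ennreal_leI)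
				also have "\<dots> <= ennreal (ph j t w)*\<psi> j (H w)"
					using drift[of j "H w"] unfolding \<phi>_def \<psi>_def by (intro mult_left_mono) auto
				finally show ?thesis using False by simp
			qed simp
		qed
		finally show "ennreal \<bar>\<integral>w. ph j t w*(V w*(\<phi> j (H w)-f j (H w))) \<partial>P x i\<bar>
			\<le> (\<integral>\<^sup>+w. ennreal (ph j t w)*(indicator {w. V w ~= 0} w*\<psi> j (H w)) \<partial>P x i)" .
	qed
	\<comment> \<open>The Markov property is now used in reverse: the error density under
	  \<open>P 0 j\<close> at time v, started from H, becomes an expectation under \<open>P x i\<close>
	  at time t + v.\<close>
	also have "\<dots> = (\<Sum>j\<in>UNIV. \<integral>\<^sup>+v. indicator {0..s} v * (\<Sum>k\<in>UNIV. \<integral>\<^sup>+w. ennreal (ph j t w*ph k (t + v) w) *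
			 (indicator {w. V w ~= 0} w*\<rho> (H w+(X (t + v) w-X t w))) \<partial>P x i) \<partial>lborel)"
	proof (rule sum.cong[OF refl])
		fix j
		interpret S: sigma_finite_measure "P 0 j" by simp
		interpret Sx: sigma_finite_measure "P x i" by simp
		interpret PS: pair_sigma_finite "P x i" lborel ..
		\<comment> \<open>With \<open>max 0\<close> the function \<open>q\<close> is jointly measurable in
		  time and position on the whole plane; on {0..s} it is the inner integral of
		  \<open>\<psi>\<close>.\<close>
		define q where "q v y = (\<integral>\<^sup>+w. \<rho> (y+X (max 0 v) w)*ennreal (alive (max 0 v) w) \<partial>P 0 j)" for v y :: real
		have q [measurable]: "(%p. q (fst p) (snd p)) \<in> Bor (borel \<Otimes>\<^sub>M borel)"
		proof -
			have m1: "(%z :: (real \<times> real) \<times> 'w. (fst (fst z), snd z)) \<in> (borel \<Otimes>\<^sub>M borel) \<Otimes>\<^sub>M P 0 j \<rightarrow>\<^sub>M borel \<Otimes>\<^sub>M M" by measurable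
			have [measurable]: "(%z :: (real \<times> real) \<times> 'w. X (max 0 (fst (fst z))) (snd z)) \<in> Bor ((borel \<Otimes>\<^sub>M borel) \<Otimes>\<^sub>M P 0 j)"
				"(%z :: (real \<times> real) \<times> 'w. alive (max 0 (fst (fst z))) (snd z)) \<in> Bor ((borel \<Otimes>\<^sub>M borel) \<Otimes>\<^sub>M P 0 j)"
				using measurable_compose[OF m1 X_joint] measurable_compose[OF m1 alive_joint] by simp_all
			have "(%p. \<integral>\<^sup>+w. (%z. \<rho> (snd (fst z)+X (max 0 (fst (fst z))) (snd z))*ennreal (alive (max 0 (fst (fst z))) (snd z))) (p, w) \<partial>P 0 j)
				 \<in> Bor (borel \<Otimes>\<^sub>M borel)"
				by (rule S.borel_measurable_nn_integral_fst) measurable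
			thus ?thesis by (simp add: q_def)
		qed
		have \<psi>q: "\<psi> j y = (\<integral>\<^sup>+v. indicator {0..s} v * q v y \<partial>lborel)" for y
			unfolding \<psi>_def q_def by (intro nn_integral_cong) (auto simp: indicator_def max_def)
		have "(\<integral>\<^sup>+w. ennreal (ph j t w)*(indicator {w. V w ~= 0} w*\<psi> j (H w)) \<partial>P x i)
			= (\<integral>\<^sup>+w. \<integral>\<^sup>+v. ennreal (ph j t w)*(indicator {w. V w ~= 0} w*(indicator {0..s} v * q v (H w))) \<partial>lborel \<partial>P x i)"
		proof (rule nn_integral_cong)
			fix w
			have qm: "(%v. q v (H w)) \<in> Bor borel"
				using measurable_compose[OF _ q, of "%v. (v, H w)" borel] by simp
			have m: "(%v. indicator {0..s} v * q v (H w)) \<in> Bor lborel"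
				by (rule borel_measurable_times_ennreal) (use qm in simp_all)
			have cm: "(\<integral>\<^sup>+v. z*g v \<partial>lborel) = z*(\<integral>\<^sup>+v. g v \<partial>lborel)" if "g \<in> Bor lborel" for z and g :: "real => ennreal"
				by (rule nn_integral_cmult[OF that])
			show "ennreal (ph j t w)*(indicator {w. V w ~= 0} w*\<psi> j (H w))
				= (\<integral>\<^sup>+v. ennreal (ph j t w)*(indicator {w. V w ~= 0} w*(indicator {0..s} v * q v (H w))) \<partial>lborel)"
				unfolding \<psi>q mult.assoc[symmetric, of "ennreal (ph j t w)"] by (rule cm[OF m, symmetric])
		qed
		also have "\<dots> = (\<integral>\<^sup>+v. \<integral>\<^sup>+w. ennreal (ph j t w)*(indicator {w. V w ~= 0} w*(indicator {0..s} v * q v (H w))) \<partial>P x i \<partial>lborel)"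
		proof (rule PS.Fubini'[symmetric])
			have [measurable]: "(%p. q (snd p) (H (fst p))) \<in> Bor (P x i \<Otimes>\<^sub>M lborel)"
				using measurable_compose[OF _ q, of "%p. (snd p, H (fst p))" "P x i \<Otimes>\<^sub>M lborel"] by simp
			show "(%(w, v). ennreal (ph j t w)*(indicator {w. V w ~= 0} w*(indicator {0..s} v * q v (H w)))) \<in> Bor (P x i \<Otimes>\<^sub>M lborel)"
				unfolding split_beta' by measurable
		qed
		also have "\<dots> = (\<integral>\<^sup>+v. indicator {0..s} v * (\<Sum>k\<in>UNIV. \<integral>\<^sup>+w. ennreal (ph j t w*ph k (t + v) w) *
			 (indicator {w. V w ~= 0} w*\<rho> (H w+(X (t + v) w-X t w))) \<partial>P x i) \<partial>lborel)"
		proof (rule nn_integral_cong)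
			fix v
			show "(\<integral>\<^sup>+w. ennreal (ph j t w)*(indicator {w. V w ~= 0} w*(indicator {0..s} v * q v (H w))) \<partial>P x i)
				= indicator {0..s} v * (\<Sum>k\<in>UNIV. \<integral>\<^sup>+w. ennreal (ph j t w*ph k (t + v) w) *
					 (indicator {w. V w ~= 0} w*\<rho> (H w+(X (t + v) w-X t w))) \<partial>P x i)"
			proof (cases "v \<in> {0..s}")
				case True
				hence v: "0 <= v" by simp
				let ?\<Phi> = "%z :: (real \<times> real) \<times> real. indicator {w. w ~= 0} (fst (fst z))*\<rho> (snd (fst z) + snd z)"
				have \<Phi>m: "?\<Phi> \<in> Bor ((borel \<Otimes>\<^sub>M borel) \<Otimes>\<^sub>M borel)" by measurable
				have qk: "q v y = (\<Sum>k\<in>UNIV. \<integral>\<^sup>+w'. ennreal (ph k v w')*\<rho> (y+(X v w'-X 0 w')) \<partial>P 0 j)" for y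
				proof -
					have "q v y = (\<integral>\<^sup>+w. (\<Sum>k\<in>UNIV. ennreal (ph k v w)*\<rho> (y+(X v w-X 0 w))) \<partial>P 0 j)"
						unfolding q_def using v
						by (intro nn_integral_cong_AE, use AE_X0[of 0 j] in eventually_elim)
							(simp add: max_absorb2 mult.commute sum_ph[symmetric] sum_distrib_left flip: sum_ennreal)
					thus ?thesis by (simp add: nn_integral_sum)
				qed
				have "(\<integral>\<^sup>+w. ennreal (ph j t w*ph k (t + v) w)*(indicator {w. V w ~= 0} w*\<rho> (H w+(X (t + v) w-X t w))) \<partial>P x i)
					= (\<integral>\<^sup>+w. ennreal (ph j t w)*(indicator {w. V w ~= 0} w*(\<integral>\<^sup>+w'. ennreal (ph k v w')*\<rho> (H w+(X v w'-X 0 w')) \<partial>P 0 j)) \<partial>P x i)" for k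
				proof -
					have "(\<integral>\<^sup>+w. ennreal (ph j t w*ph k (t + v) w)*(indicator {w. V w ~= 0} w*\<rho> (H w+(X (t + v) w-X t w))) \<partial>P x i)
						= (\<integral>\<^sup>+w. ennreal (ph j t w*ph k (t + v) w)*?\<Phi> ((V w, H w), X (t + v) w-X t w) \<partial>P x i)"
						by (rule nn_integral_cong) (simp add: indicator_def)
					also have "\<dots> = (\<integral>\<^sup>+w. ennreal (ph j t w)*(\<integral>\<^sup>+w'. ennreal (ph k v w')*?\<Phi> ((V w, H w), X v w'-X 0 w') \<partial>P 0 j) \<partial>P x i)"
						by (rule markov_nn[OF t Y v \<Phi>m])
					also have "\<dots> = (\<integral>\<^sup>+w. ennreal (ph j t w)*(indicator {w. V w ~= 0} w*(\<integral>\<^sup>+w'. ennreal (ph k v w')*\<rho> (H w+(X v w'-X 0 w')) \<partial>P 0 j)) \<partial>P x i)"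
						by (rule nn_integral_cong) (auto simp: indicator_def)
					finally show ?thesis .
				qed
				hence "(\<Sum>k\<in>UNIV. \<integral>\<^sup>+w. ennreal (ph j t w*ph k (t + v) w)*(indicator {w. V w ~= 0} w*\<rho> (H w+(X (t + v) w-X t w))) \<partial>P x i)
					= (\<integral>\<^sup>+w. (\<Sum>k\<in>UNIV. ennreal (ph j t w)*(indicator {w. V w ~= 0} w*(\<integral>\<^sup>+w'. ennreal (ph k v w')*\<rho> (H w+(X v w'-X 0 w')) \<partial>P 0 j))) \<partial>P x i)"
					by (subst nn_integral_sum) simp_all
				also have "\<dots> = (\<integral>\<^sup>+w. ennreal (ph j t w)*(indicator {w. V w ~= 0} w*q v (H w)) \<partial>P x i)"
					by (simp only: qk sum_distrib_left)
				finally show ?thesis using True by simp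
			qed simp
		qed
		finally show "(\<integral>\<^sup>+w. ennreal (ph j t w)*(indicator {w. V w ~= 0} w*\<psi> j (H w)) \<partial>P x i) =
			(\<integral>\<^sup>+v. indicator {0..s} v * (\<Sum>k\<in>UNIV. \<integral>\<^sup>+w. ennreal (ph j t w*ph k (t + v) w) *
			 (indicator {w. V w ~= 0} w*\<rho> (H w+(X (t + v) w-X t w))) \<partial>P x i) \<partial>lborel)" .
	qed
	also have "\<dots> = (\<integral>\<^sup>+v. indicator {0..s} v * (\<integral>\<^sup>+w. indicator {w. V w ~= 0} w*\<rho> (H w+(X (t + v) w-X t w))*ennreal (alive (t + v) w) \<partial>P x i) \<partial>lborel)"
	proof -
		interpret Sx: sigma_finite_measure "P x i" by simp
		define g where "g j k v = (\<integral>\<^sup>+w. ennreal (ph j t w*ph k (max 0 (t + v)) w) *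
			 (indicator {w. V w ~= 0} w*\<rho> (H w+(X (max 0 (t + v)) w-X t w))) \<partial>P x i)" for j k v
		have [measurable]: "g j k \<in> Bor borel" for j k
		proof -
			have m1: "(%z :: real \<times> 'w. (t+fst z, snd z)) \<in> borel \<Otimes>\<^sub>M P x i \<rightarrow>\<^sub>M borel \<Otimes>\<^sub>M M" by measurable
			have [measurable]: "(%z :: real \<times> 'w. X (max 0 (t+fst z)) (snd z)) \<in> Bor (borel \<Otimes>\<^sub>M P x i)"
				"(%z :: real \<times> 'w. ph k (max 0 (t+fst z)) (snd z)) \<in> Bor (borel \<Otimes>\<^sub>M P x i)"
				using measurable_compose[OF m1 X_joint] measurable_compose[OF m1 ph_joint] by simp_all
			have "(%v. \<integral>\<^sup>+w. (%z. ennreal (ph j t (snd z)*ph k (max 0 (t+fst z)) (snd z)) *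
			 (indicator {w. V w ~= 0} (snd z)*\<rho> (H (snd z)+(X (max 0 (t+fst z)) (snd z)-X t (snd z))))) (v, w) \<partial>P x i)
				 \<in> Bor borel"
				by (rule Sx.borel_measurable_nn_integral_fst) measurable
			thus ?thesis unfolding g_def by simp
		qed
		have gv: "indicator {0..s} v * (\<Sum>k\<in>UNIV. \<integral>\<^sup>+w. ennreal (ph j t w*ph k (t + v) w) *
			 (indicator {w. V w ~= 0} w*\<rho> (H w+(X (t + v) w-X t w))) \<partial>P x i)
			= indicator {0..s} v * (\<Sum>k\<in>UNIV. g j k v)" for j v
			unfolding g_def using t by (auto simp: indicator_def max_def)
		have "(\<Sum>j\<in>UNIV. \<integral>\<^sup>+v. indicator {0..s} v * (\<Sum>k\<in>UNIV. g j k v) \<partial>lborel)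
			= (\<integral>\<^sup>+v. indicator {0..s} v * (\<Sum>j\<in>UNIV. \<Sum>k\<in>UNIV. g j k v) \<partial>lborel)"
			by (subst nn_integral_sum[symmetric]) (simp_all add: sum_distrib_left)
		also have "\<dots> = (\<integral>\<^sup>+v. indicator {0..s} v * (\<integral>\<^sup>+w. indicator {w. V w ~= 0} w*\<rho> (H w+(X (t + v) w-X t w))*ennreal (alive (t + v) w) \<partial>P x i) \<partial>lborel)"
		proof (rule nn_integral_cong)
			fix v
			show "indicator {0..s} v * (\<Sum>j\<in>UNIV. \<Sum>k\<in>UNIV. g j k v)
				= indicator {0..s} v * (\<integral>\<^sup>+w. indicator {w. V w ~= 0} w*\<rho> (H w+(X (t + v) w-X t w))*ennreal (alive (t + v) w) \<partial>P x i)"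
			proof (cases "v \<in> {0..s}")
				case True
				hence v: "0 <= v" by simp
				let ?Z = "%w. indicator {w. V w ~= 0} w*\<rho> (H w+(X (t + v) w-X t w))"
				have "(\<Sum>j\<in>UNIV. \<Sum>k\<in>UNIV. g j k v) = (\<integral>\<^sup>+w. (\<Sum>j\<in>UNIV. \<Sum>k\<in>UNIV. ennreal (ph j t w*ph k (t + v) w)*?Z w) \<partial>P x i)"
					unfolding g_def using v t by (subst nn_integral_sum, simp, subst nn_integral_sum) (simp_all add: max_absorb2)
				also have "\<dots> = (\<integral>\<^sup>+w. ?Z w*ennreal (alive (t + v) w) \<partial>P x i)"
				proof (rule nn_integral_cong)
					fix w assume "w \<in> space (P x i)"
					hence om: "w \<in> space M" by simp
					have "(\<Sum>j\<in>UNIV. \<Sum>k\<in>UNIV. ennreal (ph j t w*ph k (t + v) w)) = ennreal (alive (t + v) w)"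
						using sum_ph_ph[OF om t v] by (simp add: sum_nonneg)
					thus "(\<Sum>j\<in>UNIV. \<Sum>k\<in>UNIV. ennreal (ph j t w*ph k (t + v) w)*?Z w) = ?Z w*ennreal (alive (t + v) w)"
						by (simp add: mult.commute flip: sum_distrib_right)
				qed
				finally show ?thesis using True by simp
			qed simp
		qed
		finally show ?thesis by (simp only: gv)
	qed
	finally show ?thesis .
qed

end

subsection \<open>Adaptedness of the regulators\<close>

lemma runsup_measurable:
	assumes "\<And>q. q \<in> \<rat> ==> 0 <= q ==> q <= t ==> (%w. x w q) \<in> Bor N"
		and "\<And>q. q \<in> \<rat> ==> 0 <= q ==> q <= t ==> (%w. f w q) \<in> Bor N"
	shows "(%w. runsup (x w) (f w) t) \<in> Bor N"
	unfolding runsup_def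
proof (rule borel_measurable_SUP)
	show "countable (\<rat> \<inter> {0..t})" by (rule countable_Int1) (rule countable_rat)
	fix q assume "q \<in> \<rat> \<inter> {0..t}"
	hence [measurable]: "(%w. x w q) \<in> Bor N" "(%w. f w q) \<in> Bor N"
		using assms by auto
	show "(%w. max 0 (ereal (x w q)+f w q)) \<in> Bor N" by measurable
qed

lemma lower_iter_measurable:
	assumes "\<And>q. 0 <= q ==> q <= t ==> (%w. x w q) \<in> Bor N"
	shows "(%w. lower_iter a (x w) n t) \<in> Bor N"
	using assms
proof (induction n arbitrary: t)
	case (Suc n)
	have 1: "(%w. runsup (x w) (lower_iter a (x w) n) q) \<in> Bor N" if "q <= t" for q
		using that by (intro runsup_measurable Suc.IH Suc.prems) auto
	show ?case unfolding lower_iter.simps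
		by (rule runsup_measurable) (use Suc.prems 1 in \<open>auto intro!: borel_measurable_diff\<close>)
qed simp

locale reflected_map = exp_map_process M P X J for M P X and J :: "real => 'w => 'n::finite option" +
	fixes a :: real and Rl Ru :: "real => 'w => real"
	assumes a_pos: "a > 0"
		and neg_jumps: "w \<in> space M ==> 0 < t ==> J t w ~= None ==> ((%s. X s w) \<longlongrightarrow> y) (at_left t) ==> X t w <= y"
		and reflection: "w \<in> space M ==> X 0 w \<in> {-a..0} ==>
			two_sided_reflection a (%t. X t w) (%t. Rl t w) (%t. Ru t w)"
		and Rl_meas [measurable]: "Rl t \<in> Bor M" and Ru_meas [measurable]: "Ru t \<in> Bor M"
begin

definition G :: "'w set" where "G = {w \<in> space M. X 0 w \<in> {-a..0}}"

lemma G_sets [measurable]: "G \<in> sets M" unfolding G_def by measurable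

lemma G_space: "w \<in> G ==> w \<in> space M" by (simp add: G_def)

lemma AE_G: "x \<in> {-a..0} ==> AE w in P x i. w \<in> G"
	using AE_X0[of x i] AE_space[of "P x i"] by eventually_elim (simp add: G_def)

lemma path: "w \<in> G ==> reflected_phase a (%t. X t w) (%t. Rl t w) (%t. Ru t w) (%t. J t w)"
	using a_pos reflection X_rc J_rc J_absorb X_left neg_jumps
	by unfold_locales (auto simp: G_def)

lemma path': "w \<in> G ==> reflected a (%t. X t w) (%t. Rl t w) (%t. Ru t w)"
	using path by (rule reflected_phase.axioms(1))

text \<open>Adapted copies of the regulators, computed from \<open>XA\<close> alone. By
  \<open>iter_limit\<close> they coincide with \<open>Rl\<close> and \<open>Ru\<close> at rational
  times before killing, which is where the dyadic sums evaluate them.\<close>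

definition RlA :: "real => 'w => real" where
	"RlA t w = real_of_ereal (SUP n. lower_iter a (%q. XA q w) n t)"
definition RuA :: "real => 'w => real" where
	"RuA t w = real_of_ereal (SUP n. runsup (%q. XA q w) (lower_iter a (%q. XA q w) n) t)"

lemma RlA_hist [measurable]: "RlA t \<in> Bor (hist t)"
	unfolding RlA_def by (intro borel_measurable_real_of_ereal borel_measurable_SUP lower_iter_measurable XA_hist) auto

lemma RuA_hist [measurable]: "RuA t \<in> Bor (hist t)"
	unfolding RuA_def
proof (intro borel_measurable_real_of_ereal borel_measurable_SUP runsup_measurable)
	fix n q :: real assume "0 <= q" "q <= t"
	thus "(%w. XA q w) \<in> Bor (hist t)" by (rule XA_hist)
next
	fix n and q :: real assume q: "0 <= q" "q <= t"
	show "(%w. lower_iter a (%q. XA q w) n q) \<in> Bor (hist t)"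
		by (intro lower_iter_measurable XA_hist) (use q in auto)
qed auto

lemma RA_eq:
	assumes "w \<in> G" "t \<in> \<rat>" "0 <= t" "J t w ~= None"
	shows "RlA t w = Rl t w" "RuA t w = Ru t w"
proof -
	interpret reflected a "%t. X t w" "%t. Rl t w" "%t. Ru t w" by (rule path'[OF assms(1)])
	have XA: "XA q w = X q w" if "0 <= q" "q <= t" for q
		using J_absorb[OF G_space[OF assms(1)] that] assms(4) by (auto simp: XA_def)
	have li: "lower_iter a (%q. XA q w) n s = lower_iter a (%q. X q w) n s" if "s <= t" for n s
		by (rule lower_iter_cong) (use that XA in auto)
	have "runsup (%q. XA q w) (lower_iter a (%q. XA q w) n) t = runsup (%q. X q w) (lower_iter a (%q. X q w) n) t" for n
		by (rule runsup_cong) (auto simp: XA li)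
	thus "RlA t w = Rl t w" "RuA t w = Ru t w"
		using iter_limit[OF assms(2,3)] by (simp_all add: RlA_def RuA_def li)
qed

text \<open>The observable form of \<open>G\<close>: the two agree on paths alive at time t, and
  this one belongs to every history.\<close>

definition GA :: "'w => bool" where "GA w \<longleftrightarrow> J 0 w ~= None & XA 0 w \<in> {-a..0}"

lemma GA_hist [measurable]: "0 <= t ==> Measurable.pred (hist t) GA"
proof -
	assume "0 <= t"
	note [measurable] = J_hist[OF order_refl this] XA_hist[OF order_refl this]
	show ?thesis unfolding GA_def by measurable
qed

lemma GA_G: "w \<in> space M ==> 0 <= t ==> J t w ~= None ==> GA w \<longleftrightarrow> w \<in> G"
	using J_absorb[of w 0 t] by (auto simp: GA_def G_def XA_def)

end

section \<open>A maximal inequality for exponentials of X along dyadic grids\<close>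

context exp_map_process
begin

text \<open>The Markov property at t on a past event A: whatever the phase at t, the increment
  contributes at most the bound K on a row sum of exponential moments.\<close>

lemma exp_step:
	assumes t: "0 <= t" and s: "0 <= s" and A: "A \<in> sets (hist t)" and c: "0 <= c"
		and \<kappa>: "\<And>j. (\<Sum>l\<in>UNIV. \<integral>w. exp (c*X s w)*ph l s w \<partial>P 0 j) <= K"
	shows "(\<integral>\<^sup>+w. indicator A w*ennreal (exp (c*X (t + s) w)*alive (t + s) w) \<partial>P x i)
		\<le> ennreal K*(\<integral>\<^sup>+w. indicator A w*ennreal (exp (c*X t w)*alive t w) \<partial>P x i)"
proof -
	have [measurable]: "A \<in> sets M" by (rule subsetD[OF hist_subset A])
	define Y where "Y w = indicator A w*exp (c*XA t w)" for w
	have Y: "Y \<in> Bor (hist t)"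
	proof -
		note [measurable] = XA_hist[OF t order_refl] A
		show ?thesis unfolding Y_def by measurable
	qed
	note [measurable] = measurable_hist_M[OF Y]
	let ?\<Psi> = "%z :: real \<times> real. ennreal (fst z*exp (c * snd z))"
	have \<Psi>: "?\<Psi> \<in> Bor (borel \<Otimes>\<^sub>M borel)" by measurable
	have eq: "indicator A w*ennreal (exp (c*X (t + s) w)*alive (t + s) w)
		= (\<Sum>j\<in>UNIV. \<Sum>l\<in>UNIV. ennreal (ph j t w*ph l (t + s) w)*?\<Psi> (Y w, X (t + s) w-X t w))"
		if om: "w \<in> space M" for w
	proof -
		have "(\<Sum>j\<in>UNIV. \<Sum>l\<in>UNIV. ennreal (ph j t w*ph l (t + s) w)*?\<Psi> (Y w, X (t + s) w-X t w))
			= ennreal (alive (t + s) w)*?\<Psi> (Y w, X (t + s) w-X t w)"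
			using sum_ph_ph[OF om t s] by (simp add: sum_nonneg flip: sum_distrib_right)
		also have "\<dots> = indicator A w*ennreal (exp (c*X (t + s) w)*alive (t + s) w)"
		proof (cases "J (t + s) w = None")
			case False
			have "J t w ~= None"
			proof
				assume N: "J t w = None"
				have "J (t + s) w = None" by (rule J_absorb[OF om t _ N]) (use s in simp)
				with False show False by simp
			qed
			hence y: "Y w = indicator A w*exp (c*X t w)" by (auto simp: Y_def XA_def)
			have e: "exp (c*X t w)*exp (c*(X (t + s) w-X t w)) = exp (c*X (t + s) w)"
				by (simp add: right_diff_distrib flip: exp_add)
			have "Y w*exp (c*(X (t + s) w-X t w)) = indicator A w*exp (c*X (t + s) w)"
				unfolding y mult.assoc by (simp only: e)
			thus ?thesis
				unfolding fst_conv snd_conv by (simp only:) (use False in \<open>simp add: alive_def indicator_def\<close>)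
		qed (simp add: alive_def)
		finally show ?thesis by simp
	qed
	have "(\<integral>\<^sup>+w. indicator A w*ennreal (exp (c*X (t + s) w)*alive (t + s) w) \<partial>P x i)
		= (\<Sum>j\<in>UNIV. \<Sum>l\<in>UNIV. \<integral>\<^sup>+w. ennreal (ph j t w*ph l (t + s) w)*?\<Psi> (Y w, X (t + s) w-X t w) \<partial>P x i)"
	proof -
		have "(\<integral>\<^sup>+w. indicator A w*ennreal (exp (c*X (t + s) w)*alive (t + s) w) \<partial>P x i)
			= (\<integral>\<^sup>+w. (\<Sum>j\<in>UNIV. \<Sum>l\<in>UNIV. ennreal (ph j t w*ph l (t + s) w)*?\<Psi> (Y w, X (t + s) w-X t w)) \<partial>P x i)"
			by (rule nn_integral_cong) (simp add: eq)
		also have "\<dots> = (\<Sum>j\<in>UNIV. \<Sum>l\<in>UNIV. \<integral>\<^sup>+w. ennreal (ph j t w*ph l (t + s) w)*?\<Psi> (Y w, X (t + s) w-X t w) \<partial>P x i)"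
			by (subst nn_integral_sum, simp, subst nn_integral_sum) simp_all
		finally show ?thesis .
	qed
	also have "\<dots> = (\<Sum>j\<in>UNIV. \<Sum>l\<in>UNIV. \<integral>\<^sup>+w. ennreal (ph j t w)*(\<integral>\<^sup>+w'. ennreal (ph l s w')*?\<Psi> (Y w, X s w'-X 0 w') \<partial>P 0 j) \<partial>P x i)"
		by (intro sum.cong refl markov_nn[OF t Y s \<Psi>])
	also have "\<dots> = (\<Sum>j\<in>UNIV. \<Sum>l\<in>UNIV. \<integral>\<^sup>+w. ennreal (ph j t w)*(ennreal (Y w)*ennreal (\<integral>w'. exp (c*X s w')*ph l s w' \<partial>P 0 j)) \<partial>P x i)"
	proof (intro sum.cong refl nn_integral_cong)
		fix j l w
		have "(\<integral>\<^sup>+w'. ennreal (ph l s w')*?\<Psi> (Y w, X s w'-X 0 w') \<partial>P 0 j)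
			= (\<integral>\<^sup>+w'. ennreal (Y w)*ennreal (exp (c*X s w')*ph l s w') \<partial>P 0 j)"
			by (rule nn_integral_cong_AE) (use AE_X0[of 0 j] in eventually_elim, simp add: Y_def ennreal_mult'[symmetric] mult_ac)
		also have "\<dots> = ennreal (Y w)*ennreal (\<integral>w'. exp (c*X s w')*ph l s w' \<partial>P 0 j)"
			by (subst nn_integral_cmult) (simp_all add: nn_integral_eq_integral[OF mgf[OF c s]])
		finally show "ennreal (ph j t w)*(\<integral>\<^sup>+w'. ennreal (ph l s w')*?\<Psi> (Y w, X s w'-X 0 w') \<partial>P 0 j)
			= ennreal (ph j t w)*(ennreal (Y w)*ennreal (\<integral>w'. exp (c*X s w')*ph l s w' \<partial>P 0 j))" by simp
	qed
	also have "\<dots> = (\<Sum>j\<in>UNIV. (\<Sum>l\<in>UNIV. ennreal (\<integral>w'. exp (c*X s w')*ph l s w' \<partial>P 0 j))*(\<integral>\<^sup>+w. ennreal (ph j t w)*ennreal (Y w) \<partial>P x i))"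
	proof (rule sum.cong[OF refl])
		fix j
		have "(\<integral>\<^sup>+w. ennreal (ph j t w)*(ennreal (Y w)*z) \<partial>P x i) = z*(\<integral>\<^sup>+w. ennreal (ph j t w)*ennreal (Y w) \<partial>P x i)" for z
		proof -
			have "(\<integral>\<^sup>+w. z*(ennreal (ph j t w)*ennreal (Y w)) \<partial>P x i) = z*(\<integral>\<^sup>+w. ennreal (ph j t w)*ennreal (Y w) \<partial>P x i)"
				by (rule nn_integral_cmult) simp
			thus ?thesis by (simp only: mult_ac)
		qed
		thus "(\<Sum>l\<in>UNIV. \<integral>\<^sup>+w. ennreal (ph j t w)*(ennreal (Y w)*ennreal (\<integral>w'. exp (c*X s w')*ph l s w' \<partial>P 0 j)) \<partial>P x i)
			= (\<Sum>l\<in>UNIV. ennreal (\<integral>w'. exp (c*X s w')*ph l s w' \<partial>P 0 j))*(\<integral>\<^sup>+w. ennreal (ph j t w)*ennreal (Y w) \<partial>P x i)"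
			by (simp only: sum_distrib_right)
	qed
	also have "\<dots> <= (\<Sum>j\<in>UNIV. ennreal K*(\<integral>\<^sup>+w. ennreal (ph j t w)*ennreal (Y w) \<partial>P x i))"
	proof (intro sum_mono mult_right_mono)
		fix j
		have "(\<Sum>l\<in>UNIV. ennreal (\<integral>w'. exp (c*X s w')*ph l s w' \<partial>P 0 j)) = ennreal (\<Sum>l\<in>UNIV. \<integral>w'. exp (c*X s w')*ph l s w' \<partial>P 0 j)"
			by (rule sum_ennreal) (simp add: integral_nonneg_AE)
		thus "(\<Sum>l\<in>UNIV. ennreal (\<integral>w'. exp (c*X s w')*ph l s w' \<partial>P 0 j)) <= ennreal K"
			using \<kappa>[of j] by (simp add: ennreal_leI)
	qed simp
	also have "\<dots> = ennreal K*(\<integral>\<^sup>+w. (\<Sum>j\<in>UNIV. ennreal (ph j t w)*ennreal (Y w)) \<partial>P x i)"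
		by (simp add: nn_integral_sum sum_distrib_left)
	also have "(\<integral>\<^sup>+w. (\<Sum>j\<in>UNIV. ennreal (ph j t w)*ennreal (Y w)) \<partial>P x i)
		= (\<integral>\<^sup>+w. indicator A w*ennreal (exp (c*X t w)*alive t w) \<partial>P x i)"
	proof (rule nn_integral_cong)
		fix w
		have "(\<Sum>j\<in>UNIV. ennreal (ph j t w)*ennreal (Y w)) = ennreal (alive t w)*ennreal (Y w)"
			by (simp add: sum_ph flip: sum_distrib_right)
		also have "\<dots> = indicator A w*ennreal (exp (c*X t w)*alive t w)"
			by (cases "J t w") (simp_all add: alive_def Y_def XA_def indicator_def)
		finally show "(\<Sum>j\<in>UNIV. ennreal (ph j t w)*ennreal (Y w)) = indicator A w*ennreal (exp (c*X t w)*alive t w)" .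
	qed
	finally show ?thesis .
qed

definition gr :: "nat => nat => real" where "gr n k = real k/2 ^ n"

lemma gr_nonneg [simp]: "0 <= gr n k" by (simp add: gr_def)

lemma gr_Suc: "gr n (Suc k) = gr n k+1/2 ^ n" by (simp add: gr_def add_divide_distrib)

lemma gr_mono: "k <= k' ==> gr n k <= gr n k'" by (simp add: gr_def divide_right_mono)

text \<open>By an exponential supermartingale on the grid, stopped on passing level p.\<close>

lemma grid_max_bound:
	assumes c: "0 <= c" and \<kappa>0: "0 <= \<kappa>" and \<kappa>: "\<And>t j. 0 <= t ==> (\<Sum>l\<in>UNIV. \<integral>w. exp (c*X t w)*ph l t w \<partial>P 0 j) <= exp (\<kappa>*t)"
	shows "ennreal (exp (c*p))*emeasure (P x i) {w\<in>space M. \<exists>k\<le>N. J (gr n k) w ~= None & p <= X (gr n k) w}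
		\<le> ennreal (exp (\<kappa>*gr n N)*exp (c*x))"
proof -
	define passed where "passed N w \<longleftrightarrow> (\<exists>k\<le>N. J (gr n k) w ~= None & p <= X (gr n k) w)" for N w
	have passed_h: "{w\<in>space M. passed N w} \<in> sets (hist (gr n N))" for N
	proof -
		have "{w\<in>space M. passed N w} = (\<Union>k\<in>{..N}. \<Union>l. {w\<in>space M. X (gr n k) w \<in> {p..} & J (gr n k) w = Some l})"
			by (auto simp: passed_def)
		also have "\<dots> \<in> sets (hist (gr n N))"
			by (intro sets.finite_UN hist_gen) (auto simp: gr_mono)
		finally show ?thesis .
	qed
	have [measurable]: "{w\<in>space M. passed N w} \<in> sets M" for N by (rule subsetD[OF hist_subset passed_h])
	have [measurable]: "Measurable.pred M (passed N)" for N by (simp add: pred_def)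
	\<comment> \<open>After passing, the value is frozen at exp(c p), which is at most the exponential
	  at the passing grid point; so one step multiplies the expectation by at most
	  exp(\<kappa>/2^n).\<close>
	define Q where "Q N w = (if passed N w then ennreal (exp (c*p)) else ennreal (exp (c*X (gr n N) w)*alive (gr n N) w))" for N w
	have Qm [measurable]: "Q N \<in> Bor M" for N unfolding Q_def by measurable
	have main: "(\<integral>\<^sup>+w. Q N w \<partial>P x i) <= ennreal (exp (\<kappa>*gr n N)*exp (c*x))" for N
	proof (induction N)
		case 0
		have "(\<integral>\<^sup>+w. Q 0 w \<partial>P x i) <= (\<integral>\<^sup>+w. ennreal (exp (c*x)) \<partial>P x i)"
		proof (rule nn_integral_mono_AE, use AE_X0[of x i] in eventually_elim)
			case (elim w)
			have "c*p <= c*x" if "p <= x" using that c by (rule mult_left_mono)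
			thus ?case using elim by (auto simp: Q_def passed_def gr_def alive_def intro!: ennreal_leI)
		qed
		also have "\<dots> = ennreal (exp (\<kappa>*gr n 0)*exp (c*x))"
			using prob_space.emeasure_space_1[OF prob, of x i] by (simp add: gr_def)
		finally show ?case .
	next
		case (Suc N)
		let ?A = "space M - {w\<in>space M. passed N w}"
		have A: "?A \<in> sets (hist (gr n N))" using sets.top[of "hist (gr n N)"] by (intro sets.Diff passed_h) simp
		have [measurable]: "?A \<in> sets M" by (rule subsetD[OF hist_subset A])
		let ?q = "ennreal (exp (\<kappa>*(1/2 ^ n)))"
		have q1: "1 <= ?q"
		proof -
			have "1 <= exp (\<kappa>*(1/2 ^ n))" using \<kappa>0 by simp
			thus ?thesis using ennreal_leI by fastforce
		qed
		have le: "Q (Suc N) w <= indicator {w\<in>space M. passed N w} w*ennreal (exp (c*p))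
			+ indicator ?A w*ennreal (exp (c*X (gr n N+1/2 ^ n) w)*alive (gr n N+1/2 ^ n) w)" if "w \<in> space M" for w
		proof (cases "passed N w")
			case True
			hence "passed (Suc N) w" by (auto simp: passed_def intro: le_SucI)
			thus ?thesis using True that by (simp add: Q_def)
		next
			case False
			show ?thesis
			proof (cases "passed (Suc N) w")
				case True
				hence "J (gr n (Suc N)) w ~= None & p <= X (gr n (Suc N)) w" using False by (auto simp: passed_def le_Suc_eq)
				moreover from this have "c*p <= c*X (gr n (Suc N)) w" using c by (intro mult_left_mono) auto
				ultimately show ?thesis using True False that
					by (auto simp: Q_def alive_def gr_Suc[symmetric] intro!: ennreal_leI)
			qed (use False that in \<open>simp add: Q_def gr_Suc[symmetric]\<close>)
		qed
		have "(\<integral>\<^sup>+w. Q (Suc N) w \<partial>P x i) <= (\<integral>\<^sup>+w. indicator {w\<in>space M. passed N w} w*ennreal (exp (c*p))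
			+ indicator ?A w*ennreal (exp (c*X (gr n N+1/2 ^ n) w)*alive (gr n N+1/2 ^ n) w) \<partial>P x i)"
			by (rule nn_integral_mono) (use le in simp)
		also have "\<dots> = (\<integral>\<^sup>+w. indicator {w\<in>space M. passed N w} w*ennreal (exp (c*p)) \<partial>P x i)
			+ (\<integral>\<^sup>+w. indicator ?A w*ennreal (exp (c*X (gr n N+1/2 ^ n) w)*alive (gr n N+1/2 ^ n) w) \<partial>P x i)"
			by (rule nn_integral_add) simp_all
		also have "\<dots> <= ?q*(\<integral>\<^sup>+w. indicator {w\<in>space M. passed N w} w*ennreal (exp (c*p)) \<partial>P x i)
			+ ?q*(\<integral>\<^sup>+w. indicator ?A w*ennreal (exp (c*X (gr n N) w)*alive (gr n N) w) \<partial>P x i)"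
		proof (rule add_mono)
			show "(\<integral>\<^sup>+w. indicator {w\<in>space M. passed N w} w*ennreal (exp (c*p)) \<partial>P x i)
				\<le> ?q*(\<integral>\<^sup>+w. indicator {w\<in>space M. passed N w} w*ennreal (exp (c*p)) \<partial>P x i)"
				using mult_right_mono[OF q1, of "\<integral>\<^sup>+w. indicator {w\<in>space M. passed N w} w*ennreal (exp (c*p)) \<partial>P x i"] by simp
		qed (rule exp_step[OF gr_nonneg _ A c \<kappa>], simp_all)
		also have "\<dots> = ?q*(\<integral>\<^sup>+w. indicator {w\<in>space M. passed N w} w*ennreal (exp (c*p)) +
			 indicator ?A w*ennreal (exp (c*X (gr n N) w)*alive (gr n N) w) \<partial>P x i)"
			by (subst nn_integral_add) (simp_all add: distrib_left)
		also have "\<dots> = ?q*(\<integral>\<^sup>+w. Q N w \<partial>P x i)"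
			by (intro arg_cong2[where f="(*)"] refl nn_integral_cong) (auto simp: Q_def)
		also have "\<dots> <= ?q*ennreal (exp (\<kappa>*gr n N)*exp (c*x))" by (rule mult_left_mono[OF Suc.IH]) simp
		also have "\<dots> = ennreal (exp (\<kappa>*gr n (Suc N))*exp (c*x))"
			by (simp add: gr_Suc distrib_left exp_add ennreal_mult'[symmetric] mult_ac)
		finally show ?case .
	qed
	have "ennreal (exp (c*p))*emeasure (P x i) {w\<in>space M. passed N w}
		= (\<integral>\<^sup>+w. ennreal (exp (c*p))*indicator {w\<in>space M. passed N w} w \<partial>P x i)"
		by (subst nn_integral_cmult_indicator) simp_all
	also have "\<dots> <= (\<integral>\<^sup>+w. Q N w \<partial>P x i)" by (rule nn_integral_mono) (auto simp: Q_def indicator_def)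
	also note main
	finally show ?thesis unfolding passed_def .
qed

definition sup_exp :: "real => nat => 'w => ennreal" where
	"sup_exp c m w = (SUP n. SUP k\<in>{..m*2 ^ n}. ennreal (exp (c*X (gr n k) w)*alive (gr n k) w))"

lemma sup_exp_meas [measurable]: "sup_exp c m \<in> Bor M"
	unfolding sup_exp_def by measurable

lemma sup_exp_ge: "k <= m*2 ^ n ==> ennreal (exp (c*X (gr n k) w)*alive (gr n k) w) <= sup_exp c m w"
	unfolding sup_exp_def by (intro SUP_upper2[of n] SUP_upper2[of k]) auto

text \<open>Moments of order c + 1 give tails of order exp(-(c + 1) p) for the running maximum,
  summable against exp(c (p + 1)). The bound does not depend on the mesh, so it survives the
  supremum over n.\<close>

lemma sup_exp_finite:
	assumes c: "0 <= c"
	shows "(\<integral>\<^sup>+w. sup_exp c m w \<partial>P x i) < \<infinity>"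
proof -
	obtain \<kappa> where \<kappa>0: "0 <= \<kappa>" and \<kappa>: "\<And>t j. 0 <= t ==> (\<Sum>l\<in>UNIV. \<integral>w. exp ((c+1)*X t w)*ph l t w \<partial>P 0 j) <= exp (\<kappa>*t)"
		using mgf_growth[of "c+1"] c by auto
	\<comment> \<open>exp c pays for rounding X up to p + 1; the other factors are the bound of
	  \<open>grid_max_bound\<close> at time m.\<close>
	define B where "B = exp c*(exp (\<kappa>*real m)*exp ((c+1)*x))"
	define S where "S n w = (SUP k\<in>{..m*2 ^ n}. ennreal (exp (c*X (gr n k) w)*alive (gr n k) w))" for n w
	define E where "E n p = {w\<in>space M. \<exists>k\<le>m*2 ^ n. J (gr n k) w ~= None & real p <= X (gr n k) w}" for n p
	have [measurable]: "E n p \<in> sets M" for n p unfolding E_def by measurable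
	have [measurable]: "S n \<in> Bor M" for n unfolding S_def by measurable
	have bound: "(\<integral>\<^sup>+w. S n w \<partial>P x i) <= 1+(\<Sum>p. ennreal (B*exp (- 1) ^ p))" for n
	proof -
		have "S n w <= 1+(\<Sum>p. ennreal (exp (c*(real p+1)))*indicator (E n p) w)" if om: "w \<in> space M" for w
			unfolding S_def
		proof (rule SUP_least)
			fix k assume k: "k \<in> {..m*2 ^ n}"
			show "ennreal (exp (c*X (gr n k) w)*alive (gr n k) w) <= 1+(\<Sum>p. ennreal (exp (c*(real p+1)))*indicator (E n p) w)"
			proof (cases "J (gr n k) w = None | X (gr n k) w < 0")
				case True
				have "exp (c*X (gr n k) w)*alive (gr n k) w <= 1"
					using True c by (auto simp: alive_def mult_nonneg_nonpos)
				hence "ennreal (exp (c*X (gr n k) w)*alive (gr n k) w) <= 1" by (simp add: ennreal_le_1)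
				thus ?thesis by (rule order_trans) (simp add: add_increasing2)
			next
				case False
				define p where "p = nat \<lfloor>X (gr n k) w\<rfloor>"
				have p: "real p <= X (gr n k) w" "X (gr n k) w <= real p+1"
					using False unfolding p_def by (simp_all add: of_nat_nat)
				have "w \<in> E n p" using om False k p(1) by (auto simp: E_def)
				have "ennreal (exp (c*X (gr n k) w)*alive (gr n k) w) <= ennreal (exp (c*(real p+1)))*indicator (E n p) w"
					using False \<open>w \<in> E n p\<close> p(2) c by (auto simp: alive_def intro!: ennreal_leI mult_left_mono)
				also have "\<dots> <= (\<Sum>p. ennreal (exp (c*(real p+1)))*indicator (E n p) w)"
				proof -
					let ?f = "%p. ennreal (exp (c*(real p+1)))*indicator (E n p) w"
					have "(\<Sum>p\<in>{p}. ?f p) <= (\<Sum>p. ?f p)" by (rule sum_le_suminf) simp_all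
					thus ?thesis by (simp only: sum.insert finite.emptyI empty_iff not_False_eq_True simp_thms sum.empty add.right_neutral)
				qed
				finally show ?thesis by (rule order_trans) (simp add: add_increasing)
			qed
		qed
		hence "(\<integral>\<^sup>+w. S n w \<partial>P x i) <= (\<integral>\<^sup>+w. 1+(\<Sum>p. ennreal (exp (c*(real p+1)))*indicator (E n p) w) \<partial>P x i)"
			by (intro nn_integral_mono) simp
		also have "\<dots> = 1+(\<Sum>p. ennreal (exp (c*(real p+1)))*emeasure (P x i) (E n p))"
			using prob_space.emeasure_space_1[OF prob, of x i]
			by (simp add: nn_integral_add nn_integral_suminf nn_integral_cmult_indicator)
		also have "\<dots> <= 1+(\<Sum>p. ennreal (B*exp (- 1) ^ p))"
		proof (intro add_left_mono suminf_le)
			fix p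
			have "ennreal (exp ((c+1)*real p))*emeasure (P x i) (E n p) <= ennreal (exp (\<kappa>*gr n (m*2 ^ n))*exp ((c+1)*x))"
				unfolding E_def by (rule grid_max_bound[OF _ \<kappa>0 \<kappa>]) (use c in simp_all)
			hence 1: "ennreal (exp c*exp (- 1) ^ p)*(ennreal (exp ((c+1)*real p))*emeasure (P x i) (E n p))
				\<le> ennreal (exp c*exp (- 1) ^ p)*ennreal (exp (\<kappa>*real m)*exp ((c+1)*x))"
				by (intro mult_left_mono) (simp_all add: gr_def)
			have 2: "ennreal (exp c*exp (- 1) ^ p)*ennreal (exp ((c+1)*real p)) = ennreal (exp (c*(real p+1)))"
			proof -
				have 1: "exp (- 1) ^ p = exp (- real p)" using exp_of_nat_mult[of p "- 1 :: real"] by simp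
				have "c+- real p+(c+1)*real p = c*(real p+1)" by (simp add: algebra_simps)
				hence "exp c*exp (- 1) ^ p*exp ((c+1)*real p) = exp (c*(real p+1))"
					unfolding 1 by (simp only: exp_add[symmetric])
				thus ?thesis by (subst ennreal_mult[symmetric]) simp_all
			qed
			have "ennreal (exp c*exp (- 1) ^ p)*ennreal (exp (\<kappa>*real m)*exp ((c+1)*x)) = ennreal (B*exp (- 1) ^ p)"
				by (subst ennreal_mult[symmetric]) (simp_all add: B_def mult_ac)
			thus "ennreal (exp (c*(real p+1)))*emeasure (P x i) (E n p) <= ennreal (B*exp (- 1) ^ p)"
				using 1 unfolding 2[symmetric] by (simp only: mult.assoc)
		qed auto
		finally show ?thesis .
	qed
	have "(\<Sum>p. ennreal (B*exp (- 1) ^ p)) < \<infinity>"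
	proof -
		have "summable (%p. B*exp (- 1 :: real) ^ p)" by (intro summable_mult summable_geometric) simp
		thus ?thesis by (subst suminf_ennreal2) (auto simp: B_def)
	qed
	hence fin: "1+(\<Sum>p. ennreal (B*exp (- 1) ^ p)) < \<infinity>" by (simp add: less_top[symmetric])
	have "incseq S"
	proof (rule incseq_SucI, rule le_funI)
		fix n w
		show "S n w <= S (Suc n) w" unfolding S_def
		proof (rule SUP_mono)
			fix k assume "k \<in> {..m*2 ^ n}"
			moreover have "gr n k = gr (Suc n) (2*k)" by (simp add: gr_def)
			ultimately show "\<exists>k'\<in>{..m*2 ^ Suc n}. ennreal (exp (c*X (gr n k) w)*alive (gr n k) w) <= ennreal (exp (c*X (gr (Suc n) k') w)*alive (gr (Suc n) k') w)"
				by (intro bexI[of _ "2*k"]) auto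
		qed
	qed
	hence "(\<integral>\<^sup>+w. (SUP n. S n w) \<partial>P x i) = (SUP n. \<integral>\<^sup>+w. S n w \<partial>P x i)"
		by (rule nn_integral_monotone_convergence_SUP) simp
	also have "\<dots> <= 1+(\<Sum>p. ennreal (B*exp (- 1) ^ p))" by (rule SUP_least) (rule bound)
	also note fin
	finally show ?thesis by (simp add: sup_exp_def[abs_def] S_def)
qed

end

subsection \<open>Regularity of the reflected process\<close>

context reflected_phase
begin

text \<open>Right after its passage of 0 the upper regulator is positive. Hence h returns to 0
  arbitrarily soon with u > 0 and \<open>l\<close> not yet moved, and at such a time x exceeds its
  value at the passage.\<close>

lemma exceeds_after_passage:
	assumes "0 <= t1" "0 < u t1" "j (passage u 0) ~= None" "0 < e"
	shows "\<exists>s. passage u 0 < s & s < passage u 0+e & x (passage u 0) < x s"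
proof -
	let ?r = "passage u 0"
	have r0: "0 <= ?r" and h0: "h ?r = 0" and ur: "u ?r = 0"
		using passage_u_ge[OF order_refl assms(1,2)] h_passage_u[OF order_refl assms(1,2)] u_passage_alive[OF order_refl assms(1-3)] by auto
	have "h ?r ~= - a" using h0 a_pos by simp
	then obtain d where d: "0 < d" "\<And>s. ?r <= s ==> s <= ?r+d ==> l s = l ?r"
		by (rule l_const_right[OF r0]) (rule that)
	define e' where "e' = min d e/2"
	have e': "0 < e'" "e' < e" "e' <= d" using d(1) assms(4) by (auto simp: e'_def)
	have "u ?r < u (?r+e')" using passage_u_gr[OF order_refl assms(1,2), of "?r+e'"] e'(1) ur by simp
	then obtain v where v: "v \<in> {?r<..?r+e'}" "h v = 0"
		using u_increase[of ?r "?r+e'"] r0 e'(1) by auto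
	have "0 < u v" using passage_u_gr[OF order_refl assms(1,2), of v] v by simp
	moreover have "l v = l ?r" using v e' by (intro d(2)) auto
	ultimately have "x ?r < x v" using v(2) h0 ur by (simp add: h_def)
	thus ?thesis using v e' by (intro exI[of _ v]) auto
qed

text \<open>A path whose oscillation is small compared with the strip cannot come from the top down
  to -a. So \<open>u\<close> does not move on [t, s], and since \<open>l\<close> only grows while h
  >= -a, the value of x at s is its minimum over the interval.\<close>

lemma small_osc_at_bottom:
	assumes t: "0 <= t" "t <= s" and hs: "h s = - a" and osc: "\<And>v. t <= v ==> v <= s ==> \<bar>x v-x t\<bar> <= a/3"
	shows "t <= v ==> v <= s ==> x s <= x v"
proof -
	have us: "u s = u t"
	proof (rule ccontr)
		assume "u s ~= u t"
		hence lt: "u t < u s" using u_mono[OF t] by simp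
		\<comment> \<open>If \<open>u\<close> moved, it passed level c at a time with h = 0 after which it
		  gained at most a/4. Reaching -a from there requires x to fall by 3a/4, more than the 2a/3 that
		  the oscillation bound allows.\<close>
		define c where "c = max (u t) (u s-a/4)"
		have c: "u t <= c" "c < u s" "u s-a/4 <= c" using lt a_pos by (auto simp: c_def)
		have c0: "0 <= c" using c u_nonneg[OF t(1)] by simp
		have s0: "0 <= s" using t by simp
		let ?v = "passage u c"
		have v: "t <= ?v" "?v <= s" "c <= u ?v" "h ?v = 0"
			using passage_u_gr[OF c0 s0 c(2), of t] passage_u_less[OF c0 s0 c(2), of s] u_passage[OF c0 s0 c(2)]
				h_passage_u[OF c0 s0 c(2)] c s0 by force+
		have "l ?v <= l s" using v t by (intro l_mono) auto
		hence "- a \<ge> x s-x ?v-(u s-u ?v)" using v(4) hs by (simp add: h_def)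
		moreover have "\<bar>x s-x t\<bar> <= a/3" by (rule osc[OF t(2) order_refl])
		moreover have "\<bar>x ?v-x t\<bar> <= a/3" by (rule osc[OF v(1,2)])
		ultimately show False using c v(3) a_pos by linarith
	qed
	assume v: "t <= v" "v <= s"
	have "u v = u s" using u_mono[of t v] u_mono[of v s] us v t by simp
	moreover have "l v <= l s" using v t by (intro l_mono) auto
	moreover have "- a <= h v" using v t by (intro h_ge) auto
	ultimately show "x s <= x v" using hs by (simp add: h_def)
qed

text \<open>The strip has width a and \<open>l\<close> only adds to h, so an increase of x beyond a
  has to be taken off by \<open>u\<close>.\<close>

lemma large_increment:
	assumes "0 <= s" "s <= t" "r+a < x t-x s"
	shows "r < u t"
proof -
	have "x t-x s = h t-h s-(l t-l s)+(u t-u s)" by (simp add: h_def)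
	also have "\<dots> <= a+u t"
		using h_le[of t] h_ge[of s] l_mono[OF assms(1,2)] u_nonneg[OF assms(1)] assms by simp
	finally show ?thesis using assms(3) by simp
qed

end

section \<open>Reversal of increments over an interval of constant phase\<close>

context map_process
begin

lemma measure_phase_split:
	assumes "A \<in> sets M" "0 <= t" "\<And>w. w \<in> A ==> J t w ~= None"
	shows "measure (P x i) A = (\<Sum>j\<in>UNIV. measure (P x i) (A \<inter> {w\<in>space M. J t w = Some j}))"
proof -
	have "A = (\<Union>j\<in>UNIV. A \<inter> {w\<in>space M. J t w = Some j})"
		using assms(3) sets.sets_into_space[OF assms(1)] by fastforce
	hence "measure (P x i) A = measure (P x i) (\<Union>j\<in>UNIV. A \<inter> {w\<in>space M. J t w = Some j})" by simp
	also have "\<dots> = (\<Sum>j\<in>UNIV. measure (P x i) (A \<inter> {w\<in>space M. J t w = Some j}))"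
		using assms(1) by (intro finite_measure.finite_measure_finite_Union[OF finite_P]) (auto simp: disjoint_family_on_def)
	finally show ?thesis .
qed

lemma markov1_space:
	fixes s :: "nat => real"
	assumes "0 <= t" "\<And>m. 0 <= s m" "\<And>m. B m \<in> sets borel"
	shows "measure (P x i) {w\<in>space M. J t w = Some j \<and>
						(\<forall>m. X (t + s m) w-X t w \<in> B m & J (t + s m) w = Some (k m))}
				= measure (P x i) {w\<in>space M. J t w = Some j} *
					measure (P 0 j) {w\<in>space M. \<forall>m. X (s m) w-X 0 w \<in> B m & J (s m) w = Some (k m)}"
proof -
	have top: "space M \<in> sets (hist t)" using sets.top[of "hist t"] by simp
	have *: "space M \<inter> {w\<in>space M. Q w} = {w\<in>space M. Q w}" for Q by auto
	show ?thesis using markov_seq[OF assms(1) top assms(2,3), where x=x and i=i and j=j and k=k] unfolding * .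
qed

text \<open>Increments over a grid, restricted to a constant phase on the grid, are independent and identically
	distributed; hence their joint law is invariant under reversal of the grid.\<close>

lemma increments_product:
	assumes t: "0 <= t" and h: "0 <= h" and B: "\<And>k. B k \<in> sets borel"
	shows "measure (P x i) {w\<in>space M. J t w = Some j \<and>
			(\<forall>k<K. X (t+real (Suc k)*h) w-X (t+real k*h) w \<in> B k & J (t+real (Suc k)*h) w = Some j)}
		= measure (P x i) {w\<in>space M. J t w = Some j} *
			(\<Prod>k<K. measure (P 0 j) {w\<in>space M. X h w-X 0 w \<in> B k & J h w = Some j})"
proof (induction K)
	case (Suc K)
	let ?E = "%K. {w\<in>space M. J t w = Some j \<and>
			(\<forall>k<K. X (t+real (Suc k)*h) w-X (t+real k*h) w \<in> B k & J (t+real (Suc k)*h) w = Some j)}"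
	let ?s = "t+real K*h"
	have s0: "0 <= ?s" using t h by simp
	have le: "t+real k*h <= ?s" if "k <= K" for k using that h by (simp add: mult_right_mono)
	have nn: "0 <= t+real k*h" for k using t h by simp
	define A where "A = {w\<in>space M. J t w = Some j \<and>
			(\<forall>k<K. XA (t+real (Suc k)*h) w-XA (t+real k*h) w \<in> B k & J (t+real (Suc k)*h) w = Some j)}"
	have A: "A \<in> sets (hist ?s)"
	proof -
		have A_eq: "A = {w\<in>space (hist ?s). J t w = Some j \<and>
			(\<forall>k\<in>{..<K}. XA (t+real (Suc k)*h) w-XA (t+real k*h) w \<in> B k & J (t+real (Suc k)*h) w = Some j)}"
			by (auto simp: A_def)
		have XAm: "XA (t+real k*h) \<in> Bor (hist ?s)" if "k <= K" for k
			by (rule XA_hist[OF nn le[OF that]])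
		have J0: "{w\<in>space (hist ?s). J t w = Some j} \<in> sets (hist ?s)"
			using hist_phase[OF t, of ?s j] h by simp
		have each: "{w\<in>space (hist ?s). XA (t+real (Suc k)*h) w-XA (t+real k*h) w \<in> B k & J (t+real (Suc k)*h) w = Some j} \<in> sets (hist ?s)"
			if k: "k \<in> {..<K}" for k
		proof -
			have kK: "Suc k <= K" "k <= K" using k by auto
			have f: "(%w. XA (t+real (Suc k)*h) w-XA (t+real k*h) w) \<in> Bor (hist ?s)"
				by (rule borel_measurable_diff[OF XAm[OF kK(1)] XAm[OF kK(2)]])
			have 1: "{w\<in>space (hist ?s). XA (t+real (Suc k)*h) w-XA (t+real k*h) w \<in> B k} \<in> sets (hist ?s)"
				using measurable_sets[OF f B[of k]] by (simp only: vimage_def Int_def mem_Collect_eq conj_commute)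
			have 2: "{w\<in>space (hist ?s). J (t+real (Suc k)*h) w = Some j} \<in> sets (hist ?s)"
				using hist_phase[OF nn le[OF kK(1)], of j] by (simp only: space_hist)
			show ?thesis by (intro sets.sets_Collect_conj 1 2)
		qed
		show ?thesis unfolding A_eq
			by (intro sets.sets_Collect_conj J0 sets.sets_Collect_finite_All each) auto
	qed
	have alive': "XA (t+real k*h) w = X (t+real k*h) w"
		if "J t w = Some j" "\<forall>k<K. J (t+real (Suc k)*h) w = Some j" "k <= K" for k w
		using that by (cases k) (auto simp: XA_def)
	have inc: "XA (t+real (Suc k)*h) w-XA (t+real k*h) w = X (t+real (Suc k)*h) w-X (t+real k*h) w"
		if "J t w = Some j" "\<forall>k<K. J (t+real (Suc k)*h) w = Some j" "k < K" for k w
		using alive'[OF that(1,2), of "Suc k"] alive'[OF that(1,2), of k] that(3) by (simp only: Suc_leI less_imp_le)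
	have AE: "A \<inter> {w\<in>space M. J ?s w = Some j} = ?E K"
	proof (intro set_eqI iffI)
		fix w assume w: "w \<in> A \<inter> {w\<in>space M. J ?s w = Some j}"
		hence j: "J t w = Some j" "\<forall>k<K. J (t+real (Suc k)*h) w = Some j" unfolding A_def by blast+
		show "w \<in> ?E K" using w j inc[OF j] unfolding A_def by simp
	next
		fix w assume w: "w \<in> ?E K"
		hence j: "J t w = Some j" "\<forall>k<K. J (t+real (Suc k)*h) w = Some j" by blast+
		have "J ?s w = Some j" using j by (cases K) auto
		thus "w \<in> A \<inter> {w\<in>space M. J ?s w = Some j}"
			using w j inc[OF j] unfolding A_def by simp
	qed
	have "?E (Suc K) = A \<inter> {w\<in>space M. J ?s w = Some j & X (?s+h) w-X ?s w \<in> B K & J (?s+h) w = Some j}"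
	proof -
		have "?E (Suc K) = ?E K \<inter> {w\<in>space M. X (?s+h) w-X ?s w \<in> B K & J (?s+h) w = Some j}"
			by (auto simp: less_Suc_eq distrib_right add.assoc algebra_simps)
		thus ?thesis unfolding AE[symmetric] by auto
	qed
	hence "measure (P x i) (?E (Suc K)) = measure (P x i) (?E K)*measure (P 0 j) {w\<in>space M. X h w-X 0 w \<in> B K & J h w = Some j}"
		using markov1[OF s0 A h B[of K], where x=x and i=i and j=j and k=j] AE by simp
	thus ?case using Suc.IH by simp
qed simp

lemma increments_reversal:
	assumes t: "0 <= t" and h: "0 <= h"
	shows "measure (P x i) {w\<in>space M. J t w = Some j & (\<forall>k<K. J (t+real (Suc k)*h) w = Some j) \<and>
			(\<forall>k\<le>K. X (t+real K*h) w <= X (t+real k*h) w)}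
		= measure (P x i) {w\<in>space M. J t w = Some j & (\<forall>k<K. J (t+real (Suc k)*h) w = Some j) \<and>
			(\<forall>k\<le>K. X (t+real k*h) w <= X t w)}"
proof -
	define D where "D = {w\<in>space M. J t w = Some j & (\<forall>k<K. J (t+real (Suc k)*h) w = Some j)}"
	have [measurable]: "D \<in> sets M" unfolding D_def by measurable
	define xi where "xi k w = X (t+real (Suc k)*h) w-X (t+real k*h) w" for k w
	have [measurable]: "xi k \<in> Bor M" for k unfolding xi_def by measurable
	define Q where "Q = density (P x i) (indicator D)"
	have Qs [measurable_cong]: "sets Q = sets M" by (simp add: Q_def)
	let ?Pi = "PiM {..<K} (%_. borel :: real measure)"
	define f1 where "f1 w = (\<lambda>k\<in>{..<K}. xi k w)" for w
	define f2 where "f2 w = (\<lambda>k\<in>{..<K}. xi (K-1-k) w)" for w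
	have [measurable]: "f1 \<in> M \<rightarrow>\<^sub>M ?Pi" "f2 \<in> M \<rightarrow>\<^sub>M ?Pi" unfolding f1_def f2_def by measurable
	have rect: "emeasure (P x i) {w\<in>space M. w \<in> D & (\<forall>k<K. xi k w \<in> B k)} = ennreal (measure (P x i) {w\<in>space M. J t w = Some j} *
			(\<Prod>k<K. measure (P 0 j) {w\<in>space M. X h w-X 0 w \<in> B k & J h w = Some j}))"
		if "\<And>k. B k \<in> sets borel" for B
	proof -
		have "{w\<in>space M. w \<in> D & (\<forall>k<K. xi k w \<in> B k)} = {w\<in>space M. J t w = Some j \<and>
			(\<forall>k<K. X (t+real (Suc k)*h) w-X (t+real k*h) w \<in> B k & J (t+real (Suc k)*h) w = Some j)}"
			by (auto simp: D_def xi_def)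
		thus ?thesis using increments_product[OF t h that, of x i j K] by (simp add: finite_measure.emeasure_eq_measure)
	qed
	have em: "emeasure (distr Q ?Pi f) S = emeasure (P x i) {w\<in>space M. w \<in> D & f w \<in> S}"
		if [measurable]: "f \<in> M \<rightarrow>\<^sub>M ?Pi" "S \<in> sets ?Pi" for f S
	proof -
		have "emeasure (distr Q ?Pi f) S = emeasure Q (f -` S \<inter> space M)"
			by (subst emeasure_distr) (simp_all add: Q_def)
		also have "\<dots> = emeasure (P x i) (D \<inter> (f -` S \<inter> space M))"
			unfolding Q_def by (subst emeasure_restricted) (auto intro: measurable_sets)
		also have "D \<inter> (f -` S \<inter> space M) = {w\<in>space M. w \<in> D & f w \<in> S}" by auto
		finally show ?thesis .
	qed
	\<comment> \<open>On every rectangle both laws give a product of one-step probabilities, with the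
	  same factors in opposite order.\<close>
	have "distr Q ?Pi f1 = distr Q ?Pi f2"
	proof (rule measure_eqI_PiM_finite)
		show "finite {..<K}" by simp
		fix B :: "nat => real set" assume B: "\<And>k. k \<in> {..<K} ==> B k \<in> sets borel"
		have SB: "Pi\<^sub>E {..<K} B \<in> sets ?Pi" using B by (intro sets_PiM_I_finite) auto
		define B' where "B' k = (if k < K then B k else UNIV)" for k
		have B': "B' k \<in> sets borel" for k using B by (simp add: B'_def)
		have "{w\<in>space M. w \<in> D & f1 w \<in> Pi\<^sub>E {..<K} B} = {w\<in>space M. w \<in> D & (\<forall>k<K. xi k w \<in> B' k)}"
			by (auto simp: f1_def B'_def PiE_def Pi_def)
		hence e1: "emeasure (distr Q ?Pi f1) (Pi\<^sub>E {..<K} B) = ennreal (measure (P x i) {w\<in>space M. J t w = Some j} *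
			(\<Prod>k<K. measure (P 0 j) {w\<in>space M. X h w-X 0 w \<in> B' k & J h w = Some j}))"
			using rect[OF B'] by (simp add: em[OF _ SB])
		define B'' where "B'' k = B' (K-1-k)" for k
		have B'': "B'' k \<in> sets borel" for k using B' by (simp add: B''_def)
		have "(\<forall>k<K. xi (K-1-k) w \<in> B k) \<longleftrightarrow> (\<forall>k<K. xi k w \<in> B'' k)" for w
		proof
			assume *: "\<forall>k<K. xi (K-1-k) w \<in> B k"
			show "\<forall>k<K. xi k w \<in> B'' k"
			proof (intro allI impI)
				fix k assume "k < K"
				thus "xi k w \<in> B'' k" using *[rule_format, of "K-1-k"] by (simp add: B''_def B'_def)
			qed
		next
			assume *: "\<forall>k<K. xi k w \<in> B'' k"
			show "\<forall>k<K. xi (K-1-k) w \<in> B k"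
			proof (intro allI impI)
				fix k assume "k < K"
				thus "xi (K-1-k) w \<in> B k" using *[rule_format, of "K-1-k"] by (simp add: B''_def B'_def)
			qed
		qed
		hence "{w\<in>space M. w \<in> D & f2 w \<in> Pi\<^sub>E {..<K} B} = {w\<in>space M. w \<in> D & (\<forall>k<K. xi k w \<in> B'' k)}"
			by (auto simp: f2_def PiE_def Pi_def)
		hence e2: "emeasure (distr Q ?Pi f2) (Pi\<^sub>E {..<K} B) = ennreal (measure (P x i) {w\<in>space M. J t w = Some j} *
			(\<Prod>k<K. measure (P 0 j) {w\<in>space M. X h w-X 0 w \<in> B'' k & J h w = Some j}))"
			using rect[OF B''] by (simp add: em[OF _ SB])
		have "(\<Prod>k<K. measure (P 0 j) {w\<in>space M. X h w-X 0 w \<in> B'' k & J h w = Some j})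
			= (\<Prod>k<K. measure (P 0 j) {w\<in>space M. X h w-X 0 w \<in> B' k & J h w = Some j})"
		proof -
			have "(\<Prod>k<K. g (K-1-k)) = (\<Prod>k<K. g k)" for g :: "nat => real"
				by (rule prod.reindex_bij_witness[where i="%n. K-1-n" and j="%n. K-1-n"]) auto
			thus ?thesis unfolding B''_def .
		qed
		thus "emeasure (distr Q ?Pi f1) (Pi\<^sub>E {..<K} B) = emeasure (distr Q ?Pi f2) (Pi\<^sub>E {..<K} B)"
			unfolding e1 e2 by simp
	next
		show "sets (distr Q ?Pi f1) = sets ?Pi" "sets (distr Q ?Pi f2) = sets ?Pi" by simp_all
		show "range (%_::nat. space ?Pi) \<subseteq> prod_algebra {..<K} (%_. borel :: real measure)"
			using space_in_prod_algebra[of "{..<K}" "%_. borel :: real measure"] by (auto simp: space_PiM)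
		show "(\<Union>n::nat. space ?Pi) = space ?Pi" by simp
		show "emeasure (distr Q ?Pi f1) (space ?Pi) ~= \<infinity>"
			using em[of f1 "space ?Pi"] finite_measure.emeasure_finite[OF finite_P] by simp
	qed
	\<comment> \<open>For the increments in their order, nonpositive tail sums say that the last value
	  is the minimum; for the reversed increments they say that no value exceeds the first.\<close>
	define S where "S = {y \<in> space ?Pi. \<forall>k\<in>{..K}. (\<Sum>n\<in>{k..<K}. y n) <= 0}"
	have "{y \<in> space ?Pi. (\<Sum>n\<in>{k..<K}. y n) <= 0} \<in> sets ?Pi" for k
		by (intro borel_measurable_le borel_measurable_sum measurable_component_singleton measurable_const) auto
	hence S: "S \<in> sets ?Pi" unfolding S_def by (intro sets.sets_Collect_finite_All) auto
	have tele: "(\<Sum>n\<in>{k..<k'}. xi n w) = X (t+real k'*h) w-X (t+real k*h) w" if "k <= k'" for k k' w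
		unfolding xi_def using sum_Suc_diff'[OF that, of "%n. X (t+real n*h) w"] by simp
	have space: "f1 w \<in> space ?Pi" "f2 w \<in> space ?Pi" for w by (auto simp: f1_def f2_def space_PiM)
	have m1: "f1 w \<in> S \<longleftrightarrow> (\<forall>k\<le>K. X (t+real K*h) w <= X (t+real k*h) w)" for w
	proof -
		have "(\<Sum>n\<in>{k..<K}. f1 w n) = X (t+real K*h) w-X (t+real k*h) w" if "k <= K" for k
			using tele[OF that] by (simp add: f1_def)
		thus ?thesis using space by (auto simp: S_def)
	qed
	have m2: "f2 w \<in> S \<longleftrightarrow> (\<forall>k\<le>K. X (t+real k*h) w <= X t w)" for w
	proof -
		have "(\<Sum>n\<in>{k..<K}. f2 w n) = X (t+real (K-k)*h) w-X t w" if k: "k <= K" for k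
		proof -
			have "(\<Sum>n\<in>{k..<K}. f2 w n) = (\<Sum>n\<in>{k..<K}. xi (K-1-n) w)" by (simp add: f2_def)
			also have "\<dots> = (\<Sum>n\<in>{0..<K-k}. xi n w)"
				by (rule sum.reindex_bij_witness[where i="%n. K-1-n" and j="%n. K-1-n"]) auto
			also have "\<dots> = X (t+real (K-k)*h) w-X t w" using tele[of 0 "K-k"] by simp
			finally show ?thesis .
		qed
		hence "f2 w \<in> S \<longleftrightarrow> (\<forall>k\<le>K. X (t+real (K-k)*h) w <= X t w)" using space by (auto simp: S_def)
		also have "\<dots> \<longleftrightarrow> (\<forall>k\<le>K. X (t+real k*h) w <= X t w)"
			by (metis diff_diff_cancel diff_le_self)
		finally show ?thesis .
	qed
	have "emeasure (P x i) {w\<in>space M. w \<in> D & f1 w \<in> S} = emeasure (P x i) {w\<in>space M. w \<in> D & f2 w \<in> S}"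
		using em[OF _ S, of f1] em[OF _ S, of f2] \<open>distr Q ?Pi f1 = distr Q ?Pi f2\<close> by simp
	hence "measure (P x i) {w\<in>space M. w \<in> D & f1 w \<in> S} = measure (P x i) {w\<in>space M. w \<in> D & f2 w \<in> S}"
		by (simp add: measure_def)
	thus ?thesis unfolding m1 m2 by (simp add: D_def conj_assoc cong: conj_cong)
qed

end

section \<open>Regularity at the upper barrier and its consequences\<close>

definition rats :: "real => nat => real" where "rats d = from_nat_into (\<rat> \<inter> {0..d})"

lemma range_rats: "0 <= d ==> range (rats d) = \<rat> \<inter> {0..d}"
	unfolding rats_def by (intro range_from_nat_into countable_Int1 countable_rat) (auto intro: exI[of _ 0])

lemma rats_bounds: "0 <= d ==> rats d m \<in> \<rat>" "0 <= d ==> 0 <= rats d m" "0 <= d ==> rats d m <= d"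
	using range_rats[of d] rangeI[of "rats d" m] by auto

text \<open>\<open>up\<close> states the regularity: started at the upper barrier in phase i, the
  process is in phase i at rho_0. It is derived in \<open>start_at_top\<close> from the exponent at
  r = 0.\<close>

locale regular_reflected_map = reflected_map M P X J a Rl Ru
	for M P X and J :: "real => 'w => 'n::finite option" and a Rl Ru +
	assumes up: "AE w in P 0 i. phase_at_passage (%t. J t w) (%t. Ru t w) 0 = Some i"
begin

definition below :: "'n => real => 'w set" where
	"below i d = {w\<in>space M. \<forall>m. X (rats d m) w-X 0 w \<in> {..0} & J (rats d m) w = Some i}"

lemma below_meas [measurable]: "below i d \<in> sets M"
	unfolding below_def by measurable

text \<open>Let T_n be the first grid time at which \<open>u\<close> is positive. With probability
  tending to 1 the phase at T_n is i, and by the Markov property X then stays below X(T_n) for time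
  d with probability g. But X exceeds X(rho_0) right after rho_0 while X(T_n) tends to X(rho_0), so
  the probability of staying below tends to 0, and g = 0.\<close>

lemma below_null:
	assumes d: "0 < d"
	shows "measure (P 0 i) (below i d) = 0"
proof -
	define g where "g = measure (P 0 i) (below i d)"
	\<comment> \<open>\<open>A n k\<close> says in adapted terms that \<open>gr n (Suc k)\<close> is
	  the first grid time with positive \<open>u\<close>. These events are disjoint in k, so the Markov
	  property at grid times can be summed over them.\<close>
	define A where "A n k = {w\<in>space M. J (gr n (Suc k)) w ~= None & GA w & RuA (gr n k) w <= 0 & 0 < RuA (gr n (Suc k)) w}" for n k
	define U where "U n k = A n k \<inter> {w\<in>space M. J (gr n (Suc k)) w = Some i}" for n k
	define V where "V n k = A n k \<inter> {w\<in>space M. J (gr n (Suc k)) w = Some i \<and>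
		 (\<forall>m. X (gr n (Suc k)+rats d m) w-X (gr n (Suc k)) w \<in> {..0} & J (gr n (Suc k)+rats d m) w = Some i)}" for n k
	have Ah: "A n k \<in> sets (hist (gr n (Suc k)))" for n k
	proof -
		let ?H = "hist (gr n (Suc k))"
		have R: "RuA (gr n k) \<in> Bor ?H" by (rule measurable_hist_mono[OF gr_mono RuA_hist]) simp
		have "{w\<in>space ?H. J (gr n (Suc k)) w ~= None} \<in> sets ?H"
			by (rule predE, rule measurable_compose[OF J_hist[OF gr_nonneg order_refl]]) simp
		moreover have "{w\<in>space ?H. GA w} \<in> sets ?H" by (rule predE[OF GA_hist[OF gr_nonneg]])
		moreover have "{w\<in>space ?H. RuA (gr n k) w <= 0} \<in> sets ?H" by (rule borel_measurable_le[OF R borel_measurable_const])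
		moreover have "{w\<in>space ?H. 0 < RuA (gr n (Suc k)) w} \<in> sets ?H" by (rule borel_measurable_less[OF borel_measurable_const RuA_hist])
		ultimately have "{w\<in>space ?H. J (gr n (Suc k)) w ~= None & GA w & RuA (gr n k) w <= 0 & 0 < RuA (gr n (Suc k)) w} \<in> sets ?H"
			by (intro sets.sets_Collect_conj)
		thus ?thesis by (simp add: A_def)
	qed
	have [measurable]: "A n k \<in> sets M" for n k by (rule subsetD[OF hist_subset Ah])
	have [measurable]: "U n k \<in> sets M" "V n k \<in> sets M" for n k unfolding U_def V_def by measurable
	have rat: "gr n k \<in> \<rat>" for n k by (simp add: gr_def)
	have A_iff: "w \<in> A n k ==> w \<in> G & J (gr n (Suc k)) w ~= None & Ru (gr n k) w <= 0 & 0 < Ru (gr n (Suc k)) w" for n k w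
	proof -
		assume w: "w \<in> A n k"
		hence om: "w \<in> space M" and j: "J (gr n (Suc k)) w ~= None" by (auto simp: A_def)
		have G: "w \<in> G" using w GA_G[OF om gr_nonneg j] by (simp add: A_def)
		have j': "J (gr n k) w ~= None" using J_absorb[OF om gr_nonneg gr_mono[of k "Suc k" n]] j by auto
		show ?thesis using w G j RA_eq(2)[OF G rat gr_nonneg j] RA_eq(2)[OF G rat gr_nonneg j'] by (auto simp: A_def)
	qed
	have disj: "disjoint_family (A n)" for n
		unfolding disjoint_family_on_def
	proof (intro ballI impI equals0I)
		fix k k' w assume k: "k ~= k'" and w: "w \<in> A n k \<inter> A n k'"
		interpret reflected_phase a "%t. X t w" "%t. Rl t w" "%t. Ru t w" "%t. J t w"
			using A_iff w by (blast intro: path)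
		have "False" if "p < q" "w \<in> A n p" "w \<in> A n q" for p q
			using u_mono[OF gr_nonneg gr_mono[of "Suc p" q n]] A_iff[OF that(2)] A_iff[OF that(3)] that(1) by auto
		thus False using k w by (metis IntE linorder_neqE_nat)
	qed
	have eq: "measure (P 0 i) (V n k) = g*measure (P 0 i) (U n k)" for n k
		unfolding V_def U_def g_def below_def
		using markov_seq[OF gr_nonneg Ah[of n k] rats_bounds(2)[of d], where B="%_. {..0}" and x=0 and i=i and j=i and k="%_. i"] d
		by (simp add: mult.commute)
	have tot: "measure (P 0 i) (\<Union>k. V n k) = g*measure (P 0 i) (\<Union>k. U n k)" for n
	proof -
		have dV: "disjoint_family (V n)" "disjoint_family (U n)" using disj[of n] unfolding disjoint_family_on_def V_def U_def by blast+
		have "(%k. measure (P 0 i) (V n k)) sums measure (P 0 i) (\<Union>k. V n k)"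
			"(%k. measure (P 0 i) (U n k)) sums measure (P 0 i) (\<Union>k. U n k)"
			using dV by (intro finite_measure.finite_measure_UNION[OF finite_P]; auto)+
		moreover from this(2) have "(%k. g*measure (P 0 i) (U n k)) sums (g*measure (P 0 i) (\<Union>k. U n k))" by (rule sums_mult)
		ultimately show ?thesis unfolding eq by (metis sums_unique2)
	qed
	have zero: "0 \<in> {-a..0}" using a_pos by simp
	have ae: "AE w in P 0 i. (\<forall>\<^sub>F n in sequentially. w \<in> (\<Union>k. U n k) & w \<notin> (\<Union>k. V n k))"
		using up[of i] AE_G[OF zero]
	proof (eventually_elim, goal_cases)
		case (1 w)
		hence G: "w \<in> G" and ph: "phase_at_passage (%t. J t w) (%t. Ru t w) 0 = Some i" by auto
		have om: "w \<in> space M" using G by (rule G_space)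
		interpret reflected_phase a "%t. X t w" "%t. Rl t w" "%t. Ru t w" "%t. J t w" by (rule path[OF G])
		define r where "r = passage (%t. Ru t w) 0"
		obtain t1 where t1: "0 <= t1" "0 < Ru t1 w" and Jr: "J r w = Some i"
			using ph unfolding phase_at_passage_def r_def by (auto split: if_splits)
		have r0: "0 <= r" unfolding r_def by (rule passage_u_ge[OF order_refl t1])
		have ggr: "grid n k = gr n k" for n k by (simp add: grid_def gr_def)
		have "\<exists>k. Ru (gr n k) w <= 0 & 0 < Ru (gr n (Suc k)) w" for n
		proof -
			obtain N where N: "t1*2 ^ n <= real N" using real_arch_simple by blast
			have "t1 <= gr n N" using N by (simp add: gr_def field_simps)
			hence "0 < Ru (gr n N) w" using u_mono[OF t1(1)] t1(2) by fastforce
			hence lt: "0 < Ru (grid n N) w" by (simp add: ggr)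
			have z: "Ru (grid n 0) w <= 0" using u0 by simp
			have "incseq (%k. Ru (grid n k) w)" by (auto simp: incseq_def intro!: u_mono grid_mono)
			thus ?thesis by (rule incseq_locate[OF _ z lt, where F="%_. 0"]) (auto simp: ggr)
		qed
		hence "\<forall>n. \<exists>k. Ru (gr n k) w <= 0 & 0 < Ru (gr n (Suc k)) w" by (rule allI)
		from choice[OF this] obtain K where K: "\<forall>n. Ru (gr n (K n)) w <= 0 & 0 < Ru (gr n (Suc (K n))) w" ..
		define T where "T n = gr n (Suc (K n))" for n
		have T: "grid n (K n) <= r" "r <= grid n (Suc (K n))" for n
			unfolding r_def using passage_grid_u[OF order_refl, of n "K n"] K by (auto simp: ggr)
		have Tlim: "T \<leadsto> r" using grid_squeeze(2)[OF T] by (simp add: T_def[abs_def] ggr)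
		have Tr: "r <= T n" for n using T(2)[of n] by (simp add: T_def ggr)
		have T0: "0 <= T n" for n by (simp add: T_def)
		have Jev: "\<forall>\<^sub>F n in sequentially. J (T n) w = Some i"
			using j_eventually[OF r0 Tr Tlim] by (simp only: Jr)
		obtain s0 where s0: "r < s0" "s0 < r+d/2" "X r w < X s0 w"
			using exceeds_after_passage[OF t1, of "d/2"] Jr d by (auto simp: r_def)
		have "(%n. X (T n) w) \<leadsto> X r w" by (rule continuous_at_right_seq[OF x_rc[OF r0] Tr Tlim])
		hence Xev: "\<forall>\<^sub>F n in sequentially. X (T n) w < X s0 w" using s0(3) by (rule order_tendstoD)
		have Tev: "\<forall>\<^sub>F n in sequentially. T n < s0" using Tlim s0(1) by (rule order_tendstoD)
		show ?case using Jev Xev Tev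
		proof eventually_elim
			case (elim n)
			have alive: "J (gr n (Suc (K n))) w ~= None" using elim(1) by (simp add: T_def)
			have alive': "J (gr n (K n)) w ~= None" using J_absorb[OF om gr_nonneg gr_mono[of "K n" "Suc (K n)" n]] alive by auto
			have inA: "w \<in> A n (K n)"
				using om alive K GA_G[OF om gr_nonneg alive] G RA_eq(2)[OF G rat gr_nonneg alive] RA_eq(2)[OF G rat gr_nonneg alive']
				by (auto simp: A_def)
			have U: "w \<in> (\<Union>k. U n k)" using inA elim(1) om by (auto simp: U_def T_def)
			have "w \<notin> V n k" for k
			proof
				assume v: "w \<in> V n k"
				hence "k = K n" using inA disj[of n] by (auto simp: V_def disjoint_family_on_def)
				hence *: "\<And>m. X (T n+rats d m) w <= X (T n) w" using v by (auto simp: V_def T_def)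
				have rc: "continuous (at_right s0) (%s. X s w)" using r0 s0(1) by (intro x_rc) simp
				have "s0 < r+d" using s0(2) d by simp
				then obtain q where q: "q \<in> \<rat>" "s0 < q" "q < r+d" "X (T n) w < X q w"
					using right_rat[OF rc elim(2)] by blast
				have "q-T n \<in> \<rat> \<inter> {0..d}" using q elim(3) Tr[of n] rat[of n "Suc (K n)"] by (auto simp: T_def)
				then obtain m where "rats d m = q-T n" using range_rats[of d] d by (metis less_imp_le rangeE)
				thus False using *[of m] q(4) by simp
			qed
			thus ?case using U by blast
		qed
	qed
	have lim: "(%n. measure (P 0 i) (\<Union>k. U n k)) \<leadsto> 1" "(%n. measure (P 0 i) (\<Union>k. V n k)) \<leadsto> 0"
	proof -
		have gen: "(%n. measure (P 0 i) (S n)) \<leadsto> c"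
			if [measurable]: "\<And>n. S n \<in> sets M" and e: "AE w in P 0 i. (%n. indicator (S n) w :: real) \<leadsto> c" for S c
		proof -
			have "(%n. \<integral>w. indicator (S n) w \<partial>P 0 i) \<leadsto> (\<integral>w. c \<partial>P 0 i)"
				using e by (intro integral_dominated_convergence[where w="%_. 1"])
					(auto intro!: finite_measure.integrable_const[OF finite_P])
			thus ?thesis using prob_space.prob_space[OF prob, of 0 i] by simp
		qed
		show "(%n. measure (P 0 i) (\<Union>k. U n k)) \<leadsto> 1"
		proof (rule gen)
			show "AE w in P 0 i. (%n. indicator (\<Union>k. U n k) w :: real) \<leadsto> 1"
				using ae
			proof eventually_elim
				case (elim w)
				have "\<forall>\<^sub>F n in sequentially. 1 = (indicator (\<Union>k. U n k) w :: real)" using elim by eventually_elim simp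
				thus ?case by (rule Lim_transform_eventually[OF tendsto_const])
			qed
		qed measurable
		show "(%n. measure (P 0 i) (\<Union>k. V n k)) \<leadsto> 0"
		proof (rule gen)
			show "AE w in P 0 i. (%n. indicator (\<Union>k. V n k) w :: real) \<leadsto> 0"
				using ae
			proof eventually_elim
				case (elim w)
				have "\<forall>\<^sub>F n in sequentially. 0 = (indicator (\<Union>k. V n k) w :: real)" using elim by eventually_elim simp
				thus ?case by (rule Lim_transform_eventually[OF tendsto_const])
			qed
		qed measurable
	qed
	have "(%n. measure (P 0 i) (\<Union>k. V n k)) \<leadsto> g*1" unfolding tot by (intro tendsto_mult tendsto_const lim)
	hence "g = 0" using LIMSEQ_unique[OF lim(2)] by simp
	thus ?thesis by (simp add: g_def)
qed

text \<open>The bound a/3 is the one required by \<open>small_osc_at_bottom\<close>; rational times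
  determine the segment by right continuity.\<close>

definition calm :: "'n => real => 'w set" where
	"calm i d = {w\<in>space M. \<forall>m. X (rats d m) w-X 0 w \<in> {- a/3..a/3} & J (rats d m) w = Some i}"

lemma calm_meas [measurable]: "calm i d \<in> sets M"
	unfolding calm_def by measurable

lemma calm_tendsto: "(%n. measure (P 0 i) (calm i (1/real (Suc n)))) \<leadsto> 1"
proof -
	have "(%n. \<integral>w. (indicator (calm i (1/real (Suc n))) w :: real) \<partial>P 0 i) \<leadsto> (\<integral>w. 1 \<partial>P 0 i)"
	proof (rule integral_dominated_convergence[where w="%_. 1"])
		show "AE w in P 0 i. (%n. indicator (calm i (1/real (Suc n))) w :: real) \<leadsto> 1"
			using start[of 0 i] AE_space
		proof eventually_elim
			case (elim w)
			hence om: "w \<in> space M" by simp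
			obtain e where e: "e > 0" "\<forall>s\<in>{0..0+e}. J s w = J 0 w" using J_rc[OF om order_refl] by blast
			have "\<forall>\<^sub>F s in at_right 0. X s w \<in> {X 0 w-a/3<..<X 0 w+a/3}"
			proof -
				have "((%s. X s w) \<longlongrightarrow> X 0 w) (at_right 0)" using X_rc[OF om order_refl] by (simp add: continuous_within)
				thus ?thesis by (rule topological_tendstoD) (use a_pos in auto)
			qed
			then obtain b where b: "b > 0" "\<And>s. 0 < s ==> s < b ==> X s w \<in> {X 0 w-a/3<..<X 0 w+a/3}"
				unfolding eventually_at_right_field by blast
			have "\<forall>\<^sub>F n in sequentially. 1/real (Suc n) < min b e"
				using LIMSEQ_inverse_real_of_nat b(1) e(1) by (intro order_tendstoD) (auto simp: inverse_eq_divide)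
			hence "\<forall>\<^sub>F n in sequentially. 1 = (indicator (calm i (1/real (Suc n))) w :: real)"
			proof eventually_elim
				case (elim n)
				define d where "d = 1/real (Suc n)"
				have d: "0 <= d" "d < b" "d < e" using elim by (simp_all add: d_def)
				have "w \<in> calm i d" unfolding calm_def
				proof (intro CollectI conjI allI)
					fix m
					note r = rats_bounds(2,3)[OF d(1), of m]
					show "X (rats d m) w-X 0 w \<in> {- a/3..a/3}"
					proof (cases "rats d m = 0")
						case False
						hence "X (rats d m) w \<in> {X 0 w-a/3<..<X 0 w+a/3}" using r d by (intro b(2)) auto
						thus ?thesis by auto
					qed (use a_pos in simp)
					have "J (rats d m) w = J 0 w" by (rule bspec[OF e(2)]) (use r d in simp)
					thus "J (rats d m) w = Some i" using \<open>X 0 w = 0 \<and> J 0 w = Some i\<close> by simp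
				qed (rule om)
				thus ?case by (simp add: d_def)
			qed
			thus ?case by (rule Lim_transform_eventually[OF tendsto_const])
		qed
	qed (auto intro!: finite_measure.integrable_const[OF finite_P])
	thus ?thesis using prob_space.prob_space[OF prob, of 0 i] by simp
qed

text \<open>A point of constant phase at which the path attains its minimum over the preceding interval
	is, after reversal of increments, a path that does not exceed its starting value.\<close>

lemma min_at_end_null:
	assumes t: "0 <= t" and d: "0 < d"
	shows "AE w in P x i. \<not> (J t w = Some j & (\<forall>v\<in>{t..t+d}. J v w = Some j & X (t+d) w <= X v w))"
proof -
	let ?m = "measure (P x i)"
	define h where "h n = d/2 ^ n" for n :: nat
	have h0: "0 <= h n" for n using d by (simp add: h_def)
	have hK: "real (2 ^ n)*h n = d" for n by (simp add: h_def)
	let ?E = "%n. {w\<in>space M. J t w = Some j & (\<forall>k<2 ^ n. J (t+real (Suc k)*h n) w = Some j) \<and>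
			(\<forall>k\<le>2 ^ n. X (t+real k*h n) w <= X t w)}"
	let ?F = "%n. {w\<in>space M. J t w = Some j & (\<forall>k<2 ^ n. J (t+real (Suc k)*h n) w = Some j) \<and>
			(\<forall>k\<le>2 ^ n. X (t+real (2 ^ n)*h n) w <= X (t+real k*h n) w)}"
	let ?B = "\<Inter>n. ?F n"
	let ?D = "%n. {w\<in>space M. \<forall>k<Suc (2 ^ n). X (real k*h n) w-X 0 w \<in> {..0} & J (real k*h n) w = Some j}"
	have le1: "real k*h n <= d" if "k <= 2 ^ n" for k n
		using mult_right_mono[of "real k" "real (2 ^ n)" "h n"] that h0[of n] hK[of n]
		by (metis of_nat_le_iff)
	have eqE: "?m (?F n) = ?m {w\<in>space M. J t w = Some j}*measure (P 0 j) (?D n)" for n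
	proof -
		\<comment> \<open>After reversal the event constrains increments from t onwards, so the Markov
		  property at t bounds it by the probability of staying below the start.\<close>
		have "?m (?F n) = ?m (?E n)" by (rule increments_reversal[OF t h0])
		also have "?E n = space M \<inter> {w\<in>space M. J t w = Some j \<and>
				(\<forall>k<Suc (2 ^ n). X (t+real k*h n) w-X t w \<in> {..0} & J (t+real k*h n) w = Some j)}"
		proof (intro set_eqI iffI)
			fix w assume w: "w \<in> ?E n"
			have "J (t+real k*h n) w = Some j" if "k < Suc (2 ^ n)" for k using w that by (cases k) auto
			thus "w \<in> space M \<inter> {w\<in>space M. J t w = Some j \<and>
				(\<forall>k<Suc (2 ^ n). X (t+real k*h n) w-X t w \<in> {..0} & J (t+real k*h n) w = Some j)}"
				using w by (auto simp: less_Suc_eq_le)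
		next
			fix w assume w: "w \<in> space M \<inter> {w\<in>space M. J t w = Some j \<and>
				(\<forall>k<Suc (2 ^ n). X (t+real k*h n) w-X t w \<in> {..0} & J (t+real k*h n) w = Some j)}"
			have "J (t+real (Suc k)*h n) w = Some j" if "k < 2 ^ n" for k
			proof -
				have "Suc k < Suc (2 ^ n)" using that by simp
				thus ?thesis using w by blast
			qed
			moreover have "X (t+real k*h n) w <= X t w" if "k <= 2 ^ n" for k
				using w that by (auto simp: less_Suc_eq_le)
			ultimately show "w \<in> ?E n" using w by blast
		qed
		also have "?m \<dots> = ?m (space M \<inter> {w\<in>space M. J t w = Some j})*measure (P 0 j) (?D n)"
			by (rule increments[rule_format]) (use t h0 sets.top[of "hist t"] in \<open>auto simp: sets_hist[symmetric]\<close>)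
		also have "space M \<inter> {w\<in>space M. J t w = Some j} = {w\<in>space M. J t w = Some j}" by auto
		finally show ?thesis .
	qed
	have sub: "?B \<subseteq> ?F n" for n by (rule INT_lower) (rule UNIV_I)
	have Bm: "?m ?B <= measure (P 0 j) (?D n)" for n
	proof -
		have "?m ?B <= ?m (?F n)" by (rule finite_measure.finite_measure_mono[OF finite_P sub]) simp
		also have "\<dots> <= 1*measure (P 0 j) (?D n)" unfolding eqE
			by (intro mult_right_mono prob_space.prob_le_1[OF prob]) simp
		finally show ?thesis by simp
	qed
	have "(%n. measure (P 0 j) (?D n)) \<leadsto> measure (P 0 j) (\<Inter>n. ?D n)"
	proof (rule finite_measure.finite_Lim_measure_decseq[OF finite_P])
		have "?D n \<in> sets M" for n by measurable
		thus "range ?D \<subseteq> sets (P 0 j)" by auto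
		show "decseq ?D"
		proof (rule decseq_SucI, rule subsetI)
			fix n w assume w: "w \<in> ?D (Suc n)"
			show "w \<in> ?D n"
			proof (intro CollectI conjI allI impI)
				fix k assume k: "k < Suc (2 ^ n)"
				have e: "real (2*k)*h (Suc n) = real k*h n" by (simp add: h_def)
				have k2: "2*k < Suc (2 ^ Suc n)" using k by simp
				have "X (real (2*k)*h (Suc n)) w-X 0 w \<in> {..0} & J (real (2*k)*h (Suc n)) w = Some j"
					using w k2 by blast
				thus "X (real k*h n) w-X 0 w \<in> {..0}" "J (real k*h n) w = Some j" unfolding e by blast+
			qed (use w in blast)
		qed
	qed
	hence "?m ?B <= measure (P 0 j) (\<Inter>n. ?D n)" by (rule LIMSEQ_le_const) (intro exI allI impI, rule Bm)
	\<comment> \<open>Half of the interval leaves room on the right: a time q <= d/2 is approached by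
	  grid points above it, which eventually lie below d.\<close>
	also have "\<dots> <= measure (P 0 j) (below j (d/2))"
	proof (rule finite_measure.finite_measure_mono[OF finite_P])
		show "(\<Inter>n. ?D n) \<subseteq> below j (d/2)"
		proof
			fix w assume w: "w \<in> (\<Inter>n. ?D n)"
			hence om: "w \<in> space M" by blast
			show "w \<in> below j (d/2)" unfolding below_def
			proof (intro CollectI conjI allI)
				fix m
				define q where "q = rats (d/2) m"
				have q: "0 <= q" "q <= d/2" using rats_bounds[of "d/2" m] d by (auto simp: q_def)
				define k where "k n = nat \<lceil>q/h n\<rceil>" for n
				have hpos: "0 < h n" for n using d by (simp add: h_def)
				have k1: "q <= real (k n)*h n" and k2: "real (k n)*h n <= q+h n" for n
				proof -
					have "real (k n) = of_int \<lceil>q/h n\<rceil>" using q(1) hpos[of n] by (simp add: k_def)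
					hence "q/h n <= real (k n)" "real (k n) <= q/h n+1" by linarith+
					thus "q <= real (k n)*h n" "real (k n)*h n <= q+h n" using hpos[of n] by (simp_all add: field_simps)
				qed
				have hlim: "h \<leadsto> 0"
				proof -
					have "(%n. d*inverse (2 ^ n)) \<leadsto> d*0" by (intro tendsto_mult tendsto_const LIMSEQ_inverse_realpow_zero) simp
					thus ?thesis by (simp add: h_def[abs_def] divide_inverse)
				qed
				have lim: "(%n. real (k n)*h n) \<leadsto> q"
				proof (rule tendsto_sandwich[OF _ _ tendsto_const])
					show "(%n. q+h n) \<leadsto> q" using tendsto_add[OF tendsto_const hlim, of q] by simp
				qed (auto simp: k1 k2)
				have "\<forall>\<^sub>F n in sequentially. real (k n)*h n < d" using lim by (rule order_tendstoD) (use q d in simp)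
				hence ev: "\<forall>\<^sub>F n in sequentially. X (real (k n)*h n) w-X 0 w \<in> {..0} & J (real (k n)*h n) w = Some j"
				proof eventually_elim
					case (elim n)
					hence "real (k n) < 2 ^ n" using hpos[of n] hK[of n] by (metis mult_less_cancel_right_pos of_nat_numeral of_nat_power)
					hence "k n < Suc (2 ^ n)" by (metis less_SucI of_nat_less_iff of_nat_numeral of_nat_power)
					thus ?case using w by blast
				qed
				have Xl: "(%n. X (real (k n)*h n) w-X 0 w) \<leadsto> X q w-X 0 w"
					by (intro tendsto_diff tendsto_const continuous_at_right_seq[OF X_rc[OF om q(1)] k1 lim])
				have "X q w-X 0 w <= 0"
					by (rule tendsto_upperbound[OF Xl]) (use ev in \<open>auto elim: eventually_mono\<close>)
				thus "X (rats (d/2) m) w-X 0 w \<in> {..0}" by (simp add: q_def)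
				obtain e where e: "e > 0" "\<forall>s\<in>{q..q+e}. J s w = J q w" using J_rc[OF om q(1)] by blast
				have "\<forall>\<^sub>F n in sequentially. real (k n)*h n < q+e" using lim by (rule order_tendstoD) (use e(1) in simp)
				hence "\<forall>\<^sub>F n in sequentially. J q w = Some j" using ev
				proof eventually_elim
					case (elim n)
					have "J (real (k n)*h n) w = J q w" by (rule bspec[OF e(2)]) (use elim(1) k1[of n] in simp)
					thus ?case using elim(2) by simp
				qed
				thus "J (rats (d/2) m) w = Some j" by (simp add: q_def)
			qed (rule om)
		qed
	qed simp
	also have "\<dots> = 0" by (rule below_null) (use d in simp)
	finally have "?m ?B = 0" by (simp add: measure_le_0_iff)
	moreover have "?B \<in> sets M" by measurable
	ultimately have "?B \<in> null_sets (P x i)" by (simp add: null_sets_def finite_measure.emeasure_eq_measure[OF finite_P])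
	have inF: "{w\<in>space M. J t w = Some j & (\<forall>v\<in>{t..t+d}. J v w = Some j & X (t+d) w <= X v w)} \<subseteq> ?F n" for n
	proof
		fix w assume w: "w \<in> {w\<in>space M. J t w = Some j & (\<forall>v\<in>{t..t+d}. J v w = Some j & X (t+d) w <= X v w)}"
		have 1: "t+real k*h n \<in> {t..t+d}" if "k <= 2 ^ n" for k using le1[OF that] h0[of n] by simp
		have "J (t+real (Suc k)*h n) w = Some j" if "k < 2 ^ n" for k
			using w 1[of "Suc k"] that by auto
		moreover have "X (t+real (2 ^ n)*h n) w <= X (t+real k*h n) w" if "k <= 2 ^ n" for k
			using w 1[OF that] unfolding hK by auto
		ultimately show "w \<in> ?F n" using w by blast
	qed
	show ?thesis by (rule AE_I'[OF \<open>?B \<in> null_sets (P x i)\<close>]) (use inF in auto)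
qed

end

lemma (in map_process) alive_before:
	assumes "w \<in> space M" "0 <= s" "s <= t" "J t w ~= None"
	shows "J s w ~= None"
proof
	assume "J s w = None"
	from J_absorb[OF assms(1-3) this] show False using assms(4) by simp
qed

section \<open>No mass at the lower barrier; every level of the upper regulator is passed unless
  killing occurs\<close>

context regular_reflected_map
begin

text \<open>Compare s with t = s - d. On a calm piece [t, s] in one phase, being at -a at time s
  makes X s the minimum over the piece, a null event by \<open>min_at_end_null\<close>. What remains
  is that the piece is not calm, which has probability tending to 0 with d.\<close>

lemma bottom_null:
	assumes s: "0 < s"
	shows "AE w in P x i. w \<in> G --> J s w ~= None --> X s w+Rl s w-Ru s w ~= - a"
proof -
	define S where "S = {w\<in>space M. w \<in> G & J s w ~= None & X s w+Rl s w-Ru s w = - a}"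
	have [measurable]: "S \<in> sets M" unfolding S_def by measurable
	have bd: "measure (P x i) S <= (\<Sum>j\<in>UNIV. 1-measure (P 0 j) (calm j d))"
		if d: "d = 1/real (Suc n)" "d < s" for n d
	proof -
		define t where "t = s-d"
		have d0: "0 < d" using d by simp
		have t0: "0 <= t" and s_eq: "s = t+d" using d by (simp_all add: t_def)
		define Cc where "Cc j = {w\<in>space M. J t w = Some j \<and>
				(\<forall>m. X (t+rats d m) w-X t w \<in> {- a/3..a/3} & J (t+rats d m) w = Some j)}" for j
		define Jt where "Jt j = {w\<in>space M. J t w = Some j}" for j
		have [measurable]: "Cc j \<in> sets M" "Jt j \<in> sets M" for j unfolding Cc_def Jt_def by measurable
		have mC: "measure (P x i) (Cc j) = measure (P x i) (Jt j)*measure (P 0 j) (calm j d)" for j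
			unfolding Cc_def Jt_def calm_def by (rule markov1_space[OF t0]) (use rats_bounds(2) d0 in auto)
		have inc: "AE w in P x i. w \<in> S --> w \<in> (\<Union>j. Jt j-Cc j)"
		proof -
			have "AE w in P x i. \<forall>j\<in>UNIV. \<not> (J t w = Some j & (\<forall>v\<in>{t..t+d}. J v w = Some j & X (t+d) w <= X v w))"
				by (intro AE_finite_allI ballI min_at_end_null t0 d0) simp
			thus ?thesis
			proof (rule AE_mp, intro AE_I2 impI)
				fix w assume *: "\<forall>j\<in>UNIV. \<not> (J t w = Some j & (\<forall>v\<in>{t..t+d}. J v w = Some j & X (t+d) w <= X v w))"
					and w: "w \<in> S"
				have om: "w \<in> space M" and G: "w \<in> G" and Js: "J s w ~= None" and hs: "X s w+Rl s w-Ru s w = - a"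
					using w by (auto simp: S_def)
				interpret reflected_phase a "%t. X t w" "%t. Rl t w" "%t. Ru t w" "%t. J t w" by (rule path[OF G])
				have "J t w ~= None" by (rule alive_before[OF om t0 _ Js]) (use d0 in \<open>simp add: s_eq\<close>)
				then obtain j where j: "J t w = Some j" by auto
				have "w \<notin> Cc j"
				proof
					assume c: "w \<in> Cc j"
					have q: "\<bar>X q w-X t w\<bar> <= a/3 & J q w = Some j" if "q-t \<in> \<rat> \<inter> {0..d}" for q
					proof -
						have "q-t \<in> range (rats d)" using range_rats[of d] d0 that by simp
						then obtain m where m: "rats d m = q-t" by (rule rangeE) (rule that[OF sym])
						have "X (t+rats d m) w-X t w \<in> {- a/3..a/3} & J (t+rats d m) w = Some j"
							by (rule CollectE[OF c[unfolded Cc_def]]) (elim conjE, erule spec)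
						hence "- a/3 <= X q w-X t w & X q w-X t w <= a/3 & J q w = Some j" unfolding m by simp
						thus ?thesis unfolding abs_le_iff by linarith
					qed
					\<comment> \<open>The bounds are given at rational offsets from t. The endpoint s is one of
					  these because d = 1/(n + 1) is rational; every other time is a limit of them from the
					  right.\<close>
					have all: "\<bar>X v w-X t w\<bar> <= a/3 & J v w = Some j" if v: "t <= v" "v <= s" for v
					proof (cases "v = s")
						case True
						have "d \<in> \<rat>" using d by simp
						thus ?thesis unfolding True by (intro q) (use d0 in \<open>auto simp: s_eq\<close>)
					next
						case False
						hence lt: "v-t < d" using v by (simp add: s_eq)
						have "\<forall>k. \<exists>p. p \<in> \<rat> & v-t < p & p < min d (v-t+1/real (Suc k))"
						proof
							fix k
							have "v-t < min d (v-t+1/real (Suc k))" using lt by simp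
							from Rats_dense_in_real[OF this] show "\<exists>p. p \<in> \<rat> & v-t < p & p < min d (v-t+1/real (Suc k))" by auto
						qed
						from choice[OF this] obtain p where p: "\<And>k. p k \<in> \<rat> & v-t < p k & p k < min d (v-t+1/real (Suc k))" by blast
						have pl: "(%k. t+p k) \<leadsto> v"
						proof (rule tendsto_sandwich[OF _ _ tendsto_const])
							show "(%k. v + 1/real (Suc k)) \<leadsto> v"
								using tendsto_add[OF tendsto_const LIMSEQ_inverse_real_of_nat, of v] by (simp add: inverse_eq_divide)
							show "\<forall>\<^sub>F k in sequentially. v <= t+p k" "\<forall>\<^sub>F k in sequentially. t+p k <= v + 1/real (Suc k)"
								using p by (auto intro!: always_eventually simp: less_imp_le) (smt (verit) min_less_iff_conj p)+
						qed
						have v0: "0 <= v" using v t0 by simp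
						have vp: "v <= t+p k" for k using p[of k] by simp
						have Q: "\<bar>X (t+p k) w-X t w\<bar> <= a/3 & J (t+p k) w = Some j" for k
							using p[of k] v by (intro q) auto
						have "(%k. \<bar>X (t+p k) w-X t w\<bar>) \<leadsto> \<bar>X v w-X t w\<bar>"
							by (intro tendsto_rabs tendsto_diff tendsto_const continuous_at_right_seq[OF x_rc[OF v0] vp pl])
						hence "\<bar>X v w-X t w\<bar> <= a/3" by (rule LIMSEQ_le_const2) (use Q in blast)
						moreover have "\<forall>\<^sub>F k in sequentially. J (t+p k) w = J v w" by (rule j_eventually[OF v0 vp pl])
						hence "\<forall>\<^sub>F k in sequentially. J v w = Some j"
						proof eventually_elim
							case (elim k)
							thus ?case using Q[of k] by simp
						qed
						ultimately show ?thesis by simp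
					qed
					have "h s = - a" using hs by (simp add: h_def)
					hence "X s w <= X v w" if "t <= v" "v <= s" for v
						using small_osc_at_bottom[OF t0, of s v] all that d0 by (auto simp: s_eq)
					hence "J t w = Some j & (\<forall>v\<in>{t..t+d}. J v w = Some j & X (t+d) w <= X v w)"
						using all j by (auto simp: s_eq)
					thus False using * by blast
				qed
				thus "w \<in> (\<Union>j. Jt j-Cc j)" using j om by (auto simp: Jt_def)
			qed
		qed
		have "measure (P x i) S <= measure (P x i) (\<Union>j. Jt j-Cc j)"
			by (rule finite_measure.finite_measure_mono_AE[OF finite_P inc]) (auto intro!: sets.finite_UN)
		also have "\<dots> <= (\<Sum>j\<in>UNIV. measure (P x i) (Jt j-Cc j))"
			by (rule measure_UNION_le) auto
		also have "\<dots> <= (\<Sum>j\<in>UNIV. 1-measure (P 0 j) (calm j d))"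
		proof (rule sum_mono)
			fix j
			have "Cc j \<subseteq> Jt j" by (auto simp: Cc_def Jt_def)
			hence "measure (P x i) (Jt j-Cc j) = measure (P x i) (Jt j)-measure (P x i) (Cc j)"
				by (intro finite_measure.finite_measure_Diff[OF finite_P]) auto
			also have "\<dots> = measure (P x i) (Jt j)*(1-measure (P 0 j) (calm j d))" by (simp add: mC right_diff_distrib)
			also have "\<dots> <= 1*(1-measure (P 0 j) (calm j d))"
				by (intro mult_right_mono prob_space.prob_le_1[OF prob]) (simp add: prob_space.prob_le_1[OF prob])
			finally show "measure (P x i) (Jt j-Cc j) <= 1-measure (P 0 j) (calm j d)" by simp
		qed
		finally show ?thesis .
	qed
	have lim: "(%n. \<Sum>j\<in>UNIV. 1-measure (P 0 j) (calm j (1/real (Suc n)))) \<leadsto> (\<Sum>j\<in>(UNIV::'n set). 1-1)"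
		by (intro tendsto_sum tendsto_diff tendsto_const calm_tendsto)
	have "\<forall>\<^sub>F n in sequentially. 1/real (Suc n) < s"
		using LIMSEQ_inverse_real_of_nat s by (intro order_tendstoD) (auto simp: inverse_eq_divide)
	hence "\<forall>\<^sub>F n in sequentially. measure (P x i) S <= (\<Sum>j\<in>UNIV. 1-measure (P 0 j) (calm j (1/real (Suc n))))"
		by eventually_elim (rule bd[OF refl])
	hence "measure (P x i) S <= (\<Sum>j\<in>(UNIV::'n set). 1-1)" by (rule tendsto_lowerbound[OF lim]) simp
	hence "measure (P x i) S = 0" by (simp add: measure_le_0_iff)
	hence "S \<in> null_sets (P x i)" by (simp add: null_sets_def finite_measure.emeasure_eq_measure[OF finite_P])
	thus ?thesis by (rule AE_I') (auto simp: S_def)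
qed

text \<open>If X had no chance to be above its start while in phase i, calm paths would almost
  surely lie in \<open>below\<close>, which is null, whereas calm has probability near 1 over short
  times. A gain e of positive probability is then repeated until it exceeds L.\<close>

lemma climb: "\<exists>t\<ge>0. 0 < measure (P 0 i) {w\<in>space M. X t w-X 0 w \<in> {L<..} & J t w = Some i}"
proof -
	have "\<exists>t\<ge>0. \<exists>e>0. 0 < measure (P 0 i) {w\<in>space M. X t w-X 0 w \<in> {e<..} & J t w = Some i}"
	proof (rule ccontr)
		assume neg: "\<not> ?thesis"
		define D where "D t k = {w\<in>space M. X t w-X 0 w \<in> {1/real (Suc k)<..} & J t w = Some i}" for t k
		have [measurable]: "D t k \<in> sets M" for t k unfolding D_def by measurable
		have "measure (P 0 i) (D t k) = 0" if "0 <= t" for t k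
			unfolding D_def using neg that by (meson divide_pos_pos linorder_neqE_linordered_idom measure_nonneg not_less of_nat_0_less_iff zero_less_Suc zero_less_one)
		hence Dn: "D t k \<in> null_sets (P 0 i)" if "0 <= t" for t k
			using that by (simp add: null_sets_def finite_measure.emeasure_eq_measure[OF finite_P])
		have z: "measure (P 0 i) (calm i (1/real (Suc n))) = 0" for n
		proof -
			let ?d = "1/real (Suc n)"
			have "AE w in P 0 i. \<forall>m k. w \<notin> D (rats ?d m) k"
				unfolding AE_all_countable by (intro allI AE_not_in Dn rats_bounds(2)) simp
			hence "AE w in P 0 i. w \<in> calm i ?d --> w \<in> below i ?d"
			proof (rule AE_mp, intro AE_I2 impI)
				fix w assume D: "\<forall>m k. w \<notin> D (rats ?d m) k" and c: "w \<in> calm i ?d"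
				show "w \<in> below i ?d" unfolding below_def
				proof (intro CollectI conjI allI)
					show om: "w \<in> space M" using c by (simp add: calm_def)
					fix m
					show Jm: "J (rats ?d m) w = Some i" using c unfolding calm_def by blast
					show "X (rats ?d m) w-X 0 w \<in> {..0}"
					proof (rule ccontr)
						assume "X (rats ?d m) w-X 0 w \<notin> {..0}"
						hence "0 < X (rats ?d m) w-X 0 w" by simp
						then obtain k where "inverse (real (Suc k)) < X (rats ?d m) w-X 0 w" using reals_Archimedean by blast
						hence "w \<in> D (rats ?d m) k" using om Jm by (simp add: D_def inverse_eq_divide)
						thus False using D by blast
					qed
				qed
			qed
			hence "measure (P 0 i) (calm i ?d) <= measure (P 0 i) (below i ?d)"
				by (rule finite_measure.finite_measure_mono_AE[OF finite_P]) simp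
			also have "\<dots> = 0" by (rule below_null) simp
			finally show ?thesis by (simp add: measure_le_0_iff)
		qed
		show False using calm_tendsto[of i] unfolding z by (simp add: LIMSEQ_const_iff)
	qed
	then obtain t e where t: "0 <= t" "0 < e" and p: "0 < measure (P 0 i) {w\<in>space M. X t w-X 0 w \<in> {e<..} & J t w = Some i}" by blast
	have it: "0 < measure (P 0 i) {w\<in>space M. X (real (Suc k)*t) w-X 0 w \<in> {real (Suc k)*e<..} & J (real (Suc k)*t) w = Some i}" for k
	proof (induction k)
		case (Suc k)
		let ?s = "real (Suc k)*t"
		have s0: "0 <= ?s" using t by simp
		let ?J0 = "{w\<in>space M. J 0 w = Some i}"
		let ?A = "{w\<in>space M. X ?s w-X 0 w \<in> {real (Suc k)*e<..} & J ?s w = Some i}"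
		\<comment> \<open>\<open>?A'\<close> is \<open>?A\<close> expressed through \<open>XA\<close> and
		  survival, in which form it visibly belongs to the history.\<close>
		let ?A' = "{w\<in>space M. J 0 w ~= None & J ?s w = Some i & XA ?s w-XA 0 w \<in> {real (Suc k)*e<..}}"
		have A': "?A' \<in> sets (hist ?s)"
		proof -
			let ?H = "hist ?s"
			have R: "(%w. XA ?s w-XA 0 w) \<in> Bor ?H"
				by (intro borel_measurable_diff XA_hist s0 order_refl)
			have "{w\<in>space ?H. J 0 w ~= None} \<in> sets ?H"
				by (rule predE, rule measurable_compose[OF J_hist[OF order_refl s0]]) simp
			moreover have "{w\<in>space ?H. J ?s w = Some i} \<in> sets ?H"
				by (rule predE, rule measurable_compose[OF J_hist[OF s0 order_refl]]) simp
			moreover have "{w\<in>space ?H. XA ?s w-XA 0 w \<in> {real (Suc k)*e<..}} \<in> sets ?H"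
				using borel_measurable_less[OF borel_measurable_const R] by simp
			ultimately have "{w\<in>space ?H. J 0 w ~= None & J ?s w = Some i & XA ?s w-XA 0 w \<in> {real (Suc k)*e<..}} \<in> sets ?H"
				by (intro sets.sets_Collect_conj)
			thus ?thesis by simp
		qed
		have "J 0 w ~= None" if "w \<in> space M" "J ?s w = Some i" for w
			by (rule alive_before[OF that(1) order_refl s0]) (use that(2) in simp)
		hence "?A' = ?A" by (auto simp: XA_def)
		have A: "?A \<in> sets (hist ?s)" using A' unfolding \<open>?A' = ?A\<close> .
		have "measure (P 0 i) (?A \<inter> {w\<in>space M. J ?s w = Some i & X (?s+t) w-X ?s w \<in> {e<..} & J (?s+t) w = Some i})
			 = measure (P 0 i) (?A \<inter> {w\<in>space M. J ?s w = Some i})*measure (P 0 i) {w\<in>space M. X t w-X 0 w \<in> {e<..} & J t w = Some i}"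
			by (rule markov1[OF s0 A t(1)]) simp
		also have "?A \<inter> {w\<in>space M. J ?s w = Some i} = ?A" by blast
		also have "0 < measure (P 0 i) ?A*measure (P 0 i) {w\<in>space M. X t w-X 0 w \<in> {e<..} & J t w = Some i}"
			by (rule mult_pos_pos[OF Suc p])
		also (xtrans) have "measure (P 0 i) (?A \<inter> {w\<in>space M. J ?s w = Some i & X (?s+t) w-X ?s w \<in> {e<..} & J (?s+t) w = Some i})
			\<le> measure (P 0 i) {w\<in>space M. X (real (Suc (Suc k))*t) w-X 0 w \<in> {real (Suc (Suc k))*e<..} & J (real (Suc (Suc k))*t) w = Some i}"
		proof (rule finite_measure.finite_measure_mono[OF finite_P])
			have st: "?s+t = real (Suc (Suc k))*t" by (simp add: distrib_right)
			have ee: "real (Suc k)*e+e = real (Suc (Suc k))*e" by (simp add: distrib_right)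
			show "?A \<inter> {w\<in>space M. J ?s w = Some i & X (?s+t) w-X ?s w \<in> {e<..} & J (?s+t) w = Some i}
				\<subseteq> {w\<in>space M. X (real (Suc (Suc k))*t) w-X 0 w \<in> {real (Suc (Suc k))*e<..} & J (real (Suc (Suc k))*t) w = Some i}"
				unfolding st[symmetric] ee[symmetric] by auto
		qed measurable
		finally show ?case .
	qed (use p in simp)
	obtain k where k: "L/e <= real k" using real_arch_simple by blast
	hence "L <= real (Suc k)*e" using t(2) by (simp add: field_simps)
	hence "measure (P 0 i) {w\<in>space M. X (real (Suc k)*t) w-X 0 w \<in> {real (Suc k)*e<..} & J (real (Suc k)*t) w = Some i}
		 <= measure (P 0 i) {w\<in>space M. X (real (Suc k)*t) w-X 0 w \<in> {L<..} & J (real (Suc k)*t) w = Some i}"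
		by (intro finite_measure.finite_measure_mono[OF finite_P]) auto
	with it[of k] t(1) show ?thesis by (intro exI[of _ "real (Suc k)*t"]) auto
qed

text \<open>An increase of X by more than r + a within a block forces R_u above r. From every phase
  this happens within N time units with probability at least c, so being alive after k blocks with
  R_u still at most r has probability at most (1 - c)^k.\<close>

lemma passes_or_killed:
	assumes r: "0 <= r"
	shows "AE w in P x i. w \<in> G --> (\<exists>n::nat. r < Ru (real n) w | J (real n) w = None)"
proof -
	define D where "D j t = {w\<in>space M. X t w-X 0 w \<in> {r+a<..} & J t w = Some j}" for j t
	have "\<forall>j. \<exists>t. 0 <= t & 0 < measure (P 0 j) (D j t)" unfolding D_def using climb[of _ "r+a"] by blast
	from choice[OF this] obtain T where T: "\<And>j. 0 <= T j" "\<And>j. 0 < measure (P 0 j) (D j (T j))" by blast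
	obtain N :: nat where N: "Max (range T) <= real N" using real_arch_simple by blast
	have TN: "T j <= real N" for j by (rule order_trans[OF Max_ge N]) auto
	define c where "c = Min (range (%j. measure (P 0 j) (D j (T j))))"
	have c0: "0 < c" unfolding c_def using T(2) by (subst Min_gr_iff) auto
	have cle: "c <= measure (P 0 j) (D j (T j))" for j unfolding c_def by (rule Min_le) auto
	have c1: "c <= 1" using cle[of undefined] prob_space.prob_le_1[OF prob] by (rule order_trans)
	define A where "A k = {w\<in>space M. J (real (k*N)) w ~= None & GA w & RuA (real (k*N)) w <= r}" for k
	have Ah: "A k \<in> sets (hist (real (k*N)))" for k
	proof -
		let ?H = "hist (real (k*N))"
		have "{w\<in>space ?H. J (real (k*N)) w ~= None} \<in> sets ?H"
			by (rule predE, rule measurable_compose[OF J_hist[OF of_nat_0_le_iff order_refl]]) simp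
		moreover have "{w\<in>space ?H. GA w} \<in> sets ?H" by (rule predE[OF GA_hist]) simp
		moreover have "{w\<in>space ?H. RuA (real (k*N)) w <= r} \<in> sets ?H" by (rule borel_measurable_le[OF RuA_hist borel_measurable_const])
		ultimately have "{w\<in>space ?H. J (real (k*N)) w ~= None & GA w & RuA (real (k*N)) w <= r} \<in> sets ?H"
			by (intro sets.sets_Collect_conj)
		thus ?thesis by (simp add: A_def)
	qed
	have AM [measurable]: "A k \<in> sets M" for k by (rule subsetD[OF hist_subset Ah])
	have A_iff: "w \<in> A k ==> w \<in> space M & w \<in> G & J (real (k*N)) w ~= None & Ru (real (k*N)) w <= r" for k w
	proof -
		assume w: "w \<in> A k"
		hence om: "w \<in> space M" and j: "J (real (k*N)) w ~= None" by (auto simp: A_def)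
		have G: "w \<in> G" using w GA_G[OF om of_nat_0_le_iff j] by (simp add: A_def)
		have "RuA (real (k*N)) w = Ru (real (k*N)) w" by (rule RA_eq(2)[OF G _ of_nat_0_le_iff j]) (rule Rats_of_nat)
		thus ?thesis using w om G j by (auto simp: A_def)
	qed
	have step: "measure (P x i) (A (Suc k)) <= (1-c)*measure (P x i) (A k)" for k
	proof -
		let ?t = "real (k*N)"
		define B where "B j = A k \<inter> {w\<in>space M. J ?t w = Some j}" for j
		define E where "E j = A k \<inter> {w\<in>space M. J ?t w = Some j & X (?t+T j) w-X ?t w \<in> {r+a<..} & J (?t+T j) w = Some j}" for j
		have [measurable]: "B j \<in> sets M" "E j \<in> sets M" for j unfolding B_def E_def by measurable
		have mE: "measure (P x i) (E j) = measure (P x i) (B j)*measure (P 0 j) (D j (T j))" for j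
			unfolding E_def B_def D_def by (rule markov1[OF of_nat_0_le_iff Ah T(1)]) simp
		have sub: "A (Suc k) \<subseteq> (\<Union>j. B j-E j)"
		proof
			fix w assume "w \<in> A (Suc k)"
			note w = A_iff[OF this]
			interpret reflected_phase a "%t. X t w" "%t. Rl t w" "%t. Ru t w" "%t. J t w" by (rule path) (use w in simp)
			have om: "w \<in> space M" using w by simp
			have le: "?t <= real (Suc k*N)" by simp
			have J: "J ?t w ~= None" by (rule alive_before[OF om of_nat_0_le_iff le]) (use w in blast)
			have "Ru ?t w <= r" using u_mono[OF of_nat_0_le_iff le] w by auto
			moreover have "RuA ?t w = Ru ?t w" by (rule RA_eq(2)[OF _ _ of_nat_0_le_iff J]) (use w in \<open>auto intro: Rats_of_nat\<close>)
			ultimately have "w \<in> A k" using om J GA_G[OF om of_nat_0_le_iff J] w by (simp add: A_def)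
			moreover obtain j where j: "J ?t w = Some j" using J by auto
			moreover have "w \<notin> E j"
			proof
				assume "w \<in> E j"
				hence "r+a < X (?t+T j) w-X ?t w" by (auto simp: E_def)
				hence "r < Ru (?t+T j) w" using T(1)[of j] by (intro large_increment[of ?t]) auto
				also have "\<dots> <= Ru (real (Suc k*N)) w" using T(1)[of j] TN[of j] by (intro u_mono) auto
				finally show False using w by simp
			qed
			ultimately show "w \<in> (\<Union>j. B j-E j)" using om by (auto simp: B_def)
		qed
		have "measure (P x i) (A (Suc k)) <= measure (P x i) (\<Union>j. B j-E j)"
			by (rule finite_measure.finite_measure_mono[OF finite_P sub]) (auto intro!: sets.finite_UN)
		also have "\<dots> <= (\<Sum>j\<in>UNIV. measure (P x i) (B j-E j))" by (rule measure_UNION_le) auto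
		also have "\<dots> <= (\<Sum>j\<in>UNIV. (1-c)*measure (P x i) (B j))"
		proof (rule sum_mono)
			fix j
			have "E j \<subseteq> B j" by (auto simp: E_def B_def)
			hence "measure (P x i) (B j-E j) = measure (P x i) (B j)-measure (P x i) (E j)"
				by (intro finite_measure.finite_measure_Diff[OF finite_P]) auto
			also have "\<dots> = (1-measure (P 0 j) (D j (T j)))*measure (P x i) (B j)" by (simp add: mE left_diff_distrib)
			also have "\<dots> <= (1-c)*measure (P x i) (B j)" using cle[of j] by (intro mult_right_mono) auto
			finally show "measure (P x i) (B j-E j) <= (1-c)*measure (P x i) (B j)" .
		qed
		also have "\<dots> = (1-c)*measure (P x i) (A k)"
		proof -
			have "measure (P x i) (A k) = (\<Sum>j\<in>UNIV. measure (P x i) (B j))"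
				unfolding B_def by (rule measure_phase_split[OF AM of_nat_0_le_iff]) (use A_iff in blast)
			thus ?thesis by (simp add: sum_distrib_left)
		qed
		finally show ?thesis .
	qed
	have pow: "measure (P x i) (A k) <= (1-c) ^ k" for k
	proof (induction k)
		case (Suc k)
		have "(1-c)*measure (P x i) (A k) <= (1-c)*(1-c) ^ k" using Suc c1 by (intro mult_left_mono) auto
		with step[of k] show ?case by simp
	qed (simp add: prob_space.prob_le_1[OF prob])
	have "(%k. (1-c) ^ k) \<leadsto> 0" using c0 c1 by (intro LIMSEQ_realpow_zero) auto
	moreover have "measure (P x i) (\<Inter>k. A k) <= (1-c) ^ k" for k
		by (rule order_trans[OF _ pow], rule finite_measure.finite_measure_mono[OF finite_P]) auto
	ultimately have "measure (P x i) (\<Inter>k. A k) <= 0" by (intro LIMSEQ_le_const) auto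
	hence "measure (P x i) (\<Inter>k. A k) = 0" by (simp add: measure_le_0_iff)
	moreover have "(\<Inter>k. A k) \<in> sets M" by measurable
	ultimately have null: "(\<Inter>k. A k) \<in> null_sets (P x i)" by (simp add: null_sets_def finite_measure.emeasure_eq_measure[OF finite_P])
	have pk: "\<exists>n::nat. r < Ru (real n) w | J (real n) w = None" if w: "w \<in> G" "w \<notin> (\<Inter>k. A k)" for w
	proof -
		obtain k where k: "w \<notin> A k" using w by blast
		have om: "w \<in> space M" using w by (simp add: G_space)
		show ?thesis
		proof (intro exI[of _ "k*N"] disjCI)
			assume J: "J (real (k*N)) w ~= None"
			have "RuA (real (k*N)) w = Ru (real (k*N)) w" by (rule RA_eq(2)[OF w(1) Rats_of_nat of_nat_0_le_iff J])
			thus "r < Ru (real (k*N)) w" using k om J GA_G[OF om of_nat_0_le_iff J] w(1) by (auto simp: A_def)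
		qed
	qed
	show ?thesis
	proof (rule AE_I'[OF null], rule subsetI, rule ccontr)
		fix w assume "w \<in> {w\<in>space (P x i). \<not> (w \<in> G --> (\<exists>n::nat. r < Ru (real n) w | J (real n) w = None))}" "w \<notin> (\<Inter>k. A k)"
		thus False using pk[of w] by blast
	qed
qed

end

subsection \<open>Laplace transforms of integrated functions\<close>

text \<open>The integral defining W is a gauge integral over the half-line and may converge only
  conditionally; the limit of truncated integrals is what can be extracted from it.\<close>

lemma has_integral_at_top:
	fixes f :: "real => real"
	assumes "(f has_integral I) {0..}"
	shows "((%T. integral {0..T} f) \<longlongrightarrow> I) at_top"
proof (rule tendstoI)
	fix e :: real assume e: "0 < e"
	obtain B where B: "0 < B" "\<And>a b. ball 0 B \<subseteq> cbox a b ==>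
			\<exists>z. ((%x. if x \<in> {0..} then f x else 0) has_integral z) (cbox a b) & norm (z-I) < e"
		using assms e unfolding has_integral'[of f I] by meson
	show "\<forall>\<^sub>F T in at_top. dist (integral {0..T} f) I < e"
	proof (rule eventually_at_top_linorderI[of B])
		fix T assume T: "B <= T"
		have "ball 0 B \<subseteq> cbox (-T) T" using T by (auto simp: dist_real_def)
		from B(2)[OF this] obtain z where z: "((%x. if x \<in> {0..} then f x else 0) has_integral z) (cbox (-T) T)" "norm (z-I) < e" by blast
		have "{0..} \<inter> cbox (-T) T = {0..T}" using T B(1) by auto
		hence "(f has_integral z) {0..T}" using z(1) unfolding has_integral_restrict_Int by (simp only:)
		thus "dist (integral {0..T} f) I < e" using z(2) by (simp add: integral_unique dist_norm)
	qed
qed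

lemma bounded_at_top:
	fixes B :: "real => real"
	assumes c: "continuous_on {0..} B" and l: "(B \<longlongrightarrow> L) at_top"
	obtains C where "0 <= C" "\<And>x. 0 <= x ==> \<bar>B x\<bar> <= C"
proof -
	have "\<forall>\<^sub>F T in at_top. \<bar>B T\<bar> < \<bar>L\<bar>+1" using tendsto_rabs[OF l] by (rule order_tendstoD) simp
	then obtain T0 where T0: "\<And>T. T0 <= T ==> \<bar>B T\<bar> < \<bar>L\<bar>+1" by (auto simp: eventually_at_top_linorder)
	have "compact (B ` {0..T0})" using c by (intro compact_continuous_image) (auto elim: continuous_on_subset)
	then obtain C where C: "\<And>x. x \<in> {0..T0} ==> norm (B x) <= C" by (meson bounded_iff compact_imp_bounded imageI)
	show thesis
	proof (rule that[of "max C (\<bar>L\<bar>+1)"])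
		fix x :: real assume "0 <= x"
		thus "\<bar>B x\<bar> <= max C (\<bar>L\<bar>+1)" using C[of x] T0[of x] by (cases "x <= T0") auto
	qed simp
qed

lemma laplace_antideriv:
	fixes g G :: "real => real"
	assumes g: "continuous_on {0..} g" and c: "0 < c" and G: "\<And>x. 0 <= x ==> G x = integral {0..x} g"
		and L: "((%T. integral {0..T} (%x. exp (- c*x)*g x)) \<longlongrightarrow> L) at_top"
		and z: "((%T. exp (- c*T)*G T) \<longlongrightarrow> 0) at_top"
	shows "((%T. integral {0..T} (%x. exp (- c*x)*G x)) \<longlongrightarrow> L/c) at_top"
proof -
	have eq: "integral {0..T} (%x. exp (- c*x)*G x) = integral {0..T} (%x. exp (- c*x)*g x)/c-exp (- c*T)*G T/c"
		if T: "0 <= T" for T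
	proof -
		let ?G = "%x. integral {0..x} g"
		have gT: "continuous_on {0..T} g" by (rule continuous_on_subset[OF g]) auto
		have "((%x. exp (- c*x)*?G x-exp (- c*x)*g x/c) has_integral (- (exp (- c*T)*?G T/c) - - (exp (- c*0)*?G 0/c))) {0..T}"
		proof (rule fundamental_theorem_of_calculus[OF T])
			fix x assume x: "x \<in> {0..T}"
			have d: "(?G has_real_derivative g x) (at x within {0..T})" by (rule integral_has_real_derivative[OF gT x])
			have "((%x. exp (- c*x)) has_real_derivative exp (- c*x)*- c) (at x within {0..T})"
				by (auto intro!: derivative_eq_intros)
			from DERIV_minus[OF DERIV_cdivide[OF DERIV_mult[OF this d], of c]]
			have "((%x. - (exp (- c*x)*?G x/c)) has_real_derivative-((exp (- c*x)*- c*?G x+g x*exp (- c*x))/c)) (at x within {0..T})" .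
			thus "((%x. - (exp (- c*x)*?G x/c)) has_vector_derivative exp (- c*x)*?G x-exp (- c*x)*g x/c) (at x within {0..T})"
				unfolding has_real_derivative_iff_has_vector_derivative[symmetric] by (rule DERIV_cong) (use c in \<open>simp add: field_simps\<close>)
		qed
		hence 1: "((%x. exp (- c*x)*?G x-exp (- c*x)*g x/c) has_integral-(exp (- c*T)*?G T/c)) {0..T}" by simp
		have "continuous_on {0..T} (%x. exp (- c*x)*g x)" by (intro continuous_intros gT)
		hence "(%x. exp (- c*x)*g x) integrable_on {0..T}" by (rule integrable_continuous_real)
		hence "((%x. exp (- c*x)*g x/c) has_integral (integral {0..T} (%x. exp (- c*x)*g x)/c)) {0..T}"
			by (intro has_integral_divide integrable_integral)
		from has_integral_add[OF 1 this]
		have "((%x. exp (- c*x)*?G x) has_integral (- (exp (- c*T)*?G T/c)+integral {0..T} (%x. exp (- c*x)*g x)/c)) {0..T}" by simp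
		hence "((%x. exp (- c*x)*G x) has_integral (- (exp (- c*T)*?G T/c)+integral {0..T} (%x. exp (- c*x)*g x)/c)) {0..T}"
			by (rule has_integral_eq[rotated]) (simp add: G)
		thus ?thesis using G[OF T] by (simp add: integral_unique)
	qed
	have "((%T. integral {0..T} (%x. exp (- c*x)*g x)/c-exp (- c*T)*G T/c) \<longlongrightarrow> L/c-0/c) at_top"
		using c by (intro tendsto_intros L z) auto
	hence "((%T. integral {0..T} (%x. exp (- c*x)*g x)/c-exp (- c*T)*G T/c) \<longlongrightarrow> L/c) at_top" by simp
	thus ?thesis
		by (rule Lim_transform_eventually) (rule eventually_at_top_linorderI[of 0], rule eq[symmetric])
qed

lemma integral_exp_le:
	fixes g :: "real => real"
	assumes b: "0 < b" and x: "0 <= x" and g: "continuous_on {0..x} g" and C: "0 <= C" "\<And>y. 0 <= y ==> y <= x ==> \<bar>g y\<bar> <= C*exp (b*y)"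
	shows "\<bar>integral {0..x} g\<bar> <= C/b*exp (b*x)"
proof -
	have e: "((%y. C*exp (b*y)) has_integral (C/b*exp (b*x)-C/b*exp (b*0))) {0..x}"
	proof (rule fundamental_theorem_of_calculus[OF x])
		fix y
		have "((%y. C/b*exp (b*y)) has_real_derivative C*exp (b*y)) (at y within {0..x})"
			using b by (auto intro!: derivative_eq_intros)
		thus "((%y. C/b*exp (b*y)) has_vector_derivative C*exp (b*y)) (at y within {0..x})"
			by (simp add: has_real_derivative_iff_has_vector_derivative)
	qed
	have "norm (integral {0..x} g) <= integral {0..x} (%y. C*exp (b*y))"
		by (rule integral_norm_bound_integral) (use e C integrable_continuous_real[OF g] in \<open>auto simp: has_integral_iff\<close>)
	also have "\<dots> = C/b*exp (b*x)-C/b" unfolding integral_unique[OF e] by simp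
	also have "\<dots> <= C/b*exp (b*x)" using b C by simp
	finally show ?thesis by simp
qed

text \<open>Integration by parts in the manner of Abel: a bounded primitive at the larger parameter
  t controls the primitive at \<alpha>, with growth exp((t - \<alpha>) x).\<close>

lemma antideriv_bound:
	fixes w :: "real => real"
	assumes w: "continuous_on {0..} w" and b: "0 < t - \<alpha>" and C: "0 <= C" "\<And>x. 0 <= x ==> \<bar>integral {0..x} (%y. exp (- t*y)*w y)\<bar> <= C"
		and x: "0 <= x"
	shows "\<bar>integral {0..x} (%y. exp (- \<alpha>*y)*w y)\<bar> <= 2*C*exp ((t - \<alpha>)*x)"
proof -
	let ?b = "t - \<alpha>"
	let ?B = "%x. integral {0..x} (%y. exp (- t*y)*w y)"
	have wx: "continuous_on {0..x} w" by (rule continuous_on_subset[OF w]) auto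
	have cB: "continuous_on {0..x} (%y. exp (- t*y)*w y)" by (intro continuous_intros wx)
	have Bc: "continuous_on {0..x} ?B" by (rule indefinite_integral_continuous_1[OF integrable_continuous_real[OF cB]])
	have "((%y. ?b*exp (?b*y)*?B y+exp (- \<alpha>*y)*w y) has_integral (exp (?b*x)*?B x-exp (?b*0)*?B 0)) {0..x}"
	proof (rule fundamental_theorem_of_calculus[OF x])
		fix y :: real assume y: "y \<in> {0..x}"
		have d: "(?B has_real_derivative exp (- t*y)*w y) (at y within {0..x})" by (rule integral_has_real_derivative[OF cB y])
		have "((%y. exp (?b*y)*?B y) has_real_derivative (exp (?b*y)*(exp (- t*y)*w y)+exp (?b*y)*?b*?B y)) (at y within {0..x})"
			by (rule derivative_eq_intros d refl | simp)+
		moreover have "exp (?b*y)*(exp (- t*y)*w y)+exp (?b*y)*?b*?B y = ?b*exp (?b*y)*?B y+exp (- \<alpha>*y)*w y"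
		proof -
			have "exp (?b*y)*(exp (- t*y)*w y) = exp (- \<alpha>*y)*w y"
				by (simp add: left_diff_distrib flip: exp_add mult.assoc)
			thus ?thesis by (simp only: mult.commute[of "exp (?b*y)" ?b] add.commute)
		qed
		ultimately show "((%y. exp (?b*y)*?B y) has_vector_derivative ?b*exp (?b*y)*?B y+exp (- \<alpha>*y)*w y) (at y within {0..x})"
			unfolding has_real_derivative_iff_has_vector_derivative[symmetric] by (rule DERIV_cong)
	qed
	moreover have i1: "continuous_on {0..x} (%y. ?b*exp (?b*y)*?B y)" by (intro continuous_intros Bc)
	have "(%y. ?b*exp (?b*y)*?B y) integrable_on {0..x}" by (rule integrable_continuous_real[OF i1])
	moreover have "(%y. exp (- \<alpha>*y)*w y) integrable_on {0..x}"
		by (intro integrable_continuous_real continuous_intros wx)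
	ultimately have "integral {0..x} (%y. ?b*exp (?b*y)*?B y)+integral {0..x} (%y. exp (- \<alpha>*y)*w y) = exp (?b*x)*?B x"
		by (simp add: integral_unique flip: Henstock_Kurzweil_Integration.integral_add)
	moreover have "\<bar>integral {0..x} (%y. ?b*exp (?b*y)*?B y)\<bar> <= (?b*C)/?b*exp (?b*x)"
	proof (rule integral_exp_le[OF b x i1])
		fix y :: real assume "0 <= y"
		show "\<bar>?b*exp (?b*y)*?B y\<bar> <= ?b*C*exp (?b*y)"
			using mult_left_mono[OF C(2)[OF \<open>0 \<le> y\<close>], of "?b*exp (?b*y)"] b by (simp add: abs_mult mult_ac)
	qed (use b C in simp)
	moreover have "\<bar>exp (?b*x)*?B x\<bar> <= C*exp (?b*x)" using C(2)[OF x] by (simp add: abs_mult mult.commute)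
	moreover have "(?b*C)/?b = C" using b by simp
	ultimately show ?thesis by simp
qed

lemma lebesgue_laplace:
	fixes h :: "real => real"
	assumes h: "continuous_on UNIV h" and h0: "\<And>x. x <= 0 ==> h x = 0" and C: "\<And>x. \<bar>h x\<bar> <= C*exp (t1*x)" and t: "t1 < t"
		and L: "((%T. integral {0..T} (%x. exp (- t*x)*h x)) \<longlongrightarrow> L) at_top"
	shows "integrable lborel (%x. exp (- t*x)*h x)" "(\<integral>x. exp (- t*x)*h x \<partial>lborel) = L"
proof -
	have [measurable]: "h \<in> Bor borel" by (rule borel_measurable_continuous_onI[OF h])
	\<comment> \<open>The exponential distribution supplies the integrability of exp(-(t - t1) x) on
	  the half-line.\<close>
	let ?e = "exponential_density (t-t1)"
	have pe: "prob_space (density lborel ?e)" by (rule prob_space_exponential_density) (use t in simp)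
	have "emeasure (density lborel ?e) UNIV = 1" using prob_space.emeasure_space_1[OF pe] by simp
	hence "(\<integral>\<^sup>+x. ennreal (?e x) \<partial>lborel) = 1" by (simp add: emeasure_density)
	moreover have e0: "0 <= ?e x" for x using t by (simp add: exponential_density_def)
	ultimately have ei: "integrable lborel ?e" by (intro integrableI_nonneg) auto
	show int: "integrable lborel (%x. exp (- t*x)*h x)"
	proof (rule Bochner_Integration.integrable_bound[of _ "%x. \<bar>C\<bar>/(t-t1)*?e x"])
		show "integrable lborel (%x. \<bar>C\<bar>/(t-t1)*?e x)" using ei by simp
		show "AE x in lborel. norm (exp (- t*x)*h x) <= norm (\<bar>C\<bar>/(t-t1)*?e x)"
		proof (rule AE_I2)
			fix x :: real
			show "norm (exp (- t*x)*h x) <= norm (\<bar>C\<bar>/(t-t1)*?e x)"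
			proof (cases "x < 0")
				case True thus ?thesis using h0[of x] by simp
			next
				case False
				have "exp (- t*x)*\<bar>h x\<bar> <= exp (- t*x)*(\<bar>C\<bar>*exp (t1*x))"
					using C[of x] by (intro mult_left_mono) (auto intro: order_trans[OF _ mult_right_mono[OF abs_ge_self]])
				also have "\<dots> = \<bar>C\<bar>*exp (- x*(t-t1))" by (simp add: right_diff_distrib mult.commute flip: exp_add)
				also have "\<dots> = \<bar>C\<bar>/(t-t1)*?e x" using False t by (simp add: exponential_density_def)
				finally show ?thesis using e0[of x] t by (simp add: abs_mult)
			qed
		qed
	qed measurable
	have ss: "set_integrable lborel S (%x. exp (- t*x)*h x)" if "S \<in> sets borel" for S
		unfolding set_integrable_def by (rule integrable_mult_indicator[OF _ int]) (use that in simp)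
	have "((%b. LINT x:{0..b}|lborel. exp (- t*x)*h x) \<longlongrightarrow> (LINT x:{0..}|lborel. exp (- t*x)*h x)) at_top"
		by (rule tendsto_set_lebesgue_integral_at_top[OF _ ss]) auto
	moreover have "(LINT x:{0..b}|lborel. exp (- t*x)*h x) = integral {0..b} (%x. exp (- t*x)*h x)" for b
		by (rule set_borel_integral_eq_integral(2)[OF ss]) simp
	ultimately have "(LINT x:{0..}|lborel. exp (- t*x)*h x) = L"
		using L by (simp add: tendsto_unique[OF trivial_limit_at_top_linorder])
	moreover have "(LINT x:{0..}|lborel. exp (- t*x)*h x) = (\<integral>x. exp (- t*x)*h x \<partial>lborel)"
		unfolding set_lebesgue_integral_def by (rule Bochner_Integration.integral_cong) (auto simp: indicator_def h0)
	ultimately show "(\<integral>x. exp (- t*x)*h x \<partial>lborel) = L" by simp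
qed

lemma exp_decay: "0 < (b::real) ==> ((%x. C*exp (- b*x)) \<longlongrightarrow> 0) at_top"
	by real_asymp

lemma decay_bound:
	fixes G :: "real => real"
	assumes "b < c" "\<And>x. 0 <= x ==> \<bar>G x\<bar> <= C*exp (b*x)"
	shows "((%T. exp (- c*T)*G T) \<longlongrightarrow> 0) at_top"
proof (rule Lim_null_comparison)
	show "((%x. C*exp (- (c-b)*x)) \<longlongrightarrow> 0) at_top" by (rule exp_decay) (use assms in simp)
	show "\<forall>\<^sub>F T in at_top. norm (exp (- c*T)*G T) <= C*exp (- (c-b)*T)"
	proof (rule eventually_at_top_linorderI[of 0])
		fix T :: real assume T: "0 <= T"
		have "exp (- c*T)*\<bar>G T\<bar> <= exp (- c*T)*(C*exp (b*T))" using assms(2)[OF T] by (rule mult_left_mono) simp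
		also have "\<dots> = C*exp (- (c-b)*T)" by (simp add: left_diff_distrib flip: exp_add)
		finally show "norm (exp (- c*T)*G T) <= C*exp (- (c-b)*T)" by (simp add: abs_mult)
	qed
qed

text \<open>Each integration divides the transform by t - \<alpha>. The first yields an exponential
  bound, and with it absolutely convergent integrals; the second yields a C^1 function, the
  smoothness required of a test function. The weight exp(\<alpha> x) undoes the damping of
  w.\<close>

lemma laplace_twice:
	fixes w :: "real => real" and L :: "real => real"
	assumes w: "continuous_on {0..} w" and \<alpha>: "0 <= \<alpha>" "\<alpha> < t1"
		and L: "\<And>t. t1 <= t ==> ((%y. exp (- t*y)*w y) has_integral L t) {0..}"
	defines "w1 \<equiv> %x. integral {0..x} (%y. exp (- \<alpha>*y)*w y)"
	defines "w2 \<equiv> %x. integral {0..x} w1"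
	shows "continuous_on UNIV w1" "continuous_on UNIV w2" "\<exists>C\<ge>0. \<forall>x. \<bar>exp (\<alpha>*x)*w2 x\<bar> <= C*exp (t1*x)"
		"t1 < t ==> integrable lborel (%x. exp (- t*x)*(exp (\<alpha>*x)*w2 x))"
		"t1 < t ==> (\<integral>x. exp (- t*x)*(exp (\<alpha>*x)*w2 x) \<partial>lborel) = L t/(t - \<alpha>)\<^sup>2"
proof -
	have neg: "integral {0..x} g = 0" if "x <= 0" for x and g :: "real => real"
		using that by (cases "x = 0") auto
	have ext: "continuous_on UNIV (%x. integral {0..x} g)" if g: "continuous_on {0..} g" for g :: "real => real"
	proof -
		have "continuous_on {0..} (%x. integral {0..x} g)"
			unfolding continuous_on_eq_continuous_within
		proof
			fix x :: real assume x: "x \<in> {0..}"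
			have "continuous_on {0..x+1} (%x. integral {0..x} g)"
				by (rule indefinite_integral_continuous_1[OF integrable_continuous_real]) (rule continuous_on_subset[OF g], auto)
			hence c: "continuous (at x within {0..x+1}) (%x. integral {0..x} g)" using x by (simp add: continuous_on_eq_continuous_within)
			have "at x within {0..x+1} = at x within {0..}"
				by (rule at_within_nhd[of _ "{..<x+1}"]) (use x in auto)
			thus "continuous (at x within {0..}) (%x. integral {0..x} g)" using c by (simp add: continuous_within)
		qed
		moreover have "continuous_on {..0} (%x. integral {0..x} g)"
			by (rule continuous_on_cong[THEN iffD2, OF refl _ continuous_on_const[of _ 0]]) (simp add: neg)
		ultimately have "continuous_on ({..0} \<union> {0..}) (%x. integral {0..x} g)" by (intro continuous_on_closed_Un) auto
		moreover have "{..0} \<union> {0..} = (UNIV :: real set)" by auto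
		ultimately show ?thesis by simp
	qed
	have g: "continuous_on {0..} (%y. exp (- c*y)*w y)" for c by (intro continuous_intros w)
	show c1: "continuous_on UNIV w1" unfolding w1_def by (rule ext[OF g])
	have c10: "continuous_on {0..} w1" by (rule continuous_on_subset[OF c1]) simp
	show c2: "continuous_on UNIV w2" unfolding w2_def by (rule ext[OF c10])
	have b: "0 < t1 - \<alpha>" using \<alpha> by simp
	have "continuous_on {0..} (%x. integral {0..x} (%y. exp (- t1*y)*w y))" using continuous_on_subset[OF ext[OF g]] by blast
	then obtain C where C: "0 <= C" "\<And>x. 0 <= x ==> \<bar>integral {0..x} (%y. exp (- t1*y)*w y)\<bar> <= C"
		by (rule bounded_at_top[OF _ has_integral_at_top[OF L[OF order_refl]]]) (rule that)
	have b1: "\<bar>w1 x\<bar> <= 2*C*exp ((t1 - \<alpha>)*x)" if "0 <= x" for x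
		unfolding w1_def by (rule antideriv_bound[OF w b C that])
	have b2: "\<bar>w2 x\<bar> <= 2*C/(t1 - \<alpha>)*exp ((t1 - \<alpha>)*x)" if x: "0 <= x" for x
		unfolding w2_def by (rule integral_exp_le[OF b x continuous_on_subset[OF c1]]) (use C b1 in auto)
	define D where "D = 2*C/(t1 - \<alpha>)"
	have D0: "0 <= D" using C b by (simp add: D_def)
	have w20: "w2 x = 0" if "x <= 0" for x unfolding w2_def by (rule neg[OF that])
	have D: "\<bar>exp (\<alpha>*x)*w2 x\<bar> <= D*exp (t1*x)" for x
	proof (cases "0 <= x")
		case True
		have "exp (\<alpha>*x)*\<bar>w2 x\<bar> <= exp (\<alpha>*x)*(D*exp ((t1 - \<alpha>)*x))" using b2[OF True] by (intro mult_left_mono) (simp_all add: D_def)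
		also have "\<dots> = D*exp (t1*x)" by (simp add: left_diff_distrib flip: exp_add)
		finally show ?thesis by (simp add: abs_mult)
	qed (use w20[of x] D0 in simp)
	thus "\<exists>C\<ge>0. \<forall>x. \<bar>exp (\<alpha>*x)*w2 x\<bar> <= C*exp (t1*x)" using D0 by blast
	assume t: "t1 < t"
	let ?c = "t - \<alpha>"
	have c: "0 < ?c" using t b by simp
	have rw: "exp (- ?c*x)*(exp (- \<alpha>*x)*w x) = exp (- t*x)*w x" for x
		by (simp add: left_diff_distrib flip: exp_add mult.assoc)
	have l0: "((%T. integral {0..T} (%x. exp (- ?c*x)*(exp (- \<alpha>*x)*w x))) \<longlongrightarrow> L t) at_top"
		unfolding rw by (rule has_integral_at_top[OF L]) (use t in simp)
	have bc: "t1 - \<alpha> < ?c" using t by simp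
	have l1: "((%T. integral {0..T} (%x. exp (- ?c*x)*w1 x)) \<longlongrightarrow> L t/?c) at_top"
		by (rule laplace_antideriv[OF g c _ l0 decay_bound[OF bc b1]]) (simp only: w1_def)
	have "((%T. integral {0..T} (%x. exp (- ?c*x)*w2 x)) \<longlongrightarrow> L t/?c/?c) at_top"
		by (rule laplace_antideriv[OF c10 c _ l1 decay_bound[OF bc b2]]) (simp only: w2_def)
	moreover have rw2: "exp (- ?c*x)*w2 x = exp (- t*x)*(exp (\<alpha>*x)*w2 x)" for x
		by (simp add: left_diff_distrib flip: exp_add mult.assoc)
	ultimately have lim: "((%T. integral {0..T} (%x. exp (- t*x)*(exp (\<alpha>*x)*w2 x))) \<longlongrightarrow> L t/?c\<^sup>2) at_top"
		by (simp only: power2_eq_square divide_divide_eq_left)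
	have cE: "continuous_on UNIV (%x. exp (\<alpha>*x)*w2 x)" by (intro continuous_intros c2)
	have zE: "exp (\<alpha>*x)*w2 x = 0" if "x <= 0" for x using w20[OF that] by simp
	show "integrable lborel (%x. exp (- t*x)*(exp (\<alpha>*x)*w2 x))"
		"(\<integral>x. exp (- t*x)*(exp (\<alpha>*x)*w2 x) \<partial>lborel) = L t/?c\<^sup>2"
		by (rule lebesgue_laplace[OF cE zE D t lim]; assumption)+
qed

text \<open>The counterpart of \<open>laplace_twice\<close> for the unit mass at 0, which becomes x
  exp(\<alpha> x) on the positive half-line after two integrations with the same weights.\<close>

lemma laplace_ramp:
	fixes \<alpha> t1 :: real
	assumes \<alpha>: "0 <= \<alpha>" "\<alpha> < t1"
	defines "k \<equiv> %x. max 0 x*exp (\<alpha>*x)"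
	shows "continuous_on UNIV k" "\<exists>C\<ge>0. \<forall>x. \<bar>k x\<bar> <= C*exp (t1*x)"
		"t1 < t ==> integrable lborel (%x. exp (- t*x)*k x)"
		"t1 < t ==> (\<integral>x. exp (- t*x)*k x \<partial>lborel) = 1/(t - \<alpha>)\<^sup>2"
proof -
	show c: "continuous_on UNIV k" unfolding k_def by (intro continuous_intros)
	define C where "C = 1/(t1 - \<alpha>)"
	have b: "0 < t1 - \<alpha>" and C0: "0 <= C" using \<alpha> by (simp_all add: C_def)
	have x: "max 0 x <= C*exp ((t1 - \<alpha>)*x)" for x
	proof (cases "0 <= x")
		case True
		have "(t1 - \<alpha>)*x <= exp ((t1 - \<alpha>)*x)" using exp_ge_add_one_self[of "(t1 - \<alpha>)*x"] by linarith
		thus ?thesis using True b by (simp add: C_def field_simps)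
	qed (use C0 in simp)
	have D: "\<bar>k x\<bar> <= C*exp (t1*x)" for x
	proof -
		have "max 0 x*exp (\<alpha>*x) <= C*exp ((t1 - \<alpha>)*x)*exp (\<alpha>*x)" using x[of x] by (rule mult_right_mono) simp
		also have "\<dots> = C*exp (t1*x)" by (simp add: left_diff_distrib mult.assoc flip: exp_add)
		finally show ?thesis by (simp add: k_def abs_mult)
	qed
	thus "\<exists>C\<ge>0. \<forall>x. \<bar>k x\<bar> <= C*exp (t1*x)" using C0 by blast
	assume t: "t1 < t"
	let ?c = "t - \<alpha>"
	have cp: "0 < ?c" using t b by simp
	have "((%x. exp (- ?c*x)) has_integral exp (- ?c*0)/?c) {0..}" by (rule has_integral_exp_minus_to_infinity[OF cp])
	hence "((%T. integral {0..T} (%x. exp (- ?c*x)*1)) \<longlongrightarrow> 1/?c) at_top" using has_integral_at_top by fastforce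
	hence "((%T. integral {0..T} (%x. exp (- ?c*x)*max 0 x)) \<longlongrightarrow> 1/?c/?c) at_top"
	proof (rule laplace_antideriv[OF continuous_on_const cp, rotated])
		show "((%T. exp (- ?c*T)*max 0 T) \<longlongrightarrow> 0) at_top"
			by (rule decay_bound[where b="t1 - \<alpha>" and C=C]) (use t x in auto)
	qed simp
	moreover have "exp (- ?c*x)*max 0 x = exp (- t*x)*k x" for x
	proof -
		have "exp (- ?c*x) = exp (- t*x)*exp (\<alpha>*x)" by (simp add: left_diff_distrib flip: exp_add)
		thus ?thesis by (simp add: k_def)
	qed
	ultimately have lim: "((%T. integral {0..T} (%x. exp (- t*x)*k x)) \<longlongrightarrow> 1/?c\<^sup>2) at_top"
		by (simp only: power2_eq_square divide_divide_eq_left)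
	have z: "k x = 0" if "x <= 0" for x using that by (simp add: k_def)
	show "integrable lborel (%x. exp (- t*x)*k x)" "(\<integral>x. exp (- t*x)*k x \<partial>lborel) = 1/?c\<^sup>2"
		by (rule lebesgue_laplace[OF c z D t lim]; assumption)+
qed

text \<open>Translating h by Y multiplies its transform by exp(t Y), and Fubini does the rest. It
  serves twice: with Y the position at a fixed time, and with Y the position at a time spread over
  an interval.\<close>

lemma laplace_mixture:
	fixes h Y v L :: "_ => real"
	assumes N: "sigma_finite_measure N" and Y [measurable]: "Y \<in> Bor N" and v [measurable]: "v \<in> Bor N"
		and v0: "\<And>w. 0 <= v w" and mg: "\<And>c. t1 <= c ==> integrable N (%w. exp (c*Y w) * v w)" and t1: "0 <= t1"
		and h: "continuous_on UNIV h" and C: "0 <= C" "\<And>x. \<bar>h x\<bar> <= C*exp (t1*x)"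
		and I: "\<And>t. t1 < t ==> integrable lborel (%x. exp (- t*x)*h x)" "\<And>t. t1 < t ==> (\<integral>x. exp (- t*x)*h x \<partial>lborel) = L t"
	shows "integrable N (%w. h (x+Y w) * v w)"
		"continuous_on UNIV (%x. \<integral>w. h (x+Y w) * v w \<partial>N)"
		"t1 < t ==> integrable lborel (%x. exp (- t*x)*(\<integral>w. h (x+Y w) * v w \<partial>N))"
		"t1 < t ==> (\<integral>x. exp (- t*x)*(\<integral>w. h (x+Y w) * v w \<partial>N) \<partial>lborel) = L t*(\<integral>w. exp (t*Y w) * v w \<partial>N)"
proof -
	have [measurable]: "h \<in> Bor borel" by (rule borel_measurable_continuous_onI[OF h])
	have bd: "norm (h (x+Y w) * v w) <= C*exp (t1*z)*(exp (t1*Y w) * v w)" if "x <= z" for x z w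
	proof -
		have "\<bar>h (x+Y w)\<bar> <= C*exp (t1*(x+Y w))" by (rule C)
		also have "\<dots> <= C*exp (t1*(z+Y w))" using C(1) t1 that by (intro mult_left_mono) (auto intro: mult_left_mono)
		also have "\<dots> = C*exp (t1*z)*exp (t1*Y w)" by (simp add: distrib_left mult.assoc flip: exp_add)
		finally have "\<bar>h (x+Y w)\<bar> * v w <= C*exp (t1*z)*exp (t1*Y w) * v w" by (rule mult_right_mono[OF _ v0])
		thus ?thesis using v0[of w] by (simp add: abs_mult mult.assoc)
	qed
	have dom: "integrable N (%w. C*exp (t1*z)*(exp (t1*Y w) * v w))" for z using mg[of t1] by simp
	show "integrable N (%w. h (x+Y w) * v w)" for x
		by (rule Bochner_Integration.integrable_bound[OF dom[of x]], measurable, rule AE_I2, rule order_trans[OF bd[OF order_refl]]) simp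
	show "continuous_on UNIV (%x. \<integral>w. h (x+Y w) * v w \<partial>N)"
		unfolding continuous_on_sequentially
	proof (intro ballI allI impI, elim conjE)
		fix y and x :: "nat => real" assume x: "x \<leadsto> y"
		then obtain K where K: "\<And>n. x n <= K" using convergent_imp_Bseq[of x] by (auto simp: convergent_def Bseq_def abs_le_iff)
		show "((%x. \<integral>w. h (x+Y w) * v w \<partial>N) \<circ> x) \<leadsto> (\<integral>w. h (y+Y w) * v w \<partial>N)"
			unfolding o_def
		proof (rule integral_dominated_convergence[OF _ _ dom[of K]])
			have "(%n. h (x n+Y w)) \<leadsto> h (y+Y w)" for w
				by (rule isCont_tendsto_compose[of _ h]) (use h x in \<open>auto simp: continuous_on_eq_continuous_at intro!: tendsto_intros\<close>)
			thus "AE w in N. (%n. h (x n+Y w) * v w) \<leadsto> h (y+Y w) * v w" by (intro AE_I2 tendsto_mult tendsto_const)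
			show "AE w in N. norm (h (x n+Y w) * v w) <= C*exp (t1*K)*(exp (t1*Y w) * v w)" for n
				by (intro AE_I2 bd K)
		qed measurable
	qed
	assume t: "t1 < t"
	interpret pair_sigma_finite N lborel by (intro pair_sigma_finite.intro N sigma_finite_lborel)
	let ?f = "%w x. exp (- t*x)*(h (x+Y w) * v w)"
	let ?k = "%x. exp (- t*x)*h x"
	have sh: "?f w x = exp (t*Y w) * v w*?k (Y w+1*x)" for w x
	proof -
		have "exp (- t*x) = exp (t*Y w)*exp (- t*(Y w+1*x))" by (simp add: distrib_left flip: exp_add)
		thus ?thesis by (simp add: add.commute)
	qed
	have i1: "integrable lborel (?f w)" for w
		unfolding sh by (intro integrable_mult_right lborel_integrable_real_affine I(1) t) simp
	have e1: "(\<integral>x. ?f w x \<partial>lborel) = exp (t*Y w) * v w*L t" for w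
	proof -
		have "(\<integral>x. ?k (Y w+1*x) \<partial>lborel) = L t" using lborel_integral_real_affine[of 1 ?k "Y w"] I(2)[OF t] by simp
		thus ?thesis unfolding sh integral_mult_right_zero by (simp only:)
	qed
	have e2: "(\<integral>x. norm (?f w x) \<partial>lborel) = exp (t*Y w) * v w*(\<integral>x. norm (?k x) \<partial>lborel)" for w
	proof -
		have "norm (?f w x) = exp (t*Y w) * v w*norm (?k (Y w+1*x))" for x
			unfolding sh norm_mult[of "exp (t*Y w) * v w"] using v0[of w] by simp
		thus ?thesis using lborel_integral_real_affine[of 1 "%x. norm (?k x)" "Y w"] by simp
	qed
	have int: "integrable (N \<Otimes>\<^sub>M lborel) (case_prod ?f)"
	proof (rule Fubini_integrable)
		show "integrable N (%w. \<integral>x. norm (case_prod ?f (w, x)) \<partial>lborel)"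
			unfolding split_conv e2 by (intro integrable_mult_left mg) (use t in simp)
		show "AE w in N. integrable lborel (%x. case_prod ?f (w, x))" using i1 by simp
	qed measurable
	have pull: "(\<integral>w. ?f w x \<partial>N) = exp (- t*x)*(\<integral>w. h (x+Y w) * v w \<partial>N)" for x by simp
	show "integrable lborel (%x. exp (- t*x)*(\<integral>w. h (x+Y w) * v w \<partial>N))"
		using integrable_snd[OF int] unfolding pull .
	have "(\<integral>x. (\<integral>w. ?f w x \<partial>N) \<partial>lborel) = (\<integral>w. (\<integral>x. ?f w x \<partial>lborel) \<partial>N)" by (rule Fubini_integral[OF int])
	thus "(\<integral>x. exp (- t*x)*(\<integral>w. h (x+Y w) * v w \<partial>N) \<partial>lborel) = L t*(\<integral>w. exp (t*Y w) * v w \<partial>N)"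
		unfolding pull e1 by (simp add: mult.commute)
qed

subsection \<open>Harmonicity of the scale functions\<close>

lemma invertible_matrix_inv:
	fixes A :: "real^'n::finite^'n"
	assumes "invertible A"
	shows "A ** matrix_inv A = mat 1" "matrix_inv A ** A = mat 1"
	using someI_ex[OF assms[unfolded invertible_def]] unfolding matrix_inv_def by auto

lemma mpow_row_sum:
	fixes A :: "real^'n::finite^'n"
	assumes B: "\<And>i j. \<bar>A$i$j\<bar> <= B"
	shows "(\<Sum>l\<in>UNIV. \<bar>mpow A k $ i $ l\<bar>) <= (real CARD('n)*B) ^ k"
proof (induction k arbitrary: i)
	case 0
	have "(\<Sum>l\<in>UNIV. \<bar>mpow A 0 $ i $ l\<bar>) = (\<Sum>l\<in>UNIV. if l = i then 1 else 0)"
		by (rule sum.cong) (auto simp: mat_def)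
	thus ?case by simp
next
	case (Suc k)
	have B0: "0 <= B" using B[of i i] by simp
	have "(\<Sum>l\<in>UNIV. \<bar>mpow A (Suc k) $ i $ l\<bar>) <= (\<Sum>l\<in>UNIV. \<Sum>p\<in>UNIV. \<bar>A$i$p\<bar>*\<bar>mpow A k $ p $ l\<bar>)"
		by (intro sum_mono) (auto simp: matrix_matrix_mult_def abs_mult intro: order_trans[OF sum_abs])
	also have "\<dots> = (\<Sum>p\<in>UNIV. \<bar>A$i$p\<bar>*(\<Sum>l\<in>UNIV. \<bar>mpow A k $ p $ l\<bar>))"
		by (subst sum.swap) (simp add: sum_distrib_left)
	also have "\<dots> <= (\<Sum>p\<in>(UNIV::'n set). B*(real CARD('n)*B) ^ k)"
		by (intro sum_mono mult_mono B Suc.IH) (auto intro: B0 sum_nonneg)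
	finally show ?case by simp
qed

text \<open>Row sums instead of entries keep the constant in front equal to 1. The bound is iterated
  over all grid steps in \<open>grid_max_bound\<close>, where a larger constant would grow without
  limit as the mesh shrinks.\<close>

lemma mexp_row_sum:
	fixes A :: "real^'n::finite^'n"
	shows "\<exists>\<kappa>\<ge>0. \<forall>t\<ge>0. \<forall>j. (\<Sum>l\<in>UNIV. mexp (scaleR t A) $ j $ l) <= exp (\<kappa>*t)"
proof -
	define B where "B = (\<Sum>i\<in>UNIV. \<Sum>j\<in>UNIV. \<bar>A$i$j\<bar>)"
	have B: "\<bar>A$i$j\<bar> <= B" for i j
	proof -
		have "\<bar>A$i$j\<bar> <= (\<Sum>j\<in>UNIV. \<bar>A$i$j\<bar>)" by (rule member_le_sum) auto
		also have "\<dots> <= B" unfolding B_def by (rule member_le_sum) (auto intro: sum_nonneg)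
		finally show ?thesis .
	qed
	have B0: "0 <= B" unfolding B_def by (intro sum_nonneg) auto
	have "(\<Sum>l\<in>UNIV. mexp (scaleR t A) $ j $ l) <= exp (real CARD('n)*B*t)" if t: "0 <= t" for t j
	proof (rule sums_le)
		show "(%k. \<Sum>l\<in>UNIV. (mpow A k $ j $ l/fact k)*t ^ k) sums (\<Sum>l\<in>UNIV. mexp (scaleR t A) $ j $ l)"
			unfolding mexp_entry by (intro sums_sum summable_sums mexp_summable)
		show "(%k. (real CARD('n)*B*t) ^ k /\<^sub>R fact k) sums exp (real CARD('n)*B*t)" by (rule exp_converges)
		fix k
		have "(\<Sum>l\<in>UNIV. (mpow A k $ j $ l/fact k)*t ^ k) = (\<Sum>l\<in>UNIV. mpow A k $ j $ l)*(t ^ k/fact k)"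
			by (simp add: sum_distrib_right sum_divide_distrib)
		also have "\<dots> <= (real CARD('n)*B) ^ k*(t ^ k/fact k)"
			using t by (intro mult_right_mono order_trans[OF sum_mono[OF abs_ge_self] mpow_row_sum[OF B]]) auto
		also have "\<dots> = (real CARD('n)*B*t) ^ k /\<^sub>R fact k" by (simp add: power_mult_distrib divide_inverse mult_ac)
		finally show "(\<Sum>l\<in>UNIV. (mpow A k $ j $ l/fact k)*t ^ k) <= (real CARD('n)*B*t) ^ k /\<^sub>R fact k" .
	qed
	thus ?thesis using B0 by (intro exI[of _ "real CARD('n)*B"]) auto
qed

lemma matrix_matrix_mult_add_left:
	fixes A B C :: "real^'n::finite^'n"
	shows "(A+B) ** C = A ** C+B ** C"
	by (simp add: vec_eq_iff matrix_matrix_mult_def distrib_right sum.distrib)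

definition clip :: "real => real" where "clip z = max 0 (min 1 z)"

lemma clip_bounds [simp]: "0 <= clip z" "clip z <= 1"
	by (auto simp: clip_def)

lemma clip_cont: "continuous_on S f ==> continuous_on S (%x. clip (f x))"
	unfolding clip_def by (intro continuous_intros)

lemma clip_meas [measurable]: "clip \<in> Bor borel"
	by (rule borel_measurable_continuous_onI) (rule clip_cont, rule continuous_on_id)

locale scale_map = map_process M P X J for M P X and J :: "real => 'w => 'n::finite option" +
	fixes F W :: "real => real^'n^'n"
	assumes F_exp: "is_matrix_exponent P X J F" and W_scale: "is_scale_matrix F W"
begin

lemma ph_indicator: "indicator {w. J t w = Some j} w = ph j t w"
	by (simp add: ph_def indicator_def)

lemma mgf_mexp:
	assumes "0 <= c" "0 <= t"
	shows "integrable (P 0 i) (%w. exp (c*X t w)*ph l t w)"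
		"(\<integral>w. exp (c*X t w)*ph l t w \<partial>P 0 i) = mexp (scaleR t (F c)) $ i $ l"
proof -
	have *: "(\<forall>i j. integrable (P 0 i) (%w. exp (c*X t w)*indicator {w. J t w = Some j} w)) \<and>
				E_mat (P 0) (%w. exp (c*X t w)) (J t) = mexp (scaleR t (F c))"
		using F_exp assms unfolding is_matrix_exponent_def by blast
	thus "integrable (P 0 i) (%w. exp (c*X t w)*ph l t w)" by (simp add: ph_indicator)
	from * have "E_mat (P 0) (%w. exp (c*X t w)) (J t) $ i $ l = mexp (scaleR t (F c)) $ i $ l" by simp
	thus "(\<integral>w. exp (c*X t w)*ph l t w \<partial>P 0 i) = mexp (scaleR t (F c)) $ i $ l" by (simp add: E_mat_def ph_indicator)
qed

lemma exp_map: "exp_map_process M P X J"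
proof
	show "integrable (P 0 i) (%w. exp (c*X t w)*ph l t w)" if "0 <= c" "0 <= t" for c t i l by (rule mgf_mexp(1)[OF that])
	show "\<exists>\<kappa>\<ge>0. \<forall>t\<ge>0. \<forall>j. (\<Sum>l\<in>UNIV. \<integral>w. exp (c*X t w)*ph l t w \<partial>P 0 j) <= exp (\<kappa>*t)" if "0 <= c" for c
		using mexp_row_sum[of "F c"] by (simp add: mgf_mexp(2)[OF that])
qed

text \<open>The integral inside Z, followed by its antiderivative. Integrals over empty intervals
  vanish, so both are 0 on the negative half-line, and Z is continued there as exp(al y) times the
  identity.\<close>

definition w1 :: "real => 'n => 'n => real => real" where
	"w1 al k l y = integral {0..y} (%u. exp (- al*u)*W u $ k $ l)"
definition w2 :: "real => 'n => 'n => real => real" where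
	"w2 al k l y = integral {0..y} (w1 al k l)"

lemma W_cont: "continuous_on {0..} (%u. W u $ k $ l)"
	using W_scale unfolding is_scale_matrix_def by (auto intro!: continuous_intros)

lemma W_transform:
	obtains t1 where "\<And>t. t1 <= t ==> invertible (F t)"
		"\<And>t k l. t1 <= t ==> ((%y. exp (- t*y)*W y $ k $ l) has_integral matrix_inv (F t) $ k $ l) {0..}" "al < t1" "0 <= t1"
proof -
	obtain a0 where a0: "a0 \<ge> 0" "\<And>t. a0 < t ==> invertible (F t) \<and>
				((%y. scaleR (exp (- t*y)) (W y)) has_integral matrix_inv (F t)) {0..}"
		using W_scale unfolding is_scale_matrix_def by blast
	show thesis
	proof (rule that[of "max a0 al+1"])
		fix t k l assume t: "max a0 al+1 <= t"
		have bl: "bounded_linear (%A::real^'n^'n. A $ k $ l)"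
			using bounded_linear_compose[OF bounded_linear_vec_nth[of l] bounded_linear_vec_nth[of k]] by (simp add: o_def)
		have "((%y. scaleR (exp (- t*y)) (W y)) has_integral matrix_inv (F t)) {0..}" using a0(2)[of t] t by simp
		from has_integral_linear[OF this bl]
		show "((%y. exp (- t*y)*W y $ k $ l) has_integral matrix_inv (F t) $ k $ l) {0..}" by (simp add: o_def)
	qed (use a0 in auto)
qed

lemma w_cont: "0 <= al ==> continuous_on S (w1 al k l)" "0 <= al ==> continuous_on S (w2 al k l)"
proof -
	assume al: "0 <= al"
	obtain t1 where t1: "\<And>t. t1 <= t ==> invertible (F t)"
		"\<And>t k l. t1 <= t ==> ((%y. exp (- t*y)*W y $ k $ l) has_integral matrix_inv (F t) $ k $ l) {0..}" "al < t1" "0 <= t1"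
		by (rule W_transform) (rule that)
	note lt = laplace_twice[OF W_cont al t1(3) t1(2)]
	show "continuous_on S (w1 al k l)"
		unfolding w1_def[abs_def] by (rule continuous_on_subset[OF lt(1)]) (assumption, rule subset_UNIV)
	show "continuous_on S (w2 al k l)"
		unfolding w2_def[abs_def] w1_def[abs_def] by (rule continuous_on_subset[OF lt(2)]) (assumption, rule subset_UNIV)
qed

lemma w_neg: "y <= 0 ==> w1 al k l y = 0" "y <= 0 ==> w2 al k l y = 0"
	by (cases "y = 0"; simp add: w1_def w2_def)+

lemma w2_deriv:
	assumes al: "0 <= al"
	shows "(w2 al k l has_real_derivative w1 al k l y) (at y)"
proof -
	\<comment> \<open>Integrating from -K, to the left of 0 where \<open>w1\<close> is 0, gives a
	  two-sided derivative at every y, including y <= 0.\<close>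
	define K where "K = \<bar>y\<bar>+1"
	have eq: "w2 al k l z = integral {- K..z} (w1 al k l)" if z: "- K <= z" "z <= K" for z
	proof (cases "0 <= z")
		case True
		have "integral {- K..0} (w1 al k l)+integral {0..z} (w1 al k l) = integral {- K..z} (w1 al k l)"
			by (rule Henstock_Kurzweil_Integration.integral_combine)
				(use True in \<open>auto simp: K_def intro!: integrable_continuous_real w_cont al\<close>)
		moreover have "integral {- K..0} (w1 al k l) = integral {- K..0} (%_. 0)"
			by (rule Henstock_Kurzweil_Integration.integral_cong) (simp add: w_neg)
		ultimately show ?thesis by (simp add: w2_def)
	next
		case False
		have "integral {- K..z} (w1 al k l) = integral {- K..z} (%_. 0)"
			by (rule Henstock_Kurzweil_Integration.integral_cong) (use False in \<open>simp add: w_neg\<close>)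
		thus ?thesis using False by (simp add: w_neg)
	qed
	have y: "y \<in> {- K<..<K}" by (auto simp: K_def)
	have "((%z. integral {- K..z} (w1 al k l)) has_real_derivative w1 al k l y) (at y within {- K..K})"
		by (rule integral_has_real_derivative[OF w_cont(1)[OF al]]) (use y in auto)
	hence "((%z. integral {- K..z} (w1 al k l)) has_real_derivative w1 al k l y) (at y within {- K<..<K})"
		by (rule has_field_derivative_subset) auto
	hence "((%z. integral {- K..z} (w1 al k l)) has_real_derivative w1 al k l y) (at y)"
		using at_within_open[OF y] by simp
	moreover have "\<forall>\<^sub>F z in nhds y. integral {- K..z} (w1 al k l) = w2 al k l z"
		unfolding eventually_nhds
		by (intro exI[of _ "{- K<..<K}"] conjI ballI) (use y eq in auto)
	ultimately show ?thesis by (simp add: DERIV_cong_ev[OF refl _ refl])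
qed

text \<open>A density on time and paths jointly; integrated against it, a function of position
  yields the expected time integral over the stay in phase l up to t.\<close>

definition occupied :: "real => 'n => real \<times> 'w => real" where
	"occupied t l p = indicator {0..t} (fst p)*ph l (max 0 (fst p)) (snd p)"
abbreviation level :: "real \<times> 'w => real" where "level p \<equiv> X (max 0 (fst p)) (snd p)"

lemma joint_cong [measurable_cong]: "sets (lborel \<Otimes>\<^sub>M P x i) = sets (borel \<Otimes>\<^sub>M M)"
	by (intro sets_pair_measure_cong) auto

lemma occupied_meas [measurable]: "occupied t l \<in> Bor (borel \<Otimes>\<^sub>M M)"
	unfolding occupied_def by measurable

lemma occupied_bounds: "0 <= occupied t l p" "occupied t l p <= 1"
	unfolding occupied_def by (auto simp: indicator_def)

lemma pair_sf: "pair_sigma_finite lborel (P x i)"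
	by (intro pair_sigma_finite.intro sigma_finite_lborel sigma_finite_P)

lemma occupied_mgf:
	assumes c: "0 <= c" and t: "0 <= t"
	shows "integrable (lborel \<Otimes>\<^sub>M P 0 i) (%p. exp (c*level p) * occupied t l p)"
		"(\<integral>p. exp (c*level p) * occupied t l p \<partial>(lborel \<Otimes>\<^sub>M P 0 i)) = integral {0..t} (%s. mexp (scaleR s (F c)) $ i $ l)"
proof -
	interpret pair_sigma_finite lborel "P 0 i" by (rule pair_sf)
	let ?m = "%s. mexp (scaleR s (F c)) $ i $ l"
	let ?f = "%p. exp (c*level p) * occupied t l p"
	have si: "set_integrable lborel {0..t} ?m" by (rule borel_integrable_atLeastAtMost'[OF mexp_cont])
	have nrm: "norm (?f p) = ?f p" for p using occupied_bounds(1)[of t l p] by simp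
	have inner: "(\<integral>w. ?f (s, w) \<partial>P 0 i) = indicator {0..t} s *\<^sub>R ?m s" for s
	proof (cases "s \<in> {0..t}")
		case True
		thus ?thesis using mgf_mexp(2)[OF c, of s i l] by (simp add: occupied_def max_def)
	qed (simp add: occupied_def)
	have ii: "integrable (P 0 i) (%w. ?f (s, w))" for s
	proof (cases "s \<in> {0..t}")
		case True
		thus ?thesis using mgf_mexp(1)[OF c, of s i l] by (simp add: occupied_def max_def)
	qed (simp add: occupied_def)
	show int: "integrable (lborel \<Otimes>\<^sub>M P 0 i) ?f"
	proof (rule Fubini_integrable)
		show "integrable lborel (%s. \<integral>w. norm (?f (s, w)) \<partial>P 0 i)"
			unfolding nrm inner using si unfolding set_integrable_def .
		show "AE s in lborel. integrable (P 0 i) (%w. ?f (s, w))" by (intro AE_I2 ii)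
	qed measurable
	have "integral\<^sup>L (lborel \<Otimes>\<^sub>M P 0 i) ?f = (\<integral>s. indicator {0..t} s *\<^sub>R ?m s \<partial>lborel)"
		unfolding inner[symmetric] by (rule integral_fst'[OF int, symmetric])
	also have "\<dots> = integral {0..t} ?m" using set_borel_integral_eq_integral(2)[OF si] by (simp add: set_lebesgue_integral_def)
	finally show "integral\<^sup>L (lborel \<Otimes>\<^sub>M P 0 i) ?f = integral {0..t} ?m" .
qed

definition ramp :: "real => real => real" where "ramp al x = max 0 x*exp (al*x)"

text \<open>Transform in x at a large parameter c: the left side gives exp(t F) F^{-1}, the right
  side F^{-1} plus the integral of exp(s F) over s, both divided by (c - al)^2, and
  \<open>mexp_integral\<close> equates them. The transform is bilateral because x + X t can be
  positive for negative x.\<close>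

lemma scale_renewal:
	assumes al: "0 <= al" and t: "0 <= t"
	defines "E \<equiv> %k l y. exp (al*y)*w2 al k l y"
	shows "integrable (P 0 i) (%w. E j l (x+X t w)*ph j t w)"
		"integrable (lborel \<Otimes>\<^sub>M P 0 i) (%p. ramp al (x+level p) * occupied t l p)"
		"(\<Sum>j\<in>UNIV. \<integral>w. E j l (x+X t w)*ph j t w \<partial>P 0 i)
			= E i l x+(\<integral>p. ramp al (x+level p) * occupied t l p \<partial>(lborel \<Otimes>\<^sub>M P 0 i))"
proof -
	obtain t1 where t1: "\<And>t. t1 <= t ==> invertible (F t)"
		"\<And>t k l. t1 <= t ==> ((%y. exp (- t*y)*W y $ k $ l) has_integral matrix_inv (F t) $ k $ l) {0..}" "al < t1" "0 <= t1"
		by (rule W_transform) (rule that)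
	note lt = laplace_twice[OF W_cont al t1(3) t1(2), folded w1_def w2_def, OF _ ]
	have E1: "continuous_on UNIV (E j l)" for j l unfolding E_def by (intro continuous_intros w_cont al)
	have "\<exists>C\<ge>0. \<forall>x. \<bar>exp (al*x)*w2 al j l x\<bar> <= C*exp (t1*x)" for j l
		unfolding w2_def w1_def[abs_def] by (rule laplace_twice(3)[OF W_cont al t1(3) t1(2)])
	hence E2: "\<exists>C\<ge>0. \<forall>x. \<bar>E j l x\<bar> <= C*exp (t1*x)" for j l unfolding E_def .
	have E3: "integrable lborel (%x. exp (- t*x)*E j l x)" if "t1 < t" for t j l
		unfolding E_def w2_def w1_def[abs_def] by (rule laplace_twice(4)[OF W_cont al t1(3) t1(2) that])
	have E4: "(\<integral>x. exp (- t*x)*E j l x \<partial>lborel) = matrix_inv (F t) $ j $ l/(t-al)\<^sup>2" if "t1 < t" for t j l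
		unfolding E_def w2_def w1_def[abs_def] by (rule laplace_twice(5)[OF W_cont al t1(3) t1(2) that])
	note R = laplace_ramp[OF al t1(3), folded ramp_def]
	have mix1: "integrable (P 0 i) (%w. E j l (x+X t w)*ph j t w)"
			"continuous_on UNIV (%x. \<integral>w. E j l (x+X t w)*ph j t w \<partial>P 0 i)"
			"t1 < c ==> integrable lborel (%x. exp (- c*x)*(\<integral>w. E j l (x+X t w)*ph j t w \<partial>P 0 i))"
			"t1 < c ==> (\<integral>x. exp (- c*x)*(\<integral>w. E j l (x+X t w)*ph j t w \<partial>P 0 i) \<partial>lborel)
				 = matrix_inv (F c) $ j $ l/(c-al)\<^sup>2*mexp (scaleR t (F c)) $ i $ j" for c j x
	proof -
		obtain C where C: "C \<ge> 0" "\<And>x. \<bar>E j l x\<bar> <= C*exp (t1*x)" using E2 by blast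
		have mg: "integrable (P 0 i) (%w. exp (c*X t w)*ph j t w)" if "t1 <= c" for c
			by (rule mgf_mexp(1)[OF _ t]) (use that t1(4) in simp)
		have [measurable]: "X t \<in> Bor (P 0 i)" "ph j t \<in> Bor (P 0 i)" by measurable
		note m = laplace_mixture[where N="P 0 i" and Y="X t" and v="ph j t" and h="E j l" and L="%c. matrix_inv (F c) $ j $ l/(c-al)\<^sup>2",
			OF sigma_finite_P _ _ ph_bounds(1) mg t1(4) E1 C E3 E4]
		show "integrable (P 0 i) (%w. E j l (x+X t w)*ph j t w)" by (rule m(1)) measurable
		show "continuous_on UNIV (%x. \<integral>w. E j l (x+X t w)*ph j t w \<partial>P 0 i)" by (rule m(2)) measurable
		assume c: "t1 < c"
		hence c0: "0 <= c" using t1(4) by simp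
		show "integrable lborel (%x. exp (- c*x)*(\<integral>w. E j l (x+X t w)*ph j t w \<partial>P 0 i))" by (rule m(3)) (measurable, rule c)
		show "(\<integral>x. exp (- c*x)*(\<integral>w. E j l (x+X t w)*ph j t w \<partial>P 0 i) \<partial>lborel)
				 = matrix_inv (F c) $ j $ l/(c-al)\<^sup>2*mexp (scaleR t (F c)) $ i $ j"
			unfolding mgf_mexp(2)[OF c0 t, symmetric] by (rule m(4)) (measurable, rule c)
	qed
	let ?N = "lborel \<Otimes>\<^sub>M P 0 i"
	have sfN: "sigma_finite_measure ?N"
	proof -
		interpret pair_sigma_finite lborel "P 0 i" by (rule pair_sf)
		show ?thesis by unfold_locales
	qed
	have mix2: "integrable ?N (%p. ramp al (x+level p) * occupied t l p)"
			"continuous_on UNIV (%x. \<integral>p. ramp al (x+level p) * occupied t l p \<partial>?N)"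
			"t1 < c ==> integrable lborel (%x. exp (- c*x)*(\<integral>p. ramp al (x+level p) * occupied t l p \<partial>?N))"
			"t1 < c ==> (\<integral>x. exp (- c*x)*(\<integral>p. ramp al (x+level p) * occupied t l p \<partial>?N) \<partial>lborel)
				 = 1/(c-al)\<^sup>2*integral {0..t} (%s. mexp (scaleR s (F c)) $ i $ l)" for c x
	proof -
		obtain C where C: "C \<ge> 0" "\<And>x. \<bar>ramp al x\<bar> <= C*exp (t1*x)" using laplace_ramp(2)[OF al t1(3)] unfolding ramp_def by blast
		have mg: "integrable ?N (%p. exp (c*level p) * occupied t l p)" if "t1 <= c" for c
			by (rule occupied_mgf(1)[OF _ t]) (use that t1(4) in simp)
		have rc: "continuous_on UNIV (ramp al)" unfolding ramp_def by (rule laplace_ramp(1)[OF al t1(3)])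
		have r3: "integrable lborel (%x. exp (- c*x)*ramp al x)" "(\<integral>x. exp (- c*x)*ramp al x \<partial>lborel) = 1/(c-al)\<^sup>2" if "t1 < c" for c
			unfolding ramp_def using laplace_ramp(3,4)[OF al t1(3) that] by auto
		note m = laplace_mixture[where N="?N" and Y=level and v="occupied t l" and h="ramp al" and L="%c. 1/(c-al)\<^sup>2",
			OF sfN _ _ occupied_bounds(1) mg t1(4) rc C r3]
		show "integrable ?N (%p. ramp al (x+level p) * occupied t l p)" by (rule m(1)) measurable
		show "continuous_on UNIV (%x. \<integral>p. ramp al (x+level p) * occupied t l p \<partial>?N)" by (rule m(2)) measurable
		assume c: "t1 < c"
		hence c0: "0 <= c" using t1(4) by simp
		show "integrable lborel (%x. exp (- c*x)*(\<integral>p. ramp al (x+level p) * occupied t l p \<partial>?N))" by (rule m(3)) (measurable, rule c)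
		show "(\<integral>x. exp (- c*x)*(\<integral>p. ramp al (x+level p) * occupied t l p \<partial>?N) \<partial>lborel)
				 = 1/(c-al)\<^sup>2*integral {0..t} (%s. mexp (scaleR s (F c)) $ i $ l)"
			unfolding occupied_mgf(2)[OF c0 t, symmetric] by (rule m(4)) (measurable, rule c)
	qed
	show "integrable (P 0 i) (%w. E j l (x+X t w)*ph j t w)" by (rule mix1(1))
	show "integrable ?N (%p. ramp al (x+level p) * occupied t l p)" by (rule mix2(1))
	let ?p = "%j x. \<integral>w. E j l (x+X t w)*ph j t w \<partial>P 0 i"
	let ?s = "%x. \<integral>p. ramp al (x+level p) * occupied t l p \<partial>?N"
	define g where "g x = (\<Sum>j\<in>UNIV. ?p j x)-?s x-E i l x" for x
	have "g x = 0"
	proof (rule laplace_bilateral_zero[where c=t1 and g=g and x=x])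
		show "continuous_on UNIV g" unfolding g_def by (intro continuous_intros mix1(2) mix2(2) E1)
		fix c assume c: "t1 < c"
		have exp_g: "exp (- c*x)*g x = (\<Sum>j\<in>UNIV. exp (- c*x)*?p j x)-exp (- c*x)*?s x-exp (- c*x)*E i l x" for x
			unfolding g_def by (simp only: right_diff_distrib sum_distrib_left)
		have i1: "integrable lborel (%x. \<Sum>j\<in>UNIV. exp (- c*x)*?p j x)" by (intro Bochner_Integration.integrable_sum mix1(3) c)
		have i2: "integrable lborel (%x. (\<Sum>j\<in>UNIV. exp (- c*x)*?p j x)-exp (- c*x)*?s x)"
			by (intro Bochner_Integration.integrable_diff i1 mix2(3) c)
		show "integrable lborel (%x. exp (- c*x)*g x)" unfolding exp_g by (intro Bochner_Integration.integrable_diff[OF i2] E3 c)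
		have inv: "invertible (F c)" by (rule t1(1)) (use c in simp)
		define I where "I = (\<chi> i j. integral {0..t} (%s. mexp (scaleR s (F c)) $ i $ j))"
		have "mexp (scaleR t (F c)) = mat 1+I ** F c" unfolding I_def by (rule mexp_integral[OF t])
		hence "mexp (scaleR t (F c)) ** matrix_inv (F c) = matrix_inv (F c)+I ** (F c ** matrix_inv (F c))"
			by (simp add: matrix_matrix_mult_add_left matrix_mul_assoc)
		hence "mexp (scaleR t (F c)) ** matrix_inv (F c) = matrix_inv (F c)+I" by (simp add: invertible_matrix_inv(1)[OF inv])
		from arg_cong[OF this, of "%A. A $ i $ l"]
		have me: "(\<Sum>j\<in>UNIV. mexp (scaleR t (F c)) $ i $ j*matrix_inv (F c) $ j $ l)
				= matrix_inv (F c) $ i $ l+integral {0..t} (%s. mexp (scaleR s (F c)) $ i $ l)"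
			by (simp add: matrix_matrix_mult_def I_def)
		have "(\<integral>x. exp (- c*x)*g x \<partial>lborel) = (\<Sum>j\<in>UNIV. matrix_inv (F c) $ j $ l/(c-al)\<^sup>2*mexp (scaleR t (F c)) $ i $ j)
				- 1/(c-al)\<^sup>2*integral {0..t} (%s. mexp (scaleR s (F c)) $ i $ l)-matrix_inv (F c) $ i $ l/(c-al)\<^sup>2"
			unfolding exp_g Bochner_Integration.integral_diff[OF i2 E3[OF c]] Bochner_Integration.integral_diff[OF i1 mix2(3)[OF c]]
				Bochner_Integration.integral_sum[OF mix1(3)[OF c]] mix1(4)[OF c] mix2(4)[OF c] E4[OF c] by (rule refl)
		also have "(\<Sum>j\<in>UNIV. matrix_inv (F c) $ j $ l/(c-al)\<^sup>2*mexp (scaleR t (F c)) $ i $ j)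
			= (\<Sum>j\<in>UNIV. mexp (scaleR t (F c)) $ i $ j*matrix_inv (F c) $ j $ l)/(c-al)\<^sup>2"
			by (simp add: sum_divide_distrib mult.commute)
		finally show "(\<integral>x. exp (- c*x)*g x \<partial>lborel) = 0" unfolding me by (simp add: add_divide_distrib)
	qed
	thus "(\<Sum>j\<in>UNIV. ?p j x) = E i l x+?s x" by (simp add: g_def)
qed

text \<open>Column c of Z with \<open>w1\<close> replaced by the backward difference quotient of
  \<open>w2\<close>, and the resulting substitute for the column of W F. Backward differences keep
  both corrections 0 for y <= 0, as the boundary condition at the lower barrier demands.\<close>

definition fn :: "real => real => 'n => 'n => real => real" where
	"fn al \<eta> c k y = exp (al*y)*((if k = c then 1 else 0)-(\<Sum>l\<in>UNIV. (w2 al k l y-w2 al k l (y - \<eta>))/\<eta>*F al $ l $ c))"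
definition bn :: "real => real => 'n => 'n => real => real" where
	"bn al \<eta> c k y = exp (al*y)*(\<Sum>l\<in>UNIV. (w1 al k l y-w1 al k l (y - \<eta>))/\<eta>*F al $ l $ c)"

lemma fn_deriv:
	assumes "0 <= al"
	shows "(fn al \<eta> c k has_real_derivative al*fn al \<eta> c k y-bn al \<eta> c k y) (at y)"
proof -
	have d0: "((%y. y - \<eta>) has_real_derivative 1) (at y)" by (auto intro!: derivative_eq_intros)
	have d2: "((%y. w2 al k l (y - \<eta>)) has_real_derivative w1 al k l (y - \<eta>)) (at y)" for l
		using DERIV_chain'[OF d0 w2_deriv[OF assms]] by simp
	have d3: "((%y. \<Sum>l\<in>UNIV. (w2 al k l y-w2 al k l (y - \<eta>))/\<eta>*F al $ l $ c) has_real_derivative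
			(\<Sum>l\<in>UNIV. (w1 al k l y-w1 al k l (y - \<eta>))/\<eta>*F al $ l $ c)) (at y)"
		by (intro DERIV_sum DERIV_cmult_right DERIV_cdivide DERIV_diff w2_deriv[OF assms] d2)
	have d1: "((%y. exp (al*y)) has_real_derivative exp (al*y)*al) (at y)" by (auto intro!: derivative_eq_intros)
	have "(fn al \<eta> c k has_real_derivative
			exp (al*y)*al*((if k = c then 1 else 0)-(\<Sum>l\<in>UNIV. (w2 al k l y-w2 al k l (y - \<eta>))/\<eta>*F al $ l $ c))
			+ (0-(\<Sum>l\<in>UNIV. (w1 al k l y-w1 al k l (y - \<eta>))/\<eta>*F al $ l $ c))*exp (al*y)) (at y)"
		unfolding fn_def[abs_def] by (rule DERIV_mult[OF d1 DERIV_diff[OF DERIV_const d3]])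
	thus ?thesis by (rule DERIV_cong) (simp add: fn_def bn_def)
qed

lemma bn_cont: "0 <= al ==> continuous_on UNIV (bn al \<eta> c k)"
	unfolding bn_def[abs_def] divide_inverse
	by (intro continuous_intros w_cont continuous_on_compose2[OF w_cont(1)[where S=UNIV]]) auto

lemma bn_neg: "0 < \<eta> ==> y <= 0 ==> bn al \<eta> c k y = 0"
	by (simp add: bn_def w_neg)

lemma fn_bound:
	assumes al: "0 <= al" and e: "0 < \<eta>"
	shows "\<exists>C th. 0 <= th & (\<forall>k y. \<bar>fn al \<eta> c k y\<bar> <= C*(1+exp (th*y)))"
proof -
	obtain t1 where t1: "\<And>t. t1 <= t ==> invertible (F t)"
		"\<And>t k l. t1 <= t ==> ((%y. exp (- t*y)*W y $ k $ l) has_integral matrix_inv (F t) $ k $ l) {0..}" "al < t1" "0 <= t1"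
		by (rule W_transform) (rule that)
	have "\<forall>k l. \<exists>C. 0 <= C & (\<forall>x. \<bar>exp (al*x)*w2 al k l x\<bar> <= C*exp (t1*x))"
		unfolding w2_def w1_def[abs_def] using laplace_twice(3)[OF W_cont al t1(3) t1(2)] by auto
	then obtain C where C: "\<And>k l. 0 <= C k l" "\<And>k l x. \<bar>exp (al*x)*w2 al k l x\<bar> <= C k l*exp (t1*x)" by metis
	define D where "D = 1+(\<Sum>k\<in>UNIV. \<Sum>l\<in>UNIV. (C k l+exp (al*\<eta>)*C k l)/\<eta>*\<bar>F al $ l $ c\<bar>)"
	have Dk: "1+(\<Sum>l\<in>UNIV. (C k l+exp (al*\<eta>)*C k l)/\<eta>*\<bar>F al $ l $ c\<bar>) <= D" for k
		unfolding D_def by (rule add_left_mono, rule member_le_sum) (use C(1) e in \<open>auto intro!: sum_nonneg mult_nonneg_nonneg divide_nonneg_nonneg add_nonneg_nonneg\<close>)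
	have "\<bar>fn al \<eta> c k y\<bar> <= D*(1+exp (t1*y))" for k y
	proof -
		have e1: "exp (al*y) <= 1+exp (t1*y)"
		proof (cases "0 <= y")
			case True
			hence "al*y <= t1*y" using t1(3) by (intro mult_right_mono) auto
			hence "exp (al*y) <= exp (t1*y)" by simp
			thus ?thesis using exp_gt_zero[of "t1*y"] by linarith
		next
			case False
			hence "exp (al*y) <= 1" using al by (simp add: mult_nonneg_nonpos)
			thus ?thesis using exp_gt_zero[of "t1*y"] by linarith
		qed
		have e2: "exp (t1*(y - \<eta>)) <= exp (t1*y)" using t1(4) e by (simp add: mult_left_mono)
		have t: "\<bar>exp (al*y)*((w2 al k l y-w2 al k l (y - \<eta>))/\<eta>*F al $ l $ c)\<bar>
				\<le> (C k l+exp (al*\<eta>)*C k l)/\<eta>*\<bar>F al $ l $ c\<bar>*exp (t1*y)" for l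
		proof -
			have "exp (al*y)*w2 al k l (y - \<eta>) = exp (al*\<eta>)*(exp (al*(y - \<eta>))*w2 al k l (y - \<eta>))"
				by (simp add: right_diff_distrib flip: exp_add mult.assoc)
			hence "\<bar>exp (al*y)*w2 al k l (y - \<eta>)\<bar> = exp (al*\<eta>)*\<bar>exp (al*(y - \<eta>))*w2 al k l (y - \<eta>)\<bar>" by (simp only: abs_mult abs_exp_cancel)
			also have "\<dots> <= exp (al*\<eta>)*(C k l*exp (t1*(y - \<eta>)))" by (intro mult_left_mono C) simp
			also have "\<dots> <= exp (al*\<eta>)*(C k l*exp (t1*y))" by (intro mult_left_mono e2 C(1)) simp
			finally have 1: "\<bar>exp (al*y)*w2 al k l (y - \<eta>)\<bar> <= exp (al*\<eta>)*(C k l*exp (t1*y))" .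
			have "\<bar>exp (al*y)*(w2 al k l y-w2 al k l (y - \<eta>))\<bar> <= \<bar>exp (al*y)*w2 al k l y\<bar>+\<bar>exp (al*y)*w2 al k l (y - \<eta>)\<bar>"
				unfolding right_diff_distrib by (rule abs_triangle_ineq4)
			also have "\<dots> <= C k l*exp (t1*y)+exp (al*\<eta>)*(C k l*exp (t1*y))" by (intro add_mono 1 C)
			also have "\<dots> = (C k l+exp (al*\<eta>)*C k l)*exp (t1*y)" by (simp add: distrib_right)
			finally have "\<bar>exp (al*y)*(w2 al k l y-w2 al k l (y - \<eta>))\<bar>/\<eta>*\<bar>F al $ l $ c\<bar> <= (C k l+exp (al*\<eta>)*C k l)*exp (t1*y)/\<eta>*\<bar>F al $ l $ c\<bar>"
				using e by (intro mult_right_mono divide_right_mono) auto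
			thus ?thesis using e by (simp add: abs_mult mult_ac)
		qed
		have "\<bar>fn al \<eta> c k y\<bar> = \<bar>exp (al*y)*(if k = c then 1 else 0)-(\<Sum>l\<in>UNIV. exp (al*y)*((w2 al k l y-w2 al k l (y - \<eta>))/\<eta>*F al $ l $ c))\<bar>"
			unfolding fn_def right_diff_distrib sum_distrib_left ..
		also have "\<dots> <= exp (al*y)+(\<Sum>l\<in>UNIV. (C k l+exp (al*\<eta>)*C k l)/\<eta>*\<bar>F al $ l $ c\<bar>*exp (t1*y))"
			by (intro order_trans[OF abs_triangle_ineq4] add_mono order_trans[OF sum_abs] sum_mono t) auto
		also have "\<dots> <= (1+exp (t1*y))+(\<Sum>l\<in>UNIV. (C k l+exp (al*\<eta>)*C k l)/\<eta>*\<bar>F al $ l $ c\<bar>)*(1+exp (t1*y))"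
			unfolding sum_distrib_right[symmetric] using C(1) e
			by (intro add_mono e1 mult_left_mono sum_nonneg mult_nonneg_nonneg divide_nonneg_nonneg add_nonneg_nonneg) auto
		also have "\<dots> = (1+(\<Sum>l\<in>UNIV. (C k l+exp (al*\<eta>)*C k l)/\<eta>*\<bar>F al $ l $ c\<bar>))*(1+exp (t1*y))" by (simp only: distrib_right mult_1)
		also have "\<dots> <= D*(1+exp (t1*y))" by (rule mult_right_mono[OF Dk]) (simp add: add_nonneg_nonneg)
		finally show ?thesis .
	qed
	thus ?thesis using t1(4) by blast
qed

text \<open>\<open>scale_renewal\<close> at y and at y - \<eta> gives the drift of the correction
  term, \<open>mexp_integral\<close> that of exp(al y) times the identity. Together they form an
  occupation integral of \<open>d\<close> weighted by column c of F, and \<open>d\<close> vanishes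
  above \<eta>.\<close>

lemma fn_drift:
	fixes c :: 'n
	assumes al: "0 <= al" and e: "0 < \<eta>" and t: "0 <= t"
	defines "K \<equiv> exp (al*\<eta>)*(\<Sum>l\<in>UNIV. \<bar>F al $ l $ c\<bar>)"
	shows "ennreal \<bar>(\<integral>w. phase_eval (fn al \<eta> c) (J t w) (y+X t w) \<partial>P 0 i)-fn al \<eta> c i y\<bar>
			\<le> (\<integral>\<^sup>+v. indicator {0..t} v * (\<integral>\<^sup>+w. ennreal (K*clip ((\<eta> - (y+X v w))/\<eta>))*ennreal (alive v w) \<partial>P 0 i) \<partial>lborel)"
proof -
	interpret pair_sigma_finite lborel "P 0 i" by (rule pair_sf)
	let ?N = "lborel \<Otimes>\<^sub>M P 0 i"
	let ?E = "%k l y. exp (al*y)*w2 al k l y"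
	let ?F = "%l. F al $ l $ c"
	\<comment> \<open>The first term stems from the identity part of \<open>fn\<close>, the quotient of
	  ramps from the correction; above \<eta> the quotient equals exp(al z) and cancels it.\<close>
	define d where "d z = exp (al*z)-(ramp al z-exp (al*\<eta>)*ramp al (z - \<eta>))/\<eta>" for z
	have d_eq: "d z = exp (al*z)*clip ((\<eta> - z)/\<eta>)" for z
	proof -
		have "exp (al*\<eta>)*ramp al (z - \<eta>) = max 0 (z - \<eta>)*exp (al*z)"
			by (simp add: ramp_def right_diff_distrib mult.left_commute flip: exp_add)
		hence "d z = exp (al*z)*(1-(max 0 z-max 0 (z - \<eta>))/\<eta>)"
			unfolding d_def ramp_def using e by (simp add: field_simps)
		moreover have "1-(max 0 z-max 0 (z - \<eta>))/\<eta> = clip ((\<eta> - z)/\<eta>)"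
			using e by (auto simp: clip_def max_def min_def field_simps)
		ultimately show ?thesis by simp
	qed
	have d_bound: "0 <= d z" "d z <= exp (al*\<eta>)*clip ((\<eta> - z)/\<eta>)" for z
	proof -
		show "0 <= d z" unfolding d_eq by simp
		show "d z <= exp (al*\<eta>)*clip ((\<eta> - z)/\<eta>)"
		proof (cases "z <= \<eta>")
			case True
			thus ?thesis unfolding d_eq using al by (intro mult_right_mono) (auto intro: mult_left_mono)
		next
			case False
			hence "clip ((\<eta> - z)/\<eta>) = 0" using e by (simp add: clip_def max_def min_def field_simps)
			thus ?thesis unfolding d_eq by simp
		qed
	qed
	note ren = scale_renewal[OF al t, where i=i]
	let ?p = "%l y. \<Sum>k\<in>UNIV. \<integral>w. ?E k l (y+X t w)*ph k t w \<partial>P 0 i"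
	let ?s = "%l y. \<integral>p. ramp al (y+level p) * occupied t l p \<partial>?N"
	let ?m = "mexp (scaleR t (F al))"
	let ?d = "%l. \<integral>p. d (y+level p) * occupied t l p \<partial>?N"
	have fnE: "fn al \<eta> c k z = exp (al*z)*(if k = c then 1 else 0)-(\<Sum>l\<in>UNIV. (?E k l z-exp (al*\<eta>)*?E k l (z - \<eta>))/\<eta>*?F l)" for k z
	proof -
		have eq: "exp (al*z)*w2 al k l (z - \<eta>) = exp (al*\<eta>)*?E k l (z - \<eta>)" for l
			by (simp add: right_diff_distrib flip: exp_add mult.assoc)
		have t: "exp (al*z)*((w2 al k l z-w2 al k l (z - \<eta>))/\<eta>*?F l) = (?E k l z-exp (al*\<eta>)*?E k l (z - \<eta>))/\<eta>*?F l" for l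
			unfolding eq[symmetric] by (simp add: right_diff_distrib diff_divide_distrib left_diff_distrib mult.assoc)
		have "fn al \<eta> c k z = exp (al*z)*(if k = c then 1 else 0)-exp (al*z)*(\<Sum>l\<in>UNIV. (w2 al k l z-w2 al k l (z - \<eta>))/\<eta>*?F l)"
			unfolding fn_def by (rule right_diff_distrib)
		also have "exp (al*z)*(\<Sum>l\<in>UNIV. (w2 al k l z-w2 al k l (z - \<eta>))/\<eta>*?F l)
				= (\<Sum>l\<in>UNIV. exp (al*z)*((w2 al k l z-w2 al k l (z - \<eta>))/\<eta>*?F l))" by (rule sum_distrib_left)
		finally show ?thesis unfolding t .
	qed
	have ie: "integrable (P 0 i) (%w. exp (al*(y+X t w))*ph c t w)"
		using mgf_mexp(1)[OF al t, of i c] by (simp add: distrib_left exp_add mult.assoc)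
	have iE: "integrable (P 0 i) (%w. ?E k l (y'+X t w)*ph k t w)" for k l y' by (rule ren(1))
	have ar: "(A-q*B)/\<eta>*D*p = A*p*(D/\<eta>)-B*p*(q*D/\<eta>)" for A B D p q
		using e by (simp add: field_simps)
	have pe: "phase_eval (fn al \<eta> c) (J t w) (y+X t w) = exp (al*(y+X t w))*ph c t w
		 - (\<Sum>l\<in>UNIV. (\<Sum>k\<in>UNIV. ?E k l (y+X t w)*ph k t w)*(?F l/\<eta>)-(\<Sum>k\<in>UNIV. ?E k l ((y - \<eta>)+X t w)*ph k t w)*(exp (al*\<eta>)*?F l/\<eta>))" for w
	proof -
		have "phase_eval (fn al \<eta> c) (J t w) (y+X t w) = (\<Sum>k\<in>UNIV. exp (al*(y+X t w))*((if k = c then 1 else 0)*ph k t w))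
			 - (\<Sum>k\<in>UNIV. (\<Sum>l\<in>UNIV. (?E k l (y+X t w)-exp (al*\<eta>)*?E k l (y+X t w - \<eta>))/\<eta>*?F l)*ph k t w)"
			unfolding phase_eval_ph fnE left_diff_distrib sum_subtractf by (simp only: mult.assoc)
		also have "(\<Sum>k\<in>UNIV. exp (al*(y+X t w))*((if k = c then 1 else 0)*ph k t w)) = exp (al*(y+X t w))*ph c t w"
			by (simp add: if_distrib[of "%a. a*_"] cong: if_cong flip: sum_distrib_left)
		also have "(\<Sum>k\<in>UNIV. (\<Sum>l\<in>UNIV. (?E k l (y+X t w)-exp (al*\<eta>)*?E k l (y+X t w - \<eta>))/\<eta>*?F l)*ph k t w)
			 = (\<Sum>l\<in>UNIV. \<Sum>k\<in>UNIV. (?E k l (y+X t w)-exp (al*\<eta>)*?E k l (y+X t w - \<eta>))/\<eta>*?F l*ph k t w)"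
			unfolding sum_distrib_right by (rule sum.swap)
		also have "\<dots> = (\<Sum>l\<in>UNIV. (\<Sum>k\<in>UNIV. ?E k l (y+X t w)*ph k t w)*(?F l/\<eta>)-(\<Sum>k\<in>UNIV. ?E k l ((y - \<eta>)+X t w)*ph k t w)*(exp (al*\<eta>)*?F l/\<eta>))"
			unfolding sum_distrib_right sum_subtractf[symmetric]
		proof (intro sum.cong refl)
			fix l k
			have "y+X t w - \<eta> = (y - \<eta>)+X t w" by simp
			thus "(?E k l (y+X t w)-exp (al*\<eta>)*?E k l (y+X t w - \<eta>))/\<eta>*?F l*ph k t w
				= ?E k l (y+X t w)*ph k t w*(?F l/\<eta>)-?E k l ((y - \<eta>)+X t w)*ph k t w*(exp (al*\<eta>)*?F l/\<eta>)"
				using ar by (simp only:)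
		qed
		finally show ?thesis .
	qed
	have int_pe: "(\<integral>w. phase_eval (fn al \<eta> c) (J t w) (y+X t w) \<partial>P 0 i) = exp (al*y)*?m $ i $ c
		 - (\<Sum>l\<in>UNIV. ?p l y*(?F l/\<eta>)-?p l (y - \<eta>)*(exp (al*\<eta>)*?F l/\<eta>))"
	proof -
		have "(\<integral>w. exp (al*(y+X t w))*ph c t w \<partial>P 0 i) = exp (al*y)*?m $ i $ c"
			unfolding mgf_mexp(2)[OF al t, symmetric] by (simp add: distrib_left exp_add mult.assoc)
		thus ?thesis unfolding pe
			by (simp add: Bochner_Integration.integral_diff Bochner_Integration.integral_sum Bochner_Integration.integrable_sum Bochner_Integration.integrable_diff iE ie
				del: times_divide_eq_right)
	qed
	have id: "integrable ?N (%p. d (y+level p) * occupied t l p)"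
		"?d l = exp (al*y)*integral {0..t} (%s. mexp (scaleR s (F al)) $ i $ l)-(?s l y-exp (al*\<eta>)*?s l (y - \<eta>))/\<eta>" for l
	proof -
		have i0: "integrable ?N (%p. exp (al*y)*(exp (al*level p) * occupied t l p))"
			by (intro integrable_mult_right occupied_mgf(1) al t)
		have i1: "integrable ?N (%p. ramp al (y'+level p) * occupied t l p)" for y' by (rule ren(2))
		have rw: "d (y+level p) * occupied t l p = exp (al*y)*(exp (al*level p) * occupied t l p)
				- (ramp al (y+level p) * occupied t l p-exp (al*\<eta>)*(ramp al ((y - \<eta>)+level p) * occupied t l p))/\<eta>" for p
		proof -
			have "y+level p - \<eta> = (y - \<eta>)+level p" by simp
			thus ?thesis unfolding d_def left_diff_distrib distrib_left exp_add
				by (simp only: diff_divide_distrib left_diff_distrib times_divide_eq_left mult.assoc)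
		qed
		have i2: "integrable ?N (%p. (ramp al (y+level p) * occupied t l p-exp (al*\<eta>)*(ramp al ((y - \<eta>)+level p) * occupied t l p))/\<eta>)"
			by (intro integrable_divide Bochner_Integration.integrable_diff integrable_mult_right i1)
		show "integrable ?N (%p. d (y+level p) * occupied t l p)" unfolding rw by (intro Bochner_Integration.integrable_diff i0 i2)
		show "?d l = exp (al*y)*integral {0..t} (%s. mexp (scaleR s (F al)) $ i $ l)-(?s l y-exp (al*\<eta>)*?s l (y - \<eta>))/\<eta>"
			unfolding rw Bochner_Integration.integral_diff[OF i0 i2] integral_divide_zero integral_mult_right_zero
				Bochner_Integration.integral_diff[OF i1 integrable_mult_right[OF i1]] occupied_mgf(2)[OF al t] by (rule refl)
	qed
	have mx: "?m $ i $ c = (if i = c then 1 else 0)+(\<Sum>l\<in>UNIV. integral {0..t} (%s. mexp (scaleR s (F al)) $ i $ l)*?F l)"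
		using arg_cong[OF mexp_integral[OF t, of "F al"], of "%A. A $ i $ c"] by (simp add: matrix_matrix_mult_def mat_def)
	have key: "(\<integral>w. phase_eval (fn al \<eta> c) (J t w) (y+X t w) \<partial>P 0 i)-fn al \<eta> c i y = (\<Sum>l\<in>UNIV. ?F l*?d l)"
	proof -
		have p: "?p l y' = ?E i l y'+?s l y'" for l y' by (rule ren(3))
		have "(\<Sum>l\<in>UNIV. ?p l y*(?F l/\<eta>)-?p l (y - \<eta>)*(exp (al*\<eta>)*?F l/\<eta>))
			 = (\<Sum>l\<in>UNIV. (?E i l y-exp (al*\<eta>)*?E i l (y - \<eta>))/\<eta>*?F l+(?s l y-exp (al*\<eta>)*?s l (y - \<eta>))/\<eta>*?F l)"
			unfolding p using e by (intro sum.cong refl) (simp add: field_simps)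
		hence "(\<integral>w. phase_eval (fn al \<eta> c) (J t w) (y+X t w) \<partial>P 0 i)-fn al \<eta> c i y
			= exp (al*y)*(\<Sum>l\<in>UNIV. integral {0..t} (%s. mexp (scaleR s (F al)) $ i $ l)*?F l)-(\<Sum>l\<in>UNIV. (?s l y-exp (al*\<eta>)*?s l (y - \<eta>))/\<eta>*?F l)"
			unfolding int_pe fnE mx by (simp add: sum.distrib distrib_left)
		also have "\<dots> = (\<Sum>l\<in>UNIV. ?F l*?d l)"
			unfolding id(2) by (simp add: sum_distrib_left right_diff_distrib sum_subtractf mult_ac)
		finally show ?thesis .
	qed
	have d0: "0 <= ?d l" for l by (intro integral_nonneg_AE AE_I2 mult_nonneg_nonneg d_bound occupied_bounds)
	have [measurable]: "d \<in> Bor borel" unfolding d_eq[abs_def] by measurable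
	let ?r = "%z. exp (al*\<eta>)*clip ((\<eta> - z)/\<eta>)"
	have "ennreal \<bar>\<Sum>l\<in>UNIV. ?F l*?d l\<bar> <= ennreal (\<Sum>l\<in>UNIV. \<bar>?F l\<bar>*?d l)"
		by (intro ennreal_leI order_trans[OF sum_abs] sum_mono) (simp add: abs_mult d0)
	also have "\<dots> = (\<Sum>l\<in>UNIV. ennreal (\<bar>?F l\<bar>)*ennreal (?d l))"
		by (subst sum_ennreal[symmetric]) (auto simp: d0 ennreal_mult)
	also have "\<dots> <= (\<Sum>l\<in>UNIV. ennreal (\<bar>?F l\<bar>)*(\<integral>\<^sup>+v. indicator {0..t} v * (\<integral>\<^sup>+w. ennreal (?r (y+X v w))*ennreal (alive v w) \<partial>P 0 i) \<partial>lborel))"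
	proof (intro sum_mono mult_left_mono)
		fix l
		have "ennreal (?d l) = (\<integral>\<^sup>+p. ennreal (d (y+level p) * occupied t l p) \<partial>?N)"
			by (rule nn_integral_eq_integral[OF id(1), symmetric]) (intro AE_I2 mult_nonneg_nonneg d_bound occupied_bounds)
		also have "\<dots> = (\<integral>\<^sup>+v. (\<integral>\<^sup>+w. ennreal (d (y+level (v, w)) * occupied t l (v, w)) \<partial>P 0 i) \<partial>lborel)"
			by (rule M2.nn_integral_fst[symmetric]) measurable
		also have "\<dots> <= (\<integral>\<^sup>+v. indicator {0..t} v * (\<integral>\<^sup>+w. ennreal (?r (y+X v w))*ennreal (alive v w) \<partial>P 0 i) \<partial>lborel)"
		proof (rule nn_integral_mono)
			fix v :: real
			show "(\<integral>\<^sup>+w. ennreal (d (y+level (v, w)) * occupied t l (v, w)) \<partial>P 0 i)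
				\<le> indicator {0..t} v * (\<integral>\<^sup>+w. ennreal (?r (y+X v w))*ennreal (alive v w) \<partial>P 0 i)"
			proof (cases "v \<in> {0..t}")
				case True
				hence v: "max 0 v = v" by simp
				have "ph l v w <= alive v w" for w by (simp add: ph_def alive_def)
				hence "d (y+X v w)*ph l v w <= ?r (y+X v w)*alive v w" for w
					by (intro mult_mono d_bound) (auto intro: mult_nonneg_nonneg)
				hence "ennreal (d (y+X v w)*ph l v w) <= ennreal (?r (y+X v w))*ennreal (alive v w)" for w
					by (subst ennreal_mult[symmetric]) (auto intro!: ennreal_leI)
				thus ?thesis using True by (auto simp: occupied_def v intro!: nn_integral_mono)
			qed (simp add: occupied_def)
		qed
		finally show "ennreal (?d l) <= (\<integral>\<^sup>+v. indicator {0..t} v * (\<integral>\<^sup>+w. ennreal (?r (y+X v w))*ennreal (alive v w) \<partial>P 0 i) \<partial>lborel)" .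
	qed simp
	also have "\<dots> = ennreal (\<Sum>l\<in>UNIV. \<bar>?F l\<bar>)*(\<integral>\<^sup>+v. indicator {0..t} v * (\<integral>\<^sup>+w. ennreal (?r (y+X v w))*ennreal (alive v w) \<partial>P 0 i) \<partial>lborel)"
		unfolding sum_distrib_right[symmetric] by (subst sum_ennreal) auto
	also have "\<dots> = (\<integral>\<^sup>+v. ennreal (\<Sum>l\<in>UNIV. \<bar>?F l\<bar>)*(indicator {0..t} v * (\<integral>\<^sup>+w. ennreal (?r (y+X v w))*ennreal (alive v w) \<partial>P 0 i)) \<partial>lborel)"
	proof (rule nn_integral_cmult[symmetric])
		have "(%v. indicator {0..t} v * (\<integral>\<^sup>+w. ennreal (?r (y+level (v, w)))*ennreal (alive (max 0 v) w) \<partial>P 0 i)) \<in> Bor lborel"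
			using alive_joint by measurable
		moreover have "indicator {0..t} v * (\<integral>\<^sup>+w. ennreal (?r (y+level (v, w)))*ennreal (alive (max 0 v) w) \<partial>P 0 i)
			= indicator {0..t} v * (\<integral>\<^sup>+w. ennreal (?r (y+X v w))*ennreal (alive v w) \<partial>P 0 i)" for v
			by (cases "v \<in> {0..t}") (auto simp: max_def)
		ultimately show "(%v. indicator {0..t} v * (\<integral>\<^sup>+w. ennreal (?r (y+X v w))*ennreal (alive v w) \<partial>P 0 i)) \<in> Bor lborel"
			by (simp only:)
	qed
	also have "\<dots> = (\<integral>\<^sup>+v. indicator {0..t} v * (\<integral>\<^sup>+w. ennreal (K*clip ((\<eta> - (y+X v w))/\<eta>))*ennreal (alive v w) \<partial>P 0 i) \<partial>lborel)"
	proof (rule nn_integral_cong)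
		fix v
		have "ennreal (\<Sum>l\<in>UNIV. \<bar>?F l\<bar>)*(\<integral>\<^sup>+w. ennreal (?r (y+X v w))*ennreal (alive v w) \<partial>P 0 i)
			 = (\<integral>\<^sup>+w. ennreal (\<Sum>l\<in>UNIV. \<bar>?F l\<bar>)*(ennreal (?r (y+X v w))*ennreal (alive v w)) \<partial>P 0 i)"
			by (rule nn_integral_cmult[symmetric]) measurable
		also have "\<dots> = (\<integral>\<^sup>+w. ennreal (K*clip ((\<eta> - (y+X v w))/\<eta>))*ennreal (alive v w) \<partial>P 0 i)"
		proof (rule nn_integral_cong)
			fix w
			have "ennreal (\<Sum>l\<in>UNIV. \<bar>?F l\<bar>)*ennreal (?r (y+X v w)) = ennreal (K*clip ((\<eta> - (y+X v w))/\<eta>))"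
				by (subst ennreal_mult[symmetric]) (auto simp: K_def mult_ac intro: sum_nonneg)
			thus "ennreal (\<Sum>l\<in>UNIV. \<bar>?F l\<bar>)*(ennreal (?r (y+X v w))*ennreal (alive v w)) = ennreal (K*clip ((\<eta> - (y+X v w))/\<eta>))*ennreal (alive v w)"
				by (simp only: mult.assoc[symmetric])
		qed
		finally show "ennreal (\<Sum>l\<in>UNIV. \<bar>?F l\<bar>)*(indicator {0..t} v * (\<integral>\<^sup>+w. ennreal (?r (y+X v w))*ennreal (alive v w) \<partial>P 0 i))
			= indicator {0..t} v * (\<integral>\<^sup>+w. ennreal (K*clip ((\<eta> - (y+X v w))/\<eta>))*ennreal (alive v w) \<partial>P 0 i)"
			by (simp only: mult.left_commute[of _ "indicator {0..t} v"])
	qed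
	finally show ?thesis unfolding key .
qed

end

subsection \<open>Dynkin formula\<close>

context reflected_map
begin

definition stopped :: "real => nat => real => 'w => bool" where
	"stopped r m t w \<longleftrightarrow> r < Ru t w | real m < Rl t w | real m <= t"
definition kap :: "real => nat => nat => 'w => nat" where
	"kap r m n w = (LEAST k. stopped r m (gr n k) w)"
definition tt :: "real => nat => 'w => real" where
	"tt r m w = Inf {t. 0 <= t & stopped r m t w}"

lemma stopped_meas [measurable]: "Measurable.pred M (stopped r m t)"
	unfolding stopped_def by measurable

lemma kap_meas [measurable]: "kap r m n \<in> M \<rightarrow>\<^sub>M count_space UNIV"
	unfolding kap_def by measurable

text \<open>Set to 0 off \<open>G\<close>, where the reflection gives no path regularity, so that
  every path is right-continuous as \<open>measurable_right_cont_process\<close> requires.\<close>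

definition Hp :: "real => 'w => real" where
	"Hp t w = (if w \<in> G then X t w+Rl t w-Ru t w else 0)"

lemma Hp_meas [measurable]: "Hp t \<in> Bor M"
	unfolding Hp_def by measurable

lemma Hp_joint [measurable]: "(%p. Hp (max 0 (fst p)) (snd p)) \<in> Bor (borel \<Otimes>\<^sub>M M)"
proof (rule measurable_right_cont_process)
	fix w t assume t: "w \<in> space M" "(0::real) <= t"
	show "continuous (at_right t) (%s. Hp s w)"
	proof (cases "w \<in> G")
		case True
		interpret reflected_phase a "%t. X t w" "%t. Rl t w" "%t. Ru t w" "%t. J t w" by (rule path[OF True])
		show ?thesis using True by (simp add: Hp_def continuous_add continuous_diff x_rc[OF t(2)] l_rc[OF t(2)] u_rc[OF t(2)])
	qed (simp add: Hp_def)
qed simp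

end

text \<open>Test functions that are harmonic up to the drift density \<open>rho\<close>, with the
  boundary condition of \<open>reflected_functional\<close>. The growth bound reaches beyond the
  strip because a position with frozen regulators can leave it between grid points.\<close>

locale functional_map = reflected_map M P X J a Rl Ru
	for M P X and J :: "real => 'w => 'n::finite option" and a Rl Ru +
	fixes al :: real and f b :: "'n => real => real" and rho :: "real => real" and C th R :: real
	assumes al: "0 <= al"
		and f_deriv: "(f i has_real_derivative al*f i y-b i y) (at y)"
		and b_cont: "continuous_on UNIV (b i)"
		and b_neg: "y <= 0 ==> b i y = 0"
		and th: "0 <= th" and f_bound: "\<bar>f i y\<bar> <= C*(1+exp (th*y))"
		and rho_cont: "continuous_on UNIV rho" and rho_bounds: "0 <= rho y" "rho y <= R"
		and drift: "0 <= s ==> ennreal \<bar>(\<integral>w. phase_eval f (J s w) (y+X s w) \<partial>P 0 i)-f i y\<bar>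
			\<le> (\<integral>\<^sup>+v. indicator {0..s} v * (\<integral>\<^sup>+w. ennreal (rho (y+X v w))*ennreal (alive v w) \<partial>P 0 i) \<partial>lborel)"
begin

lemma func: "w \<in> G ==> reflected_functional a (%t. X t w) (%t. Rl t w) (%t. Ru t w) (%t. J t w) al f b"
proof -
	assume g: "w \<in> G"
	interpret reflected_phase a "%t. X t w" "%t. Rl t w" "%t. Ru t w" "%t. J t w" by (rule path[OF g])
	show ?thesis by unfold_locales (auto intro: al f_deriv b_cont b_neg)
qed

lemma f_meas [measurable]: "f i \<in> Bor borel"
	by (intro borel_measurable_continuous_onI continuous_at_imp_continuous_on ballI DERIV_isCont[OF f_deriv])

lemma rho_meas [measurable]: "rho \<in> Bor borel"
	by (rule borel_measurable_continuous_onI[OF rho_cont])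

lemma C_nonneg: "0 <= C"
proof -
	have "0 <= C*(1+exp (th*0))" by (rule order_trans[OF abs_ge_zero f_bound])
	thus ?thesis by simp
qed

lemma f_upper: "y <= Y ==> \<bar>f i y\<bar> <= C*(1+exp (th*Y))"
	by (rule order_trans[OF f_bound]) (use C_nonneg th in \<open>auto intro!: mult_left_mono\<close>)

lemma b_upper: "\<exists>B\<ge>0. \<forall>i. \<forall>y\<le>Y. \<bar>b i y\<bar> <= B"
proof -
	have "\<exists>B\<ge>0. \<forall>y\<le>Y. \<bar>b i y\<bar> <= B" for i
	proof -
		have "compact (b i ` {0..Y})" by (intro compact_continuous_image continuous_on_subset[OF b_cont]) auto
		then obtain B where B: "\<And>y. y \<in> {0..Y} ==> norm (b i y) <= B" by (meson bounded_iff compact_imp_bounded imageI)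
		have "\<bar>b i y\<bar> <= max 0 B" if "y <= Y" for y using B[of y] b_neg[of y i] that by (cases "0 <= y") auto
		thus ?thesis by (intro exI[of _ "max 0 B"]) auto
	qed
	then obtain B where B: "\<And>i. 0 <= B i" "\<And>i y. y <= Y ==> \<bar>b i y\<bar> <= B i" by metis
	have "B i <= (\<Sum>i\<in>UNIV. B i)" for i by (rule member_le_sum) (auto intro: B)
	from order_trans[OF B(2) this] have "\<And>i y. y <= Y ==> \<bar>b i y\<bar> <= (\<Sum>i\<in>UNIV. B i)" .
	thus ?thesis by (intro exI[of _ "\<Sum>i\<in>UNIV. B i"]) (auto intro!: sum_nonneg B(1))
qed

definition Ph :: "real => 'w => real" where
	"Ph t w = phase_eval f (J t w) (a+(X t w+Rl t w-Ru t w))*exp (- al*Rl t w)"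
definition pu :: "nat => nat => 'w => real" where
	"pu n k w = Ph (gr n (Suc k)) w -
		 exp (- al*Rl (gr n k) w)*phase_eval f (J (gr n (Suc k)) w) (a+X (gr n (Suc k)) w+Rl (gr n k) w-Ru (gr n k) w)"
text \<open>Adapted weight and position at a grid point, the input of \<open>step_bound\<close>. On
  paths that start in the strip and are alive there, the weight is exp(-al R_l) before stopping and
  0 afterwards, and \<open>Hh\<close> is a + H.\<close>

definition V :: "real => nat => nat => nat => 'w => real" where
	"V r m n k w = (if J (gr n k) w ~= None & GA w & \<not> r < RuA (gr n k) w & \<not> real m < RlA (gr n k) w & \<not> real m <= gr n k
		 then exp (- al*RlA (gr n k) w) else 0)"
definition Hh :: "nat => nat => 'w => real" where
	"Hh n k w = a+XA (gr n k) w+RlA (gr n k) w-RuA (gr n k) w"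

lemma Ph_meas [measurable]: "Ph t \<in> Bor M"
	unfolding Ph_def phase_eval_ph by measurable

lemma pu_meas [measurable]: "pu n k \<in> Bor M"
	unfolding pu_def phase_eval_ph by measurable

lemma gr_rat: "gr n k \<in> \<rat>" by (simp add: gr_def)

lemma V_hist: "V r m n k \<in> Bor (hist (gr n k))"
proof -
	let ?H = "hist (gr n k)"
	have 1: "Measurable.pred ?H (%w. J (gr n k) w ~= None)"
		by (rule measurable_compose[OF J_hist[OF gr_nonneg order_refl]]) simp
	have 2: "Measurable.pred ?H GA" by (rule GA_hist[OF gr_nonneg])
	note [measurable] = RuA_hist[of "gr n k"] RlA_hist[of "gr n k"]
	have 3: "Measurable.pred ?H (%w. \<not> r < RuA (gr n k) w & \<not> real m < RlA (gr n k) w & \<not> real m <= gr n k)" by measurable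
	have 4: "(%w. exp (- al*RlA (gr n k) w)) \<in> Bor ?H" by measurable
	show ?thesis unfolding V_def
		by (rule measurable_If[OF 4 borel_measurable_const]) (intro predE pred_intros_logic 1 2 3)
qed

lemma Hh_hist: "Hh n k \<in> Bor (hist (gr n k))"
	unfolding Hh_def[abs_def]
	by (intro borel_measurable_add borel_measurable_diff borel_measurable_const XA_hist RuA_hist RlA_hist gr_nonneg order_refl)

lemma V_G:
	assumes "w \<in> G" "J (gr n k) w ~= None"
	shows "V r m n k w = (if stopped r m (gr n k) w then 0 else exp (- al*Rl (gr n k) w))"
		and "Hh n k w = a+(X (gr n k) w+Rl (gr n k) w-Ru (gr n k) w)"
proof -
	have om: "w \<in> space M" using assms(1) by (rule G_space)
	have g: "GA w" using GA_G[OF om gr_nonneg assms(2)] assms(1) by simp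
	note R = RA_eq[OF assms(1) gr_rat gr_nonneg assms(2)]
	show "V r m n k w = (if stopped r m (gr n k) w then 0 else exp (- al*Rl (gr n k) w))"
		using assms(2) g by (auto simp: V_def stopped_def R)
	show "Hh n k w = a+(X (gr n k) w+Rl (gr n k) w-Ru (gr n k) w)"
	proof -
		have "XA (gr n k) w = X (gr n k) w" unfolding XA_def by (rule if_not_P[OF assms(2)])
		thus ?thesis by (simp add: Hh_def R)
	qed
qed

lemma V_nonzero: "w \<in> space M ==> V r m n k w ~= 0 ==> w \<in> G & J (gr n k) w ~= None"
	using GA_G[OF _ gr_nonneg, of w n k] by (auto simp: V_def split: if_splits)

lemma V_bound: "w \<in> space M ==> \<bar>V r m n k w\<bar> <= 1"
proof (cases "V r m n k w = 0")
	case False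
	assume "w \<in> space M"
	note G = V_nonzero[OF this False]
	interpret reflected_phase a "%t. X t w" "%t. Rl t w" "%t. Ru t w" "%t. J t w" by (rule path) (use G in simp)
	show ?thesis using V_G(1)[of w n k r m] G al l_nonneg[of "gr n k"] by (auto simp: mult_nonneg_nonpos)
qed simp

lemma Hh_le: "w \<in> space M ==> V r m n k w ~= 0 ==> Hh n k w <= a"
proof -
	assume "w \<in> space M" "V r m n k w ~= 0"
	note G = V_nonzero[OF this]
	interpret reflected_phase a "%t. X t w" "%t. Rl t w" "%t. Ru t w" "%t. J t w" by (rule path) (use G in simp)
	show ?thesis using V_G(2)[of w n k] G h_le[of "gr n k"] by (simp add: h_def)
qed

definition Aa :: "real => nat => nat => nat => 'w => real" where
	"Aa r m n k w = V r m n k w*phase_eval f (J (gr n k+1/2 ^ n) w) (Hh n k w+(X (gr n k+1/2 ^ n) w-X (gr n k) w))*alive (gr n k) w"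
definition Bb :: "real => nat => nat => nat => 'w => real" where
	"Bb r m n k w = V r m n k w*phase_eval f (J (gr n k) w) (Hh n k w)"
definition Dn :: "real => nat => nat => 'w => real" where
	"Dn r m n w = indicator G w*(Ph (gr n (kap r m n w)) w-Ph 0 w-(\<Sum>k<kap r m n w. pu n k w))"

text \<open>The difference of \<open>Aa\<close> and \<open>Bb\<close> is the step with regulators
  frozen at the left grid point, while their movement is booked in \<open>pu\<close>. The increments
  of \<open>Ph\<close> telescope up to the stopping index, after which \<open>V\<close> is
  0.\<close>

lemma Dn_sum:
	assumes om: "w \<in> space M"
	shows "Dn r m n w = (\<Sum>k<m*2 ^ n. Aa r m n k w-Bb r m n k w)"
proof (cases "w \<in> G")
	case False
	hence "V r m n k w = 0" for k using V_nonzero[OF om] by blast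
	thus ?thesis using False by (simp add: Dn_def Aa_def Bb_def)
next
	case True
	interpret reflected_phase a "%t. X t w" "%t. Rl t w" "%t. Ru t w" "%t. J t w" by (rule path[OF True])
	have ggr: "grid n k = gr n k" for n k by (simp add: grid_def gr_def)
	have st: "stop r m t \<longleftrightarrow> stopped r m t w" for t by (simp add: stop_def stopped_def)
	have ki: "stop_index r m n = kap r m n w" by (simp add: stop_index_def kap_def st ggr)
	have kN: "kap r m n w <= m*2 ^ n" using stop_index_le[of r m n] by (simp add: ki)
	have kiff: "stopped r m (gr n k) w \<longleftrightarrow> kap r m n w <= k" for k using stop_iff[of r m n k] by (simp add: ki st ggr)
	have one: "Aa r m n k w-Bb r m n k w = (if k < kap r m n w then Ph (gr n (Suc k)) w-Ph (gr n k) w-pu n k w else 0)" for k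
	proof (cases "J (gr n k) w = None")
		case dead: True
		have "J (gr n (Suc k)) w = None" by (rule J_absorb[OF om gr_nonneg gr_mono dead]) simp
		thus ?thesis using dead by (simp add: Aa_def Bb_def V_def Ph_def pu_def)
	next
		case alive: False
		have al1: "alive (gr n k) w = 1" using alive by (simp add: alive_def)
		show ?thesis
		proof (cases "k < kap r m n w")
			case True
			hence "\<not> stopped r m (gr n k) w" using kiff by simp
			hence Vk: "V r m n k w = exp (- al*Rl (gr n k) w)" using V_G(1)[OF \<open>w \<in> G\<close> alive] by simp
			have Hs: "Hh n k w+(X (gr n (Suc k)) w-X (gr n k) w) = a+X (gr n (Suc k)) w+Rl (gr n k) w-Ru (gr n k) w"
				using V_G(2)[OF \<open>w \<in> G\<close> alive] by simp
			have 1: "Aa r m n k w = exp (- al*Rl (gr n k) w)*phase_eval f (J (gr n (Suc k)) w) (a+X (gr n (Suc k)) w+Rl (gr n k) w-Ru (gr n k) w)"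
				unfolding Aa_def gr_Suc[symmetric] Vk Hs al1 by (rule mult_1_right)
			have 2: "Bb r m n k w = Ph (gr n k) w"
				unfolding Bb_def Vk V_G(2)[OF \<open>w \<in> G\<close> alive] Ph_def by (rule mult.commute)
			show ?thesis unfolding 1 2 using True by (simp add: pu_def)
		next
			case False
			hence "V r m n k w = 0" using V_G(1)[OF \<open>w \<in> G\<close> alive] kiff by simp
			thus ?thesis using False by (simp add: Aa_def Bb_def)
		qed
	qed
	have "(\<Sum>k<m*2 ^ n. Aa r m n k w-Bb r m n k w) = (\<Sum>k<kap r m n w. Ph (gr n (Suc k)) w-Ph (gr n k) w-pu n k w)"
		unfolding one using kN by (intro sum.mono_neutral_cong_right) auto
	also have "\<dots> = Ph (gr n (kap r m n w)) w-Ph (gr n 0) w-(\<Sum>k<kap r m n w. pu n k w)"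
		unfolding sum_subtractf[of "%k. Ph (gr n (Suc k)) w-Ph (gr n k) w"] by (simp only: sum_lessThan_telescope[of "%k. Ph (gr n k) w"])
	finally show ?thesis using True by (simp add: Dn_def gr_def)
qed

lemma Bb_integrable: "integrable (P x i) (Bb r m n k)"
proof (rule finite_measure.integrable_const_bound[OF finite_P])
	note [measurable] = measurable_hist_M[OF V_hist] measurable_hist_M[OF Hh_hist]
	show "Bb r m n k \<in> Bor (P x i)" unfolding Bb_def phase_eval_ph by measurable
	show "AE w in P x i. norm (Bb r m n k w) <= 1*(C*(1+exp (th*a)))"
	proof (rule AE_I2)
		fix w assume "w \<in> space (P x i)"
		hence om: "w \<in> space M" by simp
		show "norm (Bb r m n k w) <= 1*(C*(1+exp (th*a)))"
		proof (cases "V r m n k w = 0")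
			case True thus ?thesis using C_nonneg by (simp add: Bb_def add_nonneg_nonneg)
		next
			case False
			have "\<bar>phase_eval f (J (gr n k) w) (Hh n k w)\<bar> <= C*(1+exp (th*a))"
				using f_upper[OF Hh_le[OF om False]] C_nonneg by (cases "J (gr n k) w") (auto simp: add_nonneg_nonneg)
			thus ?thesis unfolding Bb_def real_norm_def abs_mult by (intro mult_mono V_bound[OF om]) auto
		qed
	qed
qed

lemma Aa_integrable: "integrable (P x i) (Aa r m n k)"
proof -
	have eq: "Aa r m n k w = (\<Sum>j\<in>UNIV. \<Sum>l\<in>UNIV. ph j (gr n k) w*ph l (gr n k+1/2 ^ n) w *
			(V r m n k w*f l (Hh n k w+(X (gr n k+1/2 ^ n) w-X (gr n k) w))))" for w
		unfolding Aa_def phase_eval_ph sum_ph[symmetric]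
		by (simp add: sum_distrib_left sum_distrib_right mult_ac) (rule sum.swap)
	have d: "0 <= 1/(2::real) ^ n" by simp
	show ?thesis unfolding eq
		by (intro Bochner_Integration.integrable_sum step_integrable[OF gr_nonneg d measurable_hist_M[OF V_hist] measurable_hist_M[OF Hh_hist] V_bound Hh_le f_meas th f_bound])
qed

lemma joint_cong [measurable_cong]: "sets (lborel \<Otimes>\<^sub>M P x i) = sets (borel \<Otimes>\<^sub>M M)"
	by (intro sets_pair_measure_cong) auto

lemma pair_sf: "pair_sigma_finite lborel (P x i)"
	by (intro pair_sigma_finite.intro sigma_finite_lborel sigma_finite_P)

text \<open>\<open>step_bound\<close> in absolute time. The event that the weight is nonzero is
  enlarged to \<open>G\<close>, so the bound is free of the stopping rule.\<close>

lemma step_error: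
	"ennreal \<bar>(\<integral>w. Aa r m n k w \<partial>P x i)-(\<integral>w. Bb r m n k w \<partial>P x i)\<bar>
		\<le> (\<integral>\<^sup>+s. indicator {gr n k..gr n (Suc k)} s *
				(\<integral>\<^sup>+w. indicator G w*ennreal (rho (a+(X s w+Rl (gr n k) w-Ru (gr n k) w)))*ennreal (alive s w) \<partial>P x i) \<partial>lborel)"
proof -
	interpret pair_sigma_finite lborel "P x i" by (rule pair_sf)
	let ?t = "gr n k" and ?d = "1/2 ^ n :: real"
	have d: "0 <= ?d" by simp
	let ?Q = "%s. \<integral>\<^sup>+w. indicator G w*ennreal (rho (a+(X s w+Rl ?t w-Ru ?t w)))*ennreal (alive s w) \<partial>P x i"
	have "ennreal \<bar>(\<integral>w. Aa r m n k w \<partial>P x i)-(\<integral>w. Bb r m n k w \<partial>P x i)\<bar>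
		\<le> (\<integral>\<^sup>+v. indicator {0..?d} v * (\<integral>\<^sup>+w. indicator {w. V r m n k w ~= 0} w*ennreal (rho (Hh n k w+(X (?t + v) w-X ?t w)))*ennreal (alive (?t + v) w) \<partial>P x i) \<partial>lborel)"
		unfolding Aa_def Bb_def
		by (rule step_bound[OF gr_nonneg d V_hist Hh_hist V_bound Hh_le f_meas th f_bound _ drift[OF d]]) measurable
	also have "\<dots> <= (\<integral>\<^sup>+v. indicator {0..?d} v * ?Q (?t + v) \<partial>lborel)"
	proof (rule nn_integral_mono)
		fix v :: real
		show "indicator {0..?d} v * (\<integral>\<^sup>+w. indicator {w. V r m n k w ~= 0} w*ennreal (rho (Hh n k w+(X (?t + v) w-X ?t w)))*ennreal (alive (?t + v) w) \<partial>P x i)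
			\<le> indicator {0..?d} v * ?Q (?t + v)"
		proof (rule mult_left_mono, rule nn_integral_mono)
			fix w assume "w \<in> space (P x i)"
			hence om: "w \<in> space M" by simp
			show "indicator {w. V r m n k w ~= 0} w*ennreal (rho (Hh n k w+(X (?t + v) w-X ?t w)))*ennreal (alive (?t + v) w)
				\<le> indicator G w*ennreal (rho (a+(X (?t + v) w+Rl ?t w-Ru ?t w)))*ennreal (alive (?t + v) w)"
			proof (cases "V r m n k w = 0")
				case False
				note G = V_nonzero[OF om False]
				have hs: "Hh n k w+(X (?t + v) w-X ?t w) = a+(X (?t + v) w+Rl ?t w-Ru ?t w)"
					using V_G(2)[of w n k] G by simp
				show ?thesis unfolding hs using G False by (simp add: indicator_def)
			qed simp
		qed simp
	qed
	also have "\<dots> = (\<integral>\<^sup>+s. indicator {?t..gr n (Suc k)} s*?Q s \<partial>lborel)"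
	proof -
		have meas: "(%s. indicator {?t..gr n (Suc k)} s*?Q s) \<in> Bor lborel"
		proof -
			have "(%s. indicator {?t..gr n (Suc k)} s*(\<integral>\<^sup>+w. indicator G w*ennreal (rho (a+(X (max 0 (fst (s, w))) (snd (s, w))+Rl ?t w-Ru ?t w)))*ennreal (alive (max 0 (fst (s, w))) (snd (s, w))) \<partial>P x i)) \<in> Bor lborel"
				using alive_joint X_joint by measurable
			moreover have "indicator {?t..gr n (Suc k)} s*(\<integral>\<^sup>+w. indicator G w*ennreal (rho (a+(X (max 0 (fst (s, w))) (snd (s, w))+Rl ?t w-Ru ?t w)))*ennreal (alive (max 0 (fst (s, w))) (snd (s, w))) \<partial>P x i)
				= indicator {?t..gr n (Suc k)} s*?Q s" for s
			proof (cases "s \<in> {?t..gr n (Suc k)}")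
				case True
				hence "0 <= s" using gr_nonneg[of n k] by (simp del: gr_nonneg)
				thus ?thesis using True by simp
			qed simp
			ultimately show ?thesis by (simp only:)
		qed
		have "(\<integral>\<^sup>+s. indicator {?t..gr n (Suc k)} s*?Q s \<partial>lborel) = ennreal \<bar>1\<bar>*(\<integral>\<^sup>+v. indicator {?t..gr n (Suc k)} (?t+1 * v)*?Q (?t+1 * v) \<partial>lborel)"
			by (rule nn_integral_real_affine[OF meas[simplified]]) simp
		also have "\<dots> = (\<integral>\<^sup>+v. indicator {0..?d} v * ?Q (?t + v) \<partial>lborel)"
			unfolding abs_one ennreal_1 mult_1_left
			by (intro nn_integral_cong) (auto simp: gr_Suc indicator_def)
		finally show ?thesis by simp
	qed
	finally show ?thesis .
qed

definition Th :: "nat => nat => real \<times> 'w => ennreal" where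
	"Th m n p = (\<Sum>k<m*2 ^ n. indicator {gr n k..gr n (Suc k)} (fst p)*(indicator G (snd p) *
		 ennreal (rho (a+(X (max 0 (fst p)) (snd p)+Rl (gr n k) (snd p)-Ru (gr n k) (snd p))))*ennreal (alive (max 0 (fst p)) (snd p))))"

lemma Th_meas [measurable]: "Th m n \<in> Bor (borel \<Otimes>\<^sub>M M)"
	unfolding Th_def using alive_joint X_joint by measurable

lemma Dn_error: "ennreal \<bar>\<integral>w. Dn r m n w \<partial>P x i\<bar> <= (\<integral>\<^sup>+w. (\<integral>\<^sup>+s. Th m n (s, w) \<partial>lborel) \<partial>P x i)"
proof -
	interpret pair_sigma_finite lborel "P x i" by (rule pair_sf)
	have "(\<integral>w. Dn r m n w \<partial>P x i) = (\<integral>w. (\<Sum>k<m*2 ^ n. Aa r m n k w-Bb r m n k w) \<partial>P x i)"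
		by (rule Bochner_Integration.integral_cong) (auto simp: Dn_sum)
	also have "\<dots> = (\<Sum>k<m*2 ^ n. (\<integral>w. Aa r m n k w \<partial>P x i)-(\<integral>w. Bb r m n k w \<partial>P x i))"
		by (simp add: Bochner_Integration.integral_sum Bochner_Integration.integral_diff Aa_integrable Bb_integrable)
	finally have "ennreal \<bar>\<integral>w. Dn r m n w \<partial>P x i\<bar> <= ennreal (\<Sum>k<m*2 ^ n. \<bar>(\<integral>w. Aa r m n k w \<partial>P x i)-(\<integral>w. Bb r m n k w \<partial>P x i)\<bar>)"
		by (simp add: ennreal_leI sum_abs)
	also have "\<dots> = (\<Sum>k<m*2 ^ n. ennreal \<bar>(\<integral>w. Aa r m n k w \<partial>P x i)-(\<integral>w. Bb r m n k w \<partial>P x i)\<bar>)"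
		by (rule sum_ennreal[symmetric]) simp
	also have "\<dots> <= (\<Sum>k<m*2 ^ n. \<integral>\<^sup>+s. (\<integral>\<^sup>+w. indicator {gr n k..gr n (Suc k)} s*(indicator G w *
		 ennreal (rho (a+(X (max 0 s) w+Rl (gr n k) w-Ru (gr n k) w)))*ennreal (alive (max 0 s) w)) \<partial>P x i) \<partial>lborel)"
	proof (rule sum_mono, rule order_trans[OF step_error], rule nn_integral_mono)
		fix k and s :: real
		show "indicator {gr n k..gr n (Suc k)} s *
				(\<integral>\<^sup>+w. indicator G w*ennreal (rho (a+(X s w+Rl (gr n k) w-Ru (gr n k) w)))*ennreal (alive s w) \<partial>P x i)
			\<le> (\<integral>\<^sup>+w. indicator {gr n k..gr n (Suc k)} s*(indicator G w *
		 ennreal (rho (a+(X (max 0 s) w+Rl (gr n k) w-Ru (gr n k) w)))*ennreal (alive (max 0 s) w)) \<partial>P x i)"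
		proof (cases "s \<in> {gr n k..gr n (Suc k)}")
			case True
			hence "0 <= s" using gr_nonneg[of n k] by (simp del: gr_nonneg)
			thus ?thesis using True by simp
		qed simp
	qed
	also have "\<dots> = (\<integral>\<^sup>+s. (\<Sum>k<m*2 ^ n. \<integral>\<^sup>+w. indicator {gr n k..gr n (Suc k)} s*(indicator G w *
		 ennreal (rho (a+(X (max 0 s) w+Rl (gr n k) w-Ru (gr n k) w)))*ennreal (alive (max 0 s) w)) \<partial>P x i) \<partial>lborel)"
		using alive_joint X_joint by (intro nn_integral_sum[symmetric]) measurable
	also have "\<dots> = (\<integral>\<^sup>+s. (\<integral>\<^sup>+w. Th m n (s, w) \<partial>P x i) \<partial>lborel)"
		unfolding Th_def fst_conv snd_conv
		by (intro nn_integral_cong nn_integral_sum[symmetric]) measurable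
	also have "\<dots> = (\<integral>\<^sup>+w. (\<integral>\<^sup>+s. Th m n (s, w) \<partial>lborel) \<partial>P x i)"
		by (rule Fubini[symmetric]) measurable
	finally show ?thesis .
qed

definition Tlim :: "nat => real \<times> 'w => ennreal" where
	"Tlim m p = indicator {0..real m} (fst p)*(indicator G (snd p) *
		 ennreal (rho (a+Hp (max 0 (fst p)) (snd p)))*ennreal (alive (max 0 (fst p)) (snd p)))"

lemma Tlim_meas [measurable]: "Tlim m \<in> Bor (borel \<Otimes>\<^sub>M M)"
	unfolding Tlim_def using alive_joint Hp_joint by measurable

text \<open>At a time s off the grid at most one summand is active. The regulators are monotone, so
  outside a countable set they are continuous and their values at the left grid point converge to
  those at s.\<close>

lemma Th_limit:
	assumes om: "w \<in> space M"
	shows "AE s in lborel. (\<forall>n. Th m n (s, w) <= ennreal R*indicator {0..real m} s) & (%n. Th m n (s, w)) \<leadsto> Tlim m (s, w)"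
proof (cases "w \<in> G")
	case False
	thus ?thesis by (simp add: Th_def Tlim_def)
next
	case G: True
	interpret reflected_phase a "%t. X t w" "%t. Rl t w" "%t. Ru t w" "%t. J t w" by (rule path[OF G])
	define N where "N = range (%(n, k). gr n k) \<union> {s\<in>{0..}. \<not> continuous (at s within {0..}) (%t. Rl t w)}
		 \<union> {s\<in>{0..}. \<not> continuous (at s within {0..}) (%t. Ru t w)}"
	have "mono_on {0..} (%t. Rl t w)" "mono_on {0..} (%t. Ru t w)" by (auto intro!: mono_onI l_mono u_mono)
	hence "countable N" unfolding N_def by (intro countable_Un mono_on_ctble_discont countable_image) auto
	hence "N \<in> null_sets lborel" by (rule countable_imp_null_set_lborel)
	hence "AE s in lborel. s \<notin> N" by (rule AE_not_in)
	thus ?thesis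
	proof (rule AE_mp, intro AE_I2 impI)
		fix s assume sN: "s \<notin> N"
		have nd: "s ~= gr n k" for n k using sN by (auto simp: N_def)
		show "(\<forall>n. Th m n (s, w) <= ennreal R*indicator {0..real m} s) & (%n. Th m n (s, w)) \<leadsto> Tlim m (s, w)"
		proof (cases "0 < s & s < real m")
			case False
			have "indicator {gr n k..gr n (Suc k)} s = (0::ennreal)" if "k < m*2 ^ n" for n k
			proof -
				have "gr n (Suc k) <= gr n (m*2 ^ n)" using that by (intro gr_mono) simp
				hence "gr n (Suc k) <= real m" by (simp add: gr_def)
				thus ?thesis using False nd[of n k] nd[of n "Suc k"] gr_nonneg[of n k] by (auto simp: indicator_def simp del: gr_nonneg)
			qed
			hence Th0: "Th m n (s, w) = 0" for n unfolding Th_def fst_conv by (intro sum.neutral ballI) simp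
			have "s ~= 0" "s ~= real m" using nd[of 0 0] nd[of 0 m] by (simp_all add: gr_def)
			hence "s \<notin> {0..real m}" using False by auto
			hence "Tlim m (s, w) = 0" by (simp add: Tlim_def)
			thus ?thesis unfolding Th0 by simp
		next
			case True
			hence s0: "0 <= s" and sm: "s \<in> {0..real m}" by auto
			define K where "K n = nat \<lfloor>s*2 ^ n\<rfloor>" for n :: nat
			have K: "real (K n) <= s*2 ^ n" "s*2 ^ n < real (K n)+1" for n
			proof -
				have "real (K n) = of_int \<lfloor>s*2 ^ n\<rfloor>" using s0 by (simp add: K_def)
				thus "real (K n) <= s*2 ^ n" "s*2 ^ n < real (K n)+1" by linarith+
			qed
			have K1: "gr n (K n) <= s" "s <= gr n (Suc (K n))" for n using K[of n] by (simp_all add: gr_def field_simps)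
			have KN: "K n < m*2 ^ n" for n
			proof -
				have "s*2 ^ n < real m*2 ^ n" using True by simp
				hence "real (K n) < real m*2 ^ n" using K(1)[of n] by linarith
				hence "real (K n) < real (m*2 ^ n)" by simp
				thus ?thesis by (simp only: of_nat_less_iff)
			qed
			have uniq: "indicator {gr n k..gr n (Suc k)} s = (if k = K n then 1 else 0 :: ennreal)" for n k
			proof (cases "s \<in> {gr n k..gr n (Suc k)}")
				case in1: True
				hence "real k <= s*2 ^ n" "s*2 ^ n <= real k+1" by (simp_all add: gr_def field_simps)
				moreover have "s*2 ^ n ~= real k+1" using nd[of n "Suc k"] by (auto simp: gr_def field_simps)
				ultimately have "real k < real (K n)+1" "real (K n) < real k+1" using K[of n] by linarith+
				hence "k = K n" by linarith
				thus ?thesis using in1 by simp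
			next
				case False
				hence "k ~= K n" using K1[of n] by auto
				thus ?thesis using False by simp
			qed
			have ThK: "Th m n (s, w) = ennreal (rho (a+(X s w+Rl (gr n (K n)) w-Ru (gr n (K n)) w)))*ennreal (alive s w)" for n
			proof -
				have mx: "max 0 s = s" using s0 by simp
				have iG: "indicator G w = (1::ennreal)" using G by simp
				have "Th m n (s, w) = (\<Sum>k<m*2 ^ n. if k = K n then ennreal (rho (a+(X s w+Rl (gr n k) w-Ru (gr n k) w)))*ennreal (alive s w) else 0)"
					unfolding Th_def fst_conv snd_conv uniq mx iG
				proof (rule sum.cong[OF HOL.refl])
					fix k
					show "(if k = K n then 1 else 0)*(1*ennreal (rho (a+(X s w+Rl (gr n k) w-Ru (gr n k) w)))*ennreal (alive s w))
						 = (if k = K n then ennreal (rho (a+(X s w+Rl (gr n k) w-Ru (gr n k) w)))*ennreal (alive s w) else 0)"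
						by (cases "k = K n") simp_all
				qed
				thus ?thesis using KN[of n] by simp
			qed
			have "ennreal (rho (a+(X s w+Rl (gr n (K n)) w-Ru (gr n (K n)) w)))*ennreal (alive s w) <= ennreal R*1" for n
				by (intro mult_mono ennreal_leI rho_bounds) (auto simp: alive_def)
			hence bd: "Th m n (s, w) <= ennreal R*indicator {0..real m} s" for n unfolding ThK using sm by simp
			have lim: "(%n. gr n (K n)) \<leadsto> s"
				using grid_squeeze(1)[of K s] K1 by (simp add: grid_def gr_def)
			have cl: "continuous (at s within {0..}) (%t. Rl t w)" "continuous (at s within {0..}) (%t. Ru t w)"
				using sN s0 by (auto simp: N_def)
			have "(%n. Rl (gr n (K n)) w) \<leadsto> Rl s w" "(%n. Ru (gr n (K n)) w) \<leadsto> Ru s w"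
				by (rule continuous_within_tendsto_compose'[OF cl(1) _ lim], simp, rule continuous_within_tendsto_compose'[OF cl(2) _ lim], simp)
			hence "(%n. a+(X s w+Rl (gr n (K n)) w-Ru (gr n (K n)) w)) \<leadsto> a+(X s w+Rl s w-Ru s w)"
				by (intro tendsto_intros)
			hence rl: "(%n. rho (a+(X s w+Rl (gr n (K n)) w-Ru (gr n (K n)) w))) \<leadsto> rho (a+(X s w+Rl s w-Ru s w))"
				by (rule isCont_tendsto_compose[rotated]) (use rho_cont in \<open>simp add: continuous_on_eq_continuous_at\<close>)
			have "Tlim m (s, w) = ennreal (rho (a+(X s w+Rl s w-Ru s w)))*ennreal (alive s w)"
				using sm G s0 by (simp add: Tlim_def Hp_def max_def)
			moreover have "(%n. Th m n (s, w)) \<leadsto> ennreal (rho (a+(X s w+Rl s w-Ru s w)))*ennreal (alive s w)"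
				unfolding ThK using tendsto_ennrealI[OF rl] by (cases "J s w = None") (simp_all add: alive_def)
			ultimately show ?thesis using bd by simp
		qed
	qed
qed

text \<open>The order of integration is exchanged in the limit so that the inner expectation refers
  to a fixed time s, the form to which \<open>bottom_null\<close> applies.\<close>

lemma Th_tendsto: "(%n. \<integral>\<^sup>+w. (\<integral>\<^sup>+s. Th m n (s, w) \<partial>lborel) \<partial>P x i) \<leadsto> (\<integral>\<^sup>+s. (\<integral>\<^sup>+w. Tlim m (s, w) \<partial>P x i) \<partial>lborel)"
proof -
	interpret pair_sigma_finite lborel "P x i" by (rule pair_sf)
	interpret swapped: pair_sigma_finite "P x i" lborel by unfold_locales
	have fin: "(\<integral>\<^sup>+s. ennreal R*indicator {0..real m} s \<partial>lborel) = ennreal R*ennreal (real m)"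
		by (subst nn_integral_cmult_indicator) auto
	have bd: "(\<integral>\<^sup>+s. Th m n (s, w) \<partial>lborel) <= ennreal R*ennreal (real m)" if "w \<in> space M" for n w
		unfolding fin[symmetric] by (rule nn_integral_mono_AE) (use Th_limit[OF that, of m] in \<open>auto elim: AE_mp\<close>)
	have sect: "(%s. Th m n (s, w)) \<in> Bor lborel" "(%s. Tlim m (s, w)) \<in> Bor lborel" if "w \<in> space M" for n w
		using that by measurable
	have "(%n. \<integral>\<^sup>+w. (\<integral>\<^sup>+s. Th m n (s, w) \<partial>lborel) \<partial>P x i) \<leadsto> (\<integral>\<^sup>+w. (\<integral>\<^sup>+s. Tlim m (s, w) \<partial>lborel) \<partial>P x i)"
	proof (rule nn_integral_dominated_convergence[where w="%_. ennreal R*ennreal (real m)"])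
		show "(%w. \<integral>\<^sup>+s. Th m n (s, w) \<partial>lborel) \<in> Bor (P x i)" for n by measurable
		show "(%w. \<integral>\<^sup>+s. Tlim m (s, w) \<partial>lborel) \<in> Bor (P x i)" by measurable
		show "AE w in P x i. (\<integral>\<^sup>+s. Th m n (s, w) \<partial>lborel) <= ennreal R*ennreal (real m)" for n by (rule AE_I2) (simp add: bd)
		show "(\<integral>\<^sup>+w. ennreal R*ennreal (real m) \<partial>P x i) < \<infinity>"
			using prob_space.emeasure_space_1[OF prob[of x i]] by (simp add: ennreal_mult_less_top)
		show "AE w in P x i. (%n. \<integral>\<^sup>+s. Th m n (s, w) \<partial>lborel) \<leadsto> (\<integral>\<^sup>+s. Tlim m (s, w) \<partial>lborel)"
		proof (rule AE_I2)
			fix w assume "w \<in> space (P x i)"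
			hence om: "w \<in> space M" by simp
			show "(%n. \<integral>\<^sup>+s. Th m n (s, w) \<partial>lborel) \<leadsto> (\<integral>\<^sup>+s. Tlim m (s, w) \<partial>lborel)"
			proof (rule nn_integral_dominated_convergence[where w="%s. ennreal R*indicator {0..real m} s"])
				show "(\<integral>\<^sup>+s. ennreal R*indicator {0..real m} s \<partial>lborel) < \<infinity>" unfolding fin by (simp add: ennreal_mult_less_top)
				show "AE s in lborel. Th m n (s, w) <= ennreal R*indicator {0..real m} s" for n
					using Th_limit[OF om, of m] by eventually_elim blast
				show "AE s in lborel. (%n. Th m n (s, w)) \<leadsto> Tlim m (s, w)"
					using Th_limit[OF om, of m] by eventually_elim blast
			qed (use sect[OF om] in simp_all)
		qed
	qed simp
	also have "(\<integral>\<^sup>+w. (\<integral>\<^sup>+s. Tlim m (s, w) \<partial>lborel) \<partial>P x i) = (\<integral>\<^sup>+s. (\<integral>\<^sup>+w. Tlim m (s, w) \<partial>P x i) \<partial>lborel)"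
		by (rule Fubini) measurable
	finally show ?thesis .
qed

definition Ts :: "(real => bool) => 'w => real" where
	"Ts A w = (\<integral>c. (if 0 <= c & A c then exp (- al*Rl (passage (%t. Ru t w) c) w) *
		 phase_eval (%i y. al*f i y-b i y) (J (passage (%t. Ru t w) c) w) a else 0) \<partial>lborel)"
definition Dl :: "real => nat => 'w => real" where
	"Dl r m w = indicator G w*(Ph (tt r m w) w-Ph 0 w+Ts (%c. c < Ru (tt r m w) w) w)"

lemma Dn_meas [measurable]: "Dn r m n \<in> Bor M"
proof -
	have 1: "(%w. Ph (gr n (kap r m n w)) w) \<in> Bor M"
		by (rule measurable_compose_countable[where f="%k. Ph (gr n k)"]) measurable
	have 2: "(%w. \<Sum>k<kap r m n w. pu n k w) \<in> Bor M"
		by (rule measurable_compose_countable[where f="%K w. \<Sum>k<K. pu n k w"]) measurable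
	show ?thesis unfolding Dn_def using 1 2 by measurable
qed

lemma Dn_tendsto:
	assumes om: "w \<in> space M"
	shows "(%n. Dn r m n w) \<leadsto> Dl r m w"
proof (cases "w \<in> G")
	case False thus ?thesis by (simp add: Dn_def Dl_def)
next
	case True
	interpret reflected_functional a "%t. X t w" "%t. Rl t w" "%t. Ru t w" "%t. J t w" al f b by (rule func[OF True])
	have ggr: "grid n k = gr n k" for n k by (simp add: grid_def gr_def)
	have st: "stop r m t \<longleftrightarrow> stopped r m t w" for t by (simp add: stop_def stopped_def)
	have ki: "stop_index r m n = kap r m n w" for n by (simp add: stop_index_def kap_def st ggr)
	have tau: "tau r m = tt r m w" by (simp add: tau_def tt_def st)
	have Phi: "Phi t = Ph t w" for t by (simp add: Phi_def Ph_def h_def)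
	have push: "push n k = pu n k w" for n k by (simp add: push_def pu_def Phi ggr)
	have "(%n. Phi (grid n (stop_index r m n))) \<leadsto> Phi (tau r m)"
		by (rule Phi_tendsto[OF tau_nonneg grid_stop_index_ge grid_stop_index_tendsto])
	moreover have "(\<integral>c. indicator {0..<Ru (tau r m) w} c*(exp (- al*Rl (passage (%t. Ru t w) c) w)*phase_eval f' (J (passage (%t. Ru t w) c) w) a) \<partial>lborel)
		 = Ts (%c. c < Ru (tt r m w) w) w"
		unfolding Ts_def tau by (rule Bochner_Integration.integral_cong) (auto simp: indicator_def)
	ultimately have "(%n. Phi (grid n (stop_index r m n))-Phi 0-(\<Sum>k<stop_index r m n. push n k)) \<leadsto> Phi (tau r m)-Phi 0 - - Ts (%c. c < Ru (tt r m w) w) w"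
		using pushes_tendsto[of r m] by (intro tendsto_diff tendsto_const) simp_all
	thus ?thesis using True unfolding Phi push ki ggr tau by (simp add: Dn_def Dl_def)
qed

lemma Dl_meas [measurable]: "Dl r m \<in> Bor M"
	by (rule borel_measurable_LIMSEQ_real[OF Dn_tendsto Dn_meas])

lemma Ph_bound: "w \<in> G ==> 0 <= t ==> \<bar>Ph t w\<bar> <= C*(1+exp (th*a))"
proof -
	assume g: "w \<in> G" and t: "0 <= t"
	interpret reflected_phase a "%t. X t w" "%t. Rl t w" "%t. Ru t w" "%t. J t w" by (rule path[OF g])
	have "\<bar>phase_eval f (J t w) (a+h t)\<bar> <= C*(1+exp (th*a))"
		using f_upper[of "a+h t" a] h_le[OF t] C_nonneg by (cases "J t w") (auto simp: add_nonneg_nonneg)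
	moreover have "exp (- al*Rl t w) <= 1" using al l_nonneg[OF t] by (simp add: mult_nonneg_nonneg)
	ultimately have "\<bar>phase_eval f (J t w) (a+h t)\<bar>*exp (- al*Rl t w) <= C*(1+exp (th*a))*1"
		by (intro mult_mono) auto
	thus ?thesis by (simp add: Ph_def abs_mult h_def)
qed

text \<open>\<open>pushes_bound\<close> is uniform in n except for one exponential at the stopped
  grid point, and \<open>sup_exp\<close> dominates that one.\<close>

lemma Dn_dominated:
	assumes r: "0 <= r" and m: "0 < m"
	obtains d where "integrable (P x i) d" "\<And>n. AE w in P x i. norm (Dn r m n w) <= d w"
proof -
	obtain Cb where Cb: "\<And>i y. y <= a+r ==> \<bar>b i y\<bar> <= Cb" "0 <= Cb" using b_upper by blast
	define C0 where "C0 = C*(1+exp (th*a))"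
	define Cf where "Cf = al*(C*(1+exp (th*(a+r))))+Cb"
	have C0: "\<bar>f i y\<bar> <= C0" if "y <= a" for i y unfolding C0_def by (rule f_upper[OF that])
	have Cb': "\<bar>b i y\<bar> <= Cb" if "y <= a" for i y by (rule Cb(1)) (use that r in simp)
	have Cf: "\<bar>al*f i y-b i y\<bar> <= Cf" if "y <= a+r" for i y
	proof -
		have "\<bar>al*f i y-b i y\<bar> <= al*\<bar>f i y\<bar>+\<bar>b i y\<bar>" using abs_triangle_ineq4[of "al*f i y" "b i y"] al by (simp add: abs_mult)
		also have "\<dots> <= Cf" unfolding Cf_def by (intro add_mono mult_left_mono f_upper Cb that al)
		finally show ?thesis .
	qed
	define K1 where "K1 = Cb*real m+Cf*r+C0+C"
	define K2 where "K2 = C*exp (th*(a+real m))"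
	have K2: "0 <= K2" using C_nonneg by (simp add: K2_def)
	have fin: "(\<integral>\<^sup>+w. sup_exp th m w \<partial>P x i) < \<infinity>" by (rule sup_exp_finite[OF th])
	have si: "integrable (P x i) (%w. enn2real (sup_exp th m w))"
	proof (rule integrableI_bounded)
		have "(\<integral>\<^sup>+w. ennreal (norm (enn2real (sup_exp th m w))) \<partial>P x i) <= (\<integral>\<^sup>+w. sup_exp th m w \<partial>P x i)"
			by (rule nn_integral_mono) (simp add: ennreal_enn2real_if)
		thus "(\<integral>\<^sup>+w. ennreal (norm (enn2real (sup_exp th m w))) \<partial>P x i) < \<infinity>" using fin by (rule order_le_less_trans)
	qed measurable
	have finAE: "AE w in P x i. sup_exp th m w ~= \<infinity>"
		by (rule nn_integral_PInf_AE) (use fin in auto)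
	let ?w = "%w. (2*C0+K1)+K2*enn2real (sup_exp th m w)"
	have "AE w in P x i. norm (Dn r m n w) <= ?w w" for n
		using finAE AE_space
	proof eventually_elim
		case (elim w)
		have K1n: "0 <= 2*C0+K1"
		proof -
			have "0 <= Cf" by (rule order_trans[OF abs_ge_zero Cf[OF order_refl]])
			moreover have "0 <= C0" by (rule order_trans[OF abs_ge_zero C0[OF order_refl]])
			ultimately show ?thesis unfolding K1_def using Cb(2) C_nonneg r by (intro add_nonneg_nonneg mult_nonneg_nonneg) auto
		qed
		show ?case
		proof (cases "w \<in> G")
			case False
			thus ?thesis using K1n K2 by (simp add: Dn_def add_nonneg_nonneg)
		next
			case True
			interpret reflected_functional a "%t. X t w" "%t. Rl t w" "%t. Ru t w" "%t. J t w" al f b by (rule func[OF True])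
			have ggr: "grid n k = gr n k" for n k by (simp add: grid_def gr_def)
			have st: "stop r m t \<longleftrightarrow> stopped r m t w" for t by (simp add: stop_def stopped_def)
			have ki: "stop_index r m n = kap r m n w" for n by (simp add: stop_index_def kap_def st ggr)
			have Phi: "Phi t = Ph t w" for t by (simp add: Phi_def Ph_def h_def)
			have push: "push n k = pu n k w" for n k by (simp add: push_def pu_def Phi ggr)
			let ?k = "kap r m n w"
			have kN: "?k <= m*2 ^ n" using stop_index_le[of r m n] by (simp add: ki)
			have "(if J (gr n ?k) w = None then 0 else exp (th*X (gr n ?k) w)) = exp (th*X (gr n ?k) w)*alive (gr n ?k) w"
				by (simp add: alive_def)
			also have "\<dots> <= enn2real (sup_exp th m w)"
			proof -
				have "enn2real (ennreal (exp (th*X (gr n ?k) w)*alive (gr n ?k) w)) <= enn2real (sup_exp th m w)"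
					using elim(1) by (intro enn2real_mono sup_exp_ge kN) (simp add: top.not_eq_extremum)
				thus ?thesis by (simp add: alive_def split: if_splits)
			qed
			finally have ex: "K2*(if J (gr n ?k) w = None then 0 else exp (th*X (gr n ?k) w)) <= K2*enn2real (sup_exp th m w)"
				using K2 by (rule mult_left_mono)
			have "\<bar>\<Sum>k<?k. pu n k w\<bar> <= K1+K2*(if J (gr n ?k) w = None then 0 else exp (th*X (gr n ?k) w))"
				using pushes_bound[OF r m th Cb' Cf C0 f_bound, of n] unfolding push ki ggr K1_def K2_def .
			moreover have "\<bar>Ph (gr n ?k) w\<bar> <= C0" "\<bar>Ph 0 w\<bar> <= C0" unfolding C0_def by (intro Ph_bound True gr_nonneg order_refl)+
			ultimately have "\<bar>Ph (gr n ?k) w-Ph 0 w-(\<Sum>k<?k. pu n k w)\<bar> <= ?w w" using ex by linarith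
			thus ?thesis using True by (simp add: Dn_def)
		qed
	qed
	moreover have "integrable (P x i) ?w"
		using si by (intro Bochner_Integration.integrable_add finite_measure.integrable_const[OF finite_P] integrable_mult_right) auto
	ultimately show thesis by (intro that[of ?w])
qed

lemma dynkin:
	assumes r: "0 <= r" and m: "0 < m"
	shows "ennreal \<bar>\<integral>w. Dl r m w \<partial>P x i\<bar> <= (\<integral>\<^sup>+s. (\<integral>\<^sup>+w. Tlim m (s, w) \<partial>P x i) \<partial>lborel)"
proof (rule LIMSEQ_le)
	obtain d where w: "integrable (P x i) d" "\<And>n. AE w in P x i. norm (Dn r m n w) <= d w"
		by (rule Dn_dominated[OF r m]) (rule that)
	have "(%n. \<integral>w. Dn r m n w \<partial>P x i) \<leadsto> (\<integral>w. Dl r m w \<partial>P x i)"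
	proof (rule integral_dominated_convergence[OF _ _ w(1) _ w(2)])
		show "AE w in P x i. (%n. Dn r m n w) \<leadsto> Dl r m w" by (rule AE_I2) (simp add: Dn_tendsto)
	qed measurable
	thus "(%n. ennreal \<bar>\<integral>w. Dn r m n w \<partial>P x i\<bar>) \<leadsto> ennreal \<bar>\<integral>w. Dl r m w \<partial>P x i\<bar>"
		by (intro tendsto_ennrealI tendsto_rabs)
	show "(%n. \<integral>\<^sup>+w. (\<integral>\<^sup>+s. Th m n (s, w) \<partial>lborel) \<partial>P x i) \<leadsto> (\<integral>\<^sup>+s. (\<integral>\<^sup>+w. Tlim m (s, w) \<partial>P x i) \<partial>lborel)" by (rule Th_tendsto)
	show "\<exists>N. \<forall>n\<ge>N. ennreal \<bar>\<integral>w. Dn r m n w \<partial>P x i\<bar> <= (\<integral>\<^sup>+w. (\<integral>\<^sup>+s. Th m n (s, w) \<partial>lborel) \<partial>P x i)"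
		using Dn_error by blast
qed

end

subsection \<open>Passage over a level of the upper regulator\<close>

context reflected_phase
begin

text \<open>\<open>u\<close> can jump over r only at killing, the one moment at which X may jump up.
  A level that is passed alive and lies below the stopped value of \<open>u\<close> is therefore
  below r.\<close>

lemma pushed_alive_lt:
	assumes "0 <= r" "0 <= c" "c < u (tau r m)" "j (passage u c) ~= None"
	shows "c < r"
proof (rule ccontr)
	assume "\<not> c < r"
	hence rc: "r <= c" by simp
	note A = assms(2) tau_nonneg[of r m] assms(3)
	have uc: "u (passage u c) = c" by (rule u_passage_alive[OF A assms(4)])
	have "\<not> tau r m < passage u c"
	proof
		assume "tau r m < passage u c"
		from passage_u_less[OF A tau_nonneg this] show False using assms(3) by simp
	qed
	moreover have "\<not> passage u c < tau r m"
	proof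
		assume "passage u c < tau r m"
		then obtain s where s: "passage u c < s" "s < tau r m" using dense by blast
		have s0: "0 <= s" using passage_u_ge[OF A] s(1) by simp
		have "c < u s" by (rule passage_u_gr[OF A s(1)])
		hence "stop r m s" using rc by (simp add: stop_def)
		from stop_tau_le[OF s0 this] show False using s(2) by simp
	qed
	ultimately have "passage u c = tau r m" by simp
	thus False using uc assms(3) by simp
qed

text \<open>T is a time by which the path has passed r or is killed, and m is so large that the caps
  on time and \<open>l\<close> are inactive before T. Then the stopping time either is rho_r or
  comes after killing.\<close>

context
	fixes r :: real and m T :: nat
	assumes r: "0 <= r" and T: "r < u (real T) | j (real T) = None" and mT: "T <= m" "l (real T) <= real m"
begin

lemma stop_before: "0 <= s ==> s < real T ==> stop r m s \<longleftrightarrow> r < u s"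
proof -
	assume s: "0 <= s" "s < real T"
	have "l s <= real m" using l_mono[of s "real T"] s mT by simp
	moreover have "s < real m" using s mT by simp
	ultimately show ?thesis by (simp add: stop_def)
qed

lemma dead_case: "\<not> r < u (real T) ==> real T <= tau r m"
proof (rule ccontr)
	assume a: "\<not> r < u (real T)" "\<not> real T <= tau r m"
	then obtain s where s: "tau r m < s" "s < real T" using dense[of "tau r m" "real T"] by auto
	have s0: "0 <= s" using tau_nonneg[of r m] s by simp
	have "r < u s" using stop_gr_tau[OF s(1)] stop_before[OF s0 s(2)] by simp
	thus False using a(1) u_mono[of s "real T"] s s0 by simp
qed

lemma passes_case: "r < u (real T) ==> tau r m = passage u r"
proof (rule antisym)
	assume a: "r < u (real T)"
	note A = r of_nat_0_le_iff a
	show "tau r m <= passage u r"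
	proof (rule dense_ge)
		fix s assume s: "passage u r < s"
		have "stop r m s" using passage_u_gr[OF A s] by (simp add: stop_def)
		thus "tau r m <= s" by (rule stop_tau_le[rotated]) (use s passage_u_ge[OF A] in simp)
	qed
	show "passage u r <= tau r m"
	proof (rule ccontr)
		assume "\<not> passage u r <= tau r m"
		then obtain s where s: "tau r m < s" "s < passage u r" using dense[of "tau r m" "passage u r"] by auto
		have s0: "0 <= s" using tau_nonneg[of r m] s by simp
		have us: "u s <= r" by (rule passage_u_less[OF A s0 s(2)])
		have "s < real T"
		proof (rule ccontr)
			assume "\<not> s < real T"
			hence "u (real T) <= u s" by (intro u_mono) auto
			thus False using us a by simp
		qed
		thus False using stop_before[OF s0] stop_gr_tau[OF s(1)] us by simp
	qed
qed

text \<open>A level below r that is passed alive is included in the stopped integral: either the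
  path gets beyond r, or that passage precedes the killing and hence T.\<close>

lemma pushed_before:
	assumes c: "0 <= c" "c < r" and ex: "0 <= t1" "c < u t1" and alive: "j (passage u c) ~= None"
	shows "c < u (tau r m)"
proof (cases "r < u (real T)")
	case True
	have "r <= u (passage u r)" by (rule u_passage[OF r of_nat_0_le_iff True])
	thus ?thesis using passes_case[OF True] c by simp
next
	case False
	have jT: "j (real T) = None" using T False by simp
	have "passage u c < real T"
	proof (rule ccontr)
		assume "\<not> passage u c < real T"
		hence "j (passage u c) = None" using j_absorb[of "real T" "passage u c"] jT by simp
		thus False using alive by simp
	qed
	from passage_u_gr[OF c(1) ex this] have "c < u (real T)" .
	also have "\<dots> <= u (tau r m)" using dead_case[OF False] by (intro u_mono) auto
	finally show ?thesis .
qed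

text \<open>Either the stopping time is rho_r, where h = 0, or the path is killed before exceeding r
  and both sides are 0.\<close>

lemma eval_at_tau:
	"phase_eval g (j (tau r m)) (a+h (tau r m))*exp (- al*l (tau r m))
	 = phase_eval g (phase_at_passage j u r) a*exp (- al*l (passage u r))"
proof (cases "r < u (real T)")
	case True
	have "\<exists>t\<ge>0. r < u t" using True by (intro exI[of _ "real T"]) simp
	thus ?thesis using passes_case[OF True] h_passage_u[OF r of_nat_0_le_iff True] by (simp add: phase_at_passage_def)
next
	case False
	have jT: "j (real T) = None" using T False by simp
	have "j (tau r m) = None" using j_absorb[of "real T" "tau r m"] jT dead_case[OF False] by simp
	moreover have "phase_at_passage j u r = None"
	proof (cases "\<exists>t\<ge>0. r < u t")
		case True
		then obtain t1 where t1: "0 <= t1" "r < u t1" by blast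
		have "real T <= passage u r"
		proof (rule ccontr)
			assume "\<not> real T <= passage u r"
			from passage_u_gr[OF r t1, of "real T"] this False show False by simp
		qed
		hence "j (passage u r) = None" using j_absorb[of "real T" "passage u r"] jT by simp
		thus ?thesis using True by (simp add: phase_at_passage_def)
	qed (auto simp: phase_at_passage_def)
	ultimately show ?thesis by simp
qed

end

text \<open>If s is slightly after the passage of 0 and c is below u s, the passage of c lies
  between that of 0 and s; right continuity of J and \<open>l\<close> at the passage of 0 then gives
  the estimate.\<close>

lemma passage_right_limit:
	assumes t1: "0 <= t1" "0 < u t1" and z: "l (passage u 0) = 0" and e: "0 < e"
	shows "\<exists>d>0. \<forall>c. 0 <= c --> c < d --> j (passage u c) = j (passage u 0) & \<bar>exp (- al*l (passage u c))-1\<bar> < e"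
proof -
	let ?p = "passage u 0"
	have p0: "0 <= ?p" by (rule passage_u_ge[OF order_refl t1])
	obtain d1 where d1: "d1 > 0" "\<forall>s\<in>{?p..?p+d1}. j s = j ?p" using j_rc[OF p0] by blast
	have "((%s. exp (- al*l s)) \<longlongrightarrow> exp (- al*l ?p)) (at_right ?p)"
		using l_rc[OF p0] unfolding continuous_within by (intro tendsto_intros)
	hence "\<forall>\<^sub>F s in at_right ?p. dist (exp (- al*l s)) 1 < e" using e by (intro tendstoD) (simp_all add: z)
	then obtain b where b: "b > ?p" "\<And>s. ?p < s ==> s < b ==> dist (exp (- al*l s)) 1 < e"
		unfolding eventually_at_right_field by blast
	define s where "s = ?p+min d1 (b-?p)/2"
	have mn: "0 < min d1 (b-?p)" "min d1 (b-?p) <= d1" "min d1 (b-?p) <= b-?p" using d1(1) b(1) by auto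
	have s: "?p < s" "s < b" "s <= ?p+d1"
		unfolding s_def using mn by (simp_all add: field_simps del: min_less_iff_conj min.bounded_iff min_le_iff_disj)
	show ?thesis
	proof (intro exI[of _ "u s"] conjI allI impI)
		show "0 < u s" by (rule passage_u_gr[OF order_refl t1 s(1)])
		fix c assume c: "0 <= c" "c < u s"
		have s0: "0 <= s" using p0 s by simp
		have ge: "?p <= passage u c"
		proof (rule dense_le)
			fix v assume v: "v < ?p"
			show "v <= passage u c"
			proof (cases "0 <= v")
				case True
				have "u v <= 0" by (rule passage_u_less[OF order_refl t1 True v])
				show ?thesis
				proof (rule ccontr)
					assume "\<not> v <= passage u c"
					from passage_u_gr[OF c(1) s0 c(2), of v] this \<open>u v \<le> 0\<close> c(1) show False by simp
				qed
			qed (use passage_u_ge[OF c(1) s0 c(2)] in simp)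
		qed
		have le: "passage u c <= s"
		proof (rule ccontr)
			assume "\<not> passage u c <= s"
			from passage_u_less[OF c(1) s0 c(2) s0] this c(2) show False by simp
		qed
		show "j (passage u c) = j ?p" by (rule bspec[OF d1(2)]) (use ge le s(3) in simp)
		show "\<bar>exp (- al*l (passage u c))-1\<bar> < e"
		proof (cases "passage u c = ?p")
			case True
			show ?thesis unfolding True z using e by simp
		next
			case False
			thus ?thesis using b(2)[of "passage u c"] ge le s(2) by (simp add: dist_real_def)
		qed
	qed
qed

end

lemma quotient_limit:
	fixes f :: "real => real"
	assumes "(f has_real_derivative D) (at y)"
	shows "(%n. (f y-f (y-1/real (Suc n)))/(1/real (Suc n))) \<leadsto> D"
		and "(%n. (f (y+1/real (Suc n))-f y)/(1/real (Suc n))) \<leadsto> D"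
proof -
	let ?e = "%n. 1/real (Suc n)"
	have e: "?e \<leadsto> 0" using LIMSEQ_inverse_real_of_nat by (simp add: inverse_eq_divide)
	have d: "((%h. (f (y+h)-f y)/h) \<longlongrightarrow> D) (at 0)" by (rule DERIV_D[OF assms])
	have "filterlim (%n. - ?e n) (at 0) sequentially" "filterlim ?e (at 0) sequentially"
		using tendsto_minus[OF e] e by (auto simp: filterlim_at)
	from filterlim_compose[OF d this(1)] filterlim_compose[OF d this(2)]
	have 1: "(%n. (f (y+- ?e n)-f y)/- ?e n) \<leadsto> D" and 2: "(%n. (f (y+?e n)-f y)/?e n) \<leadsto> D" .
	have "(f (y+- ?e n)-f y)/- ?e n = (f y-f (y-?e n))/?e n" for n by (simp add: field_simps)
	thus "(%n. (f y-f (y-?e n))/?e n) \<leadsto> D" using 1 by (simp only:)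
	show "(%n. (f (y+?e n)-f y)/?e n) \<leadsto> D" by (rule 2)
qed

section \<open>Integrals over the levels of the upper regulator\<close>

context reflected_map
begin

definition Ev :: "('n => real => real) => real => real => 'w => real" where
	"Ev f al t w = phase_eval f (J t w) (a+(X t w+Rl t w-Ru t w))*exp (- al*Rl t w)"
definition ig :: "('n => real => real) => real => 'w => real => real" where
	"ig g al w c = exp (- al*Rl (passage (%t. Ru t w) c) w)*phase_eval g (J (passage (%t. Ru t w) c) w) a"
definition Tg :: "('n => real => real) => real => (real => bool) => 'w => real" where
	"Tg g al A w = (\<integral>c. (if 0 <= c & A c then ig g al w c else 0) \<partial>lborel)"
text \<open>The quantity \<open>Dl\<close> with the test function and its slope as parameters, so
  that the identity can be passed to the limit from smoothed functions to Z.\<close>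

definition DD :: "('n => real => real) => ('n => real => real) => real => real => nat => 'w => real" where
	"DD f g al r m w = indicator G w*(Ev f al (tt r m w) w-Ev f al 0 w+Tg g al (%c. c < Ru (tt r m w) w) w)"

lemma tau_tt: "w \<in> G ==> reflected_phase.tau (%t. Rl t w) (%t. Ru t w) r m = tt r m w"
proof -
	assume "w \<in> G"
	then interpret reflected_phase a "%t. X t w" "%t. Rl t w" "%t. Ru t w" "%t. J t w" by (rule path)
	show ?thesis by (simp add: tau_def tt_def stop_def stopped_def)
qed

lemma tt_nonneg: "w \<in> G ==> 0 <= tt r m w"
	using reflected_phase.tau_nonneg[OF path] tau_tt by metis

text \<open>Levels from r up to the stopped value of \<open>u\<close> can be passed only by the jump
  at killing, where the phase is the cemetery.\<close>

lemma ig_support: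
	assumes "w \<in> G" "0 <= r" "0 <= c" "c < Ru (tt r m w) w" "r <= c"
	shows "ig g al w c = 0"
proof -
	interpret reflected_phase a "%t. X t w" "%t. Rl t w" "%t. Ru t w" "%t. J t w" by (rule path[OF assms(1)])
	have "J (passage (%t. Ru t w) c) w = None"
	proof (rule ccontr)
		assume "J (passage (%t. Ru t w) c) w ~= None"
		from pushed_alive_lt[OF assms(2,3) _ this, of m] assms(4,5) show False by (simp add: tau_tt[OF assms(1)])
	qed
	thus ?thesis by (simp add: ig_def)
qed

lemma ig_bound:
	assumes "w \<in> G" "0 <= c" "\<exists>t\<ge>0. c < Ru t w" "\<And>i. \<bar>g i a\<bar> <= B" "0 <= al"
	shows "\<bar>ig g al w c\<bar> <= B"
proof -
	interpret reflected_phase a "%t. X t w" "%t. Rl t w" "%t. Ru t w" "%t. J t w" by (rule path[OF assms(1)])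
	have B: "0 <= B" by (rule order_trans[OF abs_ge_zero assms(4)])
	obtain t1 where t1: "0 <= t1" "c < Ru t1 w" using assms(3) by blast
	have "0 <= Rl (passage (%t. Ru t w) c) w" by (rule l_nonneg[OF passage_u_ge[OF assms(2) t1]])
	hence "exp (- al*Rl (passage (%t. Ru t w) c) w) <= 1" using assms(5) by (simp add: mult_nonneg_nonneg)
	moreover have "\<bar>phase_eval g (J (passage (%t. Ru t w) c) w) a\<bar> <= B"
		using assms(4) B by (cases "J (passage (%t. Ru t w) c) w") auto
	ultimately have "exp (- al*Rl (passage (%t. Ru t w) c) w)*\<bar>phase_eval g (J (passage (%t. Ru t w) c) w) a\<bar> <= 1*B"
		by (intro mult_mono) auto
	thus ?thesis by (simp add: ig_def abs_mult)
qed

lemma ig_norm: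
	assumes "w \<in> G" "0 <= r" "\<And>i. \<bar>g i a\<bar> <= B" "0 <= al"
	shows "norm (if 0 <= c & c < Ru (tt r m w) w then ig g al w c else 0) <= B*indicator {0..<r} c"
proof (cases "0 <= c & c < Ru (tt r m w) w")
	case True
	hence "\<exists>t\<ge>0. c < Ru t w" using tt_nonneg[OF assms(1)] by blast
	thus ?thesis using ig_bound[of w c g B al] ig_support[of w r c m g al] True assms by (cases "c < r") auto
next
	case False
	have B: "0 <= B" by (rule order_trans[OF abs_ge_zero assms(3)])
	show ?thesis unfolding if_not_P[OF False] using B by simp
qed

lemma int_indicator: "integrable lborel (%c. B*indicator {0..<r} c :: real)"
	"0 <= r ==> (\<integral>c. B*indicator {0..<r} c \<partial>lborel) = B*r"
proof -
	have "emeasure lborel {0..<r} < \<infinity>" by (cases "0 <= r") auto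
	thus "integrable lborel (%c. B*indicator {0..<r} c :: real)" by (intro integrable_mult_right integrable_real_indicator) auto
qed auto

lemma Tg_bound:
	assumes "w \<in> G" "0 <= r" "\<And>i. \<bar>g i a\<bar> <= B" "0 <= al"
	shows "\<bar>Tg g al (%c. c < Ru (tt r m w) w) w\<bar> <= B*r"
proof -
	let ?f = "%c. if 0 <= c & c < Ru (tt r m w) w then ig g al w c else 0"
	have B: "0 <= B" by (rule order_trans[OF abs_ge_zero assms(3)])
	have "norm (\<integral>c. ?f c \<partial>lborel) <= (\<integral>c. norm (?f c) \<partial>lborel)" by (rule integral_norm_bound)
	also have "\<dots> <= (\<integral>c. B*indicator {0..<r} c \<partial>lborel)"
		by (rule integral_mono'[OF int_indicator(1) ig_norm[where g=g and al=al, OF assms]]) (use B in simp)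
	finally show ?thesis unfolding Tg_def int_indicator(2)[OF assms(2)] real_norm_def .
qed

text \<open>\<open>pre\<close> is the integrand of the theorem. Its restriction \<open>Yr\<close> to
  \<open>G\<close> is a limit of grid quantities and therefore measurable.\<close>

definition pre :: "real => real => 'n => 'w => real" where
	"pre r al k w = exp (- al*Rl (passage (%t. Ru t w) r) w)*indicator {w. phase_at_passage (%t. J t w) (%t. Ru t w) r = Some k} w"
definition Yr :: "real => real => 'n => 'w => real" where
	"Yr r al k w = indicator G w*pre r al k w"

lemma Yr_bounds: "0 <= r ==> 0 <= al ==> 0 <= Yr r al k w & Yr r al k w <= 1"
proof (cases "w \<in> G & (\<exists>t\<ge>0. r < Ru t w)")
	case True
	assume r: "0 <= r" and al: "0 <= al"
	interpret reflected_phase a "%t. X t w" "%t. Rl t w" "%t. Ru t w" "%t. J t w" by (rule path) (use True in simp)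
	obtain t1 where t1: "0 <= t1" "r < Ru t1 w" using True by blast
	have "0 <= Rl (passage (%t. Ru t w) r) w" by (rule l_nonneg[OF passage_u_ge[OF r t1]])
	thus ?thesis using al by (auto simp: Yr_def pre_def indicator_def mult_nonneg_nonneg)
qed (auto simp: Yr_def pre_def phase_at_passage_def indicator_def)

text \<open>The first grid time with R_u above r tends to rho_r from the right, so the phase and R_l
  there converge to their values at rho_r.\<close>

lemma Yr_meas [measurable]:
	assumes r: "0 <= r"
	shows "Yr r al k \<in> Bor M"
proof -
	define \<kappa> where "\<kappa> n w = (LEAST k. r < Ru (gr n k) w)" for n w
	have [measurable]: "\<kappa> n \<in> M \<rightarrow>\<^sub>M count_space UNIV" for n unfolding \<kappa>_def by measurable
	define A where "A n w = indicator G w*(if \<exists>k. r < Ru (gr n k) w then exp (- al*Rl (gr n (\<kappa> n w)) w)*ph k (gr n (\<kappa> n w)) w else 0)" for n w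
	have 1: "(%w. exp (- al*Rl (gr n (\<kappa> n w)) w)*ph k (gr n (\<kappa> n w)) w) \<in> Bor M" for n
		by (rule measurable_compose_countable[where f="%K w. exp (- al*Rl (gr n K) w)*ph k (gr n K) w"]) measurable
	have [measurable]: "A n \<in> Bor M" for n unfolding A_def using 1 by measurable
	have "(%n. A n w) \<leadsto> Yr r al k w" if om: "w \<in> space M" for w
	proof (cases "w \<in> G")
		case False thus ?thesis by (simp add: A_def Yr_def)
	next
		case G: True
		interpret reflected_phase a "%t. X t w" "%t. Rl t w" "%t. Ru t w" "%t. J t w" by (rule path[OF G])
		show ?thesis
		proof (cases "\<exists>t\<ge>0. r < Ru t w")
			case False
			hence "\<not> (\<exists>k. r < Ru (gr n k) w)" for n using gr_nonneg by blast
			hence "A n w = 0" for n by (simp add: A_def)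
			moreover have "Yr r al k w = 0" using False by (simp add: Yr_def pre_def phase_at_passage_def)
			ultimately show ?thesis by simp
		next
			case True
			then obtain t1 where t1: "0 <= t1" "r < Ru t1 w" by blast
			let ?p = "passage (%t. Ru t w) r"
			have p0: "0 <= ?p" by (rule passage_u_ge[OF r t1])
			have ggr: "grid n k = gr n k" for n k by (simp add: grid_def gr_def)
			have ex: "\<exists>k. r < Ru (gr n k) w" for n
			proof -
				obtain N where N: "t1*2 ^ n <= real N" using real_arch_simple by blast
				have "t1 <= gr n N" using N by (simp add: gr_def field_simps)
				hence "Ru t1 w <= Ru (gr n N) w" by (rule u_mono[OF t1(1)])
				thus ?thesis using t1(2) by (intro exI[of _ N]) simp
			qed
			have k1: "r < Ru (gr n (\<kappa> n w)) w" for n unfolding \<kappa>_def by (rule LeastI_ex[OF ex])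
			have "\<kappa> n w ~= 0" for n
			proof
				assume "\<kappa> n w = 0"
				thus False using k1[of n] u0 r by (simp add: gr_def)
			qed
			hence "\<forall>n. \<exists>K. \<kappa> n w = Suc K" using not0_implies_Suc by blast
			from choice[OF this] obtain K where K: "\<forall>n. \<kappa> n w = Suc (K n)" ..
			have k0: "Ru (gr n (K n)) w <= r" for n
			proof -
				have "K n < (LEAST k. r < Ru (gr n k) w)" using K by (simp add: \<kappa>_def[symmetric])
				from not_less_Least[OF this] show ?thesis by simp
			qed
			have sq: "grid n (K n) <= ?p" "?p <= grid n (Suc (K n))" for n
				using passage_grid_u[OF r, of n "K n"] k0[of n] k1[of n] K by (auto simp: ggr)
			have lim: "(%n. gr n (\<kappa> n w)) \<leadsto> ?p" using grid_squeeze(2)[OF sq] K by (simp add: ggr)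
			have ge: "?p <= gr n (\<kappa> n w)" for n using sq(2)[of n] K by (simp add: ggr)
			have l: "(%n. Rl (gr n (\<kappa> n w)) w) \<leadsto> Rl ?p w" by (rule continuous_at_right_seq[OF l_rc[OF p0] ge lim])
			have "\<forall>\<^sub>F n in sequentially. ph k ?p w = ph k (gr n (\<kappa> n w)) w"
				using j_eventually[OF p0 ge lim] by eventually_elim (simp add: ph_def)
			hence "(%n. ph k (gr n (\<kappa> n w)) w) \<leadsto> ph k ?p w" by (rule Lim_transform_eventually[OF tendsto_const])
			hence "(%n. exp (- al*Rl (gr n (\<kappa> n w)) w)*ph k (gr n (\<kappa> n w)) w) \<leadsto> exp (- al*Rl ?p w)*ph k ?p w"
				using l by (intro tendsto_intros)
			moreover have "A n w = exp (- al*Rl (gr n (\<kappa> n w)) w)*ph k (gr n (\<kappa> n w)) w" for n using G ex[of n] by (simp add: A_def)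
			moreover have "Yr r al k w = exp (- al*Rl ?p w)*ph k ?p w"
				using G True by (simp add: Yr_def pre_def phase_at_passage_def ph_def)
			ultimately show ?thesis by simp
		qed
	qed
	thus ?thesis by (rule borel_measurable_LIMSEQ_real) measurable
qed

end

context functional_map
begin

lemma DD_Dl: "DD f (%i y. al*f i y-b i y) al r m = Dl r m"
	by (rule ext, unfold DD_def Dl_def Ev_def Ph_def Tg_def Ts_def ig_def, rule HOL.refl)

lemmas DD_meas = Dl_meas[folded DD_Dl] and DD_dynkin = dynkin[folded DD_Dl, unfolded Tlim_def fst_conv snd_conv]

lemma ig_meas:
	assumes "w \<in> G"
	shows "(%c. if 0 <= c & c < Ru (tt r m w) w then ig (%i y. al*f i y-b i y) al w c else 0) \<in> Bor borel"
proof -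
	interpret reflected_functional a "%t. X t w" "%t. Rl t w" "%t. Ru t w" "%t. J t w" al f b by (rule func[OF assms])
	have "(%c. if 0 <= c & c < Ru (tt r m w) w then ig (%i y. al*f i y-b i y) al w c else 0)
		= (%c. indicator {0..<Ru (tau r m) w} c*(exp (- al*Rl (passage (%t. Ru t w) c) w)*phase_eval f' (J (passage (%t. Ru t w) c) w) a))"
		by (auto simp: ig_def indicator_def tau_tt[OF assms])
	thus ?thesis using upper_push_meas[of r m] by simp
qed

end

section \<open>From smoothed test functions to Z\<close>

locale reflected_scale_map = scale_map M P X J F W for M P X and J :: "real => 'w => 'n::finite option" and F W +
	fixes Fstar :: "real => real^'n^'n" and a :: real and Rl Ru :: "real => 'w => real"
	assumes a_gt: "a > 0"
		and jumps: "w \<in> space M ==> 0 < t ==> J t w ~= None ==> ((%s. X s w) \<longlongrightarrow> y) (at_left t) ==> X t w <= y"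
		and two_sided: "w \<in> space M ==> X 0 w \<in> {-a..0} ==>
			two_sided_reflection a (%t. X t w) (%t. Rl t w) (%t. Ru t w)"
		and R_meas: "Rl t \<in> Bor M" "Ru t \<in> Bor M"
		and Fstar: "0 <= \<alpha> ==> 0 <= r ==>
				E_mat (P 0) (%w. exp (- \<alpha>*Rl (passage (%t. Ru t w) r) w))
										(%w. phase_at_passage (%t. J t w) (%t. Ru t w) r)
				= mexp (scaleR r (Fstar \<alpha>))"

sublocale reflected_scale_map \<subseteq> reflected_map M P X J a Rl Ru
proof -
	interpret exp_map_process M P X J by (rule exp_map)
	show "reflected_map M P X J a Rl Ru" by unfold_locales (auto intro: a_gt jumps two_sided R_meas)
qed

context reflected_scale_map
begin

lemma pre_integral: "0 <= al ==> 0 <= r ==> (\<integral>w. pre r al k w \<partial>P 0 i) = mexp (scaleR r (Fstar al)) $ i $ k"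
	using arg_cong[OF Fstar[of al r], of "%A. A $ i $ k"] by (simp add: E_mat_def pre_def)

text \<open>The integrand is a priori not known to be measurable; a non-zero Bochner integral forces it to be.\<close>

lemma pre_Yr:
	assumes al: "0 <= al" and r: "0 <= r" and diag: "mexp (scaleR r (Fstar al)) $ k $ k ~= 0" and x: "x \<in> {-a..0}"
	shows "(\<integral>w. pre r al k w \<partial>P x i) = (\<integral>w. Yr r al k w \<partial>P x i)"
proof (rule integral_cong_AE)
	have "integrable (P 0 k) (pre r al k)"
		using diag pre_integral[OF al r, of k k] not_integrable_integral_eq[of "P 0 k" "pre r al k"] by auto
	hence "pre r al k \<in> Bor (P 0 k)" by (rule borel_measurable_integrable)
	thus "pre r al k \<in> Bor (P x i)" by (simp cong: measurable_cong_sets)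
	show "Yr r al k \<in> Bor (P x i)" using Yr_meas[OF r, of al k] by (simp cong: measurable_cong_sets)
	show "AE w in P x i. pre r al k w = Yr r al k w" using AE_G[OF x] by eventually_elim (simp add: Yr_def)
qed

lemma zero_in: "0 \<in> {-a..0}" using a_gt by simp

text \<open>At r = 0 the matrix exponential is the identity. The variable exp(-R_l(rho_0)) on phase
  i lies in [0, 1] and has expectation 1, so it equals 1 almost surely.\<close>

lemma start_at_top:
	"AE w in P 0 i. phase_at_passage (%t. J t w) (%t. Ru t w) 0 = Some i & Rl (passage (%t. Ru t w) 0) w = 0"
proof -
	interpret prob_space "P 0 i" by (rule prob)
	have "(\<integral>w. Yr 0 1 i w \<partial>P 0 i) = 1"
		using pre_Yr[OF _ order_refl _ zero_in, of 1 i i] pre_integral[of 1 0 i i] by (simp add: mexp_0 mat_def)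
	moreover have int: "integrable (P 0 i) (Yr 0 1 i)"
		by (rule finite_measure.integrable_const_bound[OF finite_P, of _ 1])
			(use Yr_bounds[of 0 1 i] Yr_meas[of 0 1 i] in \<open>auto cong: measurable_cong_sets\<close>)
	moreover have i1: "integrable (P 0 i) (%w. 1-Yr 0 1 i w)"
		by (rule Bochner_Integration.integrable_diff[OF finite_measure.integrable_const[OF finite_P] int])
	ultimately have "(\<integral>w. 1-Yr 0 1 i w \<partial>P 0 i) = 0"
		using prob_space by (simp add: Bochner_Integration.integral_diff)
	hence "AE w in P 0 i. 1-Yr 0 1 i w = 0"
		using integral_nonneg_eq_0_iff_AE[OF i1] Yr_bounds[of 0 1 i] by simp
	thus ?thesis
	proof eventually_elim
		case (elim w)
		hence p: "indicator G w*pre 0 1 i w = 1" by (simp add: Yr_def)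
		have ph: "phase_at_passage (%t. J t w) (%t. Ru t w) 0 = Some i"
		proof (rule ccontr)
			assume "phase_at_passage (%t. J t w) (%t. Ru t w) 0 ~= Some i"
			hence "pre 0 1 i w = 0" by (simp add: pre_def)
			thus False using p by simp
		qed
		have "exp (- 1*Rl (passage (%t. Ru t w) 0) w) = 1" using p by (cases "w \<in> G") (simp_all add: pre_def ph)
		thus ?case using ph by simp
	qed
qed

lemma regular: "regular_reflected_map M P X J a Rl Ru"
proof
	show "AE w in P 0 i. phase_at_passage (%t. J t w) (%t. Ru t w) 0 = Some i" for i
		using start_at_top[of i] by eventually_elim simp
qed

definition Zc :: "real => 'n => 'n => real => real" where
	"Zc al c k y = exp (al*y)*((if k = c then 1 else 0)-(\<Sum>l\<in>UNIV. w1 al k l y*F al $ l $ c))"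
text \<open>The slope alpha Z - W F of Z at a, as a function constant in y to fit the form that
  \<open>phase_eval\<close> expects.\<close>

definition Zd :: "real => 'n => 'n => real => real" where
	"Zd al c k y = al*Zc al c k a-(\<Sum>l\<in>UNIV. W a $ k $ l*F al $ l $ c)"

abbreviation e :: "nat => real" where "e n \<equiv> 1/real (Suc n)"

lemma e_lim: "e \<leadsto> 0" using LIMSEQ_inverse_real_of_nat by (simp add: inverse_eq_divide)

lemma fn_limit:
	assumes al: "0 <= al"
	shows "(%n. fn al (e n) c k y) \<leadsto> Zc al c k y"
	unfolding fn_def Zc_def by (intro tendsto_intros quotient_limit(1) w2_deriv al)

lemma bn_limit:
	assumes al: "0 <= al"
	shows "(%n. bn al (e n) c k a) \<leadsto> (\<Sum>l\<in>UNIV. W a $ k $ l*F al $ l $ c)"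
proof -
	have d: "(w1 al k l has_real_derivative exp (- al*a)*W a $ k $ l) (at a)" for l
	proof -
		\<comment> \<open>On [0, 2a] the point a is interior, so the derivative of the indefinite integral
		  within the interval is two-sided.\<close>
		have cW: "continuous_on {0..2*a} (%u. exp (- al*u)*W u $ k $ l)"
			by (intro continuous_intros continuous_on_subset[OF W_cont]) auto
		have "(w1 al k l has_real_derivative exp (- al*a)*W a $ k $ l) (at a within {0..2*a})"
			unfolding w1_def[abs_def] by (rule integral_has_real_derivative[OF cW]) (use a_gt in simp)
		hence "(w1 al k l has_real_derivative exp (- al*a)*W a $ k $ l) (at a within {0<..<2*a})"
			by (rule has_field_derivative_subset) auto
		thus ?thesis using at_within_open[of a "{0<..<2*a}"] a_gt by simp
	qed
	have "(%n. bn al (e n) c k a) \<leadsto> exp (al*a)*(\<Sum>l\<in>UNIV. exp (- al*a)*W a $ k $ l*F al $ l $ c)"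
		unfolding bn_def by (intro tendsto_intros quotient_limit(1) d)
	also have "exp (al*a)*(\<Sum>l\<in>UNIV. exp (- al*a)*W a $ k $ l*F al $ l $ c) = (\<Sum>l\<in>UNIV. W a $ k $ l*F al $ l $ c)"

	proof -
		have "exp (al*a)*exp (- al*a) = 1" by (simp flip: exp_add)
		thus ?thesis unfolding sum_distrib_left mult.assoc[symmetric] by simp
	qed
	finally show ?thesis .
qed

text \<open>By the mean value theorem the difference quotient of \<open>w2\<close> is a value of
  \<open>w1\<close> to the left of y, so the bound is uniform in the width.\<close>

lemma fn_upper:
	assumes al: "0 <= al"
	shows "\<exists>B. \<forall>n k. \<forall>y\<le>a. \<bar>fn al (e n) c k y\<bar> <= B"
proof -
	have "\<exists>B. \<forall>y\<le>a. \<bar>w1 al k l y\<bar> <= B" for k l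
	proof -
		have "compact (w1 al k l ` {0..a})" by (intro compact_continuous_image w_cont al) auto
		then obtain B where B: "\<And>y. y \<in> {0..a} ==> norm (w1 al k l y) <= B" by (meson bounded_iff compact_imp_bounded imageI)
		have "\<bar>w1 al k l y\<bar> <= max 0 B" if "y <= a" for y using B[of y] w_neg(1)[of y al k l] that by (cases "0 <= y") auto
		thus ?thesis by blast
	qed
	hence "\<forall>k. \<forall>l. \<exists>B. \<forall>y\<le>a. \<bar>w1 al k l y\<bar> <= B" by blast
	then obtain B where B: "\<And>k l y. y <= a ==> \<bar>w1 al k l y\<bar> <= B k l" by metis
	have B0: "0 <= B k l" for k l by (rule order_trans[OF abs_ge_zero B[OF order_refl]])
	define D where "D = exp (al*a)*(1+(\<Sum>k\<in>UNIV. \<Sum>l\<in>UNIV. B k l*\<bar>F al $ l $ c\<bar>))"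
	have "\<bar>fn al (e n) c k y\<bar> <= D" if y: "y <= a" for n k y
	proof -
		have q: "\<bar>(w2 al k l y-w2 al k l (y-e n))/e n\<bar> <= B k l" for l
		proof -
			have lt: "y-e n < y" by simp
			obtain z where z: "y-e n < z" "z < y" "w2 al k l y-w2 al k l (y-e n) = (y-(y-e n))*w1 al k l z"
				using MVT2[OF lt w2_deriv[OF al]] by blast
			have "(w2 al k l y-w2 al k l (y-e n))/e n = w1 al k l z" unfolding z(3) by simp
			thus ?thesis using B[of z k l] z(2) y by simp
		qed
		have "\<bar>(if k = c then 1 else 0)-(\<Sum>l\<in>UNIV. (w2 al k l y-w2 al k l (y-e n))/e n*F al $ l $ c)\<bar>
			\<le> 1+(\<Sum>l\<in>UNIV. B k l*\<bar>F al $ l $ c\<bar>)"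
		proof (rule order_trans[OF abs_triangle_ineq4 add_mono])
			show "\<bar>\<Sum>l\<in>UNIV. (w2 al k l y-w2 al k l (y-e n))/e n*F al $ l $ c\<bar> <= (\<Sum>l\<in>UNIV. B k l*\<bar>F al $ l $ c\<bar>)"
				by (rule order_trans[OF sum_abs sum_mono]) (simp only: abs_mult mult_right_mono[OF q] abs_ge_zero)
		qed simp
		also have "\<dots> <= 1+(\<Sum>k\<in>UNIV. \<Sum>l\<in>UNIV. B k l*\<bar>F al $ l $ c\<bar>)"
			by (rule add_left_mono, rule member_le_sum) (auto intro!: sum_nonneg mult_nonneg_nonneg B0)
		finally have i: "\<bar>(if k = c then 1 else 0)-(\<Sum>l\<in>UNIV. (w2 al k l y-w2 al k l (y-e n))/e n*F al $ l $ c)\<bar>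
			\<le> 1+(\<Sum>k\<in>UNIV. \<Sum>l\<in>UNIV. B k l*\<bar>F al $ l $ c\<bar>)" .
		have "exp (al*y) <= exp (al*a)" using al y by (simp add: mult_left_mono)
		thus ?thesis unfolding fn_def D_def abs_mult abs_exp_cancel using i by (intro mult_mono) auto
	qed
	thus ?thesis by blast
qed

abbreviation gn :: "real => nat => 'n => 'n => real => real" where
	"gn al n c \<equiv> %i y. al*fn al (e n) c i y-bn al (e n) c i y"

lemma gn_limit: "0 <= al ==> (%n. gn al n c k a) \<leadsto> Zd al c k a"
	unfolding Zd_def by (intro tendsto_intros fn_limit bn_limit)

lemma gn_upper:
	assumes al: "0 <= al"
	shows "\<exists>B. (\<forall>n k. \<bar>gn al n c k a\<bar> <= B) & (\<forall>k. \<bar>Zd al c k a\<bar> <= B)"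
proof -
	have "\<exists>B. \<forall>n. \<bar>gn al n c k a\<bar> <= B" for k
	proof -
		have "Bseq (%n. gn al n c k a)" using gn_limit[OF al] by (intro convergent_imp_Bseq) (auto simp: convergent_def)
		thus ?thesis by (auto simp: Bseq_def)
	qed
	hence "\<forall>k. \<exists>B. \<forall>n. \<bar>gn al n c k a\<bar> <= B" by blast
	from choice[OF this] obtain B where B: "\<And>k n. \<bar>gn al n c k a\<bar> <= B k" by blast
	have "B k <= Max (range B)" for k by (rule Max_ge) auto
	hence 1: "\<bar>gn al n c k a\<bar> <= Max (range B)" for n k using B order_trans by blast
	have "\<bar>Zd al c k a\<bar> <= Max (range B)" for k
		by (rule LIMSEQ_le_const2[OF tendsto_rabs[OF gn_limit[OF al]]]) (use 1 in blast)
	thus ?thesis using 1 by blast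
qed

definition Kf :: "real => 'n => real => real" where "Kf al c \<eta> = exp (al*\<eta>)*(\<Sum>l\<in>UNIV. \<bar>F al $ l $ c\<bar>)"

lemma Kf_nonneg: "0 <= Kf al c \<eta>" unfolding Kf_def by (intro mult_nonneg_nonneg sum_nonneg) auto

lemma functional:
	assumes al: "0 <= al"
	obtains C th where "functional_map M P X J a Rl Ru al (fn al (e n) c) (bn al (e n) c) (%z. Kf al c (e n)*clip ((e n-z)/e n)) C th (Kf al c (e n))"
proof -
	have en: "0 < e n" by simp
	obtain C th where C: "0 <= th" "\<And>k y. \<bar>fn al (e n) c k y\<bar> <= C*(1+exp (th*y))" using fn_bound[OF al en] by blast
	have "functional_map M P X J a Rl Ru al (fn al (e n) c) (bn al (e n) c) (%z. Kf al c (e n)*clip ((e n-z)/e n)) C th (Kf al c (e n))"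
	proof
		show "continuous_on UNIV (%z. Kf al c (e n)*clip ((e n-z)/e n))" by (intro continuous_intros clip_cont) auto
		show "Kf al c (e n)*clip ((e n-y)/e n) <= Kf al c (e n)" for y
			using mult_left_mono[OF clip_bounds(2) Kf_nonneg] by simp
		show "ennreal \<bar>(\<integral>w. phase_eval (fn al (e n) c) (J s w) (y+X s w) \<partial>P 0 i)-fn al (e n) c i y\<bar>
			\<le> (\<integral>\<^sup>+v. indicator {0..s} v * (\<integral>\<^sup>+w. ennreal (Kf al c (e n)*clip ((e n-(y+X v w))/e n))*ennreal (alive v w) \<partial>P 0 i) \<partial>lborel)"
			if "0 <= s" for s y i
			unfolding Kf_def by (rule fn_drift[OF al en that])
		show "\<bar>fn al (e n) c k y\<bar> <= C*(1+exp (th*y))" for k y by (rule C(2))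
		show "bn al (e n) c k y = 0" if "y <= 0" for k y by (rule bn_neg[OF en that])
	qed (auto intro!: al fn_deriv bn_cont C mult_nonneg_nonneg Kf_nonneg)
	thus thesis by (rule that)
qed

end

context reflected_scale_map
begin

text \<open>At time s the error density lives on a + H < 1/(n + 1), which shrinks to the event H =
  -a on survival; this is null for s > 0 by \<open>bottom_null\<close>. Domination comes from the
  constant at width 1.\<close>

lemma error_vanishes:
	assumes al: "0 <= al"
	shows "(%n. \<integral>\<^sup>+s. (\<integral>\<^sup>+w. indicator {0..real m} s*(indicator G w *
		 ennreal (Kf al c (e n)*clip ((e n-(a+Hp (max 0 s) w))/e n))*ennreal (alive (max 0 s) w)) \<partial>P x i) \<partial>lborel) \<leadsto> 0"
proof -
	interpret pair_sigma_finite lborel "P x i" by (rule pair_sf)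
	interpret R: regular_reflected_map M P X J a Rl Ru by (rule regular)
	define K where "K = Kf al c 1"
	have K: "Kf al c (e n) <= K" "0 <= K" for n
	proof -
		have "al*e n <= al*1" using al by (intro mult_left_mono) auto
		hence "exp (al*e n) <= exp (al*1)" by simp
		thus "Kf al c (e n) <= K" unfolding K_def Kf_def by (rule mult_right_mono) (auto intro: sum_nonneg)
		show "0 <= K" unfolding K_def by (rule Kf_nonneg)
	qed
	let ?q = "%n s w. indicator G w*ennreal (Kf al c (e n)*clip ((e n-(a+Hp (max 0 s) w))/e n))*ennreal (alive (max 0 s) w)"
	have qb: "?q n s w <= ennreal K" for n s w
	proof -
		have le: "Kf al c (e n)*clip ((e n-(a+Hp (max 0 s) w))/e n) <= K*1"
			by (intro mult_mono K clip_bounds)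
		have "indicator G w*ennreal (Kf al c (e n)*clip ((e n-(a+Hp (max 0 s) w))/e n)) <= 1*ennreal (K*1)"
			by (rule mult_mono[OF _ ennreal_leI[OF le]]) (auto simp: indicator_def)
		hence "indicator G w*ennreal (Kf al c (e n)*clip ((e n-(a+Hp (max 0 s) w))/e n))*ennreal (alive (max 0 s) w) <= (1*ennreal (K*1))*1"
			by (rule mult_mono) (auto simp: alive_def)
		thus ?thesis by simp
	qed
	have [measurable]: "(%p. alive (max 0 (fst p)) (snd p)) \<in> Bor (borel \<Otimes>\<^sub>M M)" by (rule alive_joint)
	have [measurable]: "(%p. Hp (max 0 (fst p)) (snd p)) \<in> Bor (borel \<Otimes>\<^sub>M M)" by (rule Hp_joint)
	have one: "(\<integral>\<^sup>+w. ennreal K \<partial>P x i) = ennreal K" using prob_space.emeasure_space_1[OF prob[of x i]] by simp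
	have inner: "(%n. \<integral>\<^sup>+w. ?q n s w \<partial>P x i) \<leadsto> (\<integral>\<^sup>+w. 0 \<partial>P x i)" if s: "0 < s" for s
	proof (rule nn_integral_dominated_convergence[where w="%_. ennreal K"])
		have ms: "max 0 s = s" using s by simp
		show "AE w in P x i. (%n. ?q n s w) \<leadsto> 0"
			using R.bottom_null[OF s, of x i] AE_space
		proof eventually_elim
			case (elim w)
			show ?case
			proof (cases "w \<in> G & J s w ~= None")
				case True
				interpret reflected_phase a "%t. X t w" "%t. Rl t w" "%t. Ru t w" "%t. J t w" by (rule path) (use True in simp)
				have "- a <= X s w+Rl s w-Ru s w" using h_ge[of s] s by (simp add: h_def)
				moreover have "X s w+Rl s w-Ru s w ~= - a" using elim True by blast
				ultimately have pos: "0 < a+Hp s w" using True by (simp add: Hp_def)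
				have "\<forall>\<^sub>F n in sequentially. e n < a+Hp s w" using e_lim pos by (rule order_tendstoD)
				hence "\<forall>\<^sub>F n in sequentially. 0 = ?q n s w"
				proof eventually_elim
					case (elim n)
					have "(e n-(a+Hp s w))/e n <= 0" using elim by (intro divide_nonpos_nonneg) auto
					hence "clip ((e n-(a+Hp s w))/e n) = 0" by (simp add: clip_def)
					thus ?case unfolding ms by simp
				qed
				thus ?thesis by (rule Lim_transform_eventually[OF tendsto_const])
			next
				case False
				hence "?q n s w = 0" for n unfolding ms by (cases "w \<in> G") (auto simp: alive_def)
				thus ?thesis by (simp only: tendsto_const)
			qed
		qed
		show "AE w in P x i. ?q n s w <= ennreal K" for n by (intro AE_I2 qb)
		show "(\<integral>\<^sup>+w. ennreal K \<partial>P x i) < \<infinity>" unfolding one by simp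
	qed measurable
	have "(%n. \<integral>\<^sup>+s. (\<integral>\<^sup>+w. indicator {0..real m} s*?q n s w \<partial>P x i) \<partial>lborel) \<leadsto> (\<integral>\<^sup>+(s::real). 0 \<partial>lborel)"
	proof (rule nn_integral_dominated_convergence[where w="%s. ennreal K*indicator {0..real m} s"])
		show "(\<integral>\<^sup>+s. ennreal K*indicator {0..real m} s \<partial>lborel) < \<infinity>"
			by (subst nn_integral_cmult_indicator) (auto simp: ennreal_mult_less_top)
		show "AE s in lborel. (\<integral>\<^sup>+w. indicator {0..real m} s*?q n s w \<partial>P x i) <= ennreal K*indicator {0..real m} s" for n
		proof (rule AE_I2)
			fix s :: real
			have "(\<integral>\<^sup>+w. ?q n s w \<partial>P x i) <= (\<integral>\<^sup>+w. ennreal K \<partial>P x i)" by (rule nn_integral_mono) (rule qb)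
			thus "(\<integral>\<^sup>+w. indicator {0..real m} s*?q n s w \<partial>P x i) <= ennreal K*indicator {0..real m} s"
				unfolding one by (cases "s \<in> {0..real m}") simp_all
		qed
		have "AE s in lborel. s ~= (0::real)" by (rule AE_lborel_singleton)
		thus "AE s in lborel. (%n. \<integral>\<^sup>+w. indicator {0..real m} s*?q n s w \<partial>P x i) \<leadsto> 0"
		proof eventually_elim
			case (elim s)
			show ?case
			proof (cases "s \<in> {0..real m}")
				case True
				hence "0 < s" using elim by simp
				thus ?thesis using inner[of s] True by simp
			qed simp
		qed
	qed measurable
	thus ?thesis by simp
qed

lemma phase_eval_tendsto:
	assumes "\<And>k. (%n. f n k y) \<leadsto> g k y"
	shows "(%n. phase_eval (f n) p y) \<leadsto> phase_eval g p y"
	using assms by (cases p) simp_all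

lemma ig_limit:
	assumes al: "0 <= al"
	shows "(%n. ig (gn al n c) al w v) \<leadsto> ig (Zd al c) al w v"
	unfolding ig_def by (intro tendsto_intros phase_eval_tendsto gn_limit al)

lemma ign_meas:
	assumes al: "0 <= al" and G: "w \<in> G"
	shows "(%v. if 0 <= v & v < Ru (tt r m w) w then ig (gn al n c) al w v else 0) \<in> Bor borel"
proof -
	obtain C th where "functional_map M P X J a Rl Ru al (fn al (e n) c) (bn al (e n) c) (%z. Kf al c (e n)*clip ((e n-z)/e n)) C th (Kf al c (e n))"
		by (rule functional[OF al]) (rule that)
	from functional_map.ig_meas[OF this G] show ?thesis .
qed

lemma if_limit:
	assumes al: "0 <= al"
	shows "(%n. if A v then ig (gn al n c) al w v else 0) \<leadsto> (if A v then ig (Zd al c) al w v else 0)"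
	using ig_limit[OF al] by (cases "A v") simp_all

lemma igZ_meas:
	assumes al: "0 <= al" and G: "w \<in> G"
	shows "(%v. if 0 <= v & v < Ru (tt r m w) w then ig (Zd al c) al w v else 0) \<in> Bor borel"
	by (rule borel_measurable_LIMSEQ_real[OF if_limit[OF al, where A="%v. 0 <= v & v < Ru (tt r m w) w"] ign_meas[OF al G]])

lemma DD_limit:
	assumes al: "0 <= al" and r: "0 <= r"
	shows "(%n. DD (fn al (e n) c) (gn al n c) al r m w) \<leadsto> DD (Zc al c) (Zd al c) al r m w"
proof (cases "w \<in> G")
	case False thus ?thesis by (simp add: DD_def)
next
	case G: True
	obtain B where B: "\<And>n k. \<bar>gn al n c k a\<bar> <= B" using gn_upper[OF al] by blast
	have "(%n. Ev (fn al (e n) c) al t w) \<leadsto> Ev (Zc al c) al t w" for t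
		unfolding Ev_def by (intro tendsto_intros phase_eval_tendsto fn_limit al)
	moreover have "(%n. Tg (gn al n c) al (%v. v < Ru (tt r m w) w) w) \<leadsto> Tg (Zd al c) al (%v. v < Ru (tt r m w) w) w"
		unfolding Tg_def
	proof (rule integral_dominated_convergence[where w="%v. B*indicator {0..<r} v"])
		show "AE v in lborel. (%n. if 0 <= v & v < Ru (tt r m w) w then ig (gn al n c) al w v else 0) \<leadsto> (if 0 <= v & v < Ru (tt r m w) w then ig (Zd al c) al w v else 0)"
			by (intro AE_I2 if_limit al)
		show "AE v in lborel. norm (if 0 <= v & v < Ru (tt r m w) w then ig (gn al n c) al w v else 0) <= B*indicator {0..<r} v" for n
			by (intro AE_I2 ig_norm G r B al)
		show "integrable lborel (%v. B*indicator {0..<r} v)" by (rule int_indicator(1))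
	qed (use igZ_meas[OF al G] ign_meas[OF al G] in simp_all)
	ultimately show ?thesis unfolding DD_def by (intro tendsto_intros)
qed

lemma DDn_meas:
	assumes al: "0 <= al"
	shows "DD (fn al (e n) c) (gn al n c) al r m \<in> Bor M"
proof -
	obtain C th where "functional_map M P X J a Rl Ru al (fn al (e n) c) (bn al (e n) c) (%z. Kf al c (e n)*clip ((e n-z)/e n)) C th (Kf al c (e n))"
		by (rule functional[OF al]) (rule that)
	from functional_map.DD_meas[OF this] show ?thesis .
qed

lemma DDZ_meas:
	assumes "0 <= al" "0 <= r"
	shows "DD (Zc al c) (Zd al c) al r m \<in> Bor M"
	by (rule borel_measurable_LIMSEQ_real[OF DD_limit[OF assms] DDn_meas[OF assms(1)]])

lemma Ev_bound:
	assumes "w \<in> G" "0 <= t" "\<And>k y. y <= a ==> \<bar>f k y\<bar> <= B" "0 <= al"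
	shows "\<bar>Ev f al t w\<bar> <= B"
proof -
	interpret reflected_phase a "%t. X t w" "%t. Rl t w" "%t. Ru t w" "%t. J t w" by (rule path[OF assms(1)])
	have B: "0 <= B" by (rule order_trans[OF abs_ge_zero assms(3)[OF order_refl]])
	have "\<bar>phase_eval f (J t w) (a+(X t w+Rl t w-Ru t w))\<bar> <= B"
		using h_le[OF assms(2)] assms(3) B by (cases "J t w") (auto simp: h_def)
	moreover have "exp (- al*Rl t w) <= 1" using assms(4) l_nonneg[OF assms(2)] by (simp add: mult_nonneg_nonneg)
	ultimately have "\<bar>phase_eval f (J t w) (a+(X t w+Rl t w-Ru t w))\<bar>*exp (- al*Rl t w) <= B*1"
		by (intro mult_mono) (use B in auto)
	thus ?thesis by (simp add: Ev_def abs_mult)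
qed

lemma DDn_bound:
	assumes al: "0 <= al" and r: "0 <= r"
	shows "\<exists>B. \<forall>n m w. \<bar>DD (fn al (e n) c) (gn al n c) al r m w\<bar> <= B"
proof -
	obtain B1 where B1: "\<And>n k y. y <= a ==> \<bar>fn al (e n) c k y\<bar> <= B1" using fn_upper[OF al] by blast
	obtain B where B: "\<And>n k. \<bar>gn al n c k a\<bar> <= B" using gn_upper[OF al] by blast
	have "0 <= B1" by (rule order_trans[OF abs_ge_zero B1[OF order_refl]])
	moreover have "0 <= B*r" by (rule mult_nonneg_nonneg[OF order_trans[OF abs_ge_zero B] r])
	ultimately have "\<bar>DD (fn al (e n) c) (gn al n c) al r m w\<bar> <= 2*B1+B*r" for n m w
	proof (cases "w \<in> G")
		case True
		have "\<bar>Ev (fn al (e n) c) al (tt r m w) w\<bar> <= B1" "\<bar>Ev (fn al (e n) c) al 0 w\<bar> <= B1"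
			by (intro Ev_bound True tt_nonneg B1 al order_refl; assumption)+
		moreover have "\<bar>Tg (gn al n c) al (%v. v < Ru (tt r m w) w) w\<bar> <= B*r" by (rule Tg_bound[where g="gn al n c" and al=al, OF True r B al])
		ultimately show ?thesis using True by (simp add: DD_def)
	qed (simp add: DD_def)
	thus ?thesis by blast
qed

lemma DDZ_bound:
	assumes al: "0 <= al" and r: "0 <= r"
	shows "\<exists>B. \<forall>m w. \<bar>DD (Zc al c) (Zd al c) al r m w\<bar> <= B"
proof -
	obtain B where B: "\<And>n m w. \<bar>DD (fn al (e n) c) (gn al n c) al r m w\<bar> <= B" using DDn_bound[OF al r] by blast
	have "\<bar>DD (Zc al c) (Zd al c) al r m w\<bar> <= B" for m w
		by (rule LIMSEQ_le_const2[OF tendsto_rabs[OF DD_limit[OF al r]]]) (use B in blast)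
	thus ?thesis by blast
qed

lemma DDZ_zero:
	assumes al: "0 <= al" and r: "0 <= r" and m: "0 < m"
	shows "(\<integral>w. DD (Zc al c) (Zd al c) al r m w \<partial>P x i) = 0"
proof -
	obtain B where B: "\<And>n m w. \<bar>DD (fn al (e n) c) (gn al n c) al r m w\<bar> <= B" using DDn_bound[OF al r] by blast
	have lim: "(%n. \<integral>w. DD (fn al (e n) c) (gn al n c) al r m w \<partial>P x i) \<leadsto> (\<integral>w. DD (Zc al c) (Zd al c) al r m w \<partial>P x i)"
	proof (rule integral_dominated_convergence[where w="%_. B"])
		show "AE w in P x i. (%n. DD (fn al (e n) c) (gn al n c) al r m w) \<leadsto> DD (Zc al c) (Zd al c) al r m w"
			by (intro AE_I2 DD_limit al r)
		show "AE w in P x i. norm (DD (fn al (e n) c) (gn al n c) al r m w) <= B" for n by (intro AE_I2) (simp only: real_norm_def B)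
		show "integrable (P x i) (%_. B)" by (rule finite_measure.integrable_const[OF finite_P])
		show "DD (Zc al c) (Zd al c) al r m \<in> Bor (P x i)" using DDZ_meas[OF al r] by (simp cong: measurable_cong_sets)
		show "DD (fn al (e n) c) (gn al n c) al r m \<in> Bor (P x i)" for n using DDn_meas[OF al] by (simp only: measurable_cong_sets[OF sets_P HOL.refl])
	qed
	let ?E = "%n. \<integral>\<^sup>+s. (\<integral>\<^sup>+w. indicator {0..real m} s*(indicator G w *
		 ennreal (Kf al c (e n)*clip ((e n-(a+Hp (max 0 s) w))/e n))*ennreal (alive (max 0 s) w)) \<partial>P x i) \<partial>lborel"
	have le: "ennreal \<bar>\<integral>w. DD (fn al (e n) c) (gn al n c) al r m w \<partial>P x i\<bar> <= ?E n" for n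
	proof -
		obtain C th where "functional_map M P X J a Rl Ru al (fn al (e n) c) (bn al (e n) c) (%z. Kf al c (e n)*clip ((e n-z)/e n)) C th (Kf al c (e n))"
			by (rule functional[OF al]) (rule that)
		from functional_map.DD_dynkin[OF this r m] show ?thesis .
	qed
	have "ennreal \<bar>\<integral>w. DD (Zc al c) (Zd al c) al r m w \<partial>P x i\<bar> <= 0"
		by (rule LIMSEQ_le[OF tendsto_ennrealI[OF tendsto_rabs[OF lim]] error_vanishes[OF al]]) (use le in blast)
	thus ?thesis by (simp add: ennreal_eq_0_iff)
qed

abbreviation reach :: "real => 'w => real => bool" where "reach r w v \<equiv> v < r & (\<exists>t\<ge>0. v < Ru t w)"

text \<open>Beyond a path-dependent threshold the stopped quantities no longer depend on m:
  \<open>passes_or_killed\<close> supplies the time T used in \<open>eval_at_tau\<close>, and the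
  stopped integral becomes one over the levels below r that are reached.\<close>

lemma DDZ_eventually:
	assumes al: "0 <= al" and r: "0 <= r"
	shows "AE w in P x i. (\<forall>\<^sub>F m in sequentially. DD (Zc al c) (Zd al c) al r m w =
			indicator G w*((\<Sum>k\<in>UNIV. Zc al c k a*Yr r al k w)-Ev (Zc al c) al 0 w+Tg (Zd al c) al (reach r w) w))
		\<and> (w \<in> G --> (%v. if 0 <= v & reach r w v then ig (Zd al c) al w v else 0) \<in> Bor borel)"
proof -
	interpret R: regular_reflected_map M P X J a Rl Ru by (rule regular)
	show ?thesis using R.passes_or_killed[OF r, of x i]
	proof eventually_elim
		case (elim w)
		show ?case
		proof (cases "w \<in> G")
			case False thus ?thesis by (simp add: DD_def)
		next
			case G: True
			interpret reflected_phase a "%t. X t w" "%t. Rl t w" "%t. Ru t w" "%t. J t w" by (rule path[OF G])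
			obtain T :: nat where T: "r < Ru (real T) w | J (real T) w = None" using elim G by blast
			obtain m0 :: nat where m0: "max (real T) (Rl (real T) w) <= real m0" using real_arch_simple by blast
			have tau: "tau r m = tt r m w" for m by (rule tau_tt[OF G])
			have big: "T <= m" "Rl (real T) w <= real m" if "m0 <= m" for m
			proof -
				have "real m0 <= real m" using that by simp
				thus "T <= m" "Rl (real T) w <= real m" using m0 by auto
			qed
			\<comment> \<open>\<open>ig\<close> is 0 at levels whose passage finds the path killed, so only
			  levels passed alive have to be compared.\<close>
			have feq: "(if 0 <= v & v < Ru (tt r m w) w then ig (Zd al c) al w v else 0) = (if 0 <= v & reach r w v then ig (Zd al c) al w v else 0)"
				if m: "m0 <= m" for m v
			proof (cases "0 <= v & (\<exists>t\<ge>0. v < Ru t w) & J (passage (%t. Ru t w) v) w ~= None")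
				case True
				then obtain t1 where t1: "0 <= t1" "v < Ru t1 w" by blast
				have "v < Ru (tt r m w) w \<longleftrightarrow> v < r"
					using pushed_alive_lt[OF r, of v m] pushed_before[OF r T big[OF m], of v t1] True t1 unfolding tau by blast
				thus ?thesis using True by simp
			next
				case False
				have "0 <= tt r m w" by (rule tt_nonneg[OF G])
				hence "J (passage (%t. Ru t w) v) w = None" if "0 <= v" "v < Ru (tt r m w) w | reach r w v" using False that by blast
				hence z: "ig (Zd al c) al w v = 0" if "0 <= v" "v < Ru (tt r m w) w | reach r w v" using that by (simp add: ig_def)
				show ?thesis
				proof (cases "ig (Zd al c) al w v = 0")
					case False
					have n: "\<not> (0 <= v & v < Ru (tt r m w) w)" "\<not> (0 <= v & reach r w v)" using z False by blast+
					show ?thesis unfolding if_not_P[OF n(1)] if_not_P[OF n(2)] by (rule HOL.refl)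
				qed simp
			qed
			have eval: "Ev (Zc al c) al (tt r m w) w = (\<Sum>k\<in>UNIV. Zc al c k a*Yr r al k w)" if m: "m0 <= m" for m
			proof -
				let ?p = "phase_at_passage (%t. J t w) (%t. Ru t w) r"
				let ?x = "exp (- al*Rl (passage (%t. Ru t w) r) w)"
				have "Ev (Zc al c) al (tt r m w) w = phase_eval (Zc al c) ?p a*?x"
					using eval_at_tau[OF r T big[OF m], of "Zc al c" al] by (simp add: Ev_def tau h_def)
				also have "\<dots> = (\<Sum>k\<in>UNIV. Zc al c k a*Yr r al k w)"
				proof (cases ?p)
					case None
					thus ?thesis by (simp add: Yr_def pre_def)
				next
					case (Some p)
					have "Zc al c k a*Yr r al k w = (if k = p then Zc al c p a*?x else 0)" for k
						using G Some by (simp add: Yr_def pre_def)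
					thus ?thesis using Some by simp
				qed
				finally show ?thesis .
			qed
			have "\<forall>\<^sub>F m in sequentially. DD (Zc al c) (Zd al c) al r m w =
				indicator G w*((\<Sum>k\<in>UNIV. Zc al c k a*Yr r al k w)-Ev (Zc al c) al 0 w+Tg (Zd al c) al (reach r w) w)"
				unfolding eventually_sequentially
			proof (intro exI[of _ m0] allI impI)
				fix m assume m: "m0 <= m"
				show "DD (Zc al c) (Zd al c) al r m w = indicator G w*((\<Sum>k\<in>UNIV. Zc al c k a*Yr r al k w)-Ev (Zc al c) al 0 w+Tg (Zd al c) al (reach r w) w)"
					unfolding DD_def eval[OF m] Tg_def feq[OF m] by (rule HOL.refl)
			qed
			moreover have "(%v. if 0 <= v & reach r w v then ig (Zd al c) al w v else 0) \<in> Bor borel"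
				using igZ_meas[OF al G, of r m0 c] unfolding feq[OF order_refl] .
			ultimately show ?thesis by blast
		qed
	qed
qed

text \<open>The expectation of the Dynkin identity with m removed. Measurability of the level
  integral \<open>Tg\<close> in the path has not been established, so a measurable version T is
  built from the almost sure limit of the localised identities.\<close>

lemma passage_identity:
	assumes al: "0 <= al" and r: "0 <= r" and x: "x \<in> {-a..0}"
	shows "\<exists>T. T \<in> Bor M & (AE w in P x i. T w = Tg (Zd al c) al (reach r w) w)
		\<and> Zc al c i (a+x) = (\<Sum>k\<in>UNIV. (\<integral>w. Yr r al k w \<partial>P x i)*Zc al c k a)+(\<integral>w. T w \<partial>P x i)"
proof -
	let ?D = "%m. DD (Zc al c) (Zd al c) al r m"
	define g where "g w = lim (%m. ?D m w)" for w
	have gm [measurable]: "g \<in> Bor M" unfolding g_def by (rule borel_measurable_lim_metric) (rule DDZ_meas[OF al r])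
	let ?S = "%w. indicator G w*((\<Sum>k\<in>UNIV. Zc al c k a*Yr r al k w)-Ev (Zc al c) al 0 w+Tg (Zd al c) al (reach r w) w)"
	have lim: "AE w in P x i. (%m. ?D m w) \<leadsto> g w & g w = ?S w"
		using DDZ_eventually[OF al r, where x=x and i=i and c=c]
	proof eventually_elim
		case (elim w)
		hence "\<forall>\<^sub>F m in sequentially. ?S w = ?D m w" by (auto elim: eventually_mono)
		hence l: "(%m. ?D m w) \<leadsto> ?S w" by (rule Lim_transform_eventually[OF tendsto_const])
		hence "g w = ?S w" unfolding g_def by (rule limI)
		thus ?case using l by simp
	qed
	obtain B where B: "\<And>m w. \<bar>?D m w\<bar> <= B" using DDZ_bound[OF al r] by blast
	have "(%m. \<integral>w. ?D m w \<partial>P x i) \<leadsto> (\<integral>w. g w \<partial>P x i)"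
	proof (rule integral_dominated_convergence[where w="%_. B"])
		show "AE w in P x i. (%m. ?D m w) \<leadsto> g w" using lim by eventually_elim (rule conjunct1)
		show "AE w in P x i. norm (?D m w) <= B" for m by (intro AE_I2) (simp only: real_norm_def B)
		show "integrable (P x i) (%_. B)" by (rule finite_measure.integrable_const[OF finite_P])
		show "g \<in> Bor (P x i)" by measurable
		show "?D m \<in> Bor (P x i)" for m using DDZ_meas[OF al r] by (simp only: measurable_cong_sets[OF sets_P HOL.refl])
	qed
	moreover have "\<forall>\<^sub>F m in sequentially. (\<integral>w. ?D m w \<partial>P x i) = 0"
		using eventually_gt_at_top[of 0] by eventually_elim (rule DDZ_zero[OF al r])
	hence "(%m. \<integral>w. ?D m w \<partial>P x i) \<leadsto> 0" by (rule tendsto_eventually)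
	ultimately have g0: "(\<integral>w. g w \<partial>P x i) = 0" by (rule LIMSEQ_unique)
	have gB: "AE w in P x i. norm (g w) <= B"
		using lim
	proof eventually_elim
		case (elim w)
		hence "(%m. ?D m w) \<leadsto> g w" by (rule conjunct1)
		from tendsto_rabs[OF this] have "\<bar>g w\<bar> <= B" by (rule LIMSEQ_le_const2) (use B in blast)
		thus ?case by simp
	qed
	have gi: "integrable (P x i) g" by (rule finite_measure.integrable_const_bound[OF finite_P gB]) measurable
	have Yi: "integrable (P x i) (Yr r al k)" for k
		by (rule finite_measure.integrable_const_bound[OF finite_P, of _ 1])
			(use Yr_bounds[OF r al, of k] Yr_meas[OF r, of al k] in \<open>auto cong: measurable_cong_sets\<close>)
	define T where "T w = g w-(\<Sum>k\<in>UNIV. Zc al c k a*Yr r al k w)+Zc al c i (a+x)" for w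
	have "T \<in> Bor M" unfolding T_def using Yr_meas[OF r] by measurable
	moreover have "AE w in P x i. T w = Tg (Zd al c) al (reach r w) w"
		using lim AE_G[OF x] start[of x i]
	proof eventually_elim
		case (elim w)
		interpret reflected_phase a "%t. X t w" "%t. Rl t w" "%t. Ru t w" "%t. J t w" by (rule path) (use elim in simp)
		have "Ev (Zc al c) al 0 w = Zc al c i (a+x)" using elim l0 u0 by (simp add: Ev_def)
		thus ?case using elim by (simp add: T_def)
	qed
	moreover have "Zc al c i (a+x) = (\<Sum>k\<in>UNIV. (\<integral>w. Yr r al k w \<partial>P x i)*Zc al c k a)+(\<integral>w. T w \<partial>P x i)"
	proof -
		have i1: "integrable (P x i) (%w. \<Sum>k\<in>UNIV. Zc al c k a*Yr r al k w)"
			by (intro Bochner_Integration.integrable_sum integrable_mult_right Yi)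
		have "(\<integral>w. T w \<partial>P x i) = (\<integral>w. g w \<partial>P x i)-(\<integral>w. (\<Sum>k\<in>UNIV. Zc al c k a*Yr r al k w) \<partial>P x i)+(\<integral>w. Zc al c i (a+x) \<partial>P x i)"
			unfolding T_def
			by (subst Bochner_Integration.integral_add[OF Bochner_Integration.integrable_diff[OF gi i1] finite_measure.integrable_const[OF finite_P]])
				(subst Bochner_Integration.integral_diff[OF gi i1], rule HOL.refl)
		also have "(\<integral>w. (\<Sum>k\<in>UNIV. Zc al c k a*Yr r al k w) \<partial>P x i) = (\<Sum>k\<in>UNIV. (\<integral>w. Yr r al k w \<partial>P x i)*Zc al c k a)"
			by (subst Bochner_Integration.integral_sum) (auto intro: Yi simp: mult.commute)
		also have "(\<integral>w. Zc al c i (a+x) \<partial>P x i) = Zc al c i (a+x)" using prob_space.prob_space[OF prob[of x i]] by simp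
		finally show ?thesis unfolding g0 by simp
	qed
	ultimately show ?thesis by blast
qed

end

section \<open>The exit identity and the derivative at r = 0\<close>

context reflected_scale_map
begin

lemma reach_norm:
	assumes "w \<in> G" "\<And>i. \<bar>g i a\<bar> <= B" "0 <= al"
	shows "norm (if 0 <= v & reach r w v then ig g al w v else 0) <= B*indicator {0..<r} v"
proof (cases "0 <= v & reach r w v")
	case True
	thus ?thesis using ig_bound[of w v g B al] assms by auto
next
	case False
	have B: "0 <= B" by (rule order_trans[OF abs_ge_zero assms(2)])
	show ?thesis unfolding if_not_P[OF False] using B by simp
qed

lemma Tg_reach_bound:
	assumes "w \<in> G" "\<And>i. \<bar>g i a\<bar> <= B" "0 <= al" "0 <= r"
	shows "\<bar>Tg g al (reach r w) w\<bar> <= B*r"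
proof -
	let ?f = "%v. if 0 <= v & reach r w v then ig g al w v else 0"
	have B: "0 <= B" by (rule order_trans[OF abs_ge_zero assms(2)])
	have "norm (\<integral>v. ?f v \<partial>lborel) <= (\<integral>v. norm (?f v) \<partial>lborel)" by (rule integral_norm_bound)
	also have "\<dots> <= (\<integral>v. B*indicator {0..<r} v \<partial>lborel)"
		by (rule integral_mono'[OF int_indicator(1) reach_norm[where g=g and al=al, OF assms(1-3)]]) (use B in simp)
	finally show ?thesis unfolding Tg_def int_indicator(2)[OF assms(4)] real_norm_def .
qed

text \<open>For small r the levels below r are passed close to rho_0, where the phase is i and R_l =
  0, so the integrand is close to the constant \<open>Zd al c i a\<close> on an interval of length
  r.\<close>

lemma Tg_rate:
	assumes al: "0 <= al" and G: "w \<in> G"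
		and start: "phase_at_passage (%t. J t w) (%t. Ru t w) 0 = Some i" "Rl (passage (%t. Ru t w) 0) w = 0"
		and meas: "\<And>n. (%v. if 0 <= v & reach (e n) w v then ig (Zd al c) al w v else 0) \<in> Bor borel"
	shows "(%n. Tg (Zd al c) al (reach (e n) w) w/e n) \<leadsto> Zd al c i a"
proof (rule LIMSEQ_I)
	fix \<epsilon> :: real assume \<epsilon>: "0 < \<epsilon>"
	interpret reflected_phase a "%t. X t w" "%t. Rl t w" "%t. Ru t w" "%t. J t w" by (rule path[OF G])
	let ?p = "passage (%t. Ru t w)"
	let ?z = "Zd al c i a"
	define d where "d = \<epsilon>/(2*(\<bar>?z\<bar>+1))"
	have d0: "0 < d" using \<epsilon> by (simp add: d_def add_nonneg_pos)
	have dz: "\<bar>?z\<bar>*d < \<epsilon>"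
	proof -
		have "\<bar>?z\<bar>*d <= (\<bar>?z\<bar>+1)*d" using d0 by (intro mult_right_mono) auto
		also have "\<dots> = \<epsilon>/2" unfolding d_def using abs_ge_zero[of ?z] by (simp add: field_simps)
		finally show ?thesis using \<epsilon> by simp
	qed
	obtain t1 where t1: "0 <= t1" "0 < Ru t1 w" and J0: "J (?p 0) w = Some i"
		using start(1) unfolding phase_at_passage_def by (auto split: if_splits)
	obtain \<delta> where \<delta>: "\<delta> > 0" "\<And>v. 0 <= v ==> v < \<delta> ==> J (?p v) w = J (?p 0) w & \<bar>exp (- al*Rl (?p v) w)-1\<bar> < d"
		using passage_right_limit[OF t1 start(2) d0, of al] by blast
	have "\<forall>\<^sub>F n in sequentially. e n < min \<delta> (Ru t1 w)" using e_lim \<delta>(1) t1(2) by (intro order_tendstoD) auto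
	then obtain N where N: "\<And>n. N <= n ==> e n < min \<delta> (Ru t1 w)" unfolding eventually_sequentially by blast
	show "\<exists>N. \<forall>n\<ge>N. norm (Tg (Zd al c) al (reach (e n) w) w/e n-?z) < \<epsilon>"
	proof (intro exI[of _ N] allI impI)
		fix n assume n: "N <= n"
		define r where "r = e n"
		have r: "0 < r" "r < \<delta>" "r < Ru t1 w" using N[OF n] by (simp_all add: r_def)
		let ?f = "%v. if 0 <= v & reach r w v then ig (Zd al c) al w v else 0"
		obtain B where B: "\<And>k. \<bar>Zd al c k a\<bar> <= B" using gn_upper[OF al] by blast
		have i1: "integrable lborel ?f"
		proof (rule Bochner_Integration.integrable_bound[OF int_indicator(1)[of B r]])
			show "?f \<in> Bor lborel" using meas[of n] by (simp add: r_def)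
			show "AE v in lborel. norm (?f v) <= norm (B*indicator {0..<r} v)"
				by (intro AE_I2, rule order_trans[OF reach_norm[where g="Zd al c" and al=al and r=r, OF G B al]]) simp
		qed
		have pt: "norm (?f v-?z*indicator {0..<r} v) <= \<bar>?z\<bar>*d*indicator {0..<r} v" for v
		proof (cases "0 <= v & v < r")
			case True
			hence re: "0 <= v & reach r w v" using t1(1) r(3) by (intro conjI exI[of _ t1]) auto
			have v\<delta>: "v < \<delta>" using True r by simp
			have "ig (Zd al c) al w v = exp (- al*Rl (?p v) w)*?z"
				using \<delta>(2)[of v] True v\<delta> J0 by (simp add: ig_def)
			hence "?f v-?z*indicator {0..<r} v = (exp (- al*Rl (?p v) w)-1)*?z"
				unfolding if_P[OF re] using True by (simp add: left_diff_distrib)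
			hence "norm (?f v-?z*indicator {0..<r} v) = \<bar>exp (- al*Rl (?p v) w)-1\<bar>*\<bar>?z\<bar>" by (simp only: real_norm_def abs_mult)
			also have "\<dots> <= d*\<bar>?z\<bar>" using \<delta>(2)[of v] True v\<delta> by (intro mult_right_mono) auto
			finally show ?thesis using True by (simp add: mult.commute)
		next
			case False
			hence n: "\<not> (0 <= v & reach r w v)" by blast
			show ?thesis unfolding if_not_P[OF n] using False by simp
		qed
		have "Tg (Zd al c) al (reach r w) w-?z*r = (\<integral>v. ?f v-?z*indicator {0..<r} v \<partial>lborel)"
			unfolding Tg_def using Bochner_Integration.integral_diff[OF i1 int_indicator(1)[of ?z r]] int_indicator(2)[of r ?z] r(1) by simp
		hence "\<bar>Tg (Zd al c) al (reach r w) w-?z*r\<bar> <= (\<integral>v. norm (?f v-?z*indicator {0..<r} v) \<partial>lborel)"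
			using integral_norm_bound[of lborel "%v. ?f v-?z*indicator {0..<r} v"] by (simp only: real_norm_def)
		also have "\<dots> <= (\<integral>v. \<bar>?z\<bar>*d*indicator {0..<r} v \<partial>lborel)"
			by (rule integral_mono'[OF int_indicator(1) pt]) (use d0 in simp)
		also have "\<dots> = \<bar>?z\<bar>*d*r" by (rule int_indicator(2)) (use r in simp)
		finally have le: "\<bar>Tg (Zd al c) al (reach r w) w-?z*r\<bar> <= \<bar>?z\<bar>*d*r" .
		have "Tg (Zd al c) al (reach r w) w/r-?z = (Tg (Zd al c) al (reach r w) w-?z*r)/r"
			using r(1) by (simp add: diff_divide_distrib)
		hence "\<bar>Tg (Zd al c) al (reach r w) w/r-?z\<bar> = \<bar>Tg (Zd al c) al (reach r w) w-?z*r\<bar>/r"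
			using r(1) by (simp only: abs_divide abs_of_pos)
		also have "\<dots> <= \<bar>?z\<bar>*d*r/r" using le r(1) by (intro divide_right_mono) auto
		also have "\<dots> = \<bar>?z\<bar>*d" using r(1) by simp
		finally show "norm (Tg (Zd al c) al (reach (e n) w) w/e n-?z) < \<epsilon>" using dz unfolding r_def real_norm_def by linarith
	qed
qed

lemma generator_identity:
	assumes al: "0 <= al"
	shows "(\<Sum>k\<in>UNIV. Fstar al $ i $ k*Zc al c k a)+Zd al c i a = 0"
proof -
	have en: "0 <= e n" "e n ~= 0" for n by simp_all
	have "\<forall>n. \<exists>T. T \<in> Bor M & (AE w in P 0 i. T w = Tg (Zd al c) al (reach (e n) w) w)
		\<and> Zc al c i (a+0) = (\<Sum>k\<in>UNIV. (\<integral>w. Yr (e n) al k w \<partial>P 0 i)*Zc al c k a)+(\<integral>w. T w \<partial>P 0 i)"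
		by (intro allI passage_identity al en zero_in)
	from choice[OF this] obtain T where Tm: "\<And>n. T n \<in> Bor M"
		and Tae: "\<And>n. AE w in P 0 i. T n w = Tg (Zd al c) al (reach (e n) w) w"
		and Tid: "\<And>n. Zc al c i (a+0) = (\<Sum>k\<in>UNIV. (\<integral>w. Yr (e n) al k w \<partial>P 0 i)*Zc al c k a)+(\<integral>w. T n w \<partial>P 0 i)" by blast
	have Tall: "AE w in P 0 i. \<forall>n. T n w = Tg (Zd al c) al (reach (e n) w) w" using Tae by (simp add: AE_all_countable)
	have meas: "AE w in P 0 i. \<forall>n. w \<in> G --> (%v. if 0 <= v & reach (e n) w v then ig (Zd al c) al w v else 0) \<in> Bor borel"
		unfolding AE_all_countable
	proof
		fix n
		show "AE w in P 0 i. w \<in> G --> (%v. if 0 <= v & reach (e n) w v then ig (Zd al c) al w v else 0) \<in> Bor borel"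
			using DDZ_eventually[OF al en(1)[of n], where x=0 and i=i and c=c] by eventually_elim blast
	qed
	obtain B where B: "\<And>k. \<bar>Zd al c k a\<bar> <= B" using gn_upper[OF al] by blast
	have "(%n. \<integral>w. T n w/e n \<partial>P 0 i) \<leadsto> (\<integral>w. Zd al c i a \<partial>P 0 i)"
	proof (rule integral_dominated_convergence[where w="%_. B"])
		show "AE w in P 0 i. (%n. T n w/e n) \<leadsto> Zd al c i a"
			using Tall meas AE_G[OF zero_in] start_at_top[of i]
		proof eventually_elim
			case (elim w)
			have "(%n. Tg (Zd al c) al (reach (e n) w) w/e n) \<leadsto> Zd al c i a"
				by (rule Tg_rate[OF al]) (use elim in blast)+
			moreover have "T n w = Tg (Zd al c) al (reach (e n) w) w" for n using elim(1) by (rule spec)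
			ultimately show ?case by (simp only:)
		qed
		show "AE w in P 0 i. norm (T n w/e n) <= B" for n
			using Tae[of n] AE_G[OF zero_in]
		proof eventually_elim
			case (elim w)
			have "\<bar>T n w\<bar> <= B*e n" unfolding elim(1) by (rule Tg_reach_bound[where g="Zd al c" and al=al, OF elim(2) B al en(1)])
			hence "\<bar>T n w\<bar>/e n <= B*e n/e n" by (rule divide_right_mono) (rule en(1))
			thus ?case by (simp add: abs_divide abs_mult)
		qed
		show "integrable (P 0 i) (%_. B)" by (rule finite_measure.integrable_const[OF finite_P])
		show "(%w. T n w/e n) \<in> Bor (P 0 i)" for n using Tm[of n] by measurable
	qed simp
	hence Tlim: "(%n. (\<integral>w. T n w \<partial>P 0 i)/e n) \<leadsto> Zd al c i a"
		using prob_space.prob_space[OF prob[of 0 i]] by simp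
	let ?m = "%n k l. mexp (scaleR (e n) (Fstar al)) $ k $ l"
	have ml: "(%n. (?m n i k-(if i = k then 1 else 0))/e n) \<leadsto> Fstar al $ i $ k" for k
	proof -
		have 0: "mexp (scaleR 0 (Fstar al)) $ i $ k = (if i = k then 1 else 0)" by (simp add: mexp_0 mat_def)
		have D: "(mexp (scaleR 0 (Fstar al)) ** Fstar al) $ i $ k = Fstar al $ i $ k" by (simp add: mexp_0)
		show ?thesis using quotient_limit(2)[OF mexp_deriv[of "Fstar al" i k 0]] unfolding 0 D add_0_left .
	qed
	\<comment> \<open>\<open>pre_Yr\<close> requires nonzero diagonal entries; for small r they are
	  close to 1.\<close>
	have diag: "\<forall>\<^sub>F n in sequentially. \<forall>k\<in>UNIV. ?m n k k ~= 0"
	proof (rule eventually_ball_finite, simp, rule ballI)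
		fix k :: 'n
		have c: "isCont (%t. mexp (scaleR t (Fstar al)) $ k $ k) 0" by (rule DERIV_isCont[OF mexp_deriv])
		have "(%n. ?m n k k) \<leadsto> mexp (scaleR 0 (Fstar al)) $ k $ k" by (rule isCont_tendsto_compose[OF c e_lim])
		hence "(%n. ?m n k k) \<leadsto> 1" by (simp add: mexp_0 mat_def)
		thus "\<forall>\<^sub>F n in sequentially. ?m n k k ~= 0" by (rule tendsto_imp_eventually_ne) simp
	qed
	have "\<forall>\<^sub>F n in sequentially. (\<Sum>k\<in>UNIV. (?m n i k-(if i = k then 1 else 0))/e n*Zc al c k a)+(\<integral>w. T n w \<partial>P 0 i)/e n = 0"
		using diag
	proof eventually_elim
		case (elim n)
		have "(\<integral>w. Yr (e n) al k w \<partial>P 0 i) = ?m n i k" for k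
			using pre_Yr[where r="e n" and k=k and i=i and x=0, OF al en(1) _ zero_in] pre_integral[where r="e n" and k=k and i=i, OF al en(1)] elim by simp
		hence id: "Zc al c i a = (\<Sum>k\<in>UNIV. ?m n i k*Zc al c k a)+(\<integral>w. T n w \<partial>P 0 i)" using Tid[of n] by simp
		have "(\<Sum>k\<in>UNIV. (?m n i k-(if i = k then 1 else 0))/e n*Zc al c k a)
			 = ((\<Sum>k\<in>UNIV. ?m n i k*Zc al c k a)-(\<Sum>k\<in>UNIV. (if i = k then 1 else 0)*Zc al c k a))/e n"
			unfolding sum_subtractf[symmetric] sum_divide_distrib by (intro sum.cong HOL.refl) (simp add: left_diff_distrib)
		also have "(\<Sum>k\<in>UNIV. (if i = k then 1 else 0)*Zc al c k a) = Zc al c i a"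
		proof -
			have "(if i = k then 1 else 0)*Zc al c k a = (if i = k then Zc al c k a else 0)" for k by simp
			thus ?thesis by simp
		qed
		finally have "(\<Sum>k\<in>UNIV. (?m n i k-(if i = k then 1 else 0))/e n*Zc al c k a)
			 = ((\<Sum>k\<in>UNIV. ?m n i k*Zc al c k a)-Zc al c i a)/e n" .
		moreover have "(\<Sum>k\<in>UNIV. ?m n i k*Zc al c k a)-Zc al c i a = - (\<integral>w. T n w \<partial>P 0 i)" using id by linarith
		ultimately show ?case by (simp only: minus_divide_left[symmetric])
	qed
	hence "(%n. (\<Sum>k\<in>UNIV. (?m n i k-(if i = k then 1 else 0))/e n*Zc al c k a)+(\<integral>w. T n w \<partial>P 0 i)/e n) \<leadsto> 0"
		by (rule tendsto_eventually)
	moreover have "(%n. (\<Sum>k\<in>UNIV. (?m n i k-(if i = k then 1 else 0))/e n*Zc al c k a)+(\<integral>w. T n w \<partial>P 0 i)/e n)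
		\<longlonglongrightarrow> (\<Sum>k\<in>UNIV. Fstar al $ i $ k*Zc al c k a)+Zd al c i a"
		by (intro tendsto_add tendsto_sum tendsto_mult tendsto_const ml Tlim)
	ultimately show ?thesis by (rule LIMSEQ_unique[rotated])
qed

lemma Zmat_entry:
	assumes y: "0 <= y"
	shows "Zmat F W al y $ k $ c = Zc al c k y"
proof -
	let ?I = "integral {0..y} (%u. scaleR (exp (- al*u)) (W u))"
	have cW: "continuous_on {0..y} W" using W_scale unfolding is_scale_matrix_def by (auto elim: continuous_on_subset)
	have int: "(%u. scaleR (exp (- al*u)) (W u)) integrable_on {0..y}"
		by (intro integrable_continuous_real continuous_intros cW)
	have "?I $ k $ l = w1 al k l y" for k l
	proof -
		have bl: "bounded_linear (%A::real^'n^'n. A $ k $ l)"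
			using bounded_linear_compose[OF bounded_linear_vec_nth[of l] bounded_linear_vec_nth[of k]] by (simp add: o_def)
		show ?thesis using integral_linear[OF int bl] by (simp add: o_def w1_def)
	qed
	thus ?thesis by (simp add: Zmat_def Zc_def matrix_matrix_mult_def mat_def)
qed

text \<open>At r = 0 no level lies below r, so the level integral in \<open>passage_identity\<close>
  disappears.\<close>

lemma exit_identity:
	assumes al: "0 <= al" and x: "x \<in> {-a..0}"
	shows "Zmat F W al (a+x) = E_mat (P x) (%w. exp (- al*Rl (passage (%t. Ru t w) 0) w))
			(%w. phase_at_passage (%t. J t w) (%t. Ru t w) 0) ** Zmat F W al a"
proof -
	have "Zc al c i (a+x) = (\<Sum>k\<in>UNIV. (\<integral>w. pre 0 al k w \<partial>P x i)*Zc al c k a)" for i c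
	proof -
		obtain T where T: "T \<in> Bor M" "AE w in P x i. T w = Tg (Zd al c) al (reach 0 w) w"
			"Zc al c i (a+x) = (\<Sum>k\<in>UNIV. (\<integral>w. Yr 0 al k w \<partial>P x i)*Zc al c k a)+(\<integral>w. T w \<partial>P x i)"
			using passage_identity[OF al order_refl x] by blast
		have "Tg (Zd al c) al (reach 0 w) w = 0" for w
		proof -
			have n: "\<not> (0 <= v & reach 0 w v)" for v by simp
			show ?thesis unfolding Tg_def if_not_P[OF n] by simp
		qed
		hence "AE w in P x i. T w = 0" using T(2) by simp
		hence "(\<integral>w. T w \<partial>P x i) = 0" by (rule integral_eq_zero_AE)
		moreover have "(\<integral>w. Yr 0 al k w \<partial>P x i) = (\<integral>w. pre 0 al k w \<partial>P x i)" for k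
			by (rule pre_Yr[OF al order_refl _ x, symmetric]) (simp add: mexp_0 mat_def)
		ultimately show ?thesis using T(3) by simp
	qed
	moreover have "0 <= a+x" "0 <= a" using x a_gt by auto
	ultimately show ?thesis
		by (simp add: vec_eq_iff matrix_matrix_mult_def Zmat_entry E_mat_def pre_def)
qed

lemma main_identity:
	assumes al: "0 <= al"
	shows "invertible (Zmat F W al a)"
		and "Fstar al = W a ** F al ** matrix_inv (Zmat F W al a)-scaleR al (mat 1)"
		and "x \<in> {-a..0} ==> E_mat (P x) (%w. exp (- al*Rl (passage (%t. Ru t w) 0) w))
			(%w. phase_at_passage (%t. J t w) (%t. Ru t w) 0) = Zmat F W al (a+x) ** matrix_inv (Zmat F W al a)"
proof -
	let ?Z = "Zmat F W al a"
	let ?E = "%x. E_mat (P x) (%w. exp (- al*Rl (passage (%t. Ru t w) 0) w)) (%w. phase_at_passage (%t. J t w) (%t. Ru t w) 0)"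
	have "Zmat F W al (a+- a) = ?E (- a) ** ?Z" by (rule exit_identity[OF al]) (use a_gt in simp)
	moreover have "Zmat F W al (a+- a) = mat 1"
		by (simp add: vec_eq_iff Zmat_entry Zc_def w_neg mat_def)
	ultimately have EZ: "?E (- a) ** ?Z = mat 1" by simp
	hence "?Z ** ?E (- a) = mat 1" by (simp add: matrix_left_right_inverse)
	with EZ show inv: "invertible ?Z" unfolding invertible_def by blast
	show "?E x = Zmat F W al (a+x) ** matrix_inv ?Z" if x: "x \<in> {-a..0}" for x
		unfolding exit_identity[OF al x] matrix_mul_assoc[symmetric] invertible_matrix_inv(1)[OF inv] by simp
	have "(Fstar al + scaleR al (mat 1)) ** ?Z = W a ** F al"
	proof -
		have one: "scaleR al (mat 1) ** ?Z = scaleR al ?Z"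
			by (simp add: scalar_matrix_assoc[symmetric] flip: scalar_mult_eq_scaleR)
		have "(Fstar al ** ?Z) $ i $ c+al*?Z $ i $ c = (W a ** F al) $ i $ c" for i c
			using generator_identity[OF al, of i c] a_gt by (simp add: matrix_matrix_mult_def Zmat_entry Zd_def)
		thus ?thesis unfolding matrix_matrix_mult_add_left one by (simp add: vec_eq_iff)
	qed
	hence "W a ** F al ** matrix_inv ?Z = (Fstar al + scaleR al (mat 1)) ** (?Z ** matrix_inv ?Z)" by (simp add: matrix_mul_assoc)
	also have "\<dots> = Fstar al + scaleR al (mat 1)" by (simp add: invertible_matrix_inv(1)[OF inv])
	finally show "Fstar al = W a ** F al ** matrix_inv ?Z-scaleR al (mat 1)" by simp
qed

end

theorem theorem6:
  fixes M :: "'w measure"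
    and P :: "real \<Rightarrow> 'n::finite \<Rightarrow> 'w measure"
    and X :: "real \<Rightarrow> 'w \<Rightarrow> real"
    and J :: "real \<Rightarrow> 'w \<Rightarrow> 'n option"
    and F W Fstar :: "real \<Rightarrow> real^'n^'n"
    and Rl Ru :: "real \<Rightarrow> 'w \<Rightarrow> real"
    and a :: real
  assumes MAP: "spectrally_negative_MAP M P X J"
    and F: "is_matrix_exponent P X J F"
    and W: "is_scale_matrix F W"
    and a_pos: "a > 0"
    and refl: "\<forall>\<omega>\<in>space M. X 0 \<omega> \<in> {-a..0} \<longrightarrow>
                 two_sided_reflection a (\<lambda>t. X t \<omega>) (\<lambda>t. Rl t \<omega>) (\<lambda>t. Ru t \<omega>)"
    and R_meas: "\<forall>t. Rl t \<in> borel_measurable M \<and> Ru t \<in> borel_measurable M"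
    and Fstar: "\<forall>\<alpha>\<ge>0. \<forall>r\<ge>0.
        E_mat (P 0) (\<lambda>\<omega>. exp (- \<alpha> * Rl (passage (\<lambda>t. Ru t \<omega>) r) \<omega>))
                    (\<lambda>\<omega>. phase_at_passage (\<lambda>t. J t \<omega>) (\<lambda>t. Ru t \<omega>) r)
        = mexp (scaleR r (Fstar \<alpha>))"
  shows "\<forall>\<alpha>\<ge>0. invertible (Zmat F W \<alpha> a) \<and>
           Fstar \<alpha> = W a ** F \<alpha> ** matrix_inv (Zmat F W \<alpha> a) - scaleR \<alpha> (mat 1) \<and>
           (\<forall>x\<in>{-a..0}.
              E_mat (P x) (\<lambda>\<omega>. exp (- \<alpha> * Rl (passage (\<lambda>t. Ru t \<omega>) 0) \<omega>))
                          (\<lambda>\<omega>. phase_at_passage (\<lambda>t. J t \<omega>) (\<lambda>t. Ru t \<omega>) 0)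
              = Zmat F W \<alpha> (a + x) ** matrix_inv (Zmat F W \<alpha> a))"
proof -
	have MA: "markov_additive M P X J" and
		down: "\<forall>w\<in>space M. \<forall>t>0. J t w ~= None --> (\<forall>l. ((%s. X s w) \<longlongrightarrow> l) (at_left t) --> X t w <= l)"
		using MAP unfolding spectrally_negative_MAP_def by blast+
	interpret reflected_scale_map M P X J F W Fstar a Rl Ru
	proof
		show "X t w <= y" if "w \<in> space M" "0 < t" "J t w ~= None" "((%s. X s w) \<longlongrightarrow> y) (at_left t)" for t w y
			using down that by blast
	qed (use MA F W a_pos refl R_meas Fstar in blast)+
	show ?thesis using main_identity by blast
qed

end
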